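(* Let $g_1, g_2$ be independent centred stationary Gaussian processes on $\mathbb{R}$ with covariance kernels $K_i(t) = \mathbb{E}[g_i(0) g_i(t)]$, $i = 1,2$. Suppose that for each $i=1,2$: $g_i$ is not identically zero; $g_i$ is almost surely $C^2$-smooth; and $K_i(t) \log |t| \to 0$ as $|t| \to \infty$. Let $f : \mathbb{R}^2 \to \mathbb{R}$ be the Gaussian field $f(x_1,x_2) = g_1(x_1) + g_2(x_2)$. Then: (1) If $\ell \le 0$, almost surely all the connected components of $\{f \le \ell\}$ are bounded. (2) If $\ell > 0$, almost surely $\{f \le \ell\}$ has a unique unbounded connected component. In particular, for all $\ell \in \mathbb{R}$, the level set $\{f = \ell\}$ has only bounded connected components almost surely.
   Context: For $\ell \in \mathbb{R}$, $\{f \le \ell\} = \{x \in \mathbb{R}^2 : f(x) \le \ell\}$ and $\{f = \ell\} = \{x \in \mathbb{R}^2 : f(x) = \ell\}$. The field $f$ is called an additive Gaussian field; equivalently it is a centred stationary Gaussian field on $\mathbb{R}^2$ with covariance $\mathbb{E}[f(0)f(x)] = K_1(x_1) + K_2(x_2)$. *)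

theory Defs
  imports "HOL-Probability.Probability"
begin

text \<open>
  A real random variable is Gaussian if its law is some $N(\mu,\sigma^2)$ with $\sigma \ge 0$. The
  degenerate case $\sigma = 0$ (an almost surely constant variable) has no density and is
  therefore a separate disjunct.
\<close>

definition gaussian_rv :: "'a measure \<Rightarrow> ('a \<Rightarrow> real) \<Rightarrow> bool" where
  "gaussian_rv M X \<longleftrightarrow> X \<in> borel_measurable M \<and>
     ((\<exists>\<mu>. AE \<omega> in M. X \<omega> = \<mu>) \<or>
      (\<exists>\<mu> \<sigma>. \<sigma> > 0 \<and> distributed M lborel X (normal_density \<mu> \<sigma>)))"

text \<open>
  Processes are written time first: \<open>g t \<omega>\<close>. The sample path of \<open>\<omega>\<close> is \<open>\<lambda>t. g t \<omega>\<close>.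
  All finite-dimensional laws being multivariate normal (possibly degenerate) is expressed, as
  usual, by every finite linear combination being Gaussian.
\<close>

definition gaussian_process :: "'a measure \<Rightarrow> (real \<Rightarrow> 'a \<Rightarrow> real) \<Rightarrow> bool" where
  "gaussian_process M g \<longleftrightarrow>
     (\<forall>T c. finite T \<longrightarrow> gaussian_rv M (\<lambda>\<omega>. \<Sum>t\<in>T. c t * g t \<omega>))"

definition centred_process :: "'a measure \<Rightarrow> (real \<Rightarrow> 'a \<Rightarrow> real) \<Rightarrow> bool" where
  "centred_process M g \<longleftrightarrow> (\<forall>t. integral\<^sup>L M (g t) = 0)"

text \<open>
  The space of paths \<open>real \<Rightarrow> real\<close> carries the product (cylinder) sigma-algebra, so equality of
  laws below is equality of all finite-dimensional distributions.
\<close>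

abbreviation path_space :: "(real \<Rightarrow> real) measure" where
  "path_space \<equiv> \<Pi>\<^sub>M t\<in>UNIV. borel"

definition stationary_process :: "'a measure \<Rightarrow> (real \<Rightarrow> 'a \<Rightarrow> real) \<Rightarrow> bool" where
  "stationary_process M g \<longleftrightarrow>
     (\<forall>h. distr M path_space (\<lambda>\<omega> t. g (t + h) \<omega>) = distr M path_space (\<lambda>\<omega> t. g t \<omega>))"

definition covariance_kernel :: "'a measure \<Rightarrow> (real \<Rightarrow> 'a \<Rightarrow> real) \<Rightarrow> real \<Rightarrow> real" where
  "covariance_kernel M g t = (\<integral>\<omega>. g 0 \<omega> * g t \<omega> \<partial>M)"

definition independent_processes ::
    "'a measure \<Rightarrow> (real \<Rightarrow> 'a \<Rightarrow> real) \<Rightarrow> (real \<Rightarrow> 'a \<Rightarrow> real) \<Rightarrow> bool" where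
  "independent_processes M g\<^sub>1 g\<^sub>2 \<longleftrightarrow>
     prob_space.indep_var M path_space (\<lambda>\<omega> t. g\<^sub>1 t \<omega>) path_space (\<lambda>\<omega> t. g\<^sub>2 t \<omega>)"

definition C2_smooth :: "(real \<Rightarrow> real) \<Rightarrow> bool" where
  "C2_smooth u \<longleftrightarrow> (\<exists>u' u''. (\<forall>t. (u has_real_derivative u' t) (at t)) \<and>
     (\<forall>t. (u' has_real_derivative u'' t) (at t)) \<and> continuous_on UNIV u'')"

definition additive_field ::
    "(real \<Rightarrow> 'a \<Rightarrow> real) \<Rightarrow> (real \<Rightarrow> 'a \<Rightarrow> real) \<Rightarrow> 'a \<Rightarrow> real \<times> real \<Rightarrow> real" where
  "additive_field g\<^sub>1 g\<^sub>2 \<omega> x = g\<^sub>1 (fst x) \<omega> + g\<^sub>2 (snd x) \<omega>"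

end

theory Submission imports Defs "HOL-Real_Asymp.Real_Asymp" begin

text \<open>Write \<open>f (x, y) = g\<^sub>1 x + g\<^sub>2 y\<close>. Circuits and infinite clusters of a general planar field are hard to
find; for an additive field rectangles suffice, and rectangles are one-dimensional objects.

\<^emph>\<open>Nonpositive levels.\<close> If \<open>g\<^sub>1 > u\<close> at two points \<open>a < b\<close>, \<open>g\<^sub>1 \<ge> - u\<close> on \<open>{a..b}\<close>, and \<open>g\<^sub>2\<close> does the same
with the same \<open>u\<close> at \<open>c < d\<close>, then \<open>f > 0\<close> on the boundary of \<open>{a..b} \<times> {c..d}\<close>. Arbitrarily large
rectangles of this kind around the origin confine every component of \<open>{f \<le> l}\<close>, \<open>l \<le> 0\<close>
(\<open>components_bounded_of_frames\<close>). By \<open>same_sign_exit\<close>, a single process has such \<open>a\<close>, \<open>b\<close> outside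
\<open>{- u..u}\<close> with probability bounded below uniformly in \<open>u\<close>: on windows of length of order \<open>exp (u\<^sup>2 / 2)\<close> on both sides of the origin
the high points and the low points behave like rare nearly independent events, so that with positive
probability one high point on each side occurs and no low one between. Independence of \<open>g\<^sub>1\<close> and \<open>g\<^sub>2\<close> makes the
probability for the pair positive as well, and since rectangles of every size are requested the event
is invariant under translations by integers. As correlations vanish at infinity, its probability is
\<open>0\<close> or \<open>1\<close> (\<open>zero_one_law\<close>), hence \<open>1\<close>.

\<^emph>\<open>Positive levels.\<close> The maximum of a process of unit variance over an interval of length \<open>exp (u\<^sup>2 / 2)\<close> lies
within \<open>e\<close> of \<open>u\<close>, almost surely for all large \<open>u\<close> in \<open>e\<nat>\<close> (\<open>growth_upper\<close>, \<open>growth_lower\<close>),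
and so does the absolute value of the minimum. Both errors are additive: they are fractions of the level \<open>l\<close>. So a vertical line
through a point where \<open>g\<^sub>1\<close> is close to its running minimum stays in \<open>{f \<le> l}\<close> along the corresponding
range of \<open>g\<^sub>2\<close>, and likewise for horizontal lines. Two vertical and two horizontal such segments at each
scale form a connected grid; the grids of consecutive scales cross, and each surrounds the origin at
growing distance. Their union lies in one unbounded component, and any other unbounded component would have to cross it
(\<open>unique_unbounded_component\<close>).

The delicate part is the lower bound for the maximum: a second moment computation only shows that the maximum reaches the level \<open>u\<close> with probability bounded away from \<open>0\<close>. It is upgraded
by \<open>concentration_of_maximum\<close>: the maximum of Gaussian variables of variance at most \<open>r\<^sup>2\<close> fluctuates
at scale \<open>r\<close>. The variables \<open>X t\<close> themselves have variance \<open>1\<close>, but where many of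
them exceed \<open>u\<close> their average exceeds \<open>u\<close> too, and it has variance of order \<open>1 / u\<^sup>2\<close>, since correlations beyond the
distance \<open>exp (\<kappa> * u\<^sup>2)\<close> are of order \<open>1 / u\<^sup>2\<close> (\<open>lower_deviation_of_maximum\<close>). The resulting
probability bound of order \<open>1 / u\<^sup>2\<close> is summable over \<open>u\<close> in \<open>e\<nat>\<close>.

Level sets: for \<open>l \<le> 0\<close> they are contained in \<open>{f \<le> l}\<close>, and for \<open>l > 0\<close> the first argument applies to
\<open>- f\<close>, whose frames avoid \<open>{f = l}\<close>.\<close>

section \<open>Laws determined by linear combinations\<close>

text \<open>Levy uniqueness for the measures with densities \<open>w\<close> and \<open>w'\<close>, which need not be probability measures: the case \<open>s = 0\<close> of
the hypothesis says that they have the same total mass, by which both are divided. If that mass is \<open>0\<close>, both weights vanish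
almost everywhere.\<close>

lemma weighted_law_eq_of_char:
  fixes X :: "'a \<Rightarrow> real" and X' :: "'b \<Rightarrow> real" and w :: "'a \<Rightarrow> real" and w' :: "'b \<Rightarrow> real"
  assumes "finite_measure M" "finite_measure N"
    and X [measurable]: "X \<in> borel_measurable M" and X' [measurable]: "X' \<in> borel_measurable N"
    and w [measurable]: "w \<in> borel_measurable M" and w' [measurable]: "w' \<in> borel_measurable N"
    and w_bd: "\<And>x. 0 \<le> w x \<and> w x \<le> b" and w'_bd: "\<And>x. 0 \<le> w' x \<and> w' x \<le> b"
    and eq: "\<And>s. (CLINT x|M. w x * iexp (s * X x)) = (CLINT x|N. w' x * iexp (s * X' x))"
    and B [measurable]: "B \<in> sets borel"
  shows "(\<integral>x. w x * indicator B (X x) \<partial>M) = (\<integral>x. w' x * indicator B (X' x) \<partial>N)"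
proof -
  interpret M: finite_measure M by fact
  interpret N: finite_measure N by fact
  have iw: "integrable M w" using w_bd by (intro M.integrable_const_bound[of _ b]) auto
  have iw': "integrable N w'" using w'_bd by (intro N.integrable_const_bound[of _ b]) auto
  define m where "m = (\<integral>x. w x \<partial>M)"
  have m': "m = (\<integral>x. w' x \<partial>N)"
    using eq[of 0] by (simp add: m_def)
  show ?thesis
  proof (cases "m = 0")
    case True
    have "AE x in M. w x = 0"
      using integral_nonneg_eq_0_iff_AE[OF iw] w_bd True by (simp add: m_def)
    then have 1: "(\<integral>x. w x * indicator B (X x) \<partial>M) = 0"
      by (intro integral_eq_zero_AE) auto
    have "AE x in N. w' x = 0"
      using integral_nonneg_eq_0_iff_AE[OF iw'] w'_bd True by (simp add: m')
    then have 2: "(\<integral>x. w' x * indicator B (X' x) \<partial>N) = 0"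
      by (intro integral_eq_zero_AE) auto
    show ?thesis using 1 2 by simp
  next
    case False
    have mpos: "m > 0" using False w_bd by (simp add: m_def less_le)
    define \<mu> where "\<mu> = distr (density M (\<lambda>x. ennreal (w x / m))) borel X"
    define \<nu> where "\<nu> = distr (density N (\<lambda>x. ennreal (w' x / m))) borel X'"
    have dens: "prob_space (density Q (\<lambda>x. ennreal (v x / m)))"
      if "integrable Q v" "\<And>x. 0 \<le> v x" "m = (\<integral>x. v x \<partial>Q)" for Q :: "'c measure" and v
    proof
      have "emeasure (density Q (\<lambda>x. ennreal (v x / m))) (space (density Q (\<lambda>x. ennreal (v x / m))))
          = (\<integral>\<^sup>+x. ennreal (v x / m) \<partial>Q)"
        using that(1) by (auto simp: emeasure_density intro!: nn_integral_cong split: split_indicator)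
      also have "\<dots> = ennreal (\<integral>x. v x / m \<partial>Q)"
        using that mpos by (intro nn_integral_eq_integral) auto
      also have "\<dots> = 1" using that mpos by simp
      finally show "emeasure (density Q (\<lambda>x. ennreal (v x / m))) (space (density Q (\<lambda>x. ennreal (v x / m)))) = 1" .
    qed
    interpret P: prob_space "density M (\<lambda>x. ennreal (w x / m))"
      using dens iw w_bd m_def by blast
    interpret P': prob_space "density N (\<lambda>x. ennreal (w' x / m))"
      using dens iw' w'_bd m' by blast
    have rd: "real_distribution \<mu>" "real_distribution \<nu>"
      unfolding \<mu>_def \<nu>_def by (auto intro!: P.real_distribution_distr P'.real_distribution_distr)
    have c1: "char \<mu> s = (CLINT x|M. w x * iexp (s * X x)) / m" for s
    proof -
      have "char \<mu> s = (CLINT x|density M (\<lambda>x. ennreal (w x / m)). iexp (s * X x))"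
        unfolding \<mu>_def char_def by (subst integral_distr) auto
      also have "\<dots> = (CLINT x|M. (w x / m) *\<^sub>R iexp (s * X x))"
        using w_bd mpos by (subst integral_density) auto
      also have "\<dots> = (CLINT x|M. (w x * iexp (s * X x)) / m)"
        by (intro Bochner_Integration.integral_cong) (auto simp: scaleR_conv_of_real)
      finally show ?thesis by simp
    qed
    have c2: "char \<nu> s = (CLINT x|N. w' x * iexp (s * X' x)) / m" for s
    proof -
      have "char \<nu> s = (CLINT x|density N (\<lambda>x. ennreal (w' x / m)). iexp (s * X' x))"
        unfolding \<nu>_def char_def by (subst integral_distr) auto
      also have "\<dots> = (CLINT x|N. (w' x / m) *\<^sub>R iexp (s * X' x))"
        using w'_bd mpos by (subst integral_density) auto
      also have "\<dots> = (CLINT x|N. (w' x * iexp (s * X' x)) / m)"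
        by (intro Bochner_Integration.integral_cong) (auto simp: scaleR_conv_of_real)
      finally show ?thesis by simp
    qed
    have "char \<mu> = char \<nu>" by (rule ext) (simp only: c1 c2 eq)
    then have "\<mu> = \<nu>" using Levy_uniqueness rd by blast
    then have "(\<integral>x. indicator B x \<partial>\<mu>) = (\<integral>x. indicator B x \<partial>\<nu> :: real)" by simp
    moreover have "(\<integral>x. indicator B x \<partial>\<mu>) = (\<integral>x. w x * indicator B (X x) \<partial>M) / m"
    proof -
      have "(\<integral>x. indicator B x \<partial>\<mu>) = (\<integral>x. indicat_real B (X x) \<partial>density M (\<lambda>x. ennreal (w x / m)))"
        unfolding \<mu>_def by (subst integral_distr) auto
      also have "\<dots> = (\<integral>x. (w x / m) *\<^sub>R indicator B (X x) \<partial>M)"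
        using w_bd mpos by (subst integral_density) auto
      finally show ?thesis by simp
    qed
    moreover have "(\<integral>x. indicator B x \<partial>\<nu>) = (\<integral>x. w' x * indicator B (X' x) \<partial>N) / m"
    proof -
      have "(\<integral>x. indicator B x \<partial>\<nu>) = (\<integral>x. indicat_real B (X' x) \<partial>density N (\<lambda>x. ennreal (w' x / m)))"
        unfolding \<nu>_def by (subst integral_distr) auto
      also have "\<dots> = (\<integral>x. (w' x / m) *\<^sub>R indicator B (X' x) \<partial>N)"
        using w'_bd mpos by (subst integral_density) auto
      finally show ?thesis by simp
    qed
    ultimately show ?thesis using mpos by simp
  qed
qed

text \<open>The indicator constraints are introduced one coordinate at a time. A coordinate \<open>j\<close> moves from the exponential to the
indicators by the weighted uniqueness lemma for \<open>X j\<close>; the remaining exponential \<open>iexp S\<close> is complex and cannot be a weight, but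
\<open>1 + cos S\<close> and \<open>1 + sin S\<close> can, and their transforms are combinations of the known ones with \<open>S\<close>, \<open>- S\<close> and \<open>0\<close>.\<close>

lemma cylinder_eq_of_char:
  fixes X :: "'i \<Rightarrow> 'a \<Rightarrow> real" and X' :: "'i \<Rightarrow> 'b \<Rightarrow> real"
  assumes M: "finite_measure M" and N: "finite_measure N"
    and X [measurable]: "\<And>i. X i \<in> borel_measurable M"
    and X' [measurable]: "\<And>i. X' i \<in> borel_measurable N"
    and eq: "\<And>K c. finite K \<Longrightarrow>
      (CLINT x|M. iexp (\<Sum>k\<in>K. c k * X k x)) = (CLINT x|N. iexp (\<Sum>k\<in>K. c k * X' k x))"
    and B [measurable]: "\<And>i. B i \<in> sets borel"
    and "finite J"
  shows "finite K \<Longrightarrow> J \<inter> K = {} \<Longrightarrow>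
    (CLINT x|M. of_real (\<Prod>j\<in>J. indicator (B j) (X j x)) * iexp (\<Sum>k\<in>K. c k * X k x)) =
    (CLINT x|N. of_real (\<Prod>j\<in>J. indicator (B j) (X' j x)) * iexp (\<Sum>k\<in>K. c k * X' k x))"
  using \<open>finite J\<close>
proof (induction J arbitrary: K c)
  case empty
  then show ?case using eq by simp
next
  case (insert j J)
  interpret M: finite_measure M by fact
  interpret N: finite_measure N by fact
  define b where "b x = (\<Prod>j\<in>J. indicator (B j) (X j x) :: real)" for x
  define b' where "b' x = (\<Prod>j\<in>J. indicator (B j) (X' j x) :: real)" for x
  define S where "S x = (\<Sum>k\<in>K. c k * X k x)" for x
  define S' where "S' x = (\<Sum>k\<in>K. c k * X' k x)" for x
  have [measurable]: "b \<in> borel_measurable M" "b' \<in> borel_measurable N"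
      "S \<in> borel_measurable M" "S' \<in> borel_measurable N"
    unfolding b_def b'_def S_def S'_def by measurable
  have b01: "0 \<le> b x \<and> b x \<le> 1" for x
    unfolding b_def by (auto intro!: prod_nonneg prod_le_1)
  have b'01: "0 \<le> b' x \<and> b' x \<le> 1" for x
    unfolding b'_def by (auto intro!: prod_nonneg prod_le_1)
  have E: "(CLINT x|M. b x * iexp (s * X j x + a * S x)) = (CLINT x|N. b' x * iexp (s * X' j x + a * S' x))" for s a
  proof -
    have 1: "(\<Sum>k\<in>insert j K. (if k = j then s else a * c k) * X k x) = s * X j x + a * S x" for x
    proof -
      have "(\<Sum>k\<in>insert j K. (if k = j then s else a * c k) * X k x)
          = s * X j x + (\<Sum>k\<in>K. (if k = j then s else a * c k) * X k x)"
        using insert by simp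
      also have "(\<Sum>k\<in>K. (if k = j then s else a * c k) * X k x) = (\<Sum>k\<in>K. a * (c k * X k x))"
        using insert by (intro sum.cong) auto
      finally show ?thesis by (simp add: S_def sum_distrib_left)
    qed
    have 2: "(\<Sum>k\<in>insert j K. (if k = j then s else a * c k) * X' k x) = s * X' j x + a * S' x" for x
    proof -
      have "(\<Sum>k\<in>insert j K. (if k = j then s else a * c k) * X' k x)
          = s * X' j x + (\<Sum>k\<in>K. (if k = j then s else a * c k) * X' k x)"
        using insert by simp
      also have "(\<Sum>k\<in>K. (if k = j then s else a * c k) * X' k x) = (\<Sum>k\<in>K. a * (c k * X' k x))"
        using insert by (intro sum.cong) auto
      finally show ?thesis by (simp add: S'_def sum_distrib_left)
    qed
    have "J \<inter> insert j K = {}" using insert by auto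
    from insert.IH[OF _ this, of "\<lambda>k. if k = j then s else a * c k"] insert.prems
    show ?thesis unfolding 1 2 b_def b'_def by simp
  qed
  have int: "integrable M (\<lambda>x. complex_of_real (b x) * iexp (f x))" if [measurable]: "f \<in> borel_measurable M" for f
    using b01 by (intro M.integrable_const_bound[of _ 1]) (auto simp: norm_mult)
  have int': "integrable N (\<lambda>x. complex_of_real (b' x) * iexp (f x))" if [measurable]: "f \<in> borel_measurable N" for f
    using b'01 by (intro N.integrable_const_bound[of _ 1]) (auto simp: norm_mult)
  have indB: "(\<integral>x. b x * indicator (B j) (X j x) \<partial>M) = (\<integral>x. b' x * indicator (B j) (X' j x) \<partial>N)"
    using b01 b'01 E[of _ 0] by (intro weighted_law_eq_of_char[where b=1] M N) auto
  have iB: "integrable M (\<lambda>x. b x * f x * indicator (B j) (X j x))"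
    if [measurable]: "f \<in> borel_measurable M" and "\<And>x. \<bar>f x\<bar> \<le> 1" for f
    using b01 that by (intro M.integrable_const_bound[of _ 1]) (auto simp: abs_mult mult_le_one split: split_indicator)
  have iB': "integrable N (\<lambda>x. b' x * f x * indicator (B j) (X' j x))"
    if [measurable]: "f \<in> borel_measurable N" and "\<And>x. \<bar>f x\<bar> \<le> 1" for f
    using b'01 that by (intro N.integrable_const_bound[of _ 1]) (auto simp: abs_mult mult_le_one split: split_indicator)
  have part: "(\<integral>x. b x * f x * indicator (B j) (X j x) \<partial>M) = (\<integral>x. b' x * f' x * indicator (B j) (X' j x) \<partial>N)"
    if [measurable]: "f \<in> borel_measurable M" "f' \<in> borel_measurable N"
      and f: "\<And>x. \<bar>f x\<bar> \<le> 1" "\<And>x. \<bar>f' x\<bar> \<le> 1"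
      and feq: "\<And>s. (CLINT x|M. b x * f x * iexp (s * X j x)) = (CLINT x|N. b' x * f' x * iexp (s * X' j x))"
    for f f'
  proof -
    have ib: "integrable M (\<lambda>x. complex_of_real (b x * f x) * iexp (s * X j x))" for s
      using b01 f by (intro M.integrable_const_bound[of _ 1]) (auto simp: norm_mult mult_le_one)
    have ib': "integrable N (\<lambda>x. complex_of_real (b' x * f' x) * iexp (s * X' j x))" for s
      using b'01 f by (intro N.integrable_const_bound[of _ 1]) (auto simp: norm_mult mult_le_one)
    have "(\<integral>x. (b x * (1 + f x)) * indicator (B j) (X j x) \<partial>M)
        = (\<integral>x. (b' x * (1 + f' x)) * indicator (B j) (X' j x) \<partial>N)"
    proof (intro weighted_law_eq_of_char[where b=2] M N)
      fix x show "0 \<le> b x * (1 + f x) \<and> b x * (1 + f x) \<le> 2"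
        using b01[of x] f(1)[of x] mult_mono[of "b x" 1 "1 + f x" 2] by (auto simp: abs_le_iff)
    next
      fix x show "0 \<le> b' x * (1 + f' x) \<and> b' x * (1 + f' x) \<le> 2"
        using b'01[of x] f(2)[of x] mult_mono[of "b' x" 1 "1 + f' x" 2] by (auto simp: abs_le_iff)
    next
      fix s
      have "(CLINT x|M. complex_of_real (b x * (1 + f x)) * iexp (s * X j x))
          = (CLINT x|M. complex_of_real (b x) * iexp (s * X j x) + complex_of_real (b x * f x) * iexp (s * X j x))"
        by (intro Bochner_Integration.integral_cong) (auto simp: algebra_simps)
      also have "\<dots> = (CLINT x|M. complex_of_real (b x) * iexp (s * X j x)) + (CLINT x|M. complex_of_real (b x * f x) * iexp (s * X j x))"
        using ib int[of "\<lambda>x. s * X j x"] by (intro Bochner_Integration.integral_add) auto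
      also have "\<dots> = (CLINT x|N. complex_of_real (b' x) * iexp (s * X' j x)) + (CLINT x|N. complex_of_real (b' x * f' x) * iexp (s * X' j x))"
        using E[of s 0] feq[of s] by simp
      also have "\<dots> = (CLINT x|N. complex_of_real (b' x) * iexp (s * X' j x) + complex_of_real (b' x * f' x) * iexp (s * X' j x))"
        using ib' int'[of "\<lambda>x. s * X' j x"] by (intro Bochner_Integration.integral_add[symmetric]) auto
      also have "\<dots> = (CLINT x|N. complex_of_real (b' x * (1 + f' x)) * iexp (s * X' j x))"
        by (intro Bochner_Integration.integral_cong) (auto simp: algebra_simps)
      finally show "(CLINT x|M. complex_of_real (b x * (1 + f x)) * iexp (s * X j x)) = (CLINT x|N. complex_of_real (b' x * (1 + f' x)) * iexp (s * X' j x))" .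
    qed auto
    moreover have "(\<integral>x. (b x * (1 + f x)) * indicator (B j) (X j x) \<partial>M)
        = (\<integral>x. b x * indicator (B j) (X j x) \<partial>M) + (\<integral>x. b x * f x * indicator (B j) (X j x) \<partial>M)"
      using iB[of f] iB[of "\<lambda>_. 1"] f by (subst Bochner_Integration.integral_add[symmetric]) (auto simp: algebra_simps)
    moreover have "(\<integral>x. (b' x * (1 + f' x)) * indicator (B j) (X' j x) \<partial>N)
        = (\<integral>x. b' x * indicator (B j) (X' j x) \<partial>N) + (\<integral>x. b' x * f' x * indicator (B j) (X' j x) \<partial>N)"
      using iB'[of f'] iB'[of "\<lambda>_. 1"] f by (subst Bochner_Integration.integral_add[symmetric]) (auto simp: algebra_simps)
    ultimately show ?thesis using indB by simp
  qed
  have ie: "iexp t = complex_of_real (cos t) + \<i> * complex_of_real (sin t)" for t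
    by (metis cis_conv_exp cis.code complex_eq mult.commute of_real_eq_iff complex.sel)
  have iE: "integrable M (\<lambda>x. complex_of_real (b x) * iexp (s * X j x + a * S x))" for s a
    by (rule int) measurable
  have iE': "integrable N (\<lambda>x. complex_of_real (b' x) * iexp (s * X' j x + a * S' x))" for s a
    by (rule int') measurable
  have cosc: "(CLINT x|M. b x * cos (S x) * iexp (s * X j x)) = (CLINT x|N. b' x * cos (S' x) * iexp (s * X' j x))" for s
  proof -
    have c: "complex_of_real (\<beta> * cos t) * iexp y = (1/2) * (complex_of_real \<beta> * iexp (y + 1 * t) + complex_of_real \<beta> * iexp (y + (-1) * t))" for \<beta> t y
      unfolding ie by (simp add: cos_add sin_add cos_diff sin_diff algebra_simps)
    show ?thesis
      unfolding c integral_mult_right_zero Bochner_Integration.integral_add[OF iE iE] Bochner_Integration.integral_add[OF iE' iE'] E ..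
  qed
  have sinc: "(CLINT x|M. b x * sin (S x) * iexp (s * X j x)) = (CLINT x|N. b' x * sin (S' x) * iexp (s * X' j x))" for s
  proof -
    have c: "complex_of_real (\<beta> * sin t) * iexp y = (-\<i>/2) * (complex_of_real \<beta> * iexp (y + 1 * t) - complex_of_real \<beta> * iexp (y + (-1) * t))" for \<beta> t y
      unfolding ie by (simp add: cos_add sin_add cos_diff sin_diff algebra_simps)
    show ?thesis
      unfolding c integral_mult_right_zero Bochner_Integration.integral_diff[OF iE iE] Bochner_Integration.integral_diff[OF iE' iE'] E ..
  qed
  have C: "(\<integral>x. b x * cos (S x) * indicator (B j) (X j x) \<partial>M) = (\<integral>x. b' x * cos (S' x) * indicator (B j) (X' j x) \<partial>N)"
    by (rule part) (use cosc in auto)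
  have Sn: "(\<integral>x. b x * sin (S x) * indicator (B j) (X j x) \<partial>M) = (\<integral>x. b' x * sin (S' x) * indicator (B j) (X' j x) \<partial>N)"
    by (rule part) (use sinc in auto)
  have "(CLINT x|M. of_real (\<Prod>j\<in>insert j J. indicator (B j) (X j x)) * iexp (S x))
      = (CLINT x|M. of_real (b x * cos (S x) * indicator (B j) (X j x)) + \<i> * of_real (b x * sin (S x) * indicator (B j) (X j x)))"
    using insert.hyps by (intro Bochner_Integration.integral_cong) (auto simp: b_def ie algebra_simps split: split_indicator)
  also have "\<dots> = of_real (\<integral>x. b x * cos (S x) * indicator (B j) (X j x) \<partial>M) + \<i> * of_real (\<integral>x. b x * sin (S x) * indicator (B j) (X j x) \<partial>M)"
    using iB[of "\<lambda>x. cos (S x)"] iB[of "\<lambda>x. sin (S x)"]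
    by (subst Bochner_Integration.integral_add) (auto simp del: of_real_mult)
  also have "\<dots> = of_real (\<integral>x. b' x * cos (S' x) * indicator (B j) (X' j x) \<partial>N) + \<i> * of_real (\<integral>x. b' x * sin (S' x) * indicator (B j) (X' j x) \<partial>N)"
    using C Sn by simp
  also have "\<dots> = (CLINT x|N. of_real (b' x * cos (S' x) * indicator (B j) (X' j x)) + \<i> * of_real (b' x * sin (S' x) * indicator (B j) (X' j x)))"
    using iB'[of "\<lambda>x. cos (S' x)"] iB'[of "\<lambda>x. sin (S' x)"]
    by (subst Bochner_Integration.integral_add) (auto simp del: of_real_mult)
  also have "\<dots> = (CLINT x|N. of_real (\<Prod>j\<in>insert j J. indicator (B j) (X' j x)) * iexp (S' x))"
    using insert.hyps by (intro Bochner_Integration.integral_cong) (auto simp: b'_def ie algebra_simps split: split_indicator)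
  finally show ?case unfolding S_def S'_def .
qed

text \<open>The Cramer-Wold principle for arbitrary index sets: the cylinder sets generate the sigma-algebra and are closed under
intersection, and their probabilities are given by the previous lemma without exponential factor.\<close>

lemma distr_eq_of_char:
  fixes X :: "'i \<Rightarrow> 'a \<Rightarrow> real" and X' :: "'i \<Rightarrow> 'b \<Rightarrow> real"
  assumes M: "prob_space M" and N: "prob_space N"
    and X [measurable]: "\<And>i. X i \<in> borel_measurable M"
    and X' [measurable]: "\<And>i. X' i \<in> borel_measurable N"
    and eq: "\<And>K c. finite K \<Longrightarrow>
      (CLINT x|M. iexp (\<Sum>k\<in>K. c k * X k x)) = (CLINT x|N. iexp (\<Sum>k\<in>K. c k * X' k x))"
  shows "distr M (\<Pi>\<^sub>M i\<in>UNIV. borel) (\<lambda>x i. X i x) = distr N (\<Pi>\<^sub>M i\<in>UNIV. borel) (\<lambda>x i. X' i x)"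
proof -
  interpret M: prob_space M by fact
  interpret N: prob_space N by fact
  have [measurable]: "(\<lambda>x i. X i x) \<in> measurable M (\<Pi>\<^sub>M i\<in>UNIV. borel)"
    by (rule measurable_PiM_single') auto
  have [measurable]: "(\<lambda>x i. X' i x) \<in> measurable N (\<Pi>\<^sub>M i\<in>UNIV. borel)"
    by (rule measurable_PiM_single') auto
  show ?thesis
  proof (rule measure_eqI_PiM_infinite)
    show "finite_measure (distr M (\<Pi>\<^sub>M i\<in>UNIV. borel) (\<lambda>x i. X i x))"
      by (rule M.finite_measure_distr) auto
  next
    fix A :: "'i \<Rightarrow> real set" and J :: "'i set"
    assume J: "finite J" and A: "\<And>i. i \<in> J \<Longrightarrow> A i \<in> sets borel"
    define B where "B i = (if i \<in> J then A i else UNIV)" for i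
    have [measurable]: "B i \<in> sets borel" for i using A by (auto simp: B_def)
    have pe: "prod_emb UNIV (\<lambda>_. borel :: real measure) J (Pi\<^sub>E J A) = {z. \<forall>j\<in>J. z j \<in> B j}"
      by (auto simp: prod_emb_def B_def PiE_iff restrict_def extensional_def space_PiM)
    have ind: "(\<Prod>j\<in>J. indicator (B j) (z j)) = (indicator {z. \<forall>j\<in>J. z j \<in> B j} z :: real)" for z
      using J by (auto split: split_indicator) 
    have cyl: "{z. \<forall>j\<in>J. z j \<in> B j} \<in> sets (\<Pi>\<^sub>M i\<in>UNIV. borel :: real measure)"
      unfolding pe[symmetric] using A J by (intro sets_PiM_I) auto
    have "(CLINT x|M. of_real (\<Prod>j\<in>J. indicator (B j) (X j x)) * iexp (\<Sum>k\<in>{}. 0 * X k x)) =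
      (CLINT x|N. of_real (\<Prod>j\<in>J. indicator (B j) (X' j x)) * iexp (\<Sum>k\<in>{}. 0 * X' k x))"
      by (rule cylinder_eq_of_char[OF M.finite_measure_axioms N.finite_measure_axioms X X' eq _ J]) auto
    then have "(\<integral>x. (\<Prod>j\<in>J. indicator (B j) (X j x)) \<partial>M) = (\<integral>x. (\<Prod>j\<in>J. indicator (B j) (X' j x)) \<partial>N :: real)"
      by (simp del: of_real_prod)
    moreover have "(\<integral>x. (\<Prod>j\<in>J. indicator (B j) (X j x)) \<partial>M :: real) = measure (distr M (\<Pi>\<^sub>M i\<in>UNIV. borel) (\<lambda>x i. X i x)) {z. \<forall>j\<in>J. z j \<in> B j}"
    proof -
      have "(\<integral>x. (\<Prod>j\<in>J. indicator (B j) (X j x)) \<partial>M :: real) = (\<integral>x. indicator {z. \<forall>j\<in>J. z j \<in> B j} (\<lambda>i. X i x) \<partial>M)"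
        by (simp only: ind[symmetric])
      also have "\<dots> = (\<integral>z. indicator {z. \<forall>j\<in>J. z j \<in> B j} z \<partial>distr M (\<Pi>\<^sub>M i\<in>UNIV. borel) (\<lambda>x i. X i x))"
        using cyl by (subst integral_distr) auto
      finally show ?thesis using cyl by (simp add: space_PiM)
    qed
    moreover have "(\<integral>x. (\<Prod>j\<in>J. indicator (B j) (X' j x)) \<partial>N :: real) = measure (distr N (\<Pi>\<^sub>M i\<in>UNIV. borel) (\<lambda>x i. X' i x)) {z. \<forall>j\<in>J. z j \<in> B j}"
    proof -
      have "(\<integral>x. (\<Prod>j\<in>J. indicator (B j) (X' j x)) \<partial>N :: real) = (\<integral>x. indicator {z. \<forall>j\<in>J. z j \<in> B j} (\<lambda>i. X' i x) \<partial>N)"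
        by (simp only: ind[symmetric])
      also have "\<dots> = (\<integral>z. indicator {z. \<forall>j\<in>J. z j \<in> B j} z \<partial>distr N (\<Pi>\<^sub>M i\<in>UNIV. borel) (\<lambda>x i. X' i x))"
        using cyl by (subst integral_distr) auto
      finally show ?thesis using cyl by (simp add: space_PiM)
    qed
    moreover have "finite_measure (distr M (\<Pi>\<^sub>M i\<in>UNIV. borel) (\<lambda>x i. X i x))" "finite_measure (distr N (\<Pi>\<^sub>M i\<in>UNIV. borel) (\<lambda>x i. X' i x))"
      by (auto intro!: M.finite_measure_distr N.finite_measure_distr)
    ultimately show "emeasure (distr M (\<Pi>\<^sub>M i\<in>UNIV. borel) (\<lambda>x i. X i x)) (prod_emb UNIV (\<lambda>_. borel) J (Pi\<^sub>E J A)) =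
       emeasure (distr N (\<Pi>\<^sub>M i\<in>UNIV. borel) (\<lambda>x i. X' i x)) (prod_emb UNIV (\<lambda>_. borel) J (Pi\<^sub>E J A))"
      unfolding pe by (simp add: finite_measure.emeasure_eq_measure)
  qed auto
qed

section \<open>Gaussian tails and Gaussian spaces\<close>

text \<open>Up to the factor \<open>1 / sqrt (2 * pi)\<close> the classical asymptotics of the standard normal tail. All probabilities of one exceedance
are compared with this function, up to constant factors.\<close>

definition mills :: "real \<Rightarrow> real" where
  "mills u = exp (- u\<^sup>2 / 2) / u"

lemma mills_pos: "u > 0 \<Longrightarrow> mills u > 0"
  by (simp add: mills_def)

lemma mills_antimono: "0 < u \<Longrightarrow> u \<le> v \<Longrightarrow> mills v \<le> mills u"
  unfolding mills_def by (intro frac_le) (auto intro!: power_mono)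

text \<open>On \<open>{u<..}\<close> the factor \<open>x / u\<close> is at least \<open>1\<close>, and \<open>x\<close> times the density has an explicit antiderivative.\<close>

lemma std_normal_tail_upper:
  assumes "u > 0"
  shows "(\<integral>\<^sup>+x. ennreal (std_normal_density x) * indicator {u<..} x \<partial>lborel) \<le> ennreal (mills u)"
proof -
  have 1: "(\<integral>\<^sup>+x. ennreal (x * std_normal_density x) * indicator {u..} x \<partial>lborel) = 0 - (- std_normal_density u)"
  proof (rule nn_integral_FTC_atLeast)
    fix x assume "u \<le> x"
    show "((\<lambda>x. - std_normal_density x) has_real_derivative x * std_normal_density x) (at x)"
    proof -
      have "((\<lambda>x. - (c * exp (- x\<^sup>2 / 2))) has_real_derivative x * (c * exp (- x\<^sup>2 / 2))) (at x)" for c :: real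
        by (auto intro!: derivative_eq_intros)
      then show ?thesis unfolding std_normal_density_def .
    qed
    show "0 \<le> x * std_normal_density x" using \<open>u \<le> x\<close> assms by simp
  next
    show "((\<lambda>x. - std_normal_density x) \<longlongrightarrow> 0) at_top"
      unfolding std_normal_density_def by real_asymp
  qed auto
  have "(\<integral>\<^sup>+x. ennreal (std_normal_density x) * indicator {u<..} x \<partial>lborel)
      \<le> (\<integral>\<^sup>+x. ennreal (1/u) * (ennreal (x * std_normal_density x) * indicator {u..} x) \<partial>lborel)"
  proof (intro nn_integral_mono)
    fix x :: real
    show "ennreal (std_normal_density x) * indicator {u<..} x \<le> ennreal (1/u) * (ennreal (x * std_normal_density x) * indicator {u..} x)"
    proof (cases "x > u")
      case True
      have "1 * std_normal_density x \<le> (x / u) * std_normal_density x"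
        using True assms by (intro mult_right_mono) auto
      then show ?thesis using True assms by (simp add: ennreal_mult[symmetric])
    qed auto
  qed
  also have "\<dots> = ennreal (1/u) * ennreal (std_normal_density u)"
    using 1 by (subst nn_integral_cmult) auto
  also have "\<dots> = ennreal (std_normal_density u / u)"
    using assms by (simp add: ennreal_mult[symmetric])
  also have "\<dots> \<le> ennreal (mills u)"
  proof (intro ennreal_leI)
    have "1 \<le> sqrt (2 * pi)" using pi_gt3 by simp
    then have "1 / sqrt (2 * pi) \<le> 1" by (simp add: divide_simps)
    then have "1 / sqrt (2 * pi) * exp (- u\<^sup>2 / 2) \<le> 1 * exp (- u\<^sup>2 / 2)"
      by (intro mult_right_mono) auto
    then show "std_normal_density u / u \<le> mills u"
      unfolding std_normal_density_def mills_def using assms by (intro divide_right_mono) auto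
  qed
  finally show ?thesis .
qed

text \<open>The interval of length \<open>1 / u\<close> above \<open>u\<close> already carries a constant fraction of the tail.\<close>

lemma std_normal_tail_lower:
  assumes "u \<ge> 1"
  shows "ennreal (mills u / 18) \<le> (\<integral>\<^sup>+x. ennreal (std_normal_density x) * indicator {u<..} x \<partial>lborel)"
proof -
  have "mills u / 18 \<le> (1/u) * std_normal_density (u + 1/u)"
  proof -
    have "sqrt (2 * pi) \<le> sqrt 9" using pi_less_4 pi_approx by (intro real_sqrt_le_mono) auto
    then have s: "sqrt (2 * pi) \<le> 3" by simp
    have "(u + 1/u)\<^sup>2 = u\<^sup>2 + 2 + 1/u\<^sup>2" using assms by (simp add: power2_sum power_divide)
    moreover have "1/u\<^sup>2 \<le> 1" using assms by (simp add: divide_simps)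
    ultimately have "(u + 1/u)\<^sup>2 \<le> u\<^sup>2 + 3" by simp
    then have e: "exp (- u\<^sup>2 / 2) * exp (- (3/2)) \<le> exp (- (u + 1/u)\<^sup>2 / 2)"
      unfolding exp_add[symmetric] by simp
    have "exp (3/2 :: real) \<le> exp 1 * exp (1/2)" by (simp add: exp_add[symmetric])
    moreover have "exp (1/2 :: real) \<le> 2"
    proof -
      have "exp (1/2 :: real) ^ 2 = exp 1" by (simp add: power2_eq_square exp_add[symmetric])
      then have "exp (1/2 :: real) ^ 2 \<le> 2 ^ 2" using exp_le by simp
      then show ?thesis by (rule power2_le_imp_le) simp
    qed
    ultimately have "exp (3/2 :: real) \<le> 3 * 2"
      using exp_le mult_mono[of "exp 1 :: real" 3 "exp (1/2)" 2] by auto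
    then have e2: "1/6 \<le> exp (- (3/2 :: real))" by (simp add: exp_minus divide_simps)
    have "exp (- u\<^sup>2 / 2) / 18 \<le> exp (- u\<^sup>2 / 2) * exp (- (3/2)) / 3"
      using e2 by simp
    also have "\<dots> \<le> exp (- (u + 1/u)\<^sup>2 / 2) / 3" using e by simp
    also have "\<dots> \<le> std_normal_density (u + 1/u)"
      unfolding std_normal_density_def using s by (simp add: divide_simps)
    finally show ?thesis using assms unfolding mills_def by (simp add: divide_simps)
  qed
  then have "ennreal (mills u / 18) \<le> ennreal ((1/u) * std_normal_density (u + 1/u))" by (rule ennreal_leI)
  also have "\<dots> = ennreal (std_normal_density (u + 1/u)) * emeasure lborel {u<..u + 1/u}"
    using assms by (simp add: ennreal_mult[symmetric] mult.commute)
  also have "\<dots> = (\<integral>\<^sup>+x. ennreal (std_normal_density (u + 1/u)) * indicator {u<..u + 1/u} x \<partial>lborel)"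
    by (subst nn_integral_cmult_indicator) auto
  also have "\<dots> \<le> (\<integral>\<^sup>+x. ennreal (std_normal_density x) * indicator {u<..} x \<partial>lborel)"
  proof (intro nn_integral_mono)
    fix x :: real
    show "ennreal (std_normal_density (u + 1/u)) * indicator {u<..u + 1/u} x \<le> ennreal (std_normal_density x) * indicator {u<..} x"
    proof (cases "x \<in> {u<..u+1/u}")
      case True
      then have "x\<^sup>2 \<le> (u + 1/u)\<^sup>2" using assms by (intro power_mono) auto
      then have "std_normal_density (u + 1/u) \<le> std_normal_density x"
        unfolding std_normal_density_def by (intro mult_left_mono) auto
      then show ?thesis using True by (auto intro!: ennreal_leI)
    qed auto
  qed
  finally show ?thesis .
qed

lemma (in prob_space) pair_expectation_mult:
  fixes f g :: "_ \<Rightarrow> complex"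
  assumes [measurable]: "f \<in> borel_measurable M" "g \<in> borel_measurable M"
    and "\<And>x. norm (f x) \<le> 1" "\<And>x. norm (g x) \<le> 1"
  shows "(\<integral>z. f (fst z) * g (snd z) \<partial>(M \<Otimes>\<^sub>M M)) = (\<integral>x. f x \<partial>M) * (\<integral>x. g x \<partial>M)"
proof -
  interpret P: pair_prob_space M M ..
  have "integrable (M \<Otimes>\<^sub>M M) (\<lambda>z. f (fst z) * g (snd z))"
    using assms by (intro P.integrable_const_bound[of _ 1]) (auto simp: norm_mult mult_le_one)
  from P.integral_fst'[OF this] show ?thesis by simp
qed

text \<open>A linear space of centred, jointly Gaussian variables, which is what conditioning by regression needs: residuals stay in the space, and
uncorrelated members are independent.\<close>

locale gaussian_space = prob_space M for M :: "'a measure" +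
  fixes H :: "('a \<Rightarrow> real) set"
  assumes zero_mem: "(\<lambda>_. 0) \<in> H"
    and add_mem: "V \<in> H \<Longrightarrow> W \<in> H \<Longrightarrow> (\<lambda>x. V x + W x) \<in> H"
    and scale_mem: "V \<in> H \<Longrightarrow> (\<lambda>x. c * V x) \<in> H"
    and meas: "V \<in> H \<Longrightarrow> V \<in> borel_measurable M"
    and gauss: "V \<in> H \<Longrightarrow> (AE x in M. V x = 0) \<or> (\<exists>\<sigma>>0. distributed M lborel V (normal_density 0 \<sigma>))"
begin

lemma diff_mem: "V \<in> H \<Longrightarrow> W \<in> H \<Longrightarrow> (\<lambda>x. V x - W x) \<in> H"
  using add_mem[of V "\<lambda>x. (-1) * W x"] scale_mem[of W "-1"] by simp

lemma minus_mem: "V \<in> H \<Longrightarrow> (\<lambda>x. - V x) \<in> H"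
  using scale_mem[of V "-1"] by simp

lemma sum_mem: "(\<And>i. i \<in> I \<Longrightarrow> V i \<in> H) \<Longrightarrow> (\<lambda>x. \<Sum>i\<in>I. c i * V i x) \<in> H"
  by (induction I rule: infinite_finite_induct) (auto intro!: zero_mem add_mem scale_mem)

lemma gauss_cases:
  assumes "V \<in> H"
  obtains "AE x in M. V x = 0" "expectation (\<lambda>x. (V x)\<^sup>2) = 0" "integrable M (\<lambda>x. (V x)\<^sup>2)"
  | \<sigma> where "\<sigma> > 0" "distributed M lborel V (normal_density 0 \<sigma>)" "expectation (\<lambda>x. (V x)\<^sup>2) = \<sigma>\<^sup>2"
      "integrable M (\<lambda>x. (V x)\<^sup>2)"
proof -
  note [measurable] = meas[OF assms]
  from gauss[OF assms] consider "AE x in M. V x = 0" | \<sigma> where "\<sigma> > 0" "distributed M lborel V (normal_density 0 \<sigma>)"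
    by blast
  then show ?thesis
  proof cases
    case 1
    have "integrable M (\<lambda>x. (V x)\<^sup>2) \<longleftrightarrow> integrable M (\<lambda>x. 0::real)"
      using 1 by (intro integrable_cong_AE) auto
    moreover have "expectation (\<lambda>x. (V x)\<^sup>2) = 0"
      using 1 by (intro integral_eq_zero_AE) auto
    ultimately show ?thesis using 1 that(1) by simp
  next
    case 2
    have "integrable M (\<lambda>x. (V x)\<^sup>2)"
      using integrable_normal_moment[OF 2(1), of 0 2] distributed_integrable[OF 2(2), of "\<lambda>x. x\<^sup>2"]
      by (simp add: normal_density_nonneg)
    moreover have "expectation (\<lambda>x. (V x)\<^sup>2) = \<sigma>\<^sup>2"
      using normal_distributed_variance[OF 2] normal_distributed_expectation[OF 2] by simp
    ultimately show ?thesis using 2 that(2) by blast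
  qed
qed

lemma square_integrable: "V \<in> H \<Longrightarrow> integrable M (\<lambda>x. (V x)\<^sup>2)"
  by (cases rule: gauss_cases) auto

lemma mult_integrable:
  assumes "V \<in> H" "W \<in> H" shows "integrable M (\<lambda>x. V x * W x)"
proof (rule Bochner_Integration.integrable_bound)
  show "integrable M (\<lambda>x. (V x)\<^sup>2 + (W x)\<^sup>2)" using assms square_integrable by auto
  show "AE x in M. norm (V x * W x) \<le> norm ((V x)\<^sup>2 + (W x)\<^sup>2)"
  proof (intro AE_I2)
    fix x
    have "0 \<le> (\<bar>V x\<bar> - \<bar>W x\<bar>)\<^sup>2" by simp
    then have "2 * (\<bar>V x\<bar> * \<bar>W x\<bar>) \<le> (V x)\<^sup>2 + (W x)\<^sup>2" by (simp add: power2_diff)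
    moreover have "0 \<le> \<bar>V x\<bar> * \<bar>W x\<bar>" by simp
    ultimately have "\<bar>V x\<bar> * \<bar>W x\<bar> \<le> (V x)\<^sup>2 + (W x)\<^sup>2" by linarith
    then show "norm (V x * W x) \<le> norm ((V x)\<^sup>2 + (W x)\<^sup>2)" by (simp add: abs_mult)
  qed
qed (use assms meas in measurable)

lemma integrable_mem:
  assumes "V \<in> H" shows "integrable M V"
proof (rule Bochner_Integration.integrable_bound)
  show "integrable M (\<lambda>x. 1 + (V x)\<^sup>2)" using assms square_integrable by auto
  show "AE x in M. norm (V x) \<le> norm (1 + (V x)\<^sup>2)"
  proof (intro AE_I2)
    fix x
    have "0 \<le> (\<bar>V x\<bar> - 1)\<^sup>2" by simp
    then show "norm (V x) \<le> norm (1 + (V x)\<^sup>2)" by (simp add: power2_diff)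
  qed
qed (use assms meas in measurable)

definition cov :: "('a \<Rightarrow> real) \<Rightarrow> ('a \<Rightarrow> real) \<Rightarrow> real" where
  "cov V W = expectation (\<lambda>x. V x * W x)"

lemma cov_commute: "cov V W = cov W V"
  unfolding cov_def by (simp add: mult.commute)

lemma cov_self: "cov V V = expectation (\<lambda>x. (V x)\<^sup>2)"
  unfolding cov_def by (simp add: power2_eq_square)

lemma cov_self_nonneg: "cov V V \<ge> 0"
  unfolding cov_self by simp

lemma cov_add_left: "U \<in> H \<Longrightarrow> V \<in> H \<Longrightarrow> W \<in> H \<Longrightarrow> cov (\<lambda>x. U x + V x) W = cov U W + cov V W"
  unfolding cov_def by (simp add: distrib_right mult_integrable)

lemma cov_scale_left: "cov (\<lambda>x. c * V x) W = c * cov V W"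
  unfolding cov_def by (simp add: mult.assoc)

lemma cov_scale_right: "cov V (\<lambda>x. c * W x) = c * cov V W"
  unfolding cov_def by (simp add: mult.left_commute)

lemma cov_diff_left: "U \<in> H \<Longrightarrow> V \<in> H \<Longrightarrow> W \<in> H \<Longrightarrow> cov (\<lambda>x. U x - V x) W = cov U W - cov V W"
  unfolding cov_def by (simp add: left_diff_distrib mult_integrable)

lemma cov_add_right: "U \<in> H \<Longrightarrow> V \<in> H \<Longrightarrow> W \<in> H \<Longrightarrow> cov W (\<lambda>x. U x + V x) = cov W U + cov W V"
  unfolding cov_def by (simp add: distrib_left mult_integrable)

lemma cov_diff_right: "U \<in> H \<Longrightarrow> V \<in> H \<Longrightarrow> W \<in> H \<Longrightarrow> cov W (\<lambda>x. U x - V x) = cov W U - cov W V"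
  unfolding cov_def by (simp add: right_diff_distrib mult_integrable)

lemma cov_minus_right: "cov V (\<lambda>x. - W x) = - cov V W"
  unfolding cov_def by simp

lemma cov_zero_left: "cov (\<lambda>_. 0) W = 0"
  unfolding cov_def by simp

lemma cov_sum_left:
  "(\<And>i. i \<in> I \<Longrightarrow> V i \<in> H) \<Longrightarrow> W \<in> H \<Longrightarrow> cov (\<lambda>x. \<Sum>i\<in>I. c i * V i x) W = (\<Sum>i\<in>I. c i * cov (V i) W)"
proof (induction I rule: infinite_finite_induct)
  case (insert i I)
  then show ?case
    using cov_add_left[of "\<lambda>x. c i * V i x" "\<lambda>x. \<Sum>i\<in>I. c i * V i x" W] sum_mem[of I V c]
    by (simp add: scale_mem cov_scale_left)
qed (auto simp: cov_zero_left)

lemma cov_sum_right: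
  "(\<And>i. i \<in> I \<Longrightarrow> V i \<in> H) \<Longrightarrow> W \<in> H \<Longrightarrow> cov W (\<lambda>x. \<Sum>i\<in>I. c i * V i x) = (\<Sum>i\<in>I. c i * cov W (V i))"
  using cov_sum_left[of I V W c] by (simp add: cov_commute)

lemma cov_add_self:
  "U \<in> H \<Longrightarrow> V \<in> H \<Longrightarrow> cov (\<lambda>x. U x + V x) (\<lambda>x. U x + V x) = cov U U + 2 * cov U V + cov V V"
  by (simp add: cov_add_left cov_add_right add_mem cov_commute)

lemma cov_diff_self:
  "U \<in> H \<Longrightarrow> V \<in> H \<Longrightarrow> cov (\<lambda>x. U x - V x) (\<lambda>x. U x - V x) = cov U U - 2 * cov U V + cov V V"
  by (simp add: cov_diff_left cov_diff_right diff_mem cov_commute)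

lemma cauchy_schwarz:
  assumes "U \<in> H" "V \<in> H"
  shows "(cov U V)\<^sup>2 \<le> cov U U * cov V V"
proof -
  have q: "0 \<le> cov U U - 2 * t * cov U V + t\<^sup>2 * cov V V" for t
    using cov_self_nonneg[of "\<lambda>x. U x - t * V x"] cov_diff_self[of U "\<lambda>x. t * V x"] assms
    by (simp add: scale_mem cov_scale_left cov_scale_right power2_eq_square algebra_simps)
  show ?thesis
  proof (cases "cov V V = 0")
    case True
    have "cov U V = 0"
    proof (rule ccontr)
      assume "cov U V \<noteq> 0"
      then show False using q[of "(cov U U + 1) / (2 * cov U V)"] True by simp
    qed
    then show ?thesis using True by simp
  next
    case False
    then have "cov V V > 0" using cov_self_nonneg[of V] by simp
    define t where "t = cov U V / cov V V"
    have t: "t * cov V V = cov U V" using False by (simp add: t_def)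
    have "t\<^sup>2 * cov V V = t * cov U V" using t by (simp add: power2_eq_square mult.assoc)
    then have "t * cov U V \<le> cov U U" using q[of t] by simp
    then have "(cov U V)\<^sup>2 / cov V V \<le> cov U U" by (simp add: t_def power2_eq_square)
    then show ?thesis using \<open>cov V V > 0\<close> by (simp add: pos_divide_le_eq)
  qed
qed

lemma characteristic:
  assumes "V \<in> H"
  shows "(CLINT x|M. iexp (V x)) = exp (- (cov V V) / 2)"
  using assms
proof (cases rule: gauss_cases)
  case 1
  note [measurable] = meas[OF assms]
  have "(CLINT x|M. iexp (V x)) = (CLINT x|M. 1)"
    using 1 by (intro integral_cong_AE) auto
  then show ?thesis using 1 by (simp add: cov_self prob_space)
next
  case (2 \<sigma>)
  note [measurable] = meas[OF assms]
  have "distributed M lborel (\<lambda>x. 0 + (1/\<sigma>) * V x) (normal_density (0 + (1/\<sigma>) * 0) (\<bar>1/\<sigma>\<bar> * \<sigma>))"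
    using 2 by (intro normal_density_affine) auto
  then have d: "distributed M lborel (\<lambda>x. V x / \<sigma>) std_normal_density" using 2 by simp
  have "(CLINT x|M. iexp (V x)) = (CLINT x|M. iexp (\<sigma> * (V x / \<sigma>)))" using 2 by simp
  also have "\<dots> = (CLINT x|distr M borel (\<lambda>x. V x / \<sigma>). iexp (\<sigma> * x))"
    by (subst integral_distr) auto
  also have "distr M borel (\<lambda>x. V x / \<sigma>) = density lborel std_normal_density"
    using d unfolding distributed_def by (metis distr_cong sets_lborel)
  also have "(CLINT x|density lborel std_normal_density. iexp (\<sigma> * x)) = char std_normal_distribution \<sigma>"
    unfolding char_def ..
  finally show ?thesis
    using 2 by (simp add: char_std_normal_distribution cov_self exp_of_real[symmetric])
qed

lemma tail_upper:
  assumes V: "V \<in> H" and s: "cov V V \<le> s\<^sup>2" "s > 0" "w > 0"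
  shows "\<P>(x in M. V x > w) \<le> mills (w / s)"
  using V
proof (cases rule: gauss_cases)
  case 1
  note [measurable] = meas[OF V]
  have "AE x in M. \<not> V x > w" using 1(1) by eventually_elim (use s(3) in simp)
  then have "\<P>(x in M. V x > w) = 0" by (subst prob_eq_0) simp_all
  moreover have "0 \<le> mills (w / s)" using s by (intro less_imp_le mills_pos) simp
  ultimately show ?thesis by simp
next
  case (2 \<sigma>)
  note [measurable] = meas[OF V]
  have "distributed M lborel (\<lambda>x. 0 + (1/\<sigma>) * V x) (normal_density (0 + (1/\<sigma>) * 0) (\<bar>1/\<sigma>\<bar> * \<sigma>))"
    using 2 by (intro normal_density_affine) auto
  then have d: "distributed M lborel (\<lambda>x. V x / \<sigma>) std_normal_density" using 2 by simp
  have "V x > w \<longleftrightarrow> V x / \<sigma> > w / \<sigma>" for x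
    using \<open>\<sigma> > 0\<close> by (simp add: divide_less_cancel)
  then have "{x\<in>space M. V x > w} = (\<lambda>x. V x / \<sigma>) -` {w/\<sigma><..} \<inter> space M" by auto
  then have "emeasure M {x\<in>space M. V x > w} = emeasure M ((\<lambda>x. V x / \<sigma>) -` {w/\<sigma><..} \<inter> space M)" by simp
  also have "\<dots> = (\<integral>\<^sup>+x. ennreal (std_normal_density x) * indicator {w/\<sigma><..} x \<partial>lborel)"
    by (rule distributed_emeasure[OF d]) simp
  also have "\<dots> \<le> ennreal (mills (w / \<sigma>))" using \<open>\<sigma> > 0\<close> s(3) by (intro std_normal_tail_upper) simp
  finally have "ennreal (\<P>(x in M. V x > w)) \<le> ennreal (mills (w / \<sigma>))"
    by (simp only: emeasure_eq_measure)
  moreover have "0 \<le> mills (w / \<sigma>)"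
    using \<open>\<sigma> > 0\<close> s(3) by (intro less_imp_le mills_pos) simp
  ultimately have "\<P>(x in M. V x > w) \<le> mills (w / \<sigma>)" by (simp only: ennreal_le_iff)
  also have "\<dots> \<le> mills (w / s)"
  proof (intro mills_antimono)
    have "\<sigma>\<^sup>2 \<le> s\<^sup>2" using 2(3) s(1) by (simp only: cov_self)
    then have "\<sigma> \<le> s" by (rule power2_le_imp_le) (use s(2) in simp)
    then show "w / s \<le> w / \<sigma>" using \<open>\<sigma> > 0\<close> s by (intro divide_left_mono) simp_all
  qed (use s in simp)
  finally show ?thesis .
qed

lemma tail_lower:
  assumes V: "V \<in> H" and s: "cov V V = 1" "w \<ge> 1"
  shows "\<P>(x in M. V x > w) \<ge> mills w / 18"
  using V
proof (cases rule: gauss_cases)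
  case (2 \<sigma>)
  note [measurable] = meas[OF V]
  have "\<sigma> = 1" using 2 s by (simp add: cov_self power2_eq_1_iff)
  then have d: "distributed M lborel V std_normal_density" using 2 by simp
  have "ennreal (mills w / 18) \<le> (\<integral>\<^sup>+x. ennreal (std_normal_density x) * indicator {w<..} x \<partial>lborel)"
    using s by (intro std_normal_tail_lower)
  also have "\<dots> = emeasure M (V -` {w<..} \<inter> space M)"
    by (rule distributed_emeasure[OF d, symmetric]) simp
  also have "V -` {w<..} \<inter> space M = {x\<in>space M. V x > w}" by auto
  finally show ?thesis by (simp add: emeasure_eq_measure)
qed (use s in \<open>auto simp: cov_self\<close>)

text \<open>Bounded by the sum of the two exponential moments, each computed by completing the square.\<close>

lemma exp_abs_moment:
  assumes V: "V \<in> H"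
  shows "(\<integral>\<^sup>+x. ennreal (exp \<bar>V x\<bar>) \<partial>M) \<le> ennreal (2 * exp (cov V V / 2))"
  using V
proof (cases rule: gauss_cases)
  case 1
  note [measurable] = meas[OF V]
  have "(\<integral>\<^sup>+x. ennreal (exp \<bar>V x\<bar>) \<partial>M) = (\<integral>\<^sup>+x. 1 \<partial>M)"
    using 1 by (intro nn_integral_cong_AE) auto
  also have "\<dots> \<le> ennreal 2" by (simp add: emeasure_space_1)
  finally show ?thesis using 1 by (simp add: cov_self)
next
  case (2 \<sigma>)
  note [measurable] = meas[OF V]
  have E: "(\<integral>\<^sup>+x. ennreal (exp (a * V x)) \<partial>M) = ennreal (exp (\<sigma>\<^sup>2 / 2))" if "a\<^sup>2 = 1" for a
  proof -
    have "(\<integral>\<^sup>+x. ennreal (exp (a * V x)) \<partial>M) = (\<integral>\<^sup>+x. ennreal (normal_density 0 \<sigma> x) * ennreal (exp (a * x)) \<partial>lborel)"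
      using 2 by (intro distributed_nn_integral[symmetric]) auto
    also have "\<dots> = (\<integral>\<^sup>+x. ennreal (exp (\<sigma>\<^sup>2 / 2)) * ennreal (normal_density (a * \<sigma>\<^sup>2) \<sigma> x) \<partial>lborel)"
    proof (intro nn_integral_cong)
      fix x :: real
      have "-(x\<^sup>2) / (2 * \<sigma>\<^sup>2) + a * x = \<sigma>\<^sup>2 / 2 + (-((x - a * \<sigma>\<^sup>2)\<^sup>2) / (2 * \<sigma>\<^sup>2))"
      proof -
        have "(x - a * \<sigma>\<^sup>2)\<^sup>2 = x\<^sup>2 - 2 * x * a * \<sigma>\<^sup>2 + a\<^sup>2 * \<sigma>\<^sup>2 * \<sigma>\<^sup>2"
          by (simp add: power2_eq_square algebra_simps)
        then have "(x - a * \<sigma>\<^sup>2)\<^sup>2 / (2 * \<sigma>\<^sup>2) = x\<^sup>2 / (2 * \<sigma>\<^sup>2) - x * a + \<sigma>\<^sup>2 / 2"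
          using that \<open>\<sigma> > 0\<close> by (simp add: field_simps)
        then show ?thesis by (simp add: mult.commute)
      qed
      then have "normal_density 0 \<sigma> x * exp (a * x) = exp (\<sigma>\<^sup>2 / 2) * normal_density (a * \<sigma>\<^sup>2) \<sigma> x"
        unfolding normal_density_def by (simp add: exp_add[symmetric])
      then show "ennreal (normal_density 0 \<sigma> x) * ennreal (exp (a * x)) = ennreal (exp (\<sigma>\<^sup>2 / 2)) * ennreal (normal_density (a * \<sigma>\<^sup>2) \<sigma> x)"
        by (simp add: ennreal_mult[symmetric])
    qed
    also have "\<dots> = ennreal (exp (\<sigma>\<^sup>2 / 2)) * 1"
      using prob_space.emeasure_space_1[OF prob_space_normal_density[OF \<open>\<sigma> > 0\<close>], of "a * \<sigma>\<^sup>2"]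
      by (subst nn_integral_cmult) (auto simp: emeasure_density)
    finally show ?thesis by simp
  qed
  have "(\<integral>\<^sup>+x. ennreal (exp \<bar>V x\<bar>) \<partial>M) \<le> (\<integral>\<^sup>+x. ennreal (exp (1 * V x)) + ennreal (exp ((-1) * V x)) \<partial>M)"
    by (intro nn_integral_mono) (auto simp: abs_if)
  also have "\<dots> = ennreal (exp (\<sigma>\<^sup>2 / 2)) + ennreal (exp (\<sigma>\<^sup>2 / 2))"
    using E[of 1] E[of "-1"] by (subst nn_integral_add) simp_all
  also have "\<dots> = ennreal (2 * exp (\<sigma>\<^sup>2 / 2))"
    by (simp flip: ennreal_plus)
  finally show ?thesis using 2 by (simp add: cov_self)
qed

end

section \<open>Weakly correlated Gaussian variables\<close>

context gaussian_space begin

lemma pair_nn_mult: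
  assumes [measurable]: "f \<in> borel_measurable M" "g \<in> borel_measurable M"
  shows "(\<integral>\<^sup>+z. f (fst z) * g (snd z) \<partial>(M \<Otimes>\<^sub>M M)) = (\<integral>\<^sup>+x. f x \<partial>M) * (\<integral>\<^sup>+x. g x \<partial>M)"
  by (subst nn_integral_fst[symmetric]) (simp_all add: nn_integral_cmult nn_integral_multc)

lemma pair_characteristic:
  assumes "A \<in> H" "B \<in> H"
  shows "(CLINT z|(M \<Otimes>\<^sub>M M). iexp (A (fst z) + B (snd z))) = exp (- (cov A A + cov B B) / 2)"
proof -
  note [measurable] = meas[OF assms(1)] meas[OF assms(2)]
  have "(CLINT z|(M \<Otimes>\<^sub>M M). iexp (A (fst z) + B (snd z))) = (CLINT z|(M \<Otimes>\<^sub>M M). iexp (A (fst z)) * iexp (B (snd z)))"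
    by (simp add: exp_add distrib_left)
  also have "\<dots> = (CLINT x|M. iexp (A x)) * (CLINT x|M. iexp (B x))"
    by (rule pair_expectation_mult) auto
  also have "\<dots> = exp (- (cov A A + cov B B) / 2)"
    unfolding characteristic[OF assms(1)] characteristic[OF assms(2)]
    by (simp add: exp_add[symmetric] of_real_mult[symmetric] diff_divide_distrib del: of_real_mult)
  finally show ?thesis .
qed

text \<open>Uncorrelated means independent, for one variable against a whole family. The pair of \<open>Y\<close> and the family has the law of the pair taken from two
independent copies of the probability space, because the characteristic functions of linear combinations agree.\<close>

lemma orthogonal_product:
  fixes R :: "'s \<Rightarrow> 'a \<Rightarrow> real"
  assumes Y: "Y \<in> H" and R: "\<And>s. R s \<in> H" and orth: "\<And>s. cov Y (R s) = 0"
    and f [measurable]: "f \<in> borel_measurable borel" and g [measurable]: "g \<in> borel_measurable (\<Pi>\<^sub>M i\<in>UNIV. borel)"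
  shows "(\<integral>\<^sup>+x. f (Y x) * g (\<lambda>s. R s x) \<partial>M) = (\<integral>\<^sup>+x. f (Y x) \<partial>M) * (\<integral>\<^sup>+x. g (\<lambda>s. R s x) \<partial>M)"
proof -
  interpret P: pair_prob_space M M ..
  note [measurable] = meas[OF Y] meas[OF R]
  define W where "W k x = (case k of None \<Rightarrow> Y x | Some s \<Rightarrow> R s x)" for k x
  define W' where "W' k z = (case k of None \<Rightarrow> Y (fst z) | Some s \<Rightarrow> R s (snd z))" for k z
  have W_H: "W k \<in> H" for k unfolding W_def using Y R by (cases k) auto
  note [measurable] = meas[OF W_H]
  have W'm [measurable]: "W' k \<in> borel_measurable (M \<Otimes>\<^sub>M M)" for k
    unfolding W'_def by (cases k) auto
  have eq: "distr M (\<Pi>\<^sub>M i\<in>UNIV. borel) (\<lambda>x i. W i x) = distr (M \<Otimes>\<^sub>M M) (\<Pi>\<^sub>M i\<in>UNIV. borel) (\<lambda>x i. W' i x)"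
  proof (rule distr_eq_of_char)
    fix K :: "'s option set" and c :: "'s option \<Rightarrow> real" assume K: "finite K"
    define a where "a = (if None \<in> K then c None else 0)"
    define B where "B x = (\<Sum>k\<in>K - {None}. c k * W k x)" for x
    have B_H: "B \<in> H" unfolding B_def using W_H by (intro sum_mem)
    have aY: "(\<lambda>x. a * Y x) \<in> H" using Y by (rule scale_mem)
    have 1: "(\<Sum>k\<in>K. c k * W k x) = a * Y x + B x" for x
      using K by (cases "None \<in> K") (auto simp: a_def B_def W_def sum.remove)
    have 2: "(\<Sum>k\<in>K. c k * W' k z) = a * Y (fst z) + B (snd z)" for z
    proof -
      have "(\<Sum>k\<in>K - {None}. c k * W' k z) = B (snd z)"
        unfolding B_def by (intro sum.cong) (auto simp: W_def W'_def split: option.splits)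
      then show ?thesis
        using K by (cases "None \<in> K") (auto simp: a_def W'_def sum.remove)
    qed
    have "cov Y (W k) = 0" if k: "k \<noteq> None" for k
    proof -
      obtain s where "k = Some s" using k by (cases k) auto
      moreover have "W (Some s) = R s" by (auto simp: W_def)
      ultimately show ?thesis using orth by simp
    qed
    then have "cov (\<lambda>x. a * Y x) B = 0"
      unfolding cov_scale_left B_def
      by (subst cov_sum_right) (auto simp: W_H Y intro!: sum.neutral)
    then have "cov (\<lambda>x. a * Y x + B x) (\<lambda>x. a * Y x + B x) = cov (\<lambda>x. a * Y x) (\<lambda>x. a * Y x) + cov B B"
      using cov_add_self[OF aY B_H] by simp
    then show "(CLINT x|M. iexp (\<Sum>k\<in>K. c k * W k x)) = (CLINT x|(M \<Otimes>\<^sub>M M). iexp (\<Sum>k\<in>K. c k * W' k x))"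
      unfolding 1 2 pair_characteristic[OF aY B_H] characteristic[OF add_mem[OF aY B_H]] by simp
  qed (auto simp: prob_space_axioms P.prob_space_axioms)
  define h where "h z = f (z None) * g (\<lambda>s. z (Some s))" for z :: "'s option \<Rightarrow> real"
  have [measurable]: "(\<lambda>z s. z (Some s)) \<in> measurable (\<Pi>\<^sub>M i\<in>(UNIV::'s option set). borel :: real measure) (\<Pi>\<^sub>M i\<in>UNIV. borel)"
    by (rule measurable_PiM_single') auto
  have [measurable]: "h \<in> borel_measurable (\<Pi>\<^sub>M i\<in>UNIV. borel)"
    unfolding h_def by measurable
  have [measurable]: "(\<lambda>x i. W i x) \<in> measurable M (\<Pi>\<^sub>M i\<in>UNIV. borel)"
    by (rule measurable_PiM_single') auto
  have [measurable]: "(\<lambda>x i. W' i x) \<in> measurable (M \<Otimes>\<^sub>M M) (\<Pi>\<^sub>M i\<in>UNIV. borel)"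
    by (rule measurable_PiM_single') auto
  have [measurable]: "(\<lambda>x s. R s x) \<in> measurable M (\<Pi>\<^sub>M i\<in>UNIV. borel)"
    by (rule measurable_PiM_single') auto
  have "(\<integral>\<^sup>+x. f (Y x) * g (\<lambda>s. R s x) \<partial>M) = (\<integral>\<^sup>+x. h (\<lambda>i. W i x) \<partial>M)"
    by (simp add: h_def W_def)
  also have "\<dots> = (\<integral>\<^sup>+z. h z \<partial>distr M (\<Pi>\<^sub>M i\<in>UNIV. borel) (\<lambda>x i. W i x))"
    by (subst nn_integral_distr) auto
  also have "\<dots> = (\<integral>\<^sup>+z. h z \<partial>distr (M \<Otimes>\<^sub>M M) (\<Pi>\<^sub>M i\<in>UNIV. borel) (\<lambda>x i. W' i x))"
    unfolding eq ..
  also have "\<dots> = (\<integral>\<^sup>+z. h (\<lambda>i. W' i z) \<partial>(M \<Otimes>\<^sub>M M))"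
    by (subst nn_integral_distr) auto
  also have "\<dots> = (\<integral>\<^sup>+z. f (Y (fst z)) * g (\<lambda>s. R s (snd z)) \<partial>(M \<Otimes>\<^sub>M M))"
    by (simp add: h_def W'_def)
  also have "\<dots> = (\<integral>\<^sup>+x. f (Y x) \<partial>M) * (\<integral>\<^sup>+x. g (\<lambda>s. R s x) \<partial>M)"
    by (rule pair_nn_mult) measurable
  finally show ?thesis .
qed

lemma orthogonal_prob:
  fixes R :: "'s \<Rightarrow> 'a \<Rightarrow> real"
  assumes Y: "Y \<in> H" and R: "\<And>s. R s \<in> H" and orth: "\<And>s. cov Y (R s) = 0"
    and A [measurable]: "A \<in> sets borel" and Q [measurable]: "Measurable.pred (\<Pi>\<^sub>M i\<in>UNIV. borel) Q"
  shows "\<P>(x in M. Y x \<in> A \<and> Q (\<lambda>s. R s x)) = \<P>(x in M. Y x \<in> A) * \<P>(x in M. Q (\<lambda>s. R s x))"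
proof -
  note [measurable] = meas[OF Y] meas[OF R]
  have [measurable]: "(\<lambda>x s. R s x) \<in> measurable M (\<Pi>\<^sub>M i\<in>UNIV. borel)"
    by (rule measurable_PiM_single') auto
  define g :: "('s \<Rightarrow> real) \<Rightarrow> ennreal" where "g z = (if Q z then 1 else 0)" for z
  have [measurable]: "g \<in> borel_measurable (\<Pi>\<^sub>M i\<in>UNIV. borel)" unfolding g_def by measurable
  have [measurable]: "Measurable.pred M (\<lambda>x. Q (\<lambda>s. R s x))"
    by (rule measurable_compose[OF _ Q]) measurable
  have 1: "(\<integral>\<^sup>+x. indicator A (Y x) * g (\<lambda>s. R s x) \<partial>M) = emeasure M {x\<in>space M. Y x \<in> A \<and> Q (\<lambda>s. R s x)}"
  proof -
    have "(\<integral>\<^sup>+x. indicator A (Y x) * g (\<lambda>s. R s x) \<partial>M) = (\<integral>\<^sup>+x. indicator {x\<in>space M. Y x \<in> A \<and> Q (\<lambda>s. R s x)} x \<partial>M)"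
      by (intro nn_integral_cong) (auto simp: g_def split: split_indicator)
    then show ?thesis by simp
  qed
  have 2: "(\<integral>\<^sup>+x. indicator A (Y x) \<partial>M) = emeasure M {x\<in>space M. Y x \<in> A}"
  proof -
    have "(\<integral>\<^sup>+x. indicator A (Y x) \<partial>M) = (\<integral>\<^sup>+x. indicator {x\<in>space M. Y x \<in> A} x \<partial>M)"
      by (intro nn_integral_cong) (auto split: split_indicator)
    then show ?thesis by simp
  qed
  have 3: "(\<integral>\<^sup>+x. g (\<lambda>s. R s x) \<partial>M) = emeasure M {x\<in>space M. Q (\<lambda>s. R s x)}"
  proof -
    have "(\<integral>\<^sup>+x. g (\<lambda>s. R s x) \<partial>M) = (\<integral>\<^sup>+x. indicator {x\<in>space M. Q (\<lambda>s. R s x)} x \<partial>M)"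
      by (intro nn_integral_cong) (auto simp: g_def split: split_indicator)
    then show ?thesis by simp
  qed
  have "emeasure M {x\<in>space M. Y x \<in> A \<and> Q (\<lambda>s. R s x)} = emeasure M {x\<in>space M. Y x \<in> A} * emeasure M {x\<in>space M. Q (\<lambda>s. R s x)}"
    using orthogonal_product[where R=R, OF Y R orth, of "indicator A" g] unfolding 1 2 3 by simp
  then show ?thesis by (simp add: emeasure_eq_measure ennreal_mult[symmetric])
qed

definition both_exceed :: "('s \<Rightarrow> 'a \<Rightarrow> real) \<Rightarrow> 's set \<Rightarrow> 's set \<Rightarrow> real \<Rightarrow> 'a set" where
  "both_exceed G S S' w = {x\<in>space M. (\<exists>s\<in>S. G s x > w) \<and> (\<exists>s\<in>S'. G s x > w)}"

lemma both_exceed_measurable: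
  assumes "\<And>s. G s \<in> H" "finite S" "finite S'" shows "both_exceed G S S' w \<in> sets M"
proof -
  note [measurable] = meas[OF assms(1)]
  show ?thesis unfolding both_exceed_def using assms by measurable
qed

text \<open>The crude constant \<open>1/2\<close> suffices for dividing out the event \<open>\<bar>Y\<bar> \<le> 2 * u\<close> in the decoupling inequality.\<close>

lemma two_sided_mass:
  assumes "Y \<in> H" "cov Y Y \<le> 1" "u \<ge> 2"
  shows "\<P>(x in M. \<bar>Y x\<bar> \<le> u) \<ge> 1/2"
proof -
  note [measurable] = meas[OF assms(1)]
  have m: "mills u \<le> 1/4"
  proof -
    have "mills u \<le> mills 2" using assms by (intro mills_antimono) auto
    also have "\<dots> = exp (-2) / 2" by (simp add: mills_def)
    also have "\<dots> \<le> 1/4"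
      using exp_ge_add_one_self[of 2] by (simp add: exp_minus field_simps)
    finally show ?thesis .
  qed
  have "\<P>(x in M. \<not> \<bar>Y x\<bar> \<le> u) \<le> \<P>(x in M. Y x > u) + \<P>(x in M. - Y x > u)"
    by (rule order_trans[OF _ measure_Un_le]) (auto intro!: finite_measure_mono)
  also have "\<dots> \<le> mills (u/1) + mills (u/1)"
    using assms minus_mem[OF assms(1)]
    by (intro add_mono tail_upper) (auto simp: cov_def)
  finally have "\<P>(x in M. \<not> \<bar>Y x\<bar> \<le> u) \<le> 1/2" using m by simp
  then show ?thesis using prob_neg[of "\<lambda>x. \<bar>Y x\<bar> \<le> u"] by simp
qed

text \<open>The residuals \<open>R s = G s - cov Y (G s) * Y\<close> are independent of \<open>Y\<close>, and on \<open>\<bar>Y\<bar> \<le> 2 * u\<close> they differ from \<open>G s\<close> by at most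
\<open>2 * u * \<epsilon>\<close>. So the event for \<open>G\<close> is passed to \<open>R\<close>, split off from \<open>Y\<close>, and passed back to \<open>G\<close> at the cost of the event
\<open>\<bar>Y\<bar> \<le> 2 * u\<close> of probability at least \<open>1/2\<close>; this is the factor \<open>2\<close>. Each passage lowers the level by \<open>2 * u * \<epsilon>\<close>.\<close>

lemma decouple:
  fixes G :: "'s \<Rightarrow> 'a \<Rightarrow> real"
  assumes Y: "Y \<in> H" "cov Y Y = 1" and G: "\<And>s. G s \<in> H" and S: "finite S" "finite S'"
    and eps: "\<And>s. s \<in> S \<union> S' \<Longrightarrow> \<bar>cov Y (G s)\<bar> \<le> \<epsilon>" and u: "u \<ge> 1"
  shows "\<P>(x in M. Y x > u \<and> x \<in> both_exceed G S S' w)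
    \<le> 2 * \<P>(x in M. Y x > u) * prob (both_exceed G S S' (w - 4 * u * \<epsilon>)) + \<P>(x in M. Y x > 2 * u)"
proof -
  note [measurable] = meas[OF Y(1)] meas[OF G] both_exceed_measurable[of G, OF G S]
  define R where "R s x = G s x - cov Y (G s) * Y x" for s x
  have R: "R s \<in> H" for s unfolding R_def using Y G by (intro diff_mem scale_mem)
  note [measurable] = meas[OF R] both_exceed_measurable[of R, OF R S]
  have orth: "cov Y (R s) = 0" for s
    unfolding R_def using Y G by (subst cov_diff_right) (auto intro: scale_mem simp: cov_scale_right)
  have RG: "\<bar>G s x - R s x\<bar> \<le> 2 * u * \<epsilon>" if "s \<in> S \<union> S'" "\<bar>Y x\<bar> \<le> 2 * u" for s x
  proof -
    have "\<bar>G s x - R s x\<bar> = \<bar>cov Y (G s)\<bar> * \<bar>Y x\<bar>" by (simp add: R_def abs_mult)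
    also have "\<dots> \<le> \<epsilon> * (2 * u)" using eps[OF that(1)] that(2) u by (intro mult_mono) auto
    finally show ?thesis by (simp add: mult_ac)
  qed
  let ?v = "w - 2 * u * \<epsilon>"
  define Q where "Q z \<longleftrightarrow> (\<exists>s\<in>S. z s > ?v) \<and> (\<exists>s\<in>S'. z s > ?v)" for z :: "'s \<Rightarrow> real"
  have [measurable]: "Measurable.pred (\<Pi>\<^sub>M i\<in>UNIV. borel) Q"
    unfolding Q_def using S by measurable
  have [measurable]: "Measurable.pred M (\<lambda>x. Q (\<lambda>s. R s x))"
    unfolding Q_def using S by measurable
  have QR: "{x\<in>space M. Q (\<lambda>s. R s x)} = both_exceed R S S' ?v"
    unfolding Q_def both_exceed_def by auto
  have "\<P>(x in M. Y x > u \<and> x \<in> both_exceed G S S' w) \<le>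
      \<P>(x in M. Y x \<in> {u<..} \<and> Q (\<lambda>s. R s x)) + \<P>(x in M. Y x > 2 * u)"
  proof (rule order_trans[OF _ measure_Un_le])
    have "x \<in> {x\<in>space M. Y x \<in> {u<..} \<and> Q (\<lambda>s. R s x)} \<union> {x\<in>space M. Y x > 2 * u}"
      if x: "x \<in> space M" "Y x > u" "x \<in> both_exceed G S S' w" for x
    proof (cases "Y x > 2 * u")
      case False
      then have "\<bar>Y x\<bar> \<le> 2 * u" using x u by auto
      then have "R s x > ?v" if "s \<in> S \<union> S'" "G s x > w" for s
        using RG[OF that(1), of x] that by (simp add: abs_le_iff)
      then show ?thesis using x unfolding both_exceed_def Q_def by auto
    qed (use x in auto)
    then show "\<P>(x in M. Y x > u \<and> x \<in> both_exceed G S S' w) \<le> prob ({x\<in>space M. Y x \<in> {u<..} \<and> Q (\<lambda>s. R s x)} \<union> {x\<in>space M. Y x > 2 * u})"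
      by (intro finite_measure_mono) auto
  qed auto
  also have "\<P>(x in M. Y x \<in> {u<..} \<and> Q (\<lambda>s. R s x)) = \<P>(x in M. Y x \<in> {u<..}) * prob (both_exceed R S S' ?v)"
    using orthogonal_prob[OF Y(1) R orth, of "{u<..}" Q] by (simp add: QR)
  finally have main: "\<P>(x in M. Y x > u \<and> x \<in> both_exceed G S S' w) \<le>
      \<P>(x in M. Y x \<in> {u<..}) * prob (both_exceed R S S' ?v) + \<P>(x in M. Y x > 2 * u)" .
  have RG2: "prob (both_exceed R S S' ?v) \<le> 2 * prob (both_exceed G S S' (w - 4 * u * \<epsilon>))"
  proof -
    have "prob (both_exceed R S S' ?v) * (1/2) \<le> prob (both_exceed R S S' ?v) * \<P>(x in M. \<bar>Y x\<bar> \<le> 2 * u)"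
      using two_sided_mass[of Y "2 * u"] Y u by (intro mult_left_mono) auto
    also have "\<dots> = \<P>(x in M. Y x \<in> {- 2 * u..2 * u}) * prob (both_exceed R S S' ?v)"
      by (simp add: abs_le_iff minus_le_iff conj_commute)
    also have "\<dots> = \<P>(x in M. Y x \<in> {- 2 * u..2 * u} \<and> Q (\<lambda>s. R s x))"
      using orthogonal_prob[OF Y(1) R orth, of "{- 2 * u..2 * u}" Q] by (simp add: QR)
    also have "\<dots> \<le> prob (both_exceed G S S' (w - 4 * u * \<epsilon>))"
    proof (rule finite_measure_mono)
      show "{x\<in>space M. Y x \<in> {- 2 * u..2 * u} \<and> Q (\<lambda>s. R s x)} \<subseteq> both_exceed G S S' (w - 4 * u * \<epsilon>)"
      proof
        fix x assume x: "x \<in> {x\<in>space M. Y x \<in> {- 2 * u..2 * u} \<and> Q (\<lambda>s. R s x)}"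
        then have "\<bar>Y x\<bar> \<le> 2 * u" by auto
        then have "G s x > w - 4 * u * \<epsilon>" if "s \<in> S \<union> S'" "R s x > ?v" for s
          using RG[OF that(1), of x] that by (simp add: abs_le_iff)
        then show "x \<in> both_exceed G S S' (w - 4 * u * \<epsilon>)"
          using x unfolding both_exceed_def Q_def by auto
      qed
    qed auto
    finally show ?thesis by simp
  qed
  show ?thesis
    using main mult_left_mono[OF RG2, of "\<P>(x in M. Y x > u)"] by simp
qed

text \<open>The same regression as for the upper bound; here \<open>Y\<close> is kept in \<open>{u<..2 * u}\<close> so that the residual controls \<open>X\<close>.\<close>

lemma joint_tail_lower:
  assumes Y: "Y \<in> H" "cov Y Y = 1" and X: "X \<in> H" and eps: "\<bar>cov Y X\<bar> \<le> \<epsilon>" and u: "u \<ge> 1"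
  shows "(\<P>(x in M. Y x > u) - \<P>(x in M. Y x > 2 * u)) * (\<P>(x in M. X x > u + 4 * u * \<epsilon>) - \<P>(x in M. \<bar>Y x\<bar> > 2 * u))
    \<le> \<P>(x in M. Y x > u \<and> X x > u)"
proof -
  note [measurable] = meas[OF Y(1)] meas[OF X]
  define R where "R (s::unit) x = X x - cov Y X * Y x" for s x
  have R: "R s \<in> H" for s unfolding R_def using Y X by (intro diff_mem scale_mem)
  note [measurable] = meas[OF R]
  have orth: "cov Y (R s) = 0" for s
    unfolding R_def using Y X by (subst cov_diff_right) (auto intro: scale_mem simp: cov_scale_right)
  have RX: "\<bar>X x - R s x\<bar> \<le> 2 * u * \<epsilon>" if "\<bar>Y x\<bar> \<le> 2 * u" for s x
  proof -
    have "\<bar>X x - R s x\<bar> = \<bar>cov Y X\<bar> * \<bar>Y x\<bar>" by (simp add: R_def abs_mult)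
    also have "\<dots> \<le> \<epsilon> * (2 * u)" using eps that u by (intro mult_mono) auto
    finally show ?thesis by (simp add: mult_ac)
  qed
  let ?v = "u + 2 * u * \<epsilon>"
  have a: "\<P>(x in M. Y x > u) - \<P>(x in M. Y x > 2 * u) = \<P>(x in M. Y x \<in> {u<..2*u})"
    using u by (subst finite_measure_Diff[symmetric]) (auto intro!: arg_cong[where f=prob])
  have b: "\<P>(x in M. X x > u + 4 * u * \<epsilon>) - \<P>(x in M. \<bar>Y x\<bar> > 2 * u) \<le> \<P>(x in M. R () x > ?v)"
  proof -
    have "\<P>(x in M. X x > u + 4 * u * \<epsilon>) \<le> \<P>(x in M. R () x > ?v) + \<P>(x in M. \<bar>Y x\<bar> > 2 * u)"
    proof (rule order_trans[OF _ measure_Un_le])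
      have "R () x > ?v" if "X x > u + 4 * u * \<epsilon>" "\<not> \<bar>Y x\<bar> > 2 * u" for x
      proof -
        have "\<bar>X x - R () x\<bar> \<le> 2 * u * \<epsilon>" using RX that by simp
        then show ?thesis using that unfolding abs_le_iff by simp
      qed
      then show "\<P>(x in M. X x > u + 4 * u * \<epsilon>) \<le> prob ({x\<in>space M. R () x > ?v} \<union> {x\<in>space M. \<bar>Y x\<bar> > 2 * u})"
        by (intro finite_measure_mono) auto
    qed auto
    then show ?thesis by simp
  qed
  have "(\<P>(x in M. Y x > u) - \<P>(x in M. Y x > 2 * u)) * (\<P>(x in M. X x > u + 4 * u * \<epsilon>) - \<P>(x in M. \<bar>Y x\<bar> > 2 * u))
      \<le> \<P>(x in M. Y x \<in> {u<..2*u}) * \<P>(x in M. R () x > ?v)"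
    unfolding a using b by (intro mult_left_mono) auto
  also have "\<dots> = \<P>(x in M. Y x \<in> {u<..2*u} \<and> R () x > ?v)"
    using orthogonal_prob[OF Y(1) R orth, of "{u<..2*u}" "\<lambda>z. z () > ?v"] by simp
  also have "\<dots> \<le> \<P>(x in M. Y x > u \<and> X x > u)"
  proof (rule finite_measure_mono)
    have "X x > u" if "Y x \<in> {u<..2*u}" "R () x > ?v" for x
    proof -
      have "\<bar>X x - R () x\<bar> \<le> 2 * u * \<epsilon>" using that u by (intro RX) auto
      then show ?thesis using that unfolding abs_le_iff by simp
    qed
    then show "{x\<in>space M. Y x \<in> {u<..2*u} \<and> R () x > ?v} \<subseteq> {x\<in>space M. Y x > u \<and> X x > u}" by auto
  qed auto
  finally show ?thesis .
qed

end

section \<open>Concentration of Gaussian maxima\<close>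

context gaussian_space begin

text \<open>Take independent copies \<open>Y'\<close>, \<open>Y''\<close> of the family and rotate: \<open>A \<theta> = cos \<theta> * Y' + sin \<theta> * Y''\<close> leads from \<open>Y'\<close> to \<open>Y''\<close>, and its
derivative \<open>B \<theta>\<close> is independent of \<open>A \<theta>\<close>. Along the path the maximum moves by at most the integral of the derivative at the
maximising index; since that index depends on \<open>A \<theta>\<close> only, the derivative there has second moment at most \<open>r\<^sup>2\<close>, however many
variables there are. Chebyshev's inequality bounds the probability that the two maxima are \<open>t\<close> apart on prescribed sides of \<open>u\<close>. The integral is replaced by sums over \<open>N\<close> equal steps, with an error that vanishes as \<open>N\<close> grows.\<close>

lemma concentration_of_maximum:
  fixes Y :: "nat \<Rightarrow> 'a \<Rightarrow> real"
  assumes Y: "\<And>v. Y v \<in> H" and n: "n > 0" and r: "\<And>v. v < n \<Longrightarrow> cov (Y v) (Y v) \<le> r\<^sup>2" and t: "t > 0"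
  shows "\<P>(x in M. Max ((\<lambda>v. Y v x) ` {..<n}) \<le> u - t) * \<P>(x in M. Max ((\<lambda>v. Y v x) ` {..<n}) > u) \<le> 16 * r\<^sup>2 / t\<^sup>2"
proof -
  interpret P: pair_prob_space M M ..
  note [measurable] = meas[OF Y]
  let ?M2 = "M \<Otimes>\<^sub>M M"
  define mx where "mx f = Max (f ` {..<n})" for f :: "nat \<Rightarrow> real"
  have mx_ge: "f v \<le> mx f" if "v < n" for f v
    unfolding mx_def using that by (intro Max_ge) auto
  have mx_in: "\<exists>v<n. mx f = f v" for f
  proof -
    have "mx f \<in> f ` {..<n}" unfolding mx_def using n by (intro Max_in) auto
    then show ?thesis by auto
  qed
  have mx_meas [measurable]: "(\<lambda>x. mx (\<lambda>v. f v x)) \<in> borel_measurable N"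
    if [measurable]: "\<And>v. f v \<in> borel_measurable N" for f :: "nat \<Rightarrow> 'b \<Rightarrow> real" and N
  proof -
    have "(\<lambda>x. mx (\<lambda>v. f v x)) = (\<lambda>x. Max ((\<lambda>v. f v x) ` {..<n}))" by (simp add: mx_def)
    then show ?thesis by simp
  qed
  \<comment> \<open>The least maximising index, so that the choice is measurable.\<close>
  define sel where "sel f = (LEAST v. v < n \<and> f v = mx f)" for f :: "nat \<Rightarrow> real"
  have sel: "sel f < n \<and> f (sel f) = mx f" for f
  proof -
    obtain v where "v < n \<and> f v = mx f" using mx_in[of f] by force
    then show ?thesis unfolding sel_def by (rule LeastI)
  qed
  have sel_meas [measurable]: "(\<lambda>x. sel (\<lambda>v. f v x)) \<in> measurable N (count_space UNIV)"
    if [measurable]: "\<And>v. f v \<in> borel_measurable N" for f :: "nat \<Rightarrow> 'b \<Rightarrow> real" and N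
    unfolding sel_def by measurable
  define A where "A \<theta> v z = cos \<theta> * Y v (fst z) + sin \<theta> * Y v (snd z)" for \<theta> v and z :: "'a \<times> 'a"
  define B where "B \<theta> v z = cos \<theta> * Y v (snd z) - sin \<theta> * Y v (fst z)" for \<theta> v and z :: "'a \<times> 'a"
  have [measurable]: "A \<theta> v \<in> borel_measurable ?M2" "B \<theta> v \<in> borel_measurable ?M2" for \<theta> v
    unfolding A_def B_def by measurable
  \<comment> \<open>The pairs \<open>(A, B)\<close> as one family, to compare laws for different angles.\<close>
  define W where "W \<theta> k z = (if snd k then B \<theta> (fst k) z else A \<theta> (fst k) z)" for \<theta> and k :: "nat \<times> bool" and z
  have [measurable]: "W \<theta> k \<in> borel_measurable ?M2" for \<theta> k unfolding W_def by (cases "snd k") auto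
  have Wm [measurable]: "(\<lambda>z k. W \<theta> k z) \<in> measurable ?M2 (\<Pi>\<^sub>M k\<in>UNIV. borel)" for \<theta>
    by (rule measurable_PiM_single') auto
  have rot: "distr ?M2 (\<Pi>\<^sub>M k\<in>UNIV. borel) (\<lambda>z k. W \<theta> k z) = distr ?M2 (\<Pi>\<^sub>M k\<in>UNIV. borel) (\<lambda>z k. W 0 k z)" for \<theta>
  proof (rule distr_eq_of_char)
    fix K :: "(nat \<times> bool) set" and c :: "nat \<times> bool \<Rightarrow> real" assume K: "finite K"
    define a where "a x = (\<Sum>k\<in>K. (if snd k then 0 else c k) * Y (fst k) x)" for x
    define b where "b x = (\<Sum>k\<in>K. (if snd k then c k else 0) * Y (fst k) x)" for x
    have ab: "a \<in> H" "b \<in> H" unfolding a_def b_def using Y by (intro sum_mem; simp)+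
    have cH: "(\<lambda>x. cos \<phi> * a x - sin \<phi> * b x) \<in> H" "(\<lambda>x. sin \<phi> * a x + cos \<phi> * b x) \<in> H" for \<phi>
      using ab by (auto intro!: diff_mem add_mem scale_mem)
    have sumW: "(\<Sum>k\<in>K. c k * W \<phi> k z) = (cos \<phi> * a (fst z) - sin \<phi> * b (fst z)) + (sin \<phi> * a (snd z) + cos \<phi> * b (snd z))" for \<phi> z
    proof -
      have "(\<Sum>k\<in>K. c k * W \<phi> k z) = (\<Sum>k\<in>K. (cos \<phi> * ((if snd k then 0 else c k) * Y (fst k) (fst z)) - sin \<phi> * ((if snd k then c k else 0) * Y (fst k) (fst z)))
         + (sin \<phi> * ((if snd k then 0 else c k) * Y (fst k) (snd z)) + cos \<phi> * ((if snd k then c k else 0) * Y (fst k) (snd z))))"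
        by (intro sum.cong) (auto simp: W_def A_def B_def algebra_simps)
      then show ?thesis
        by (simp add: a_def b_def sum.distrib sum_subtractf sum_distrib_left)
    qed
    have covsum: "cov (\<lambda>x. cos \<phi> * a x - sin \<phi> * b x) (\<lambda>x. cos \<phi> * a x - sin \<phi> * b x)
        + cov (\<lambda>x. sin \<phi> * a x + cos \<phi> * b x) (\<lambda>x. sin \<phi> * a x + cos \<phi> * b x) = cov a a + cov b b" for \<phi>
    proof -
      have "cov (\<lambda>x. cos \<phi> * a x - sin \<phi> * b x) (\<lambda>x. cos \<phi> * a x - sin \<phi> * b x)
          = (cos \<phi>)\<^sup>2 * cov a a - 2 * (cos \<phi> * sin \<phi>) * cov a b + (sin \<phi>)\<^sup>2 * cov b b"
        using ab by (subst cov_diff_self) (auto intro: scale_mem simp: cov_scale_left cov_scale_right power2_eq_square)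
      moreover have "cov (\<lambda>x. sin \<phi> * a x + cos \<phi> * b x) (\<lambda>x. sin \<phi> * a x + cos \<phi> * b x)
          = (sin \<phi>)\<^sup>2 * cov a a + 2 * (cos \<phi> * sin \<phi>) * cov a b + (cos \<phi>)\<^sup>2 * cov b b"
        using ab by (subst cov_add_self) (auto intro: scale_mem simp: cov_scale_left cov_scale_right power2_eq_square)
      ultimately show ?thesis by (simp add: sin_squared_eq algebra_simps)
    qed
    show "(CLINT z|?M2. iexp (\<Sum>k\<in>K. c k * W \<theta> k z)) = (CLINT z|?M2. iexp (\<Sum>k\<in>K. c k * W 0 k z))"
      unfolding sumW pair_characteristic[OF cH(1) cH(2)] covsum ..
  qed (auto simp: P.prob_space_axioms)
  define G where "G \<theta> z = B \<theta> (sel (\<lambda>v. A \<theta> v z)) z" for \<theta> z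
  have Gm [measurable]: "G \<theta> \<in> borel_measurable ?M2" for \<theta>
    unfolding G_def by measurable
  have G2: "(\<integral>\<^sup>+z. ennreal ((G \<theta> z)\<^sup>2) \<partial>?M2) \<le> ennreal (r\<^sup>2)" for \<theta>
  proof -
    define \<Psi> where "\<Psi> w = ennreal ((w (sel (\<lambda>v. w (v, False)), True))\<^sup>2)" for w :: "nat \<times> bool \<Rightarrow> real"
    have [measurable]: "(\<lambda>w. sel (\<lambda>v. w (v, False))) \<in> measurable (\<Pi>\<^sub>M k\<in>UNIV. borel :: real measure) (count_space UNIV)"
      by (rule sel_meas) measurable
    have [measurable]: "(\<lambda>w. w (sel (\<lambda>v. w (v, False)), True)) \<in> borel_measurable (\<Pi>\<^sub>M k\<in>UNIV. borel :: real measure)"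
      by (rule measurable_compose_countable[where f="\<lambda>i w. w (i, True)"]) measurable
    have [measurable]: "\<Psi> \<in> borel_measurable (\<Pi>\<^sub>M k\<in>UNIV. borel)" unfolding \<Psi>_def by measurable
    have G\<Psi>: "ennreal ((G \<phi> z)\<^sup>2) = \<Psi> (\<lambda>k. W \<phi> k z)" for \<phi> z
      by (simp add: \<Psi>_def W_def G_def)
    have dW: "(\<integral>\<^sup>+z. ennreal ((G \<phi> z)\<^sup>2) \<partial>?M2) = (\<integral>\<^sup>+w. \<Psi> w \<partial>distr ?M2 (\<Pi>\<^sub>M k\<in>UNIV. borel) (\<lambda>z k. W \<phi> k z))" for \<phi>
      unfolding G\<Psi> by (subst nn_integral_distr) auto
    have "(\<integral>\<^sup>+z. ennreal ((G \<theta> z)\<^sup>2) \<partial>?M2) = (\<integral>\<^sup>+z. ennreal ((G 0 z)\<^sup>2) \<partial>?M2)"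
      unfolding dW rot[of \<theta>] ..
    also have "\<dots> = (\<integral>\<^sup>+x. (\<integral>\<^sup>+y. ennreal ((G 0 (x, y))\<^sup>2) \<partial>M) \<partial>M)"
      by (subst nn_integral_fst[symmetric]) auto
    also have "\<dots> \<le> (\<integral>\<^sup>+x. ennreal (r\<^sup>2) \<partial>M)"
    proof (intro nn_integral_mono)
      fix x
      define v where "v = sel (\<lambda>v. Y v x)"
      have "(\<integral>\<^sup>+y. ennreal ((G 0 (x, y))\<^sup>2) \<partial>M) = (\<integral>\<^sup>+y. ennreal ((Y v y)\<^sup>2) \<partial>M)"
        by (simp add: G_def A_def B_def v_def)
      also have "\<dots> = ennreal (cov (Y v) (Y v))"
        unfolding cov_self using square_integrable[OF Y] by (intro nn_integral_eq_integral) auto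
      also have "\<dots> \<le> ennreal (r\<^sup>2)"
        using r[of v] sel[of "\<lambda>v. Y v x"] by (intro ennreal_leI) (simp add: v_def)
      finally show "(\<integral>\<^sup>+y. ennreal ((G 0 (x, y))\<^sup>2) \<partial>M) \<le> ennreal (r\<^sup>2)" .
    qed
    also have "\<dots> = ennreal (r\<^sup>2)" by (simp add: emeasure_space_1)
    finally show ?thesis .
  qed
  \<comment> \<open>A bound for the second-order error of a rotation step, uniform in the angle.\<close>
  define m where "m z = (\<Sum>v<n. \<bar>Y v (fst z)\<bar> + \<bar>Y v (snd z)\<bar>)" for z :: "'a \<times> 'a"
  have [measurable]: "m \<in> borel_measurable ?M2" unfolding m_def by measurable
  have m_ge: "\<bar>A \<theta> v z\<bar> \<le> m z" if "v < n" for \<theta> v z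
  proof -
    have "\<bar>A \<theta> v z\<bar> \<le> \<bar>cos \<theta>\<bar> * \<bar>Y v (fst z)\<bar> + \<bar>sin \<theta>\<bar> * \<bar>Y v (snd z)\<bar>"
      unfolding A_def abs_mult[symmetric] by (rule abs_triangle_ineq)
    also have "\<dots> \<le> 1 * \<bar>Y v (fst z)\<bar> + 1 * \<bar>Y v (snd z)\<bar>"
      by (intro add_mono mult_right_mono) auto
    also have "\<dots> \<le> m z"
      unfolding m_def using that member_le_sum[of v "{..<n}" "\<lambda>v. \<bar>Y v (fst z)\<bar> + \<bar>Y v (snd z)\<bar>"] by simp
    finally show ?thesis .
  qed
  have "(\<integral>\<^sup>+z. ennreal (m z) \<partial>?M2) < \<infinity>"
  proof -
    have 1: "(\<integral>\<^sup>+x. ennreal \<bar>Y v x\<bar> \<partial>M) < \<infinity>" for v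
      using integrable_mem[OF Y, of v] unfolding integrable_iff_bounded by simp
    have 2: "(\<integral>\<^sup>+z. ennreal \<bar>Y v (fst z)\<bar> \<partial>?M2) = (\<integral>\<^sup>+x. ennreal \<bar>Y v x\<bar> \<partial>M)" for v
      using pair_nn_mult[of "\<lambda>x. ennreal \<bar>Y v x\<bar>" "\<lambda>_. 1"] by (simp add: emeasure_space_1)
    have 3: "(\<integral>\<^sup>+z. ennreal \<bar>Y v (snd z)\<bar> \<partial>?M2) = (\<integral>\<^sup>+x. ennreal \<bar>Y v x\<bar> \<partial>M)" for v
      using pair_nn_mult[of "\<lambda>_. 1" "\<lambda>x. ennreal \<bar>Y v x\<bar>"] by (simp add: emeasure_space_1)
    have "(\<integral>\<^sup>+z. ennreal (m z) \<partial>?M2) = (\<integral>\<^sup>+z. (\<Sum>v<n. ennreal \<bar>Y v (fst z)\<bar> + ennreal \<bar>Y v (snd z)\<bar>) \<partial>?M2)"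
      unfolding m_def by (intro nn_integral_cong) (simp add: sum_ennreal[symmetric] ennreal_plus)
    also have "\<dots> = (\<Sum>v<n. (\<integral>\<^sup>+x. ennreal \<bar>Y v x\<bar> \<partial>M) + (\<integral>\<^sup>+x. ennreal \<bar>Y v x\<bar> \<partial>M))"
      by (simp add: nn_integral_sum nn_integral_add 2 3)
    also have "\<dots> < \<infinity>" using 1 by (simp add: less_top)
    finally show ?thesis .
  qed
  then obtain C where C: "(\<integral>\<^sup>+z. ennreal (m z) \<partial>?M2) = ennreal C" "C \<ge> 0"
    by (cases "\<integral>\<^sup>+z. ennreal (m z) \<partial>?M2") auto
  define p where "p = \<P>(x in M. mx (\<lambda>v. Y v x) \<le> u - t) * \<P>(x in M. mx (\<lambda>v. Y v x) > u)"
  have bound: "p \<le> 4 * C / t * inverse (real (Suc J)) + 16 * r\<^sup>2 / t\<^sup>2" for J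
  proof -
    define N where "N = Suc J"
    define h where "h = pi / (2 * real N)"
    have N: "N > 0" and hpos: "h > 0" by (simp_all add: N_def h_def)
    have hN: "real N * h = pi / 2" using N by (simp add: h_def)
    \<comment> \<open>The index \<open>v\<close> maximises at the end of the step, so that its value at the start only helps.\<close>
    have step: "mx (\<lambda>v. A \<theta> v z) - mx (\<lambda>v. A (\<theta> - h) v z) \<le> (1 - cos h) * m z + sin h * G \<theta> z" for \<theta> z
    proof -
      define v where "v = sel (\<lambda>v. A \<theta> v z)"
      have v: "v < n" "A \<theta> v z = mx (\<lambda>v. A \<theta> v z)" using sel[of "\<lambda>v. A \<theta> v z"] by (auto simp: v_def)
      have "A (\<theta> - h) v z = cos h * A \<theta> v z - sin h * B \<theta> v z"
        by (simp add: A_def B_def cos_diff sin_diff algebra_simps)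
      moreover have "A (\<theta> - h) v z \<le> mx (\<lambda>v. A (\<theta> - h) v z)" using v by (intro mx_ge)
      ultimately have "mx (\<lambda>v. A \<theta> v z) - mx (\<lambda>v. A (\<theta> - h) v z) \<le> (1 - cos h) * A \<theta> v z + sin h * B \<theta> v z"
        using v by (simp add: algebra_simps)
      moreover have "(1 - cos h) * A \<theta> v z \<le> (1 - cos h) * m z"
        using m_ge[OF v(1), of \<theta> z] by (intro mult_left_mono) auto
      ultimately show ?thesis by (simp add: G_def v_def)
    qed
    have tel: "mx (\<lambda>v. Y v (snd z)) - mx (\<lambda>v. Y v (fst z)) \<le> real N * (1 - cos h) * m z + sin h * (\<Sum>j<N. G (real (Suc j) * h) z)" for z
    proof -
      have "mx (\<lambda>v. A (real N * h) v z) - mx (\<lambda>v. A 0 v z) = (\<Sum>j<N. mx (\<lambda>v. A (real (Suc j) * h) v z) - mx (\<lambda>v. A (real j * h) v z))"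
        by (subst sum_lessThan_telescope) simp
      also have "\<dots> \<le> (\<Sum>j<N. (1 - cos h) * m z + sin h * G (real (Suc j) * h) z)"
      proof (intro sum_mono)
        fix j
        show "mx (\<lambda>v. A (real (Suc j) * h) v z) - mx (\<lambda>v. A (real j * h) v z) \<le> (1 - cos h) * m z + sin h * G (real (Suc j) * h) z"
          using step[of "real (Suc j) * h" z] by (simp add: algebra_simps)
      qed
      also have "\<dots> = real N * (1 - cos h) * m z + sin h * (\<Sum>j<N. G (real (Suc j) * h) z)"
        by (simp add: sum.distrib sum_distrib_left)
      finally show ?thesis by (simp add: hN) (simp add: A_def)
    qed
    let ?E1 = "{z\<in>space ?M2. t / 2 \<le> real N * (1 - cos h) * m z}"
    let ?E2 = "{z\<in>space ?M2. t / 2 \<le> sin h * (\<Sum>j<N. G (real (Suc j) * h) z)}"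
    have cosh_le: "real N * (1 - cos h) \<le> 2 / real N"
    proof -
      have c: "1 - cos h = 2 * (sin (h/2))\<^sup>2" using cos_double_sin[of "h/2"] by simp
      have "\<bar>sin (h/2)\<bar> \<le> \<bar>h/2\<bar>" by (rule abs_sin_x_le_abs_x)
      then have "(sin (h/2))\<^sup>2 \<le> (h/2)\<^sup>2" by (simp only: abs_le_square_iff)
      then have "real N * (1 - cos h) \<le> real N * (2 * (h/2)\<^sup>2)" unfolding c by (intro mult_left_mono) auto
      also have "\<dots> = (real N * h)\<^sup>2 / (2 * real N)" using N by (simp add: power2_eq_square)
      also have "(real N * h)\<^sup>2 \<le> 2\<^sup>2" unfolding hN using pi_less_4 by (intro power_mono) auto
      finally show ?thesis using N by (simp add: divide_simps)
    qed
    \<comment> \<open>The discretisation error: Markov for \<open>m\<close>.\<close>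
    have E1: "measure ?M2 ?E1 \<le> 4 * C / t * inverse (real N)"
    proof -
      have "emeasure ?M2 ?E1 \<le> emeasure ?M2 ({z\<in>space ?M2. 1 \<le> ennreal (4 / (t * real N)) * ennreal (m z)})"
      proof (rule emeasure_mono)
        show "?E1 \<subseteq> {z\<in>space ?M2. 1 \<le> ennreal (4 / (t * real N)) * ennreal (m z)}"
        proof
          fix z assume z: "z \<in> ?E1"
          have m0: "m z \<ge> 0" unfolding m_def by (intro sum_nonneg) auto
          have "t / 2 \<le> 2 / real N * m z" using z mult_right_mono[OF cosh_le m0] by auto
          then have "1 \<le> 4 / (t * real N) * m z" using t N by (simp add: field_simps)
          then show "z \<in> {z\<in>space ?M2. 1 \<le> ennreal (4 / (t * real N)) * ennreal (m z)}"
            using z t m0 by (auto simp: ennreal_mult[symmetric])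
        qed
      qed auto
      also have "\<dots> \<le> ennreal (4 / (t * real N)) * (\<integral>\<^sup>+z. ennreal (m z) * indicator (space ?M2) z \<partial>?M2)"
        by (rule nn_integral_Markov_inequality) auto
      also have "(\<integral>\<^sup>+z. ennreal (m z) * indicator (space ?M2) z \<partial>?M2) = ennreal C"
        unfolding C(1)[symmetric] by (intro nn_integral_cong) auto
      finally show ?thesis using C t by (simp add: P.emeasure_eq_measure ennreal_mult[symmetric] field_simps)
    qed
    \<comment> \<open>The main term: Chebyshev, and the Cauchy-Schwarz inequality for the sum over \<open>N\<close> steps.\<close>
    have E2: "measure ?M2 ?E2 \<le> 16 * r\<^sup>2 / t\<^sup>2"
    proof -
      define q where "q = 4 * (sin h)\<^sup>2 * real N / t\<^sup>2"
      have q0: "q \<ge> 0" by (simp add: q_def)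
      have qN: "q * real N \<le> 16 / t\<^sup>2"
      proof -
        have "\<bar>sin h\<bar> \<le> \<bar>h\<bar>" by (rule abs_sin_x_le_abs_x)
        then have "(sin h)\<^sup>2 \<le> h\<^sup>2" by (simp only: abs_le_square_iff)
        then have "(real N)\<^sup>2 * (sin h)\<^sup>2 \<le> (real N)\<^sup>2 * h\<^sup>2" by (intro mult_left_mono) auto
        then have "(sin h)\<^sup>2 * (real N)\<^sup>2 \<le> (real N * h)\<^sup>2" by (simp add: power_mult_distrib mult.commute)
        also have "\<dots> \<le> 2\<^sup>2" unfolding hN using pi_less_4 by (intro power_mono) auto
        finally have "(sin h)\<^sup>2 * (real N)\<^sup>2 \<le> 4" by simp
        then have "(4 * ((sin h)\<^sup>2 * (real N)\<^sup>2)) / t\<^sup>2 \<le> 16 / t\<^sup>2"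
          by (intro divide_right_mono) (linarith, simp)
        moreover have "q * real N = (4 * ((sin h)\<^sup>2 * (real N)\<^sup>2)) / t\<^sup>2"
          by (simp add: q_def power2_eq_square)
        ultimately show ?thesis by simp
      qed
      have "emeasure ?M2 ?E2 \<le> emeasure ?M2 ({z\<in>space ?M2. 1 \<le> ennreal q * ennreal (\<Sum>j<N. (G (real (Suc j) * h) z)\<^sup>2)})"
      proof (rule emeasure_mono)
        show "?E2 \<subseteq> {z\<in>space ?M2. 1 \<le> ennreal q * ennreal (\<Sum>j<N. (G (real (Suc j) * h) z)\<^sup>2)}"
        proof
          fix z assume z: "z \<in> ?E2"
          let ?S = "\<Sum>j<N. G (real (Suc j) * h) z"
          have "(t/2)\<^sup>2 \<le> (sin h * ?S)\<^sup>2" using z t by (intro power_mono) auto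
          also have "\<dots> \<le> (sin h)\<^sup>2 * (real N * (\<Sum>j<N. (G (real (Suc j) * h) z)\<^sup>2))"
            using sum_squared_le_sum_of_squares[of "\<lambda>j. G (real (Suc j) * h) z" "{..<N}"]
            by (simp add: power_mult_distrib mult_left_mono mult.commute[of _ "real N"])
          finally have "1 \<le> q * (\<Sum>j<N. (G (real (Suc j) * h) z)\<^sup>2)"
            using t by (simp add: q_def power2_eq_square field_simps)
          then show "z \<in> {z\<in>space ?M2. 1 \<le> ennreal q * ennreal (\<Sum>j<N. (G (real (Suc j) * h) z)\<^sup>2)}"
            using z q0 by (auto simp: ennreal_mult[symmetric] sum_nonneg)
        qed
      qed auto
      also have "\<dots> \<le> ennreal q * (\<integral>\<^sup>+z. ennreal (\<Sum>j<N. (G (real (Suc j) * h) z)\<^sup>2) * indicator (space ?M2) z \<partial>?M2)"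
        by (rule nn_integral_Markov_inequality) auto
      also have "(\<integral>\<^sup>+z. ennreal (\<Sum>j<N. (G (real (Suc j) * h) z)\<^sup>2) * indicator (space ?M2) z \<partial>?M2)
          = (\<integral>\<^sup>+z. (\<Sum>j<N. ennreal ((G (real (Suc j) * h) z)\<^sup>2)) \<partial>?M2)"
        by (intro nn_integral_cong) (simp add: sum_ennreal)
      also have "\<dots> = (\<Sum>j<N. (\<integral>\<^sup>+z. ennreal ((G (real (Suc j) * h) z)\<^sup>2) \<partial>?M2))"
        by (rule nn_integral_sum) auto
      also have "\<dots> \<le> (\<Sum>j<N. ennreal (r\<^sup>2))" by (intro sum_mono G2)
      also have "\<dots> = ennreal (real N * r\<^sup>2)" by (simp add: ennreal_of_nat_eq_real_of_nat ennreal_mult[symmetric])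
      finally have "emeasure ?M2 ?E2 \<le> ennreal (q * (real N * r\<^sup>2))"
        using q0 by (simp add: ennreal_mult[symmetric] mult_left_mono)
      then have "measure ?M2 ?E2 \<le> (q * real N) * r\<^sup>2" using q0 by (simp add: P.emeasure_eq_measure mult.assoc)
      also have "\<dots> \<le> 16 / t\<^sup>2 * r\<^sup>2" by (intro mult_right_mono qN) auto
      finally show ?thesis by simp
    qed
    have "p = measure ?M2 ({x\<in>space M. mx (\<lambda>v. Y v x) \<le> u - t} \<times> {x\<in>space M. mx (\<lambda>v. Y v x) > u})"
      unfolding p_def by (simp add: measure_def emeasure_pair_measure_Times enn2real_mult)
    also have "\<dots> \<le> measure ?M2 (?E1 \<union> ?E2)"
    proof (rule P.finite_measure_mono)
      show "{x\<in>space M. mx (\<lambda>v. Y v x) \<le> u - t} \<times> {x\<in>space M. mx (\<lambda>v. Y v x) > u} \<subseteq> ?E1 \<union> ?E2"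
      proof
        fix z assume z: "z \<in> {x\<in>space M. mx (\<lambda>v. Y v x) \<le> u - t} \<times> {x\<in>space M. mx (\<lambda>v. Y v x) > u}"
        then have "t \<le> real N * (1 - cos h) * m z + sin h * (\<Sum>j<N. G (real (Suc j) * h) z)"
          using tel[of z] by auto
        moreover have "z \<in> space ?M2" using z by (auto simp: space_pair_measure)
        ultimately show "z \<in> ?E1 \<union> ?E2" by auto
      qed
    qed auto
    also have "\<dots> \<le> measure ?M2 ?E1 + measure ?M2 ?E2" by (rule measure_Un_le) auto
    finally show ?thesis using E1 E2 by (simp add: N_def)
  qed
  have "p \<le> 16 * r\<^sup>2 / t\<^sup>2"
  proof (rule LIMSEQ_le_const)
    show "(\<lambda>J. 4 * C / t * inverse (real (Suc J)) + 16 * r\<^sup>2 / t\<^sup>2) \<longlonglongrightarrow> 16 * r\<^sup>2 / t\<^sup>2"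
      using tendsto_add[OF tendsto_mult_right_zero[OF LIMSEQ_inverse_real_of_nat, of "4 * C / t"] tendsto_const[of "16 * r\<^sup>2 / t\<^sup>2"]] by simp
  qed (use bound in auto)
  then show ?thesis unfolding p_def mx_def .
qed

end

section \<open>Normalised stationary processes\<close>

definition finite_combinations :: "(real \<Rightarrow> 'a \<Rightarrow> real) \<Rightarrow> ('a \<Rightarrow> real) set" where
  "finite_combinations g = {V. \<exists>T c. finite T \<and> V = (\<lambda>\<omega>. \<Sum>t\<in>T. c t * g t \<omega>)}"

lemma finite_combinationsI: "finite T \<Longrightarrow> (\<lambda>\<omega>. \<Sum>t\<in>T. c t * g t \<omega>) \<in> finite_combinations g"
  unfolding finite_combinations_def by blast

lemma process_mem_finite_combinations: "g t \<in> finite_combinations g"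
  using finite_combinationsI[of "{t}" "\<lambda>_. 1" g] by simp

text \<open>Constants occur among the Gaussian variables; centring forces the constant and the mean to be \<open>0\<close>.\<close>

lemma (in prob_space) gaussian_space_of_process:
  assumes g: "gaussian_process M g" and c: "centred_process M g"
  shows "gaussian_space M (finite_combinations g)"
proof -
  have rv: "gaussian_rv M (\<lambda>\<omega>. \<Sum>t\<in>T. c t * g t \<omega>)" if "finite T" for T c
    using g that unfolding gaussian_process_def by blast
  have rv1: "gaussian_rv M (g t)" for t using rv[of "{t}" "\<lambda>_. 1"] by simp
  have int: "integrable M (g t)" for t
  proof -
    have [measurable]: "g t \<in> borel_measurable M" using rv1[of t] unfolding gaussian_rv_def by simp
    from rv1[of t] consider \<mu> where "AE \<omega> in M. g t \<omega> = \<mu>" | \<mu> \<sigma> where "\<sigma> > 0" "distributed M lborel (g t) (normal_density \<mu> \<sigma>)"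
      unfolding gaussian_rv_def by blast
    then show ?thesis
    proof cases
      case 1
      then have "integrable M (g t) \<longleftrightarrow> integrable M (\<lambda>_. \<mu>)" by (intro integrable_cong_AE) auto
      then show ?thesis by simp
    next
      case 2
      then show ?thesis
        using integrable_normal_moment_nz_1[OF 2(1), of \<mu>] distributed_integrable[OF 2(2), of "\<lambda>x. x"]
        by simp
    qed
  qed
  have mean: "expectation (\<lambda>\<omega>. \<Sum>t\<in>T. c t * g t \<omega>) = 0" for T c
    using int assms(2) unfolding centred_process_def by (subst Bochner_Integration.integral_sum) auto
  show ?thesis
  proof
    show "(\<lambda>_. 0) \<in> finite_combinations g" using finite_combinationsI[of "{}" _ g] by simp
  next
    fix V W assume "V \<in> finite_combinations g" "W \<in> finite_combinations g"
    then obtain T c T' c' where V: "finite T" "V = (\<lambda>\<omega>. \<Sum>t\<in>T. c t * g t \<omega>)"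
        and W: "finite T'" "W = (\<lambda>\<omega>. \<Sum>t\<in>T'. c' t * g t \<omega>)"
      unfolding finite_combinations_def by blast
    have "V \<omega> + W \<omega> = (\<Sum>t\<in>T \<union> T'. ((if t \<in> T then c t else 0) + (if t \<in> T' then c' t else 0)) * g t \<omega>)" for \<omega>
    proof -
      have "V \<omega> = (\<Sum>t\<in>T \<union> T'. (if t \<in> T then c t else 0) * g t \<omega>)"
        using V W by (auto intro!: sum.mono_neutral_cong_left)
      moreover have "W \<omega> = (\<Sum>t\<in>T \<union> T'. (if t \<in> T' then c' t else 0) * g t \<omega>)"
        using V W by (auto intro!: sum.mono_neutral_cong_left)
      ultimately show ?thesis by (simp add: sum.distrib distrib_right)
    qed
    then show "(\<lambda>x. V x + W x) \<in> finite_combinations g"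
      using V W by (simp add: finite_combinationsI)
  next
    fix V k assume "V \<in> finite_combinations g"
    then obtain T c where V: "finite T" "V = (\<lambda>\<omega>. \<Sum>t\<in>T. c t * g t \<omega>)"
      unfolding finite_combinations_def by blast
    then have "(\<lambda>x. k * V x) = (\<lambda>\<omega>. \<Sum>t\<in>T. (k * c t) * g t \<omega>)"
      by (simp add: sum_distrib_left mult.assoc)
    then show "(\<lambda>x. k * V x) \<in> finite_combinations g" using V by (simp add: finite_combinationsI)
  next
    fix V assume "V \<in> finite_combinations g"
    then obtain T c where V: "finite T" "V = (\<lambda>\<omega>. \<Sum>t\<in>T. c t * g t \<omega>)"
      unfolding finite_combinations_def by blast
    have r: "gaussian_rv M V" using rv V by simp
    then show "V \<in> borel_measurable M" unfolding gaussian_rv_def by simp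
    from r consider \<mu> where "AE \<omega> in M. V \<omega> = \<mu>" | \<mu> \<sigma> where "\<sigma> > 0" "distributed M lborel V (normal_density \<mu> \<sigma>)"
      unfolding gaussian_rv_def by blast
    then show "(AE x in M. V x = 0) \<or> (\<exists>\<sigma>>0. distributed M lborel V (normal_density 0 \<sigma>))"
    proof cases
      case 1
      then have "expectation V = expectation (\<lambda>_. \<mu>)"
        using \<open>V \<in> borel_measurable M\<close> by (intro integral_cong_AE) auto
      then show ?thesis using 1 mean V by (simp add: prob_space)
    next
      case 2
      then have "\<mu> = 0" using normal_distributed_expectation[OF 2] mean V by simp
      then show ?thesis using 2 by auto
    qed
  qed
qed

context gaussian_space begin

definition nrm :: "('a \<Rightarrow> real) \<Rightarrow> real" where
  "nrm V = sqrt (cov V V)"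

lemma nrm_nonneg: "nrm V \<ge> 0"
  by (simp add: nrm_def cov_self_nonneg)

lemma nrm_square: "(nrm V)\<^sup>2 = cov V V"
  by (simp add: nrm_def cov_self_nonneg)

lemma abs_cov_le: "U \<in> H \<Longrightarrow> V \<in> H \<Longrightarrow> \<bar>cov U V\<bar> \<le> nrm U * nrm V"
  using cauchy_schwarz[of U V] unfolding nrm_def real_sqrt_mult[symmetric]
  by (intro real_le_rsqrt) simp

lemma nrm_add_le:
  assumes "U \<in> H" "V \<in> H"
  shows "nrm (\<lambda>x. U x + V x) \<le> nrm U + nrm V"
proof (rule power2_le_imp_le)
  show "(nrm (\<lambda>x. U x + V x))\<^sup>2 \<le> (nrm U + nrm V)\<^sup>2"
    unfolding nrm_square cov_add_self[OF assms] using abs_cov_le[OF assms]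
    by (simp add: power2_sum nrm_square)
qed (simp add: nrm_nonneg)

text \<open>The exponential tilt by \<open>(3/2) * u\<close> moves the bulk of the integral to the edge \<open>- u\<close>, where the density is of the order of \<open>u * mills u\<close>; the inequality
\<open>(x + u)\<^sup>2 \<ge> 0\<close> leaves an integrable factor of rate \<open>u / 2\<close>.\<close>

lemma truncated_exp_moment:
  assumes Z: "Z \<in> H" "cov Z Z = 1" and u: "u > 0"
  shows "(\<integral>\<^sup>+x. ennreal (exp (- (3/2) * u * (u + Z x))) * indicator {- u..} (Z x) \<partial>M) \<le> ennreal (2 * mills u)"
  using Z(1)
proof (cases rule: gauss_cases)
  case (2 \<sigma>)
  note [measurable] = meas[OF Z(1)]
  have "\<sigma> = 1" using 2 Z by (simp add: cov_self power2_eq_1_iff)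
  then have d: "distributed M lborel Z std_normal_density" using 2 by simp
  define k where "k = std_normal_density u"
  have k: "0 \<le> k" "k \<le> exp (- u\<^sup>2 / 2)"
  proof -
    have "1 \<le> sqrt (2 * pi)" using pi_gt3 by simp
    then have "1 / sqrt (2 * pi) \<le> 1" by (simp add: divide_simps)
    then have "1 / sqrt (2 * pi) * exp (- u\<^sup>2 / 2) \<le> 1 * exp (- u\<^sup>2 / 2)"
      by (intro mult_right_mono) auto
    then show "0 \<le> k" "k \<le> exp (- u\<^sup>2 / 2)" unfolding k_def std_normal_density_def by auto
  qed
  have "(\<integral>\<^sup>+x. ennreal (exp (- (3/2) * u * (u + Z x))) * indicator {- u..} (Z x) \<partial>M)
      = (\<integral>\<^sup>+x. ennreal (std_normal_density x) * (ennreal (exp (- (3/2) * u * (u + x))) * indicator {- u..} x) \<partial>lborel)"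
    by (rule distributed_nn_integral[OF d, symmetric]) measurable
  also have "\<dots> \<le> (\<integral>\<^sup>+x. ennreal (k * exp (- (u/2) * (u + x))) * indicator {- u..} x \<partial>lborel)"
  proof (rule nn_integral_mono)
    fix x :: real
    show "ennreal (std_normal_density x) * (ennreal (exp (- (3/2) * u * (u + x))) * indicator {- u..} x)
        \<le> ennreal (k * exp (- (u/2) * (u + x))) * indicator {- u..} x"
    proof (cases "x \<ge> - u")
      case True
      have "0 \<le> (x + u)\<^sup>2" by simp
      then have "- x\<^sup>2 / 2 + (- (3/2) * u * (u + x)) \<le> - u\<^sup>2 / 2 + (- (u/2) * (u + x))"
        by (simp add: power2_eq_square field_simps)
      then have "exp (- x\<^sup>2 / 2) * exp (- (3/2) * u * (u + x)) \<le> exp (- u\<^sup>2 / 2) * exp (- (u/2) * (u + x))"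
        unfolding exp_add[symmetric] exp_le_cancel_iff .
      then have "1 / sqrt (2 * pi) * (exp (- x\<^sup>2 / 2) * exp (- (3/2) * u * (u + x))) \<le> 1 / sqrt (2 * pi) * (exp (- u\<^sup>2 / 2) * exp (- (u/2) * (u + x)))"
        by (rule mult_left_mono) simp
      then have "std_normal_density x * exp (- (3/2) * u * (u + x)) \<le> k * exp (- (u/2) * (u + x))"
        by (simp only: k_def std_normal_density_def mult.assoc)
      then show ?thesis using True by (simp add: ennreal_mult[symmetric] ennreal_leI)
    qed auto
  qed
  also have "\<dots> = 0 - (- (2 * k / u) * exp (- (u/2) * (u + (- u))))"
  proof (rule nn_integral_FTC_atLeast)
    fix x assume "- u \<le> x"
    show "((\<lambda>x. - (2 * k / u) * exp (- (u/2) * (u + x))) has_real_derivative k * exp (- (u/2) * (u + x))) (at x)"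
      using u by (auto intro!: derivative_eq_intros simp: field_simps)
    show "0 \<le> k * exp (- (u/2) * (u + x))" using k by simp
  next
    have "((\<lambda>x. exp (- (u/2) * (u + x))) \<longlongrightarrow> 0) at_top"
      using u by real_asymp
    then show "((\<lambda>x. - (2 * k / u) * exp (- (u/2) * (u + x))) \<longlongrightarrow> 0) at_top"
      by (rule tendsto_mult_right_zero)
  qed auto
  also have "\<dots> \<le> ennreal (2 * mills u)"
    using k u by (auto simp: mills_def intro!: ennreal_leI divide_right_mono)
  finally show ?thesis .
qed (use Z in \<open>auto simp: cov_self\<close>)

end

text \<open>The setting of the one-dimensional estimates: unit variance, covariance \<open>\<rho>\<close> of the lag, the logarithmic decay of the theorem,
and Lipschitz continuity in mean square, the form in which the smoothness of the paths enters the estimates.\<close>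

locale normal_process = prob_space M for M :: "'a measure" +
  fixes X :: "real \<Rightarrow> 'a \<Rightarrow> real" and \<rho> :: "real \<Rightarrow> real" and K :: real
  assumes gaussian_X: "gaussian_process M X" and centred_X: "centred_process M X"
    and covariance_X: "expectation (\<lambda>\<omega>. X s \<omega> * X t \<omega>) = \<rho> (t - s)"
    and \<rho>_0: "\<rho> 0 = 1"
    and decay: "((\<lambda>t. \<rho> t * ln \<bar>t\<bar>) \<longlongrightarrow> 0) at_infinity"
    and K_pos: "K > 0" and lipschitz: "2 * (1 - \<rho> t) \<le> (K * t)\<^sup>2"
begin

sublocale gaussian_space M "finite_combinations X"
  by (rule gaussian_space_of_process[OF gaussian_X centred_X])

lemma X_mem: "X t \<in> finite_combinations X"
  by (rule process_mem_finite_combinations)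

lemma X_meas [measurable]: "X t \<in> borel_measurable M"
  by (rule meas[OF X_mem])

lemma cov_X: "cov (X s) (X t) = \<rho> (t - s)"
  unfolding cov_def by (rule covariance_X)

lemma \<rho>_minus: "\<rho> (- t) = \<rho> t"
  using cov_X[of 0 t] cov_X[of t 0] by (simp add: cov_commute)

lemma nrm_X: "nrm (X t) = 1"
  by (simp add: nrm_def cov_X \<rho>_0)

lemma abs_\<rho>_le_1: "\<bar>\<rho> t\<bar> \<le> 1"
  using abs_cov_le[OF X_mem[of 0] X_mem[of t]] by (simp add: cov_X nrm_X)

lemma minus_process: "normal_process M (\<lambda>t \<omega>. - X t \<omega>) \<rho> K"
proof
  show "gaussian_process M (\<lambda>t \<omega>. - X t \<omega>)"
    unfolding gaussian_process_def
  proof (intro allI impI)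
    fix T :: "real set" and c :: "real \<Rightarrow> real" assume "finite T"
    then have "gaussian_rv M (\<lambda>\<omega>. \<Sum>t\<in>T. (- c t) * X t \<omega>)"
      by (rule gaussian_X[unfolded gaussian_process_def, rule_format])
    then show "gaussian_rv M (\<lambda>\<omega>. \<Sum>t\<in>T. c t * - X t \<omega>)" by simp
  qed
  show "centred_process M (\<lambda>t \<omega>. - X t \<omega>)"
    using centred_X unfolding centred_process_def by simp
qed (use covariance_X \<rho>_0 decay K_pos lipschitz in auto)

lemma reversed_process: "normal_process M (\<lambda>t. X (- t)) \<rho> K"
proof
  show "gaussian_process M (\<lambda>t. X (- t))"
    unfolding gaussian_process_def
  proof (intro allI impI)
    fix T :: "real set" and c :: "real \<Rightarrow> real" assume "finite T"
    then have "gaussian_rv M (\<lambda>\<omega>. \<Sum>t\<in>uminus ` T. c (- t) * X t \<omega>)"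
      by (intro gaussian_X[unfolded gaussian_process_def, rule_format]) simp
    moreover have "(\<Sum>t\<in>uminus ` T. c (- t) * X t \<omega>) = (\<Sum>t\<in>T. c t * X (- t) \<omega>)" for \<omega>
      by (subst sum.reindex) auto
    ultimately show "gaussian_rv M (\<lambda>\<omega>. \<Sum>t\<in>T. c t * X (- t) \<omega>)" by simp
  qed
  show "centred_process M (\<lambda>t. X (- t))"
    using centred_X unfolding centred_process_def by simp
  show "expectation (\<lambda>\<omega>. X (- s) \<omega> * X (- t) \<omega>) = \<rho> (t - s)" for s t
    using covariance_X[of "- s" "- t"] \<rho>_minus[of "t - s"] by simp
qed (use \<rho>_0 decay K_pos lipschitz in auto)

text \<open>The canonical distance of the process: the \<open>L\<^sup>2\<close> norm of an increment. Its triangle inequality is used throughout.\<close>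

definition v :: "real \<Rightarrow> real" where "v t = sqrt (2 * (1 - \<rho> t))"

lemma nrm_diff_X: "nrm (\<lambda>\<omega>. X t \<omega> - X s \<omega>) = v (t - s)"
  unfolding nrm_def v_def using \<rho>_minus[of "t - s"]
  by (simp add: cov_diff_self X_mem cov_X \<rho>_0)

lemma v_square: "(v t)\<^sup>2 = 2 * (1 - \<rho> t)"
  using abs_\<rho>_le_1[of t] by (simp add: v_def)

lemma v_nonneg: "v t \<ge> 0"
  using abs_\<rho>_le_1[of t] by (simp add: v_def)

lemma v_minus: "v (- t) = v t"
  by (simp add: v_def \<rho>_minus)

lemma v_0: "v 0 = 0"
  by (simp add: v_def \<rho>_0)

lemma v_le_K: "v t \<le> K * \<bar>t\<bar>"
proof (rule power2_le_imp_le)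
  show "(v t)\<^sup>2 \<le> (K * \<bar>t\<bar>)\<^sup>2" using lipschitz[of t] by (simp add: v_square power_mult_distrib)
qed (use K_pos in simp)

lemma v_add_le: "v (s + t) \<le> v s + v t"
  using nrm_add_le[OF diff_mem[OF X_mem[of "s + t"] X_mem[of s]] diff_mem[OF X_mem[of s] X_mem[of 0]]]
  by (simp add: nrm_diff_X)

lemma v_mult_le: "v (real k * t) \<le> real k * v t"
proof (induction k)
  case (Suc k)
  then show ?case using v_add_le[of t "real k * t"] by (simp add: algebra_simps)
qed (simp add: v_0)

lemma abs_v_diff_le: "\<bar>v s - v t\<bar> \<le> v (s - t)"
  using v_add_le[of t "s - t"] v_add_le[of s "t - s"] v_minus[of "s - t"] by (simp add: abs_le_iff)

lemma \<rho>_tendsto_0: "eventually (\<lambda>t. \<bar>\<rho> t\<bar> * ln \<bar>t\<bar> < e) at_infinity" if "e > 0"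
proof -
  have "eventually (\<lambda>t. 1 \<le> norm t) at_infinity" by (auto simp: eventually_at_infinity)
  moreover have "eventually (\<lambda>t. \<bar>\<rho> t * ln \<bar>t\<bar>\<bar> < e) at_infinity"
    using tendstoD[OF decay that] by simp
  ultimately show ?thesis by eventually_elim (auto simp: abs_mult)
qed

text \<open>At this distance \<open>ln \<bar>t\<bar> \<ge> \<kappa> * u\<^sup>2\<close>, so the logarithmic decay gives \<open>\<bar>\<rho> t\<bar> = o (1 / u\<^sup>2)\<close>. Correlations of this size shift levels near \<open>u\<close> by
\<open>O (1 / u)\<close> only, which changes \<open>mills u\<close> by a bounded factor, while the range \<open>exp (\<kappa> * u\<^sup>2)\<close> is negligible against \<open>1 / mills u\<close> for small \<open>\<kappa>\<close>.\<close>

lemma far_correlation: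
  assumes "\<kappa> > 0" "a > 0"
  shows "\<exists>u0\<ge>1. \<forall>u\<ge>u0. \<forall>t. \<bar>t\<bar> \<ge> exp (\<kappa> * u\<^sup>2) \<longrightarrow> \<bar>\<rho> t\<bar> \<le> a / u\<^sup>2"
proof -
  obtain b where b: "\<And>t. \<bar>t\<bar> \<ge> b \<Longrightarrow> \<bar>\<rho> t\<bar> * ln \<bar>t\<bar> < \<kappa> * a"
    using \<rho>_tendsto_0[of "\<kappa> * a"] assms by (auto simp: eventually_at_infinity)
  have "eventually (\<lambda>u. b \<le> exp (\<kappa> * u\<^sup>2)) at_top" using assms by real_asymp
  then obtain u1 where u1: "\<And>u. u \<ge> u1 \<Longrightarrow> b \<le> exp (\<kappa> * u\<^sup>2)"
    by (auto simp: eventually_at_top_linorder)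
  show ?thesis
  proof (intro exI[of _ "max 1 u1"] conjI allI impI)
    fix u t assume u: "u \<ge> max 1 u1" and t: "\<bar>t\<bar> \<ge> exp (\<kappa> * u\<^sup>2)"
    have "\<kappa> * u\<^sup>2 \<le> ln \<bar>t\<bar>" using t by (metis exp_gt_zero less_le_trans ln_exp ln_le_cancel_iff)
    then have "\<bar>\<rho> t\<bar> * (\<kappa> * u\<^sup>2) \<le> \<bar>\<rho> t\<bar> * ln \<bar>t\<bar>" by (intro mult_left_mono) auto
    also have "\<dots> \<le> \<kappa> * a" using b[of t] u1[of u] u t by simp
    finally show "\<bar>\<rho> t\<bar> \<le> a / u\<^sup>2" using assms u by (simp add: field_simps)
  qed simp
qed

text \<open>Beyond some \<open>T\<close> the correlation is at most \<open>1/2\<close>, so the canonical distance is at least \<open>1\<close>. By subadditivity, a small distance over \<open>s\<close> would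
make the distance over the multiple of \<open>s\<close> next to \<open>T\<close> smaller than that. In particular the process is not periodic.\<close>

lemma v_lower: "\<exists>T>0. \<forall>s>0. s / (T + s) \<le> v s"
proof -
  obtain b where b: "\<And>t. \<bar>t\<bar> \<ge> b \<Longrightarrow> \<bar>\<rho> t\<bar> * ln \<bar>t\<bar> < 1/2"
    using \<rho>_tendsto_0[of "1/2"] by (auto simp: eventually_at_infinity)
  define T where "T = max b (exp 1)"
  have T: "T > 0" unfolding T_def using exp_gt_zero[of "1::real"] by linarith
  have v1: "v t \<ge> 1" if "t \<ge> T" for t
  proof -
    have t: "\<bar>t\<bar> \<ge> b" "t \<ge> exp 1" "t > 0" using that T unfolding T_def by auto
    have "ln \<bar>t\<bar> \<ge> 1" using t by (metis abs_of_pos exp_gt_zero ln_exp ln_le_cancel_iff)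
    then have "\<bar>\<rho> t\<bar> * 1 \<le> \<bar>\<rho> t\<bar> * ln \<bar>t\<bar>" by (intro mult_left_mono) auto
    then have "\<bar>\<rho> t\<bar> \<le> 1/2" using b[OF t(1)] by simp
    then show ?thesis unfolding v_def by (auto simp: abs_le_iff)
  qed
  show ?thesis
  proof (intro exI[of _ T] conjI allI impI T)
    fix s :: real assume s: "s > 0"
    define k where "k = nat \<lceil>T / s\<rceil>"
    have k: "real k \<ge> T / s" "real k \<le> T / s + 1" unfolding k_def using T s by (simp_all add: ceiling_correct less_imp_le)
    have kp: "real k > 0" using k(1) T s by (smt (verit) divide_pos_pos)
    have "1 \<le> v (real k * s)" using k(1) s by (intro v1) (simp add: field_simps)
    also have "\<dots> \<le> real k * v s" by (rule v_mult_le)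
    also have "\<dots> \<le> (T / s + 1) * v s" using k v_nonneg by (intro mult_right_mono)
    finally have "1 \<le> ((T + s) / s) * v s" using s by (simp add: add_divide_distrib)
    then show "s / (T + s) \<le> v s" using s T by (simp add: field_simps)
  qed
qed

text \<open>If \<open>X t\<close> were close to \<open>- X 0\<close>, then \<open>X (2 * t)\<close> would be close to \<open>- X t\<close> and so to \<open>X 0\<close>, against the lower bound for the canonical
distance. For small \<open>t\<close> the Lipschitz property makes the correlation positive.\<close>

lemma correlation_bounded_below: "\<exists>c>0. c \<le> 1 \<and> (\<forall>t. c \<le> 1 + \<rho> t)"
proof -
  obtain T where T: "T > 0" "\<And>s. s > 0 \<Longrightarrow> s / (T + s) \<le> v s" using v_lower by auto
  define a where "a = (2/K) / (T + 2/K)"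
  have "T + 2 / K > 0" "2 / K > 0" using T K_pos by (auto intro: add_pos_pos)
  then have a: "a > 0" "a \<le> 1" unfolding a_def using T(1)
    by (simp_all only: divide_pos_pos divide_le_eq_1_pos)
  have mono: "y / (T + y) \<le> z / (T + z)" if "0 < y" "y \<le> z" for y z
  proof -
    have "T + y > 0" "T + z > 0" using that T by auto
    moreover have "T * y \<le> T * z" using that T by (intro mult_left_mono) auto
    ultimately show ?thesis by (simp add: field_simps)
  qed
  have main: "a\<^sup>2 / 8 \<le> 1 + \<rho> t" if "t \<ge> 0" for t
  proof (cases "t \<le> 1/K")
    case True
    then have "K * \<bar>t\<bar> \<le> 1" using that K_pos by (simp add: field_simps)
    then have "v t \<le> 1" using v_le_K[of t] by simp
    then have "(v t)\<^sup>2 \<le> 1" using v_nonneg[of t] by (simp add: power_le_one)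
    then have "1 + \<rho> t \<ge> 1" by (simp add: v_square)
    moreover have "a\<^sup>2 \<le> 1" using a by (simp add: power_le_one)
    ultimately show ?thesis by simp
  next
    case False
    then have t: "t > 1/K" "t > 0" using K_pos by (auto intro: order.strict_trans[of 0 "1/K"])
    have "a \<le> 2 * t / (T + 2 * t)"
      unfolding a_def using t K_pos by (intro mono) (auto simp: field_simps)
    also have "\<dots> \<le> v (2 * t)" using T(2)[of "2 * t"] t by simp
    also have "v (2 * t) = nrm (\<lambda>\<omega>. (X (2 * t) \<omega> + X t \<omega>) + (-1) * (X t \<omega> + X 0 \<omega>))"
      using nrm_diff_X[of "2 * t" 0] by simp
    also have "\<dots> \<le> nrm (\<lambda>\<omega>. X (2 * t) \<omega> + X t \<omega>) + nrm (\<lambda>\<omega>. (-1) * (X t \<omega> + X 0 \<omega>))"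
      by (intro nrm_add_le add_mem scale_mem X_mem)
    also have "\<dots> = 2 * sqrt (2 * (1 + \<rho> t))"
      unfolding nrm_def cov_scale_left cov_scale_right using \<rho>_minus[of t]
      by (simp add: cov_add_self X_mem cov_X \<rho>_0)
    finally have "a / 2 \<le> sqrt (2 * (1 + \<rho> t))" by simp
    then have "(a / 2)\<^sup>2 \<le> (sqrt (2 * (1 + \<rho> t)))\<^sup>2" using a by (intro power_mono) auto
    also have "\<dots> = 2 * (1 + \<rho> t)" using abs_\<rho>_le_1[of t] by simp
    finally show ?thesis by (simp add: power_divide)
  qed
  show ?thesis
  proof (intro exI[of _ "a\<^sup>2/8"] conjI allI)
    show "a\<^sup>2 / 8 > 0" using a by simp
    show "a\<^sup>2 / 8 \<le> 1" using a power_le_one[of a 2] by simp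
    show "a\<^sup>2 / 8 \<le> 1 + \<rho> t" for t using main[of t] main[of "- t"] \<rho>_minus[of t] by (cases "t \<ge> 0") auto
  qed
qed

lemma tail_X: "w > 0 \<Longrightarrow> \<P>(\<omega> in M. X t \<omega> > w) \<le> mills w"
  using tail_upper[OF X_mem[of t], of 1 w] by (simp add: cov_X \<rho>_0)

text \<open>Both values exceed \<open>w\<close> only if their sum exceeds \<open>2 * w\<close>, and its variance falls short of \<open>4\<close> by \<open>(v (p - q))\<^sup>2\<close>.\<close>

lemma two_point_tail:
  assumes T: "T > 0" "\<And>s. s > 0 \<Longrightarrow> s / (T + s) \<le> v s" and w: "w > 0"
  shows "\<P>(\<omega> in M. X p \<omega> > w \<and> X q \<omega> > w) \<le> mills w * exp (- (w\<^sup>2 / 8) * (\<bar>p - q\<bar> / (T + \<bar>p - q\<bar>))\<^sup>2)"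
proof -
  define t where "t = \<bar>p - q\<bar>"
  define r where "r = \<rho> t"
  obtain c where c: "c > 0" "\<And>t. c \<le> 1 + \<rho> t" using correlation_bounded_below by blast
  have r: "1 + r > 0" "r \<le> 1" using c(2)[of t] c(1) abs_\<rho>_le_1[of t] unfolding r_def by (auto simp: abs_le_iff)
  have rpq: "\<rho> (q - p) = r" unfolding r_def t_def using \<rho>_minus[of "p - q"] by (cases "p \<ge> q") auto
  define s where "s = sqrt (2 + 2 * r)"
  have s: "s > 0" "s\<^sup>2 = 2 + 2 * r" "s \<le> 2" unfolding s_def using r by (auto intro: real_le_lsqrt)
  have cv: "cov (\<lambda>\<omega>. X p \<omega> + X q \<omega>) (\<lambda>\<omega>. X p \<omega> + X q \<omega>) \<le> s\<^sup>2"
    unfolding s(2) by (simp add: cov_add_self X_mem cov_X \<rho>_0 rpq)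
  have "\<P>(\<omega> in M. X p \<omega> > w \<and> X q \<omega> > w) \<le> \<P>(\<omega> in M. X p \<omega> + X q \<omega> > 2 * w)"
    by (intro finite_measure_mono) auto
  also have "\<dots> \<le> mills (2 * w / s)"
    using w s cv by (intro tail_upper add_mem X_mem) auto
  also have "\<dots> \<le> mills w * exp (- (w\<^sup>2 / 8) * (t / (T + t))\<^sup>2)"
  proof -
    have e: "(2 * w / s)\<^sup>2 / 2 = w\<^sup>2 / (1 + r)" using s r by (simp add: power_divide power_mult_distrib field_simps)
    have "(t / (T + t))\<^sup>2 \<le> (v t)\<^sup>2"
      using T(2)[of t] T(1) v_nonneg[of t] by (cases "t > 0") (auto simp: t_def intro!: power_mono)
    also have "\<dots> = 2 * (1 - r)" by (simp add: v_square r_def)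
    finally have "(w\<^sup>2 / 8) * (t / (T + t))\<^sup>2 \<le> (w\<^sup>2 / 8) * (2 * (1 - r))" by (intro mult_left_mono) auto
    also have "\<dots> \<le> w\<^sup>2 / (1 + r) - w\<^sup>2 / 2"
    proof -
      have "w\<^sup>2 / (1 + r) - w\<^sup>2 / 2 - (w\<^sup>2 / 8) * (2 * (1 - r)) = w\<^sup>2 * (1 - r)\<^sup>2 / (4 * (1 + r))"
        using r by (simp add: divide_simps) (simp add: power2_eq_square algebra_simps)
      moreover have "\<dots> \<ge> 0" using r by simp
      ultimately show ?thesis by linarith
    qed
    finally have "- (2 * w / s)\<^sup>2 / 2 \<le> - w\<^sup>2 / 2 + (- (w\<^sup>2 / 8) * (t / (T + t))\<^sup>2)" using e by linarith
    then have "exp (- (2 * w / s)\<^sup>2 / 2) \<le> exp (- w\<^sup>2 / 2) * exp (- (w\<^sup>2 / 8) * (t / (T + t))\<^sup>2)"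
      unfolding exp_add[symmetric] exp_le_cancel_iff .
    moreover have "w \<le> 2 * w / s" using s w by (simp add: field_simps)
    ultimately have "exp (- (2 * w / s)\<^sup>2 / 2) / (2 * w / s) \<le> (exp (- w\<^sup>2 / 2) * exp (- (w\<^sup>2 / 8) * (t / (T + t))\<^sup>2)) / w"
      using w by (intro frac_le) auto
    then show ?thesis by (simp add: mills_def)
  qed
  finally show ?thesis unfolding t_def .
qed

end

section \<open>The supremum over a short interval\<close>

text \<open>Jensen's inequality for finite averages.\<close>

lemma exp_average_le:
  fixes y :: "nat \<Rightarrow> real"
  assumes "N > 0"
  shows "exp ((\<Sum>i<N. y i) / real N) \<le> (\<Sum>i<N. exp (y i)) / real N"
proof -
  define m where "m = (\<Sum>i<N. y i) / real N"
  have "(\<Sum>i<N. exp m * (1 + (y i - m))) \<le> (\<Sum>i<N. exp (y i))"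
  proof (rule sum_mono)
    fix i
    have "exp m * (1 + (y i - m)) \<le> exp m * exp (y i - m)"
      by (intro mult_left_mono exp_ge_add_one_self) auto
    then show "exp m * (1 + (y i - m)) \<le> exp (y i)" by (simp add: exp_add[symmetric])
  qed
  also have "(\<Sum>i<N. exp m * (1 + (y i - m))) = exp m * real N"
    using assms by (simp add: sum_distrib_left[symmetric] sum.distrib sum_subtractf m_def)
  finally show ?thesis using assms by (simp add: m_def pos_le_divide_eq)
qed

context normal_process begin

text \<open>Exceedance over an interval of length \<open>h\<close>, seen on the dyadic points of order \<open>n\<close>. All bounds are uniform in \<open>n\<close>.\<close>

definition block_exceeds :: "nat \<Rightarrow> real \<Rightarrow> real \<Rightarrow> real \<Rightarrow> 'a set" where
  "block_exceeds n h c u = {\<omega>\<in>space M. \<exists>i\<in>{..2^n}. X (c + real i * h / 2^n) \<omega> > u}"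

lemma block_exceeds_measurable [measurable]: "block_exceeds n h c u \<in> sets M"
  unfolding block_exceeds_def by measurable

definition increment :: "nat \<Rightarrow> real \<Rightarrow> real \<Rightarrow> nat \<Rightarrow> 'a \<Rightarrow> real" where
  "increment n h c i \<omega> = X (c + real (Suc i) * h / 2^n) \<omega> - X (c + real i * h / 2^n) \<omega>"

lemma increment_mem: "increment n h c i \<in> finite_combinations X"
  unfolding increment_def by (intro diff_mem X_mem)

lemma increment_meas [measurable]: "increment n h c i \<in> borel_measurable M"
  by (rule meas[OF increment_mem])

lemma cov_increment_le:
  assumes "h > 0"
  shows "cov (increment n h c i) (increment n h c i) \<le> (K * h / 2^n)\<^sup>2"
proof -
  have "cov (increment n h c i) (increment n h c i) = (v (h / 2^n))\<^sup>2"
    unfolding nrm_square[symmetric] increment_def nrm_diff_X by (simp add: field_simps)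
  also have "\<dots> \<le> (K * h / 2^n)\<^sup>2"
    using v_le_K[of "h / 2^n"] assms v_nonneg by (intro power_mono) auto
  finally show ?thesis .
qed

lemma block_rise_le:
  assumes "i \<le> 2^n"
  shows "X (c + real i * h / 2^n) \<omega> - X c \<omega> \<le> (\<Sum>j<2^n. \<bar>increment n h c j \<omega>\<bar>)"
proof -
  have "X (c + real i * h / 2^n) \<omega> - X (c + real 0 * h / 2^n) \<omega> = (\<Sum>j<i. increment n h c j \<omega>)"
    unfolding increment_def by (subst sum_lessThan_telescope) simp
  also have "\<dots> \<le> (\<Sum>j<i. \<bar>increment n h c j \<omega>\<bar>)" by (intro sum_mono) auto
  also have "\<dots> \<le> (\<Sum>j<2^n. \<bar>increment n h c j \<omega>\<bar>)" using assms by (intro sum_mono2) auto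
  finally show ?thesis by simp
qed

text \<open>The total variation over the dyadic points is an average of rescaled increments, whose variance is bounded uniformly in \<open>n\<close> by
the mean-square Lipschitz property; Jensen's inequality transfers exponential moments.\<close>

lemma exp_variation_le:
  "exp (\<theta> * (\<Sum>j<2^n. \<bar>increment n h c j \<omega>\<bar>)) \<le> (\<Sum>j<2^n. exp (\<theta> * 2^n * \<bar>increment n h c j \<omega>\<bar>)) / 2^n"
  using exp_average_le[of "2^n" "\<lambda>j. \<theta> * 2^n * \<bar>increment n h c j \<omega>\<bar>"]
  by (simp add: sum_distrib_left[symmetric])

text \<open>Markov's inequality for the exponential moment of the variation.\<close>

lemma block_oscillation:
  assumes \<theta>: "\<theta> > 0" and h: "h > 0"
  shows "\<P>(\<omega> in M. \<exists>i\<in>{..2^n}. X (c + real i * h / 2^n) \<omega> > X c \<omega> + y)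
    \<le> 2 * exp (\<theta>\<^sup>2 * K\<^sup>2 * h\<^sup>2 / 2 - \<theta> * y)"
proof -
  let ?N = "2^n :: real"
  define D where "D \<omega> = (\<Sum>j<2^n. \<bar>increment n h c j \<omega>\<bar>)" for \<omega>
  have [measurable]: "D \<in> borel_measurable M" unfolding D_def by measurable
  let ?E = "{\<omega>\<in>space M. \<exists>i\<in>{..2^n}. X (c + real i * h / 2^n) \<omega> > X c \<omega> + y}"
  have [measurable]: "?E \<in> sets M" by measurable
  have "emeasure M ?E = (\<integral>\<^sup>+\<omega>. indicator ?E \<omega> \<partial>M)" by simp
  also have "\<dots> \<le> (\<integral>\<^sup>+\<omega>. (\<Sum>j<2^n. ennreal (exp (- \<theta> * y) / ?N) * ennreal (exp \<bar>\<theta> * ?N * increment n h c j \<omega>\<bar>)) \<partial>M)"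
  proof (intro nn_integral_mono)
    fix \<omega> assume "\<omega> \<in> space M"
    show "indicator ?E \<omega> \<le> (\<Sum>j<2^n. ennreal (exp (- \<theta> * y) / ?N) * ennreal (exp \<bar>\<theta> * ?N * increment n h c j \<omega>\<bar>))"
    proof (cases "\<omega> \<in> ?E")
      case True
      then obtain i where "i \<le> 2^n" "X (c + real i * h / 2^n) \<omega> > X c \<omega> + y" by auto
      then have "y \<le> D \<omega>" using block_rise_le[of i n c h \<omega>] by (simp add: D_def)
      then have "0 \<le> - \<theta> * y + \<theta> * D \<omega>" using \<theta> by simp
      then have "1 \<le> exp (- \<theta> * y) * exp (\<theta> * D \<omega>)" unfolding exp_add[symmetric] by simp
      also have "\<dots> \<le> exp (- \<theta> * y) * ((\<Sum>j<2^n. exp (\<theta> * ?N * \<bar>increment n h c j \<omega>\<bar>)) / ?N)"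
        unfolding D_def by (intro mult_left_mono exp_variation_le) auto
      also have "\<dots> = (\<Sum>j<2^n. exp (- \<theta> * y) / ?N * exp \<bar>\<theta> * ?N * increment n h c j \<omega>\<bar>)"
        using \<theta> by (simp add: sum_distrib_left sum_divide_distrib abs_mult)
      finally have "ennreal 1 \<le> ennreal (\<Sum>j<2^n. exp (- \<theta> * y) / ?N * exp \<bar>\<theta> * ?N * increment n h c j \<omega>\<bar>)"
        by (rule ennreal_leI)
      also have "\<dots> = (\<Sum>j<2^n. ennreal (exp (- \<theta> * y) / ?N) * ennreal (exp \<bar>\<theta> * ?N * increment n h c j \<omega>\<bar>))"
        by (subst sum_ennreal[symmetric]) (auto simp: ennreal_mult[symmetric])
      finally show ?thesis using True by simp
    qed simp
  qed
  also have "\<dots> = (\<Sum>j<2^n. ennreal (exp (- \<theta> * y) / ?N) * (\<integral>\<^sup>+\<omega>. ennreal (exp \<bar>\<theta> * ?N * increment n h c j \<omega>\<bar>) \<partial>M))"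
    by (subst nn_integral_sum) (auto simp: nn_integral_cmult)
  also have "\<dots> \<le> (\<Sum>j<(2^n::nat). ennreal (exp (- \<theta> * y) / ?N) * ennreal (2 * exp (\<theta>\<^sup>2 * K\<^sup>2 * h\<^sup>2 / 2)))"
  proof (intro sum_mono mult_left_mono)
    fix j
    have "cov (\<lambda>\<omega>. (\<theta> * ?N) * increment n h c j \<omega>) (\<lambda>\<omega>. (\<theta> * ?N) * increment n h c j \<omega>)
        = (\<theta> * ?N)\<^sup>2 * cov (increment n h c j) (increment n h c j)"
      unfolding cov_scale_left cov_scale_right by (simp add: power2_eq_square)
    also have "\<dots> \<le> (\<theta> * ?N)\<^sup>2 * (K * h / 2^n)\<^sup>2" by (intro mult_left_mono cov_increment_le h) auto
    also have "\<dots> = \<theta>\<^sup>2 * K\<^sup>2 * h\<^sup>2" by (simp add: power_mult_distrib power_divide)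
    finally have "2 * exp (cov (\<lambda>\<omega>. (\<theta> * ?N) * increment n h c j \<omega>) (\<lambda>\<omega>. (\<theta> * ?N) * increment n h c j \<omega>) / 2) \<le> 2 * exp (\<theta>\<^sup>2 * K\<^sup>2 * h\<^sup>2 / 2)"
      by simp
    then show "(\<integral>\<^sup>+\<omega>. ennreal (exp \<bar>\<theta> * ?N * increment n h c j \<omega>\<bar>) \<partial>M) \<le> ennreal (2 * exp (\<theta>\<^sup>2 * K\<^sup>2 * h\<^sup>2 / 2))"
      by (intro order_trans[OF exp_abs_moment[OF scale_mem[OF increment_mem]] ennreal_leI])
  qed auto
  also have "\<dots> = ennreal (2 * (exp (\<theta>\<^sup>2 * K\<^sup>2 * h\<^sup>2 / 2) * exp (- \<theta> * y)))"
    by (simp add: ennreal_mult[symmetric] ennreal_of_nat_eq_real_of_nat mult_ac)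
  also have "exp (\<theta>\<^sup>2 * K\<^sup>2 * h\<^sup>2 / 2) * exp (- \<theta> * y) = exp (\<theta>\<^sup>2 * K\<^sup>2 * h\<^sup>2 / 2 - \<theta> * y)"
    by (simp add: exp_add[symmetric])
  finally show ?thesis by (simp add: emeasure_eq_measure)
qed

text \<open>The supremum over an interval of length \<open>1 / u\<close> exceeds \<open>u\<close> with probability comparable to that of a single value. Condition on the value
\<open>Y\<close> at the left end: after regression on \<open>Y\<close> the increments are independent of it, and a rise by \<open>u - Y\<close> costs
a factor \<open>exp (- (3/2) * u * (u - Y))\<close> up to constants, because the variation has exponential moments of order \<open>2 * u\<close> on this scale. Integration
over \<open>Y\<close> is \<open>truncated_exp_moment\<close>.\<close>

lemma local_supremum:
  assumes u: "u > 0" "u \<ge> 2 * K" and h: "h > 0" "h \<le> 1 / u"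
  shows "prob (block_exceeds n h c u) \<le> (1 + 4 * exp (4 * K\<^sup>2)) * mills u"
proof -
  let ?N = "2^n :: real"
  define Y where "Y = X c"
  have Y: "Y \<in> finite_combinations X" "cov Y Y = 1" by (simp_all add: Y_def X_mem cov_X \<rho>_0)
  have [measurable]: "Y \<in> borel_measurable M" by (simp add: Y_def)
  define D where "D \<omega> = (\<Sum>j<2^n. \<bar>increment n h c j \<omega>\<bar>)" for \<omega>
  have [measurable]: "D \<in> borel_measurable M" unfolding D_def by measurable
  define \<kappa> where "\<kappa> j = cov Y (increment n h c j)" for j
  have \<kappa>: "\<bar>\<kappa> j\<bar> \<le> K\<^sup>2 * h\<^sup>2 / ?N" if j: "j < 2^n" for j
  proof -
    define a where "a = real j * h / ?N"
    define b where "b = real (Suc j) * h / ?N"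
    have ba: "b - a = h / ?N" by (simp add: a_def b_def field_simps)
    have "real (Suc j) \<le> ?N" using j by (metis Suc_leI of_nat_le_iff of_nat_numeral of_nat_power)
    then have "b \<le> h" unfolding b_def using h by (simp add: pos_divide_le_eq mult.commute)
    moreover have "0 \<le> a" "a \<le> b" using h by (auto simp: a_def b_def divide_right_mono)
    ultimately have ab: "0 \<le> a" "a \<le> h" "0 \<le> b" "b \<le> h" by auto
    have "\<kappa> j = \<rho> b - \<rho> a"
      unfolding \<kappa>_def increment_def Y_def by (simp add: cov_diff_right X_mem cov_X a_def b_def)
    also have "\<dots> = (v a - v b) * (v a + v b) / 2"
      using v_square[of a] v_square[of b] by (simp add: power2_eq_square algebra_simps)
    finally have "\<bar>\<kappa> j\<bar> = \<bar>v a - v b\<bar> * \<bar>v a + v b\<bar> / \<bar>2\<bar>"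
      by (simp only: abs_mult abs_divide)
    then have "\<bar>\<kappa> j\<bar> = \<bar>v a - v b\<bar> * (v a + v b) / 2"
      using v_nonneg[of a] v_nonneg[of b] by simp
    also have "\<dots> \<le> (K * (h / ?N)) * (K * h + K * h) / 2"
    proof (intro divide_right_mono mult_mono add_mono)
      show "\<bar>v a - v b\<bar> \<le> K * (h / ?N)"
        using abs_v_diff_le[of b a] v_le_K[of "b - a"] h unfolding ba by (simp add: abs_minus_commute)
      show "v a \<le> K * h" "v b \<le> K * h"
        using v_le_K[of a] v_le_K[of b] ab mult_left_mono[OF ab(2) less_imp_le[OF K_pos]] mult_left_mono[OF ab(4) less_imp_le[OF K_pos]] by auto
    qed (use v_nonneg K_pos h in auto)
    also have "\<dots> = K\<^sup>2 * h\<^sup>2 / ?N" by (simp add: power2_eq_square)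
    finally show ?thesis .
  qed
  \<comment> \<open>The coefficient \<open>\<kappa> j\<close> is of second order in \<open>h\<close>, because \<open>1 - \<rho>\<close> is half the square of \<open>v\<close>.\<close>
  define R where "R j \<omega> = increment n h c j \<omega> - \<kappa> j * Y \<omega>" for j \<omega>
  have R: "R j \<in> finite_combinations X" for j
    unfolding R_def by (intro diff_mem scale_mem increment_mem Y)
  have [measurable]: "R j \<in> borel_measurable M" for j by (rule meas[OF R])
  have YR: "cov Y (R j) = 0" for j
    unfolding R_def by (subst cov_diff_right) (auto simp: scale_mem increment_mem Y cov_scale_right \<kappa>_def)
  have RR: "cov (R j) (R j) \<le> (K * h / ?N)\<^sup>2" for j
  proof -
    have "cov (R j) (R j) = cov (increment n h c j) (increment n h c j) - (\<kappa> j)\<^sup>2"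
      unfolding R_def
      by (subst cov_diff_self)
        (auto simp: scale_mem increment_mem Y cov_scale_right cov_scale_left \<kappa>_def cov_commute power2_eq_square)
    then show ?thesis using cov_increment_le[OF h(1), of n c j] zero_le_power2[of "\<kappa> j"] by linarith
  qed
  \<comment> \<open>The rate \<open>3/2\<close> is what remains of \<open>2\<close> after the contribution of \<open>\<kappa> j * Y\<close>, which is at most \<open>u / 2 * (u - Y)\<close> up to a constant.\<close>
  define f where "f y = ennreal (exp (2 * K\<^sup>2) * exp (- (3/2) * u * (u - y))) * indicator {..u} y" for y :: real
  have [measurable]: "f \<in> borel_measurable borel" unfolding f_def by measurable
  let ?E = "{\<omega>\<in>space M. \<exists>i\<in>{..2^n}. X (c + real i * h / 2^n) \<omega> > u \<and> Y \<omega> \<le> u}"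
  have [measurable]: "?E \<in> sets M" by measurable
  have pt: "indicator ?E \<omega> \<le> (\<Sum>j<2^n. ennreal (1 / ?N) * (f (Y \<omega>) * ennreal (exp \<bar>2 * u * ?N * R j \<omega>\<bar>)))" for \<omega>
  proof (cases "\<omega> \<in> ?E")
    case True
    then obtain i where i: "i \<le> 2^n" "X (c + real i * h / 2^n) \<omega> > u" and Yu: "Y \<omega> \<le> u" by auto
    then have "u \<le> Y \<omega> + D \<omega>" using block_rise_le[of i n c h \<omega>] by (simp add: D_def Y_def)
    then have "0 \<le> 2 * u * (Y \<omega> - u) + 2 * u * D \<omega>" using u by (simp add: distrib_left[symmetric])
    then have "1 \<le> exp (2 * u * (Y \<omega> - u)) * exp (2 * u * D \<omega>)" unfolding exp_add[symmetric] by simp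
    also have "\<dots> \<le> exp (2 * u * (Y \<omega> - u)) * ((\<Sum>j<2^n. exp (2 * u * ?N * \<bar>increment n h c j \<omega>\<bar>)) / ?N)"
      unfolding D_def by (intro mult_left_mono exp_variation_le) auto
    also have "\<dots> = (\<Sum>j<2^n. (1/?N) * (exp (2 * u * (Y \<omega> - u)) * exp (2 * u * ?N * \<bar>increment n h c j \<omega>\<bar>)))"
      by (simp add: sum_distrib_left sum_divide_distrib)
    also have "\<dots> \<le> (\<Sum>j<2^n. (1/?N) * ((exp (2 * K\<^sup>2) * exp (- (3/2) * u * (u - Y \<omega>))) * exp \<bar>2 * u * ?N * R j \<omega>\<bar>))"
    proof (intro sum_mono mult_left_mono)
      fix j :: nat assume "j \<in> {..<2^n}"
      then have j: "j < 2^n" by simp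
      have "\<bar>increment n h c j \<omega>\<bar> \<le> \<bar>\<kappa> j\<bar> * \<bar>Y \<omega>\<bar> + \<bar>R j \<omega>\<bar>"
        unfolding R_def abs_mult[symmetric] by linarith
      also have "\<bar>\<kappa> j\<bar> * \<bar>Y \<omega>\<bar> \<le> (K\<^sup>2 * h\<^sup>2 / ?N) * (u + (u - Y \<omega>))"
        using \<kappa>[OF j] Yu u(1) by (intro mult_mono) auto
      finally have "2 * u * ?N * \<bar>increment n h c j \<omega>\<bar> \<le> 2 * u * ?N * ((K\<^sup>2 * h\<^sup>2 / ?N) * (u + (u - Y \<omega>)) + \<bar>R j \<omega>\<bar>)"
        using u by (intro mult_left_mono) auto
      also have "\<dots> = 2 * K\<^sup>2 * (u * h\<^sup>2) * (u + (u - Y \<omega>)) + \<bar>2 * u * ?N * R j \<omega>\<bar>"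
        using u by (simp add: abs_mult field_simps)
      also have "2 * K\<^sup>2 * (u * h\<^sup>2) * (u + (u - Y \<omega>)) \<le> 2 * K\<^sup>2 + u / 2 * (u - Y \<omega>)"
      proof -
        have "h\<^sup>2 \<le> (1/u)\<^sup>2" using h u by (intro power_mono) auto
        then have "u * h\<^sup>2 \<le> u * (1/u)\<^sup>2" using u by (intro mult_left_mono) auto
        then have uh: "u * h\<^sup>2 \<le> 1 / u" using u by (simp add: power2_eq_square)
        have "2 * K\<^sup>2 * (u * h\<^sup>2) * (u + (u - Y \<omega>)) \<le> 2 * K\<^sup>2 * (1/u) * (u + (u - Y \<omega>))"
          using uh Yu u by (intro mult_right_mono mult_left_mono) auto
        also have "\<dots> = 2 * K\<^sup>2 + 2 * K\<^sup>2 / u * (u - Y \<omega>)" using u by (simp add: field_simps)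
        also have "2 * K\<^sup>2 / u * (u - Y \<omega>) \<le> u / 2 * (u - Y \<omega>)"
        proof (intro mult_right_mono)
          have "(2 * K)\<^sup>2 \<le> u\<^sup>2" using u K_pos by (intro power_mono) auto
          then show "2 * K\<^sup>2 / u \<le> u / 2" using u by (simp add: field_simps power2_eq_square)
        qed (use Yu in simp)
        finally show ?thesis by simp
      qed
      finally have A: "2 * u * ?N * \<bar>increment n h c j \<omega>\<bar> \<le> 2 * K\<^sup>2 + u / 2 * (u - Y \<omega>) + \<bar>2 * u * ?N * R j \<omega>\<bar>"
        by simp
      have "2 * u * (Y \<omega> - u) + u / 2 * (u - Y \<omega>) = - (3/2) * u * (u - Y \<omega>)"
        by (simp add: field_simps)
      with A have "2 * u * (Y \<omega> - u) + 2 * u * ?N * \<bar>increment n h c j \<omega>\<bar>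
          \<le> 2 * K\<^sup>2 + (- (3/2) * u * (u - Y \<omega>)) + \<bar>2 * u * ?N * R j \<omega>\<bar>"
        by linarith
      then show "exp (2 * u * (Y \<omega> - u)) * exp (2 * u * ?N * \<bar>increment n h c j \<omega>\<bar>)
          \<le> exp (2 * K\<^sup>2) * exp (- (3/2) * u * (u - Y \<omega>)) * exp \<bar>2 * u * ?N * R j \<omega>\<bar>"
        unfolding exp_add[symmetric] exp_le_cancel_iff .
    qed auto
    finally have "ennreal 1 \<le> ennreal (\<Sum>j<2^n. (1/?N) * ((exp (2 * K\<^sup>2) * exp (- (3/2) * u * (u - Y \<omega>))) * exp \<bar>2 * u * ?N * R j \<omega>\<bar>))"
      by (rule ennreal_leI)
    also have "\<dots> = (\<Sum>j<2^n. ennreal (1 / ?N) * (f (Y \<omega>) * ennreal (exp \<bar>2 * u * ?N * R j \<omega>\<bar>)))"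
      using Yu by (subst sum_ennreal[symmetric]) (auto simp: f_def ennreal_mult[symmetric])
    finally show ?thesis using True by simp
  qed simp
  have fY: "(\<integral>\<^sup>+\<omega>. f (Y \<omega>) \<partial>M) \<le> ennreal (2 * exp (2 * K\<^sup>2) * mills u)"
  proof -
    define Z where "Z \<omega> = - Y \<omega>" for \<omega>
    have Z: "Z \<in> finite_combinations X" "cov Z Z = 1"
      unfolding Z_def using minus_mem[OF Y(1)] Y(2) by (auto simp: cov_def)
    have [measurable]: "Z \<in> borel_measurable M" by (rule meas[OF Z(1)])
    have "(\<integral>\<^sup>+\<omega>. f (Y \<omega>) \<partial>M) = (\<integral>\<^sup>+\<omega>. ennreal (exp (2 * K\<^sup>2)) * (ennreal (exp (- (3/2) * u * (u + Z \<omega>))) * indicator {- u..} (Z \<omega>)) \<partial>M)"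
      by (intro nn_integral_cong) (auto simp: f_def Z_def ennreal_mult mult.assoc split: split_indicator)
    also have "\<dots> = ennreal (exp (2 * K\<^sup>2)) * (\<integral>\<^sup>+\<omega>. (ennreal (exp (- (3/2) * u * (u + Z \<omega>))) * indicator {- u..} (Z \<omega>)) \<partial>M)"
      by (rule nn_integral_cmult) measurable
    also have "\<dots> \<le> ennreal (exp (2 * K\<^sup>2)) * ennreal (2 * mills u)"
      by (intro mult_left_mono truncated_exp_moment[OF Z u(1)]) auto
    finally show ?thesis using mills_pos[OF u(1)] by (simp add: ennreal_mult[symmetric] mult_ac)
  qed
  have gR: "(\<integral>\<^sup>+\<omega>. ennreal (exp \<bar>2 * u * ?N * R j \<omega>\<bar>) \<partial>M) \<le> ennreal (2 * exp (2 * K\<^sup>2))" for j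
  proof -
    have "cov (\<lambda>\<omega>. (2 * u * ?N) * R j \<omega>) (\<lambda>\<omega>. (2 * u * ?N) * R j \<omega>) = (2 * u * ?N)\<^sup>2 * cov (R j) (R j)"
      unfolding cov_scale_left cov_scale_right by (simp add: power2_eq_square)
    also have "\<dots> \<le> (2 * u * ?N)\<^sup>2 * (K * h / ?N)\<^sup>2" by (intro mult_left_mono RR) auto
    also have "\<dots> = 4 * K\<^sup>2 * (u * h)\<^sup>2" by (simp add: power_mult_distrib power_divide)
    also have "\<dots> \<le> 4 * K\<^sup>2 * 1"
      using h u by (intro mult_left_mono power_le_one) (auto simp: field_simps)
    finally have "2 * exp (cov (\<lambda>\<omega>. (2 * u * ?N) * R j \<omega>) (\<lambda>\<omega>. (2 * u * ?N) * R j \<omega>) / 2) \<le> 2 * exp (2 * K\<^sup>2)"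
      by simp
    then show ?thesis
      by (intro order_trans[OF exp_abs_moment[OF scale_mem[OF R]] ennreal_leI])
  qed
  have "emeasure M ?E = (\<integral>\<^sup>+\<omega>. indicator ?E \<omega> \<partial>M)" by simp
  also have "\<dots> \<le> (\<integral>\<^sup>+\<omega>. (\<Sum>j<2^n. ennreal (1 / ?N) * (f (Y \<omega>) * ennreal (exp \<bar>2 * u * ?N * R j \<omega>\<bar>))) \<partial>M)"
    by (intro nn_integral_mono pt)
  also have "\<dots> = (\<Sum>j<2^n. ennreal (1 / ?N) * (\<integral>\<^sup>+\<omega>. f (Y \<omega>) * ennreal (exp \<bar>2 * u * ?N * R j \<omega>\<bar>) \<partial>M))"
    by (subst nn_integral_sum) (auto simp: nn_integral_cmult)
  also have "\<dots> \<le> (\<Sum>j<(2^n::nat). ennreal (1 / ?N) * ennreal (4 * exp (4 * K\<^sup>2) * mills u))"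
  proof (intro sum_mono mult_left_mono)
    fix j
    have "(\<integral>\<^sup>+\<omega>. f (Y \<omega>) * ennreal (exp \<bar>2 * u * ?N * R j \<omega>\<bar>) \<partial>M)
        = (\<integral>\<^sup>+\<omega>. f (Y \<omega>) \<partial>M) * (\<integral>\<^sup>+\<omega>. ennreal (exp \<bar>2 * u * ?N * R j \<omega>\<bar>) \<partial>M)"
      using orthogonal_product[where R="\<lambda>s::unit. R j" and Y=Y and f=f and g="\<lambda>z. ennreal (exp \<bar>2 * u * ?N * z ()\<bar>)"] Y R YR
      by simp
    also have "\<dots> \<le> ennreal (2 * exp (2 * K\<^sup>2) * mills u) * ennreal (2 * exp (2 * K\<^sup>2))"
      by (intro mult_mono fY gR) auto
    also have "\<dots> = ennreal (4 * exp (4 * K\<^sup>2) * mills u)"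
    proof -
      have "exp (4 * K\<^sup>2) = exp (2 * K\<^sup>2) * exp (2 * K\<^sup>2)" by (simp add: exp_add[symmetric])
      then show ?thesis using mills_pos[OF u(1)] by (simp add: ennreal_mult[symmetric] mult_ac)
    qed
    finally show "(\<integral>\<^sup>+\<omega>. f (Y \<omega>) * ennreal (exp \<bar>2 * u * ?N * R j \<omega>\<bar>) \<partial>M) \<le> ennreal (4 * exp (4 * K\<^sup>2) * mills u)" .
  qed auto
  also have "\<dots> = ennreal (4 * exp (4 * K\<^sup>2) * mills u)"
    using mills_pos[OF u(1)] by (simp add: ennreal_mult[symmetric] ennreal_of_nat_eq_real_of_nat)
  finally have E: "prob ?E \<le> 4 * exp (4 * K\<^sup>2) * mills u"
    using mills_pos[OF u(1)] by (simp add: emeasure_eq_measure)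
  have "prob (block_exceeds n h c u) \<le> prob ({\<omega>\<in>space M. Y \<omega> > u} \<union> ?E)"
    by (intro finite_measure_mono) (auto simp: block_exceeds_def)
  also have "\<dots> \<le> \<P>(\<omega> in M. Y \<omega> > u) + prob ?E" by (rule measure_Un_le) auto
  also have "\<dots> \<le> mills u + 4 * exp (4 * K\<^sup>2) * mills u"
    using E tail_X[OF u(1), of c] by (simp add: Y_def)
  finally show ?thesis by (simp add: distrib_right)
qed

end

section \<open>Upper growth of the running maximum\<close>

text \<open>Levels that differ by \<open>O (1 / u)\<close> are equivalent up to constants.\<close>

lemma mills_shift_down:
  assumes "a \<ge> 0" "u > 0" "u\<^sup>2 \<ge> 2 * a"
  shows "mills (u - a / u) \<le> 2 * exp a * mills u"
proof -
  have h: "a / u \<le> u / 2" using assms by (simp add: field_simps power2_eq_square)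
  have "(u - a / u)\<^sup>2 = u\<^sup>2 - 2 * a + (a / u)\<^sup>2" using assms by (simp add: power2_diff)
  then have "- (u - a / u)\<^sup>2 / 2 \<le> a + (- u\<^sup>2 / 2)" by simp
  then have e: "exp (- (u - a / u)\<^sup>2 / 2) \<le> exp a * exp (- u\<^sup>2 / 2)" unfolding exp_add[symmetric] exp_le_cancel_iff .
  have "mills (u - a / u) \<le> (exp a * exp (- u\<^sup>2 / 2)) / (u / 2)"
    unfolding mills_def using e h assms by (intro frac_le) auto
  then show ?thesis by (simp add: mills_def mult_ac)
qed

lemma mills_shift_up:
  assumes "a \<ge> 0" "u > 0" "u\<^sup>2 \<ge> a"
  shows "mills u \<le> 2 * exp (3 * a / 2) * mills (u + a / u)"
proof -
  have h: "a / u \<le> u" using assms by (simp add: field_simps power2_eq_square)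
  have "(a / u)\<^sup>2 \<le> a"
  proof -
    have "(a / u)\<^sup>2 = a * (a / u\<^sup>2)" by (simp add: power2_eq_square)
    also have "\<dots> \<le> a * 1" using assms by (intro mult_left_mono) (auto simp: divide_le_eq_1)
    finally show ?thesis by simp
  qed
  moreover have "(u + a / u)\<^sup>2 = u\<^sup>2 + 2 * a + (a / u)\<^sup>2" using assms by (simp add: power2_sum)
  ultimately have "- u\<^sup>2 / 2 \<le> 3 * a / 2 + (- (u + a / u)\<^sup>2 / 2)" by linarith
  then have e: "exp (- u\<^sup>2 / 2) \<le> exp (3 * a / 2) * exp (- (u + a / u)\<^sup>2 / 2)" unfolding exp_add[symmetric] exp_le_cancel_iff .
  have "u + a / u > 0" using assms by (simp add: add_pos_nonneg)
  then have "exp (- u\<^sup>2 / 2) / u \<le> (exp (3 * a / 2) * exp (- (u + a / u)\<^sup>2 / 2)) / ((u + a / u) / 2)"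
    using e h assms by (intro frac_le) auto
  then show ?thesis by (simp add: mills_def mult_ac)
qed

lemma eventually_mills_double: "eventually (\<lambda>u. mills (2 * u) \<le> (mills u) ^ 3) at_top"
proof -
  have "eventually (\<lambda>u::real. exp (- (2 * u)\<^sup>2 / 2) / (2 * u) \<le> (exp (- u\<^sup>2 / 2) / u) ^ 3) at_top"
    by real_asymp
  then show ?thesis unfolding mills_def .
qed

lemma eventually_mills_le_1: "eventually (\<lambda>u. mills u \<le> 1) at_top"
proof -
  have "eventually (\<lambda>u::real. exp (- u\<^sup>2 / 2) / u \<le> 1) at_top" by real_asymp
  then show ?thesis unfolding mills_def .
qed

lemma le_on_interval_of_dyadic:
  fixes p :: "real \<Rightarrow> real"
  assumes cont: "continuous_on UNIV p" and dyadic: "\<And>n l. l \<le> 2^n \<Longrightarrow> p (c + real l * h / 2^n) \<le> u"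
    and t: "h > 0" "c \<le> t" "t \<le> c + h"
  shows "p t \<le> u"
proof -
  define i where "i n = nat \<lfloor>(t - c) * 2^n / h\<rfloor>" for n
  define s where "s n = c + real (i n) * h / 2^n" for n
  have pos: "0 \<le> (t - c) * 2^n / h" for n using t by simp
  have i: "real (i n) \<le> (t - c) * 2^n / h" "(t - c) * 2^n / h < real (i n) + 1" for n
    using pos[of n] unfolding i_def by (simp_all add: floor_correct)
  have "i n \<le> 2^n" for n
  proof -
    have "(t - c) * 2^n \<le> h * 2^n" using t by (intro mult_right_mono) auto
    then have "(t - c) * 2^n / h \<le> 2^n" using t by (simp add: pos_divide_le_eq mult.commute)
    then have "real (i n) \<le> 2^n" using i(1)[of n] by linarith
    also have "2^n = real (2^n)" by simp
    finally show ?thesis by (simp only: of_nat_le_iff)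
  qed
  then have ps: "p (s n) \<le> u" for n unfolding s_def by (rule dyadic)
  have "\<bar>s n - t\<bar> \<le> h * (1/2)^n" for n
  proof -
    have "real (i n) * h / 2^n \<le> t - c" using i(1)[of n] t by (simp add: field_simps)
    moreover have "t - c \<le> (real (i n) + 1) * h / 2^n" using i(2)[of n] t by (simp add: field_simps)
    moreover have "(real (i n) + 1) * h / 2^n = real (i n) * h / 2^n + h * (1/2)^n"
      by (simp add: power_one_over field_simps)
    ultimately show ?thesis unfolding s_def by (simp add: abs_le_iff)
  qed
  moreover have "(\<lambda>n. h * (1/2)^n) \<longlonglongrightarrow> 0"
    by (intro tendsto_mult_right_zero LIMSEQ_power_zero) simp
  ultimately have "(\<lambda>n. s n - t) \<longlonglongrightarrow> 0"
    by (intro Lim_null_comparison[of "\<lambda>n. s n - t" "\<lambda>n. h * (1/2)^n"]) auto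
  then have "s \<longlonglongrightarrow> t" by (simp add: LIM_zero_iff)
  moreover have "isCont p t" using cont by (simp add: continuous_on_eq_continuous_at)
  ultimately have "(\<lambda>n. p (s n)) \<longlonglongrightarrow> p t" by (rule isCont_tendsto_compose[rotated])
  then show ?thesis by (rule LIMSEQ_le_const2) (use ps in blast)
qed

context normal_process begin

text \<open>Distant exceedances are independent up to a constant factor: \<open>decouple\<close> with a single second variable, at correlation \<open>1 / u\<^sup>2\<close>.\<close>

lemma far_pair:
  assumes "\<kappa> > 0"
  shows "eventually (\<lambda>u. \<forall>p q. \<bar>p - q\<bar> \<ge> exp (\<kappa> * u\<^sup>2) \<longrightarrow>
    \<bar>\<rho> (p - q)\<bar> \<le> 1 / u\<^sup>2 \<and> \<P>(\<omega> in M. X p \<omega> > u \<and> X q \<omega> > u) \<le> (4 * exp 4 + 1) * (mills u)\<^sup>2) at_top"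
proof -
  obtain u0 where u0: "\<And>u t. u \<ge> u0 \<Longrightarrow> \<bar>t\<bar> \<ge> exp (\<kappa> * u\<^sup>2) \<Longrightarrow> \<bar>\<rho> t\<bar> \<le> 1 / u\<^sup>2"
    using far_correlation[OF assms, of 1] by auto
  show ?thesis
    using eventually_ge_at_top[of u0] eventually_ge_at_top[of 4] eventually_mills_double eventually_mills_le_1
  proof eventually_elim
    case (elim u)
    show ?case
    proof (intro allI impI conjI)
      fix p q assume pq: "\<bar>p - q\<bar> \<ge> exp (\<kappa> * u\<^sup>2)"
      show "\<bar>\<rho> (p - q)\<bar> \<le> 1 / u\<^sup>2" using u0[OF elim(1) pq] .
      have r: "\<bar>cov (X p) (X q)\<bar> \<le> 1 / u\<^sup>2"
        using u0[OF elim(1) pq] \<rho>_minus[of "p - q"] by (simp add: cov_X)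
      have m: "mills u > 0" using elim by (intro mills_pos) simp
      have be: "both_exceed (\<lambda>s::unit. X q) {()} {()} w = {\<omega>\<in>space M. X q \<omega> > w}" for w
        unfolding both_exceed_def by auto
      have "\<P>(\<omega> in M. X p \<omega> > u \<and> X q \<omega> > u) = \<P>(\<omega> in M. X p \<omega> > u \<and> \<omega> \<in> both_exceed (\<lambda>s::unit. X q) {()} {()} u)"
        unfolding be by (intro arg_cong[where f=prob]) auto
      also have "\<dots> \<le> 2 * \<P>(\<omega> in M. X p \<omega> > u) * prob (both_exceed (\<lambda>s::unit. X q) {()} {()} (u - 4 * u * (1 / u\<^sup>2))) + \<P>(\<omega> in M. X p \<omega> > 2 * u)"
        using elim r by (intro decouple X_mem) (auto simp: cov_X \<rho>_0)
      also have "\<dots> \<le> 2 * mills u * (2 * exp 4 * mills u) + mills (2 * u)"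
      proof (intro add_mono mult_mono)
        have "u - 4 * u * (1 / u\<^sup>2) = u - 4 / u" using elim by (simp add: power2_eq_square)
        moreover have "4 / u \<le> 1" using elim by simp
        then have "u - 4 / u > 0" using elim by linarith
        moreover have "u\<^sup>2 \<ge> 2 * 4" using elim power_mono[of 4 u 2] by simp
        ultimately show "prob (both_exceed (\<lambda>s::unit. X q) {()} {()} (u - 4 * u * (1 / u\<^sup>2))) \<le> 2 * exp 4 * mills u"
          unfolding be using tail_X[of "u - 4 / u" q] mills_shift_down[of 4 u] elim by simp
      qed (use elim m in \<open>auto intro!: tail_X\<close>)
      also have "\<dots> \<le> (4 * exp 4 + 1) * (mills u)\<^sup>2"
      proof -
        have "(mills u) ^ 3 \<le> (mills u)\<^sup>2" using m elim by (intro power_decreasing) auto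
        then show ?thesis using elim by (simp add: power2_eq_square distrib_right)
      qed
      finally show "\<P>(\<omega> in M. X p \<omega> > u \<and> X q \<omega> > u) \<le> (4 * exp 4 + 1) * (mills u)\<^sup>2" .
    qed
  qed
qed

definition block_sup :: "real \<Rightarrow> real \<Rightarrow> real \<Rightarrow> 'a set" where
  "block_sup h c u = (\<Union>n. block_exceeds n h c u)"

lemma block_sup_measurable [measurable]: "block_sup h c u \<in> sets M"
  unfolding block_sup_def by measurable

lemma block_exceeds_mono: "incseq (\<lambda>n. block_exceeds n h c u)"
proof (rule incseq_SucI)
  fix n
  show "block_exceeds n h c u \<subseteq> block_exceeds (Suc n) h c u"
  proof
    fix \<omega> assume "\<omega> \<in> block_exceeds n h c u"
    then obtain i where "\<omega> \<in> space M" "i \<le> 2^n" "X (c + real i * h / 2^n) \<omega> > u"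
      unfolding block_exceeds_def by auto
    then have "2 * i \<le> 2^Suc n \<and> X (c + real (2 * i) * h / 2^Suc n) \<omega> > u" by simp
    then show "\<omega> \<in> block_exceeds (Suc n) h c u"
      using \<open>\<omega> \<in> space M\<close> unfolding block_exceeds_def by blast
  qed
qed

lemma prob_block_sup_le:
  assumes [measurable]: "A \<in> sets M" and "\<And>n. prob (A \<inter> block_exceeds n h c u) \<le> b"
  shows "prob (A \<inter> block_sup h c u) \<le> b"
proof -
  have "incseq (\<lambda>n. A \<inter> block_exceeds n h c u)"
    by (rule incseq_SucI) (use incseq_SucD[OF block_exceeds_mono[of h c u]] in blast)
  then have "(\<lambda>n. prob (A \<inter> block_exceeds n h c u)) \<longlonglongrightarrow> prob (\<Union>n. A \<inter> block_exceeds n h c u)"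
    by (rule finite_Lim_measure_incseq[rotated]) auto
  also have "(\<Union>n. A \<inter> block_exceeds n h c u) = A \<inter> block_sup h c u"
    unfolding block_sup_def by blast
  finally show ?thesis by (rule LIMSEQ_le_const2) (use assms(2) in blast)
qed

lemma local_supremum_block:
  assumes "u > 0" "u \<ge> 2 * K" "h > 0" "h \<le> 1 / u"
  shows "prob (block_sup h c u) \<le> (1 + 4 * exp (4 * K\<^sup>2)) * mills u"
proof -
  have "space M \<inter> block_exceeds n h c u = block_exceeds n h c u" for n by (auto simp: block_exceeds_def)
  moreover have "space M \<inter> block_sup h c u = block_sup h c u" by (auto simp: block_sup_def block_exceeds_def)
  ultimately show ?thesis using prob_block_sup_le[of "space M" h c u] local_supremum[OF assms] by simp
qed

lemma not_in_block_sup: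
  assumes cont: "continuous_on UNIV (\<lambda>t. X t \<omega>)" and \<omega>: "\<omega> \<in> space M" "\<omega> \<notin> block_sup h c u"
    and t: "h > 0" "c \<le> t" "t \<le> c + h"
  shows "X t \<omega> \<le> u"
  by (rule le_on_interval_of_dyadic[OF cont _ t])
    (use \<omega> in \<open>auto simp: block_sup_def block_exceeds_def not_less\<close>)

text \<open>Cover the interval by blocks of length \<open>1 / u\<close>, \<open>u = (k + 1) * e\<close>. The expected number of blocks that exceed \<open>u\<close> is of order
\<open>exp ((k * e)\<^sup>2 / 2) * exp (- u\<^sup>2 / 2) \<le> exp (- k * e\<^sup>2)\<close>, and the Borel-Cantelli lemma applies.\<close>

lemma growth_upper:
  assumes cont: "AE \<omega> in M. continuous_on UNIV (\<lambda>t. X t \<omega>)" and e: "e > 0"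
  shows "AE \<omega> in M. eventually (\<lambda>k. \<forall>t\<in>{0..exp ((real k * e)\<^sup>2 / 2)}. X t \<omega> \<le> real k * e + e) sequentially"
proof -
  define C where "C = 1 + 4 * exp (4 * K\<^sup>2)"
  have C: "C > 0" unfolding C_def by (simp add: add_pos_pos)
  define u where "u k = real k * e + e" for k
  have u: "u k > 0" for k unfolding u_def using e by (simp add: add_nonneg_pos)
  define L where "L k = exp ((real k * e)\<^sup>2 / 2)" for k
  define J where "J k = nat \<lceil>L k * u k\<rceil>" for k
  define E where "E k = (\<Union>j<J k. block_sup (1 / u k) (real j / u k) (u k))" for k
  have [measurable]: "E k \<in> sets M" for k unfolding E_def by measurable
  have bound: "prob (E k) \<le> 2 * C * exp (- (e\<^sup>2)) ^ k" if k: "u k \<ge> 2 * K" "u k \<ge> 1" for k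
  proof -
    have L1: "L k \<ge> 1" unfolding L_def by simp
    have LU: "L k * u k \<ge> 1" using L1 k(2) mult_mono[of 1 "L k" 1 "u k"] by simp
    have "real (J k) \<le> L k * u k + 1" unfolding J_def using LU by (simp add: ceiling_correct)
    then have J: "real (J k) \<le> 2 * (L k * u k)" using LU by simp
    have "prob (E k) \<le> (\<Sum>j<J k. prob (block_sup (1 / u k) (real j / u k) (u k)))"
      unfolding E_def by (intro finite_measure_subadditive_finite) auto
    also have "\<dots> \<le> (\<Sum>j<J k. C * mills (u k))"
      unfolding C_def using u k by (intro sum_mono local_supremum_block) auto
    also have "\<dots> = real (J k) * (C * mills (u k))" by simp
    also have "\<dots> \<le> 2 * (L k * u k) * (C * mills (u k))"
      using C mills_pos[OF u[of k]] J by (intro mult_right_mono) auto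
    also have "\<dots> = 2 * C * (exp ((real k * e)\<^sup>2 / 2) * exp (- (u k)\<^sup>2 / 2))"
      using u[of k] by (simp add: L_def mills_def)
    also have "\<dots> \<le> 2 * C * exp (real k * (- (e\<^sup>2)))"
    proof (intro mult_left_mono)
      have "(real k * e)\<^sup>2 / 2 + - (u k)\<^sup>2 / 2 \<le> real k * (- (e\<^sup>2))"
        by (simp add: u_def power2_eq_square field_simps)
      then show "exp ((real k * e)\<^sup>2 / 2) * exp (- (u k)\<^sup>2 / 2) \<le> exp (real k * (- (e\<^sup>2)))"
        unfolding exp_add[symmetric] exp_le_cancel_iff .
    qed (use C in simp)
    finally show ?thesis by (simp only: exp_of_nat_mult)
  qed
  have "filterlim u at_top sequentially" unfolding u_def using e by real_asymp
  then have ev: "eventually (\<lambda>k. u k \<ge> 2 * K \<and> u k \<ge> 1) sequentially"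
    unfolding filterlim_at_top by (simp add: eventually_conj_iff)
  have "summable (\<lambda>k. prob (E k))"
  proof (rule summable_comparison_test_ev)
    show "eventually (\<lambda>k. norm (prob (E k)) \<le> 2 * C * exp (- (e\<^sup>2)) ^ k) sequentially"
      using ev by eventually_elim (use bound in auto)
    show "summable (\<lambda>k. 2 * C * exp (- (e\<^sup>2)) ^ k)"
      using e by (intro summable_mult summable_geometric) auto
  qed
  then have "AE \<omega> in M. eventually (\<lambda>k. \<omega> \<in> space M - E k) sequentially"
    by (intro borel_cantelli_AE1) (auto simp: emeasure_eq_measure)
  then show ?thesis using cont AE_space
  proof eventually_elim
    case (elim \<omega>)
    from elim(1) show ?case
    proof eventually_elim
      case (elim k)
      show ?case
      proof
        fix t assume t: "t \<in> {0..exp ((real k * e)\<^sup>2 / 2)}"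
        define j where "j = nat \<lfloor>t * u k\<rfloor>"
        have tu: "0 \<le> t * u k" using t u[of k] by simp
        have j: "real j \<le> t * u k" "t * u k < real j + 1" unfolding j_def using tu by (simp_all add: floor_correct)
        show "X t \<omega> \<le> real k * e + e"
        proof (cases "t * u k < L k * u k")
          case True
          then have "j < J k" using j(1) unfolding J_def by linarith
          then have nb: "\<omega> \<notin> block_sup (1 / u k) (real j / u k) (u k)" using elim unfolding E_def by auto
          have "X t \<omega> \<le> u k"
            by (rule not_in_block_sup[OF \<open>continuous_on UNIV (\<lambda>t. X t \<omega>)\<close> \<open>\<omega> \<in> space M\<close> nb])
              (use j u[of k] in \<open>auto simp: field_simps\<close>)
          then show ?thesis by (simp add: u_def)
        next
          case False
          \<comment> \<open>The right end of the interval may be the closed end of the last block.\<close>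
          then have "t = L k" using t u[of k] unfolding L_def by (auto simp: not_less)
          define i where "i = J k - 1"
          have LU: "L k * u k > 0" using u[of k] by (simp add: L_def)
          then have J1: "J k \<ge> 1" "real (J k) \<ge> L k * u k" "real (J k) < L k * u k + 1"
            unfolding J_def by (auto simp: ceiling_correct) linarith+
          then have i: "i < J k" "real i = real (J k) - 1" unfolding i_def by auto
          then have nb: "\<omega> \<notin> block_sup (1 / u k) (real i / u k) (u k)" using elim i(1) unfolding E_def by blast
          have "X t \<omega> \<le> u k"
            by (rule not_in_block_sup[OF \<open>continuous_on UNIV (\<lambda>t. X t \<omega>)\<close> \<open>\<omega> \<in> space M\<close> nb])
              (use i J1 u[of k] \<open>t = L k\<close> in \<open>auto simp: field_simps\<close>)
          then show ?thesis by (simp add: u_def)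
        qed
      qed
    qed
  qed
qed

end

section \<open>Lower growth of the running maximum\<close>

lemma half_le_floor: "x \<ge> 1 \<Longrightarrow> x / 2 \<le> real (nat \<lfloor>x\<rfloor>)" for x :: real
proof -
  assume x: "x \<ge> 1"
  then have "1 \<le> \<lfloor>x\<rfloor>" by (simp add: le_floor_iff)
  then have "real (nat \<lfloor>x\<rfloor>) = of_int \<lfloor>x\<rfloor>" "real_of_int \<lfloor>x\<rfloor> \<ge> 1" by auto
  then show ?thesis using floor_correct[of x] by linarith
qed

lemma card_near_le:
  assumes "\<Gamma> \<ge> 0"
  shows "real (card {j\<in>{1..n::nat}. \<bar>real i - real j\<bar> < \<Gamma>}) \<le> 2 * \<Gamma> + 1"
proof -
  define m where "m = nat \<lfloor>\<Gamma>\<rfloor>"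
  have m: "real m \<le> \<Gamma>" "\<Gamma> < real m + 1" unfolding m_def using assms by (simp_all add: floor_correct)
  have "{j\<in>{1..n::nat}. \<bar>real i - real j\<bar> < \<Gamma>} \<subseteq> {i - m..i + m}"
  proof
    fix j assume "j \<in> {j\<in>{1..n::nat}. \<bar>real i - real j\<bar> < \<Gamma>}"
    then have "\<bar>real i - real j\<bar> < real m + 1" using m by simp
    then show "j \<in> {i - m..i + m}" by auto
  qed
  then have "card {j\<in>{1..n::nat}. \<bar>real i - real j\<bar> < \<Gamma>} \<le> card {i - m..i + m}" by (intro card_mono) auto
  also have "\<dots> \<le> 2 * m + 1" by simp
  finally have "real (card {j\<in>{1..n::nat}. \<bar>real i - real j\<bar> < \<Gamma>}) \<le> 2 * real m + 1" by linarith
  then show ?thesis using m by linarith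
qed

text \<open>The Paley-Zygmund inequality, from a pointwise bound of \<open>Z\<close> by a quadratic function on the event.\<close>

lemma (in prob_space) second_moment_lower_bound:
  fixes Z :: "'a \<Rightarrow> real"
  assumes [measurable]: "Z \<in> borel_measurable M" and bd: "\<And>x. 0 \<le> Z x \<and> Z x \<le> b"
    and pos: "expectation Z > 0"
  shows "(expectation Z)\<^sup>2 \<le> 4 * expectation (\<lambda>x. (Z x)\<^sup>2) * \<P>(x in M. Z x > expectation Z / 2)"
proof -
  define s where "s = expectation Z"
  define q where "q = expectation (\<lambda>x. (Z x)\<^sup>2)"
  define p where "p = \<P>(x in M. Z x > s / 2)"
  have iZ: "integrable M Z" using bd by (intro integrable_const_bound[of _ b]) auto
  have iZ2: "integrable M (\<lambda>x. (Z x)\<^sup>2)"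
    using bd by (intro integrable_const_bound[of _ "b\<^sup>2"]) (auto intro: power_mono)
  have s: "s > 0" using pos by (simp add: s_def)
  have var: "s\<^sup>2 \<le> q"
  proof -
    have "0 \<le> expectation (\<lambda>x. (Z x - s)\<^sup>2)" by simp
    also have "\<dots> = expectation (\<lambda>x. (Z x)\<^sup>2 - 2 * s * Z x + s\<^sup>2)"
      by (intro Bochner_Integration.integral_cong) (auto simp: power2_diff)
    also have "\<dots> = q - s\<^sup>2"
      using iZ iZ2 by (simp add: q_def s_def prob_space power2_eq_square)
    finally show ?thesis by simp
  qed
  then have q: "q > 0" using s by (smt (verit) zero_less_power)
  \<comment> \<open>With this slope the quadratic term contributes \<open>s / 4\<close> to the expectation.\<close>
  define l where "l = s / (2 * q)"
  have l: "l > 0" using s q by (simp add: l_def)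
  define J where "J = {x\<in>space M. Z x > s / 2}"
  have [measurable]: "J \<in> sets M" unfolding J_def by measurable
  have iJ: "integrable M (indicat_real J)" by (intro integrable_const_bound[of _ 1]) auto
  have pt: "Z x \<le> s / 2 + (l / 2 * (Z x)\<^sup>2 + 1 / (2 * l) * indicator J x)" if "x \<in> space M" for x
  proof (cases "Z x > s / 2")
    case True
    have "0 \<le> (l * Z x - 1)\<^sup>2 / (2 * l)" using l by simp
    also have "\<dots> = l / 2 * (Z x)\<^sup>2 + 1 / (2 * l) - Z x"
      using l by (simp add: power2_diff field_simps power2_eq_square)
    finally show ?thesis using True that s by (simp add: J_def)
  next
    case False
    moreover have "0 \<le> l / 2 * (Z x)\<^sup>2" using l by simp
    ultimately show ?thesis by (simp add: J_def)
  qed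
  have "s \<le> expectation (\<lambda>x. s / 2 + (l / 2 * (Z x)\<^sup>2 + 1 / (2 * l) * indicator J x))"
    unfolding s_def[symmetric] using iZ iZ2 iJ pt by (subst s_def) (intro integral_mono; auto)
  also have "\<dots> = s / 2 + (l / 2 * q + 1 / (2 * l) * p)"
    unfolding q_def p_def J_def[symmetric] using iZ2 iJ by (simp add: prob_space)
  also have "l / 2 * q = s / 4" using q by (simp add: l_def)
  also have "1 / (2 * l) * p = q * p / s" using q s by (simp add: l_def)
  finally have "s / 4 \<le> q * p / s" by linarith
  then have "s\<^sup>2 \<le> 4 * q * p" using s by (simp add: field_simps power2_eq_square)
  then show ?thesis by (simp add: s_def q_def p_def)
qed

context normal_process begin

text \<open>Let \<open>S\<close> be the random set of indices whose value exceeds \<open>u\<close>. By the second moment method, with probability at least \<open>p\<close> it is about as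
large as expected, while the sum of the correlations within it is at most of order \<open>(card S)\<^sup>2 / u\<^sup>2\<close>. On this event the average of the process
over \<open>S\<close> exceeds \<open>u\<close>, and as a Gaussian variable for this fixed \<open>S\<close> it has variance of order \<open>1 / u\<^sup>2\<close>. Therefore the maximum \<open>F\<close> over all averages of such small
variance exceeds \<open>u\<close> with probability at least \<open>p\<close>, and it concentrates at scale \<open>1 / u\<close>. A maximum of averages never exceeds the
maximum of the process.\<close>

lemma lower_deviation_of_maximum:
  assumes u: "u \<ge> 1" and n: "real n * mills u \<ge> u\<^sup>2" and C1: "C1 \<ge> 0" and G: "\<Gamma> \<ge> 0" and b: "b \<ge> 0" "(2 * \<Gamma> + 1) * b \<le> 3"
    and far: "\<And>p q. \<bar>p - q\<bar> \<ge> \<Gamma> \<Longrightarrow> \<bar>\<rho> (p - q)\<bar> \<le> 1 / u\<^sup>2 \<and> \<P>(\<omega> in M. X p \<omega> > u \<and> X q \<omega> > u) \<le> C1 * (mills u)\<^sup>2"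
    and near: "\<And>p q. \<bar>p - q\<bar> \<ge> 1 \<Longrightarrow> \<P>(\<omega> in M. X p \<omega> > u \<and> X q \<omega> > u) \<le> mills u * b"
    and t: "t > 0"
  shows "\<P>(\<omega> in M. \<forall>i\<in>{1..n}. X (real i) \<omega> \<le> u - t) \<le> 16 * 1296 * 2592\<^sup>2 * (4 + C1) ^ 3 / (u\<^sup>2 * t\<^sup>2)"
proof -
  define \<psi> where "\<psi> = mills u"
  define a where "a = real n * \<psi>"
  define D where "D = 4 + C1"
  have D: "D > 0" using C1 by (simp add: D_def)
  have \<psi>: "\<psi> > 0" using u mills_pos by (simp add: \<psi>_def)
  have u2: "u\<^sup>2 \<ge> 1" using u by (simp add: one_le_power)
  have a: "a \<ge> u\<^sup>2" "a \<ge> 1" using n u2 by (auto simp: a_def \<psi>_def)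
  let ?I = "{1..n}"
  define ind where "ind i \<omega> = (indicator {\<omega>\<in>space M. X (real i) \<omega> > u} \<omega> :: real)" for i :: nat and \<omega>
  have [measurable]: "ind i \<in> borel_measurable M" for i unfolding ind_def by measurable
  have ind01: "0 \<le> ind i \<omega>" "ind i \<omega> \<le> 1" for i \<omega> unfolding ind_def by (auto split: split_indicator)
  define P where "P i j = \<P>(\<omega> in M. X (real i) \<omega> > u \<and> X (real j) \<omega> > u)" for i j :: nat
  have ii: "integrable M (\<lambda>\<omega>. ind i \<omega> * ind j \<omega>)" for i j
    using ind01 by (intro integrable_const_bound[of _ 1]) (auto intro!: mult_le_one)
  have EP: "expectation (\<lambda>\<omega>. ind i \<omega> * ind j \<omega>) = P i j" for i j
  proof -
    have "expectation (\<lambda>\<omega>. ind i \<omega> * ind j \<omega>) = expectation (indicator {\<omega>\<in>space M. X (real i) \<omega> > u \<and> X (real j) \<omega> > u})"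
      by (intro Bochner_Integration.integral_cong) (auto simp: ind_def split: split_indicator)
    then show ?thesis by (simp add: P_def)
  qed
  define d2 where "d2 = C1 * \<psi>\<^sup>2 / u\<^sup>2"
  have Pij0: "P i j \<le> (if j = i then \<psi> else 0) + (if \<bar>real i - real j\<bar> < \<Gamma> then \<psi> * b else 0) + C1 * \<psi>\<^sup>2"
      "\<bar>\<rho> (real i - real j)\<bar> * P i j \<le> (if j = i then \<psi> else 0) + (if \<bar>real i - real j\<bar> < \<Gamma> then \<psi> * b else 0) + d2" for i j
  proof -
    have c0: "0 \<le> C1 * \<psi>\<^sup>2" "0 \<le> d2" "0 \<le> \<psi> * b" using C1 \<psi> b by (auto simp: d2_def)
    have P0: "0 \<le> P i j" unfolding P_def by simp
    have r1: "\<bar>\<rho> (real i - real j)\<bar> * P i j \<le> P i j" using P0 abs_\<rho>_le_1 by (simp add: mult_left_le_one_le)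
    consider "j = i" | "j \<noteq> i" "\<bar>real i - real j\<bar> < \<Gamma>" | "\<bar>real i - real j\<bar> \<ge> \<Gamma>" by linarith
    then have "(P i j \<le> (if j = i then \<psi> else 0) + (if \<bar>real i - real j\<bar> < \<Gamma> then \<psi> * b else 0) + C1 * \<psi>\<^sup>2) \<and>
      (\<bar>\<rho> (real i - real j)\<bar> * P i j \<le> (if j = i then \<psi> else 0) + (if \<bar>real i - real j\<bar> < \<Gamma> then \<psi> * b else 0) + d2)"
    proof cases
      case 1
      then have "P i j \<le> \<psi>" unfolding P_def \<psi>_def using tail_X[of u "real i"] u by simp
      then show ?thesis using 1 c0 r1 by auto
    next
      case 2
      have "\<bar>real i - real j\<bar> \<ge> 1" using 2 by linarith
      then have "P i j \<le> \<psi> * b" unfolding P_def \<psi>_def by (rule near)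
      then show ?thesis using 2 c0 r1 by auto
    next
      case 3
      have f: "\<bar>\<rho> (real i - real j)\<bar> \<le> 1 / u\<^sup>2" "P i j \<le> C1 * \<psi>\<^sup>2" using far[OF 3] by (auto simp: P_def \<psi>_def)
      have "\<bar>\<rho> (real i - real j)\<bar> * P i j \<le> 1 / u\<^sup>2 * (C1 * \<psi>\<^sup>2)" using f P0 by (intro mult_mono) auto
      then show ?thesis using f c0 \<psi> by (auto simp: d2_def)
    qed
    then show "P i j \<le> (if j = i then \<psi> else 0) + (if \<bar>real i - real j\<bar> < \<Gamma> then \<psi> * b else 0) + C1 * \<psi>\<^sup>2"
      "\<bar>\<rho> (real i - real j)\<bar> * P i j \<le> (if j = i then \<psi> else 0) + (if \<bar>real i - real j\<bar> < \<Gamma> then \<psi> * b else 0) + d2"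
      by auto
  qed
  note Pij = Pij0[unfolded d2_def]
  have S: "(\<Sum>j\<in>?I. (if j = i then \<psi> else 0) + (if \<bar>real i - real j\<bar> < \<Gamma> then \<psi> * b else 0) + c) \<le> 4 * \<psi> + real n * c" if "i \<in> ?I" for i c
  proof -
    have "(\<Sum>j\<in>?I. (if \<bar>real i - real j\<bar> < \<Gamma> then \<psi> * b else 0)) = real (card {j\<in>?I. \<bar>real i - real j\<bar> < \<Gamma>}) * (\<psi> * b)"
      by (simp add: sum.If_cases Int_def)
    also have "\<dots> \<le> (2 * \<Gamma> + 1) * (\<psi> * b)" using \<psi> b by (intro mult_right_mono card_near_le G) auto
    also have "\<dots> = ((2 * \<Gamma> + 1) * b) * \<psi>" by simp
    also have "\<dots> \<le> 3 * \<psi>" using b \<psi> by (intro mult_right_mono) auto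
    finally show ?thesis using that by (simp add: sum.distrib)
  qed
  have tot: "(\<Sum>i\<in>?I. 4 * \<psi> + real n * (C1 * \<psi>\<^sup>2 / x)) \<le> D * a\<^sup>2 / x" if "x > 0" "x \<le> a" for x
  proof -
    have "(\<Sum>i\<in>?I. 4 * \<psi> + real n * (C1 * \<psi>\<^sup>2 / x)) = 4 * a + C1 * a\<^sup>2 / x"
      by (simp add: a_def power2_eq_square algebra_simps)
    moreover have "a \<le> a\<^sup>2 / x" using that by (simp add: field_simps power2_eq_square)
    ultimately show ?thesis by (simp add: D_def field_simps add_divide_distrib)
  qed
  \<comment> \<open>The number of exceedances, and the sum of correlations over pairs of exceedances.\<close>
  define N where "N \<omega> = (\<Sum>i\<in>?I. ind i \<omega>)" for \<omega>
  define T where "T \<omega> = (\<Sum>i\<in>?I. \<Sum>j\<in>?I. \<bar>\<rho> (real i - real j)\<bar> * (ind i \<omega> * ind j \<omega>))" for \<omega>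
  have [measurable]: "N \<in> borel_measurable M" "T \<in> borel_measurable M" unfolding N_def T_def by measurable
  have N01: "0 \<le> N \<omega> \<and> N \<omega> \<le> real n" for \<omega>
  proof -
    have "N \<omega> \<le> (\<Sum>i\<in>?I. 1)" unfolding N_def using ind01 by (intro sum_mono)
    then show ?thesis using ind01 by (auto simp: N_def sum_nonneg)
  qed
  have EN2: "expectation (\<lambda>\<omega>. (N \<omega>)\<^sup>2) \<le> D * a\<^sup>2"
  proof -
    have "expectation (\<lambda>\<omega>. (N \<omega>)\<^sup>2) = expectation (\<lambda>\<omega>. \<Sum>i\<in>?I. \<Sum>j\<in>?I. ind i \<omega> * ind j \<omega>)"
      unfolding N_def power2_eq_square sum_product ..
    also have "\<dots> = (\<Sum>i\<in>?I. \<Sum>j\<in>?I. P i j)"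
      using ii by (simp add: Bochner_Integration.integral_sum EP)
    also have "\<dots> \<le> (\<Sum>i\<in>?I. 4 * \<psi> + real n * (C1 * \<psi>\<^sup>2))"
      by (intro sum_mono order_trans[OF sum_mono[OF Pij(1)] S])
    also have "\<dots> \<le> D * a\<^sup>2" using tot[of 1] a by simp
    finally show ?thesis .
  qed
  have ET: "expectation T \<le> D * a\<^sup>2 / u\<^sup>2"
  proof -
    have "expectation T = (\<Sum>i\<in>?I. \<Sum>j\<in>?I. \<bar>\<rho> (real i - real j)\<bar> * P i j)"
      unfolding T_def using ii by (simp add: Bochner_Integration.integral_sum EP)
    also have "\<dots> \<le> (\<Sum>i\<in>?I. 4 * \<psi> + real n * (C1 * \<psi>\<^sup>2 / u\<^sup>2))"
      by (intro sum_mono order_trans[OF sum_mono[OF Pij(2)] S])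
    also have "\<dots> \<le> D * a\<^sup>2 / u\<^sup>2" by (rule tot) (use a u2 in linarith)+
    finally show ?thesis .
  qed
  have EN: "expectation N \<ge> a / 18"
  proof -
    have "expectation N = (\<Sum>i\<in>?I. expectation (ind i))"
      unfolding N_def using ii[of i i for i] ind01
      by (intro Bochner_Integration.integral_sum integrable_const_bound[of _ 1]) auto
    also have "\<dots> \<ge> (\<Sum>i\<in>?I. \<psi> / 18)"
    proof (intro sum_mono)
      fix i
      have "expectation (ind i) = \<P>(\<omega> in M. X (real i) \<omega> > u)" unfolding ind_def by simp
      then show "\<psi> / 18 \<le> expectation (ind i)"
        using tail_lower[OF X_mem, of "real i" u] u by (simp add: cov_X \<rho>_0 \<psi>_def)
    qed
    finally show ?thesis by (simp add: a_def)
  qed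
  define p where "p = 1 / (2592 * D)"
  have p: "p > 0" using D by (simp add: p_def)
  have PN: "\<P>(\<omega> in M. N \<omega> > a / 36) \<ge> 2 * p"
  proof -
    have "(a / 18)\<^sup>2 \<le> (expectation N)\<^sup>2" using EN a by (intro power_mono) auto
    also have "\<dots> \<le> 4 * expectation (\<lambda>\<omega>. (N \<omega>)\<^sup>2) * \<P>(\<omega> in M. N \<omega> > expectation N / 2)"
      using EN a N01 by (intro second_moment_lower_bound) auto
    also have "\<dots> \<le> 4 * (D * a\<^sup>2) * \<P>(\<omega> in M. N \<omega> > a / 36)"
      using EN EN2 D by (intro mult_mono finite_measure_mono) auto
    finally have "a\<^sup>2 / 324 \<le> a\<^sup>2 * (4 * D * \<P>(\<omega> in M. N \<omega> > a / 36))" by (simp add: power_divide mult_ac)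
    then have "1 / 324 \<le> 4 * D * \<P>(\<omega> in M. N \<omega> > a / 36)" using a by (simp add: field_simps)
    then show ?thesis using D by (simp add: p_def field_simps)
  qed
  define A where "A = D * a\<^sup>2 / (u\<^sup>2 * p)"
  have A: "A > 0" using D a u p unfolding A_def by (intro divide_pos_pos mult_pos_pos zero_less_power) auto
  have PT: "\<P>(\<omega> in M. T \<omega> > A) \<le> p"
  proof -
    have T0: "0 \<le> T \<omega>" for \<omega> unfolding T_def using ind01 by (intro sum_nonneg mult_nonneg_nonneg) auto
    have iT: "integrable M T" unfolding T_def using ii by (intro Bochner_Integration.integrable_sum) auto
    have "\<P>(\<omega> in M. T \<omega> > A) \<le> \<P>(\<omega> in M. T \<omega> \<ge> A)" by (intro finite_measure_mono) auto
    also have "\<dots> \<le> expectation T / A"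
      using integral_Markov_inequality_measure[OF iT, of "{}" A] T0 A by simp
    also have "\<dots> \<le> (D * a\<^sup>2 / u\<^sup>2) / A" using ET A by (intro divide_right_mono) auto
    also have "\<dots> = p" using D a u p by (simp add: A_def)
    finally show ?thesis .
  qed
  define r where "r = sqrt (1296 * 2592 * D\<^sup>2 * 1 / u\<^sup>2)"
  have r2: "r\<^sup>2 = 1296 * 2592 * D\<^sup>2 / u\<^sup>2" unfolding r_def by simp
  have rA: "r\<^sup>2 * (a / 36)\<^sup>2 = A"
    unfolding r2 A_def p_def using D u2 by (simp add: power_divide power2_eq_square field_simps)
  define sumcov where "sumcov S = (\<Sum>i\<in>S. \<Sum>j\<in>S. \<rho> (real i - real j))" for S :: "nat set"
  \<comment> \<open>The admissible sets do not depend on \<open>\<omega>\<close>; \<open>V\<close> indexes the Gaussian family of averages.\<close>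
  define V where "V = {S. S \<subseteq> ?I \<and> S \<noteq> {} \<and> sumcov S \<le> r\<^sup>2 * (real (card S))\<^sup>2}"
  have finV: "finite V" unfolding V_def by simp
  define Yset where "Yset S \<omega> = (\<Sum>i\<in>S. (1 / real (card S)) * X (real i) \<omega>)" for S \<omega>
  have Y_mem: "Yset S \<in> finite_combinations X" for S
    unfolding Yset_def by (intro sum_mem X_mem)
  have covY: "cov (Yset S) (Yset S) \<le> r\<^sup>2" if S: "S \<in> V" for S
  proof -
    have fS: "finite S" "card S > 0" using S by (auto simp: V_def card_gt_0_iff intro: finite_subset)
    have "cov (Yset S) (Yset S) = (\<Sum>i\<in>S. 1 / real (card S) * cov (X (real i)) (Yset S))"
      unfolding Yset_def[of S, abs_def] by (intro cov_sum_left X_mem sum_mem)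
    also have "\<dots> = (\<Sum>i\<in>S. 1 / real (card S) * (\<Sum>j\<in>S. 1 / real (card S) * \<rho> (real j - real i)))"
      unfolding Yset_def[of S, abs_def] by (subst cov_sum_right) (auto simp: X_mem cov_X)
    also have "\<dots> = (\<Sum>i\<in>S. \<Sum>j\<in>S. \<rho> (real j - real i)) / (real (card S))\<^sup>2"
      by (simp add: sum_distrib_left sum_divide_distrib power2_eq_square divide_simps)
    also have "(\<Sum>i\<in>S. \<Sum>j\<in>S. \<rho> (real j - real i)) = sumcov S"
      unfolding sumcov_def by (rule sum.swap)
    also have "sumcov S / (real (card S))\<^sup>2 \<le> r\<^sup>2" using S fS by (simp add: V_def pos_divide_le_eq)
    finally show ?thesis .
  qed
  define Good where "Good = {\<omega>\<in>space M. N \<omega> > a / 36} - {\<omega>\<in>space M. T \<omega> > A}"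
  have [measurable]: "Good \<in> sets M" unfolding Good_def by measurable
  have PGood: "prob Good \<ge> p"
  proof -
    have "2 * p \<le> prob {\<omega>\<in>space M. N \<omega> > a / 36}" by (rule PN)
    also have "\<dots> \<le> prob (Good \<union> {\<omega>\<in>space M. T \<omega> > A})" unfolding Good_def by (intro finite_measure_mono) auto
    also have "\<dots> \<le> prob Good + prob {\<omega>\<in>space M. T \<omega> > A}" by (rule measure_Un_le) auto
    finally show ?thesis using PT by simp
  qed
  \<comment> \<open>The exceedance set of \<open>\<omega>\<close> is admissible.\<close>
  have good: "\<exists>S\<in>V. Yset S \<omega> > u" if \<omega>: "\<omega> \<in> Good" for \<omega>
  proof -
    define S where "S = {i\<in>?I. X (real i) \<omega> > u}"
    have fS: "finite S" unfolding S_def by simp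
    have sp: "\<omega> \<in> space M" "N \<omega> > a / 36" "T \<omega> \<le> A" using \<omega> unfolding Good_def by auto
    have ind: "ind i \<omega> = (if X (real i) \<omega> > u then 1 else 0)" for i using sp by (simp add: ind_def)
    have cS: "real (card S) = N \<omega>" unfolding N_def ind S_def by (simp add: sum.If_cases Int_def)
    have "card S > 0" using cS sp a by (metis divide_pos_pos less_trans of_nat_0_less_iff zero_less_numeral zero_less_one less_le_trans)
    then have ne: "S \<noteq> {}" by auto
    have "sumcov S \<le> (\<Sum>i\<in>S. \<Sum>j\<in>S. \<bar>\<rho> (real i - real j)\<bar>)" unfolding sumcov_def by (intro sum_mono) auto
    also have "\<dots> = (\<Sum>i\<in>S. \<Sum>j\<in>S. \<bar>\<rho> (real i - real j)\<bar> * (ind i \<omega> * ind j \<omega>))"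
      by (intro sum.cong refl) (auto simp: S_def ind)
    also have "\<dots> = T \<omega>"
    proof -
      have "(\<Sum>j\<in>S. \<bar>\<rho> (real i - real j)\<bar> * (ind i \<omega> * ind j \<omega>)) = (\<Sum>j\<in>?I. \<bar>\<rho> (real i - real j)\<bar> * (ind i \<omega> * ind j \<omega>))" for i
        by (rule sum.mono_neutral_left) (auto simp: S_def ind)
      then show ?thesis unfolding T_def
        by (simp, intro sum.mono_neutral_left) (auto simp: S_def ind)
    qed
    also have "\<dots> \<le> r\<^sup>2 * (a / 36)\<^sup>2" using sp rA by simp
    also have "\<dots> \<le> r\<^sup>2 * (real (card S))\<^sup>2" using sp a unfolding cS by (intro mult_left_mono power_mono) auto
    finally have "S \<in> V" using ne unfolding V_def S_def by auto
    moreover have "Yset S \<omega> > u"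
    proof -
      have "(\<Sum>i\<in>S. (1 / real (card S)) * u) < Yset S \<omega>"
        unfolding Yset_def using fS ne \<open>card S > 0\<close>
        by (intro sum_strict_mono mult_strict_left_mono) (auto simp: S_def)
      then show ?thesis using \<open>card S > 0\<close> by simp
    qed
    ultimately show ?thesis by blast
  qed
  have "V \<noteq> {}"
  proof
    assume "V = {}"
    then have "Good = {}" using good by auto
    then show False using PGood p by simp
  qed
  then have cV: "card V > 0" using finV by (simp add: card_gt_0_iff)
  obtain f where f: "bij_betw f {0..<card V} V" using ex_bij_betw_nat_finite[OF finV] by blast
  have fV: "f v \<in> V" if "v < card V" for v using f that by (auto simp: bij_betw_def)
  define F where "F \<omega> = Max ((\<lambda>v. Yset (f v) \<omega>) ` {..<card V})" for \<omega>
  have [measurable]: "Yset S \<in> borel_measurable M" for S by (rule meas[OF Y_mem])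
  have [measurable]: "F \<in> borel_measurable M" unfolding F_def by measurable
  have conc: "\<P>(\<omega> in M. F \<omega> \<le> u - t) * \<P>(\<omega> in M. F \<omega> > u) \<le> 16 * r\<^sup>2 / t\<^sup>2"
    unfolding F_def using cV fV covY Y_mem t by (intro concentration_of_maximum) auto
  have "p \<le> \<P>(\<omega> in M. F \<omega> > u)"
  proof -
    have "Good \<subseteq> {\<omega>\<in>space M. F \<omega> > u}"
    proof
      fix \<omega> assume \<omega>: "\<omega> \<in> Good"
      then obtain S where S: "S \<in> V" "Yset S \<omega> > u" using good by blast
      have "S \<in> f ` {0..<card V}" using S f by (simp add: bij_betw_def)
      then obtain v where v: "v < card V" "f v = S" by auto
      then have "Yset S \<omega> \<le> F \<omega>" unfolding F_def by (intro Max_ge) auto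
      then show "\<omega> \<in> {\<omega>\<in>space M. F \<omega> > u}" using S \<omega> by (auto simp: Good_def)
    qed
    then show ?thesis using PGood by (intro order_trans[OF PGood finite_measure_mono]) auto
  qed
  then have Fp: "\<P>(\<omega> in M. F \<omega> \<le> u - t) * p \<le> 16 * r\<^sup>2 / t\<^sup>2"
    by (rule order_trans[OF mult_left_mono conc]) simp
  have XF: "\<P>(\<omega> in M. \<forall>i\<in>?I. X (real i) \<omega> \<le> u - t) \<le> \<P>(\<omega> in M. F \<omega> \<le> u - t)"
  proof (rule finite_measure_mono)
    show "{\<omega>\<in>space M. \<forall>i\<in>?I. X (real i) \<omega> \<le> u - t} \<subseteq> {\<omega>\<in>space M. F \<omega> \<le> u - t}"
    proof
      fix \<omega> assume \<omega>: "\<omega> \<in> {\<omega>\<in>space M. \<forall>i\<in>?I. X (real i) \<omega> \<le> u - t}"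
      have "Yset S \<omega> \<le> u - t" if S: "S \<in> V" for S
      proof -
        have fS: "finite S" "card S > 0" "S \<subseteq> ?I" using S by (auto simp: V_def card_gt_0_iff intro: finite_subset)
        have "Yset S \<omega> \<le> (\<Sum>i\<in>S. (1 / real (card S)) * (u - t))"
          unfolding Yset_def using fS \<omega> by (intro sum_mono mult_left_mono) auto
        moreover have "(\<Sum>i\<in>S. (1 / real (card S)) * (u - t)) = real (card S) * ((1 / real (card S)) * (u - t))" by simp
        moreover have "\<dots> = u - t" using fS(2) by simp
        ultimately show ?thesis by linarith
      qed
      then show "\<omega> \<in> {\<omega>\<in>space M. F \<omega> \<le> u - t}"
        using \<omega> cV fV unfolding F_def by (auto intro!: Max.boundedI)
    qed
  qed auto
  have "\<P>(\<omega> in M. \<forall>i\<in>?I. X (real i) \<omega> \<le> u - t) * p \<le> \<P>(\<omega> in M. F \<omega> \<le> u - t) * p"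
    using XF p by (intro mult_right_mono) auto
  then have "\<P>(\<omega> in M. \<forall>i\<in>?I. X (real i) \<omega> \<le> u - t) * p \<le> 16 * r\<^sup>2 / t\<^sup>2"
    using Fp by linarith
  then have "\<P>(\<omega> in M. \<forall>i\<in>?I. X (real i) \<omega> \<le> u - t) \<le> 16 * r\<^sup>2 / t\<^sup>2 / p"
    by (rule pos_le_divide_eq[OF p, THEN iffD2])
  also have "16 * r\<^sup>2 / t\<^sup>2 / p = 16 * 1296 * 2592\<^sup>2 * (4 + C1) ^ 3 / (u\<^sup>2 * t\<^sup>2)"
    using D t u2 unfolding r2 p_def D_def[symmetric] by (simp add: power2_eq_square power3_eq_cube)
  finally show ?thesis .
qed

text \<open>At the level \<open>u = k * e - e / 2\<close> there are enough integers in the interval for \<open>u\<^sup>2\<close> exceedances to be expected. A deviation by \<open>e / 2\<close> below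
\<open>u\<close> has probability of order \<open>1 / k\<^sup>2\<close>, which is summable.\<close>

lemma growth_lower:
  assumes e: "e > 0"
  shows "AE \<omega> in M. eventually (\<lambda>k. \<exists>t\<in>{0..exp ((real k * e)\<^sup>2 / 2)}. X t \<omega> \<ge> real k * e - e) sequentially"
proof -
  obtain T where T: "T > 0" "\<And>s. s > 0 \<Longrightarrow> s / (T + s) \<le> v s" using v_lower by auto
  define c where "c = (1 / 8) * (1 / (T + 1))\<^sup>2"
  have c: "c > 0" using T by (simp add: c_def)
  define C1 where "C1 = 4 * exp 4 + (1::real)"
  have C1: "C1 > 0" unfolding C1_def by (simp add: add_pos_pos)
  define n where "n u = nat \<lfloor>exp ((u + e / 2)\<^sup>2 / 2)\<rfloor>" for u
  define C where "C = 16 * 1296 * 2592\<^sup>2 * (4 + C1) ^ 3 / (e / 2)\<^sup>2"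
  have near: "\<P>(\<omega> in M. X p \<omega> > u \<and> X q \<omega> > u) \<le> mills u * exp (- c * u\<^sup>2)" if "\<bar>p - q\<bar> \<ge> 1" "u > 0" for p q u
  proof -
    have "\<P>(\<omega> in M. X p \<omega> > u \<and> X q \<omega> > u) \<le> mills u * exp (- (u\<^sup>2 / 8) * (\<bar>p - q\<bar> / (T + \<bar>p - q\<bar>))\<^sup>2)"
      using T that by (intro two_point_tail) auto
    also have "\<dots> \<le> mills u * exp (- c * u\<^sup>2)"
    proof (intro mult_left_mono)
      have "1 / (T + 1) \<le> \<bar>p - q\<bar> / (T + \<bar>p - q\<bar>)" using T that by (simp add: field_simps)
      then have "(1 / (T + 1))\<^sup>2 \<le> (\<bar>p - q\<bar> / (T + \<bar>p - q\<bar>))\<^sup>2" using T by (intro power_mono) auto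
      moreover have "- (u\<^sup>2 / 8) * z \<le> - (1 / 8 * y) * u\<^sup>2" if "y \<le> z" for y z :: real
        using mult_left_mono[OF that, of "u\<^sup>2"] by (simp add: mult.commute)
      ultimately show "exp (- (u\<^sup>2 / 8) * (\<bar>p - q\<bar> / (T + \<bar>p - q\<bar>))\<^sup>2) \<le> exp (- c * u\<^sup>2)"
        unfolding exp_le_cancel_iff c_def by blast
    qed (use mills_pos[OF that(2)] in simp)
    finally show ?thesis .
  qed
  have ev1: "eventually (\<lambda>u. real (n u) * mills u \<ge> u\<^sup>2) at_top"
  proof -
    have "eventually (\<lambda>u. exp ((u + e / 2)\<^sup>2 / 2) / 2 * (exp (- u\<^sup>2 / 2) / u) \<ge> u\<^sup>2) at_top"
      using e by real_asymp
    then show ?thesis using eventually_gt_at_top[of 0]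
    proof eventually_elim
      case (elim u)
      have "exp ((u + e / 2)\<^sup>2 / 2) \<ge> 1" by simp
      then have "exp ((u + e / 2)\<^sup>2 / 2) / 2 \<le> real (n u)" unfolding n_def by (rule half_le_floor)
      then have "exp ((u + e / 2)\<^sup>2 / 2) / 2 * mills u \<le> real (n u) * mills u"
        using mills_pos[OF elim(2)] by (intro mult_right_mono) auto
      then show ?case using elim(1) unfolding mills_def by linarith
    qed
  qed
  have ev2: "eventually (\<lambda>u. (2 * exp (c * u\<^sup>2) + 1) * exp (- c * u\<^sup>2) \<le> 3) at_top"
    by (intro always_eventually) (use c in \<open>auto simp: distrib_right mult.assoc exp_add[symmetric]\<close>)
  have ev: "eventually (\<lambda>u. \<P>(\<omega> in M. \<forall>i\<in>{1..n u}. X (real i) \<omega> \<le> u - e / 2) \<le> C / u\<^sup>2) at_top"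
    using ev1 ev2 far_pair[OF c] eventually_ge_at_top[of 1]
  proof eventually_elim
    case (elim u)
    have "\<P>(\<omega> in M. \<forall>i\<in>{1..n u}. X (real i) \<omega> \<le> u - e / 2) \<le> 16 * 1296 * 2592\<^sup>2 * (4 + C1) ^ 3 / (u\<^sup>2 * (e / 2)\<^sup>2)"
      using elim C1 near e
      by (intro lower_deviation_of_maximum[where \<Gamma>="exp (c * u\<^sup>2)" and b="exp (- c * u\<^sup>2)"]) (auto simp: C1_def)
    then show ?case by (simp add: C_def mult.commute)
  qed
  define E where "E k = {\<omega>\<in>space M. \<forall>i\<in>{1..n (real k * e - e / 2)}. X (real i) \<omega> \<le> real k * e - e}" for k :: nat
  have [measurable]: "E k \<in> sets M" for k unfolding E_def by measurable
  have "filterlim (\<lambda>k. real k * e - e / 2) at_top sequentially" using e by real_asymp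
  from eventually_compose_filterlim[OF ev this]
  have evk: "eventually (\<lambda>k. prob (E k) \<le> C / (real k * e - e / 2)\<^sup>2) sequentially"
    by eventually_elim (simp add: E_def)
  have "summable (\<lambda>k. prob (E k))"
  proof (rule summable_comparison_test_ev)
    show "eventually (\<lambda>k. norm (prob (E k)) \<le> 4 * C / e\<^sup>2 * inverse ((real k)\<^sup>2)) sequentially"
      using evk eventually_ge_at_top[of 1]
    proof eventually_elim
      case (elim k)
      have "C \<ge> 0" unfolding C_def using C1 by simp
      have k: "real k \<ge> 1" using elim by simp
      have ke: "e / 2 * real k > 0" using e k by simp
      have "real k * e - e / 2 \<ge> e / 2 * real k" using k e by (simp add: field_simps)
      then have le: "(e / 2 * real k)\<^sup>2 \<le> (real k * e - e / 2)\<^sup>2" using ke by (intro power_mono) auto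
      have q: "0 < (e / 2 * real k)\<^sup>2" using ke by (rule zero_less_power)
      have "C / (real k * e - e / 2)\<^sup>2 \<le> C / (e / 2 * real k)\<^sup>2"
        by (rule divide_left_mono[OF le \<open>C \<ge> 0\<close> mult_pos_pos[OF less_le_trans[OF q le] q]])
      also have "\<dots> = 4 * C / e\<^sup>2 * inverse ((real k)\<^sup>2)" by (simp add: power_mult_distrib power_divide divide_simps)
      finally show ?case using elim by simp
    qed
    show "summable (\<lambda>k. 4 * C / e\<^sup>2 * inverse ((real k)\<^sup>2))"
      by (intro summable_mult inverse_power_summable) auto
  qed
  then have "AE \<omega> in M. eventually (\<lambda>k. \<omega> \<in> space M - E k) sequentially"
    by (intro borel_cantelli_AE1) (auto simp: emeasure_eq_measure)
  then show ?thesis using AE_space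
  proof eventually_elim
    case (elim \<omega>)
    from elim(1) show ?case
    proof eventually_elim
      case (elim k)
      then obtain i where i: "i \<in> {1..n (real k * e - e / 2)}" "X (real i) \<omega> > real k * e - e"
        using \<open>\<omega> \<in> space M\<close> unfolding E_def by (auto simp: not_le)
      have "real i \<le> real (n (real k * e - e / 2))" using i by simp
      also have "\<dots> \<le> exp ((real k * e)\<^sup>2 / 2)" unfolding n_def by (simp add: floor_correct)
      finally show ?case using i by (intro bexI[of _ "real i"]) auto
    qed
  qed
qed

end

section \<open>Joint probabilities of distant high and low points\<close>

lemma shifted_level_at_top: "filterlim (\<lambda>u::real. u - a / u) at_top at_top"
  by real_asymp

context normal_process begin

text \<open>Correlation \<open>1 / u\<^sup>2\<close> is what the decoupling inequality tolerates at level \<open>u\<close>: the level drops by \<open>4 / u\<close> only.\<close>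

definition far_from :: "real \<Rightarrow> real \<Rightarrow> real \<Rightarrow> bool" where
  "far_from u p q \<longleftrightarrow> \<bar>\<rho> (p - q)\<bar> \<le> 1 / u\<^sup>2"

text \<open>High points of \<open>X\<close> and of \<open>- X\<close> in one family, so that decoupling treats high and low points together.\<close>

definition signed :: "bool \<times> real \<Rightarrow> 'a \<Rightarrow> real" where
  "signed s \<omega> = (if fst s then - X (snd s) \<omega> else X (snd s) \<omega>)"

lemma signed_mem: "signed s \<in> finite_combinations X"
  unfolding signed_def by (cases "fst s") (auto intro: X_mem minus_mem)

lemma cov_signed: "\<bar>cov (X p) (signed s)\<bar> = \<bar>\<rho> (p - snd s)\<bar>"
  unfolding signed_def using \<rho>_minus[of "p - snd s"] by (cases "fst s") (auto simp: cov_minus_right cov_X)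

lemma both_exceed_antimono:
  assumes "w \<le> w'" shows "both_exceed G S S' w' \<subseteq> both_exceed G S S' w"
proof
  fix x assume "x \<in> both_exceed G S S' w'"
  then obtain s s' where "x \<in> space M" "s \<in> S" "G s x > w'" "s' \<in> S'" "G s' x > w'"
    unfolding both_exceed_def by blast
  moreover from this have "G s x > w" "G s' x > w" using assms by auto
  ultimately show "x \<in> both_exceed G S S' w"
    unfolding both_exceed_def by blast
qed

lemma decouple_signed:
  assumes u: "u > 0" and y: "y \<ge> 1" "y \<le> u" and S: "finite S" "finite S'" and far: "\<And>s. s \<in> S \<union> S' \<Longrightarrow> far_from u b (snd s)"
  shows "\<P>(\<omega> in M. X b \<omega> > y \<and> \<omega> \<in> both_exceed signed S S' y)
    \<le> 2 * mills y * prob (both_exceed signed S S' (y - 4 / u)) + mills (2 * y)"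
proof -
  have "\<P>(\<omega> in M. X b \<omega> > y \<and> \<omega> \<in> both_exceed signed S S' y)
    \<le> 2 * \<P>(\<omega> in M. X b \<omega> > y) * prob (both_exceed signed S S' (y - 4 * y * (1 / u\<^sup>2))) + \<P>(\<omega> in M. X b \<omega> > 2 * y)"
    using y far by (intro decouple X_mem signed_mem S) (auto simp: cov_X \<rho>_0 cov_signed far_from_def)
  also have "\<dots> \<le> 2 * mills y * prob (both_exceed signed S S' (y - 4 / u)) + mills (2 * y)"
  proof (intro add_mono mult_mono tail_X mult_nonneg_nonneg)
    have "4 * y * (1 / u\<^sup>2) \<le> 4 * u * (1 / u\<^sup>2)" using y by (intro mult_right_mono) auto
    also have "\<dots> = 4 / u" using u by (simp add: power2_eq_square)
    finally have "y - 4 / u \<le> y - 4 * y * (1 / u\<^sup>2)" by simp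
    then show "prob (both_exceed signed S S' (y - 4 * y * (1 / u\<^sup>2))) \<le> prob (both_exceed signed S S' (y - 4 / u))"
      by (intro finite_measure_mono both_exceed_antimono both_exceed_measurable signed_mem S)
  qed (use y mills_pos[of y] in auto)
  finally show ?thesis .
qed

lemma eventually_far:
  assumes "\<kappa> > 0"
  shows "eventually (\<lambda>u. \<forall>p q. \<bar>p - q\<bar> \<ge> exp (\<kappa> * u\<^sup>2) \<longrightarrow> far_from u p q) at_top"
  using far_pair[OF assms] by eventually_elim (auto simp: far_from_def)

text \<open>The elementary inequalities between the levels \<open>u\<close>, \<open>u - 4 / u\<close> and \<open>u - 8 / u\<close> that the successive decouplings need.\<close>

lemma eventually_levels:
  "eventually (\<lambda>u. u \<ge> 4 \<and> u \<ge> 4 * K \<and> u - 8 / u \<ge> u / 2 \<and> u - 8 / u \<ge> 2 \<and> (u - 4 / u)\<^sup>2 \<ge> u\<^sup>2 / 2 \<and> mills (2 * u) \<le> (mills u) ^ 3 \<and>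
      mills (2 * (u - 4 / u)) \<le> (mills (u - 4 / u)) ^ 3 \<and> mills u \<le> 1 \<and> 0 < mills u \<and>
      mills (u - 4 / u) \<le> 2 * exp 4 * mills u \<and> mills (u - 8 / u) \<le> 2 * exp 8 * mills u) at_top"
proof -
  have 1: "eventually (\<lambda>u::real. u - 8 / u \<ge> u / 2) at_top" by real_asymp
  have 2: "eventually (\<lambda>u::real. u - 8 / u \<ge> 2) at_top" by real_asymp
  have 3: "eventually (\<lambda>u::real. (u - 4 / u)\<^sup>2 \<ge> u\<^sup>2 / 2) at_top" by real_asymp
  have 4: "eventually (\<lambda>u. mills (2 * (u - 4 / u)) \<le> (mills (u - 4 / u)) ^ 3) at_top"
    by (rule eventually_compose_filterlim[OF eventually_mills_double shifted_level_at_top])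
  show ?thesis
    using 1 2 3 4 eventually_ge_at_top[of 4] eventually_ge_at_top[of "4 * K"] eventually_mills_double eventually_mills_le_1
  proof eventually_elim
    case (elim u)
    have "u\<^sup>2 \<ge> 4\<^sup>2" using elim by (intro power_mono) auto
    then show ?case using elim mills_shift_down[of 4 u] mills_shift_down[of 8 u] mills_pos[of u] by auto
  qed
qed

lemma three_exceed:
  "eventually (\<lambda>u. \<forall>a a' b. far_from u b a \<and> far_from u b a' \<longrightarrow>
    \<P>(\<omega> in M. X b \<omega> > u \<and> X a \<omega> > u \<and> X a' \<omega> > u) \<le>
      2 * mills u * \<P>(\<omega> in M. X a \<omega> > u - 4 / u \<and> X a' \<omega> > u - 4 / u) + (mills u) ^ 3) at_top"
  using eventually_levels
proof eventually_elim
  case (elim u)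
  show ?case
  proof (intro allI impI)
    fix a a' b assume far: "far_from u b a \<and> far_from u b a'"
    have be: "both_exceed signed {(False, a)} {(False, a')} w = {\<omega>\<in>space M. X a \<omega> > w \<and> X a' \<omega> > w}" for w
      unfolding both_exceed_def signed_def by auto
    have "\<P>(\<omega> in M. X b \<omega> > u \<and> X a \<omega> > u \<and> X a' \<omega> > u) = \<P>(\<omega> in M. X b \<omega> > u \<and> \<omega> \<in> both_exceed signed {(False, a)} {(False, a')} u)"
      unfolding be by (intro arg_cong[where f=prob]) auto
    also have "\<dots> \<le> 2 * mills u * prob (both_exceed signed {(False, a)} {(False, a')} (u - 4 / u)) + mills (2 * u)"
      using elim far by (intro decouple_signed) auto
    finally show "\<P>(\<omega> in M. X b \<omega> > u \<and> X a \<omega> > u \<and> X a' \<omega> > u) \<le>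
      2 * mills u * \<P>(\<omega> in M. X a \<omega> > u - 4 / u \<and> X a' \<omega> > u - 4 / u) + (mills u) ^ 3"
      unfolding be using elim by linarith
  qed
qed

lemma two_exceed_shifted:
  assumes T: "T > 0" "\<And>s. s > 0 \<Longrightarrow> s / (T + s) \<le> v s"
  shows "eventually (\<lambda>u. \<forall>a a'. \<P>(\<omega> in M. X a \<omega> > u - 4 / u \<and> X a' \<omega> > u - 4 / u)
    \<le> 2 * exp 4 * mills u * exp (- (u\<^sup>2 / 16) * (\<bar>a - a'\<bar> / (T + \<bar>a - a'\<bar>))\<^sup>2)) at_top"
  using eventually_levels
proof eventually_elim
  case (elim u)
  show ?case
  proof (intro allI)
    fix a a'
    let ?z = "(\<bar>a - a'\<bar> / (T + \<bar>a - a'\<bar>))\<^sup>2"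
    have w: "u - 4 / u > 0" using elim by (smt (verit) divide_right_mono)
    have "\<P>(\<omega> in M. X a \<omega> > u - 4 / u \<and> X a' \<omega> > u - 4 / u) \<le> mills (u - 4 / u) * exp (- ((u - 4 / u)\<^sup>2 / 8) * ?z)"
      by (rule two_point_tail[OF T w])
    also have "\<dots> \<le> (2 * exp 4 * mills u) * exp (- (u\<^sup>2 / 16) * ?z)"
    proof (intro mult_mono)
      have "u\<^sup>2 / 16 * ?z \<le> (u - 4 / u)\<^sup>2 / 8 * ?z" using elim by (intro mult_right_mono) auto
      then show "exp (- ((u - 4 / u)\<^sup>2 / 8) * ?z) \<le> exp (- (u\<^sup>2 / 16) * ?z)" by simp
    qed (use elim in auto)
    finally show "\<P>(\<omega> in M. X a \<omega> > u - 4 / u \<and> X a' \<omega> > u - 4 / u)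
      \<le> 2 * exp 4 * mills u * exp (- (u\<^sup>2 / 16) * ?z)" .
  qed
qed

lemma two_exceed_shifted_far:
  assumes \<kappa>: "\<kappa> > 0"
  shows "eventually (\<lambda>u. \<forall>a a'. \<bar>a - a'\<bar> \<ge> exp (\<kappa> * u\<^sup>2) \<longrightarrow> \<P>(\<omega> in M. X a \<omega> > u - 4 / u \<and> X a' \<omega> > u - 4 / u)
    \<le> (4 * exp 4 + 1) * (2 * exp 4 * mills u)\<^sup>2) at_top"
  using eventually_levels eventually_compose_filterlim[OF far_pair[OF \<kappa>] shifted_level_at_top[of 4]]
proof eventually_elim
  case (elim u)
  have w: "u - 4 / u > 0" "u - 4 / u \<le> u" using elim by (smt (verit) divide_right_mono divide_nonneg_pos)+
  show ?case
  proof (intro allI impI)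
    fix a a' assume far: "\<bar>a - a'\<bar> \<ge> exp (\<kappa> * u\<^sup>2)"
    have "(u - 4 / u)\<^sup>2 \<le> u\<^sup>2" using w by (intro power_mono) auto
    then have "exp (\<kappa> * (u - 4 / u)\<^sup>2) \<le> exp (\<kappa> * u\<^sup>2)" using \<kappa> by simp
    then have "\<P>(\<omega> in M. X a \<omega> > u - 4 / u \<and> X a' \<omega> > u - 4 / u) \<le> (4 * exp 4 + 1) * (mills (u - 4 / u))\<^sup>2"
      using elim(2)[rule_format, OF order_trans[OF _ far]] by blast
    also have "\<dots> \<le> (4 * exp 4 + 1) * (2 * exp 4 * mills u)\<^sup>2"
      using elim mills_pos[OF w(1)] by (intro mult_left_mono power_mono) (auto simp: add_nonneg_nonneg)
    finally show "\<P>(\<omega> in M. X a \<omega> > u - 4 / u \<and> X a' \<omega> > u - 4 / u) \<le> (4 * exp 4 + 1) * (2 * exp 4 * mills u)\<^sup>2" .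
  qed
qed

lemma both_exceed_signed:
  "both_exceed signed {(False, a)} ((\<lambda>l. (True, c + real l * h / 2^n)) ` {..2^n}) w
    = {\<omega>\<in>space M. X a \<omega> > w \<and> (\<exists>l\<in>{..2^n}. - X (c + real l * h / 2^n) \<omega> > w)}"
  unfolding both_exceed_def signed_def by auto

text \<open>The constants of two decouplings and of \<open>local_supremum\<close> at level \<open>u - 8 / u\<close>, collected.\<close>

definition low_far_const :: real where
  "low_far_const = 2 * (2 * (2 * exp 4) * ((1 + 4 * exp (4 * K\<^sup>2)) * (2 * exp 8)) + (2 * exp 4) ^ 3) + 1"

text \<open>Decouple \<open>b\<close> first, then \<open>a\<close>; each step costs a factor \<open>mills u\<close> and lowers the level by \<open>4 / u\<close>. The block remains, bounded by \<open>local_supremum\<close>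
for \<open>- X\<close>.\<close>

lemma two_high_one_low_far:
  "eventually (\<lambda>u. \<forall>a b c n. far_from u b a \<and> (\<forall>l\<in>{..2^n}. far_from u b (c + real l * (1 / u) / 2^n) \<and> far_from u a (c + real l * (1 / u) / 2^n)) \<longrightarrow>
    \<P>(\<omega> in M. X b \<omega> > u \<and> X a \<omega> > u \<and> (\<exists>l\<in>{..2^n}. - X (c + real l * (1 / u) / 2^n) \<omega> > u)) \<le> low_far_const * (mills u) ^ 3) at_top"
  using eventually_levels
proof eventually_elim
  case (elim u)
  interpret minus: normal_process M "\<lambda>t \<omega>. - X t \<omega>" \<rho> K by (rule minus_process)
  define \<psi> where "\<psi> = mills u"
  have \<psi>: "0 < \<psi>" "\<psi> \<le> 1" using elim by (auto simp: \<psi>_def)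
  define w where "w = u - 4 / u"
  have u: "u > 0" using elim by simp
  have "u - 8 / u \<le> w" "w \<le> u" using u by (auto simp: w_def divide_right_mono)
  then have w: "w > 0" "w \<ge> 1" "w \<le> u" "w - 4 / u = u - 8 / u" using elim by (auto simp: w_def)
  show ?case
  proof (intro allI impI)
    fix a b c n assume far: "far_from u b a \<and> (\<forall>l\<in>{..2^n}. far_from u b (c + real l * (1 / u) / 2^n) \<and> far_from u a (c + real l * (1 / u) / 2^n))"
    define L where "L = (\<lambda>l. (True, c + real l * (1 / u) / 2^n)) ` {..2^n}"
    have fL: "finite L" unfolding L_def by simp
    have le: "\<P>(\<omega> in M. X b \<omega> > u \<and> X a \<omega> > u \<and> (\<exists>l\<in>{..2^n}. - X (c + real l * (1 / u) / 2^n) \<omega> > u))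
       = \<P>(\<omega> in M. X b \<omega> > u \<and> \<omega> \<in> both_exceed signed {(False, a)} L u)"
      unfolding L_def both_exceed_signed by (intro arg_cong[where f=prob]) auto
    have 1: "\<P>(\<omega> in M. X b \<omega> > u \<and> \<omega> \<in> both_exceed signed {(False, a)} L u)
        \<le> 2 * \<psi> * prob (both_exceed signed {(False, a)} L w) + mills (2 * u)"
      unfolding \<psi>_def w_def using elim far fL by (intro decouple_signed) (auto simp: L_def)
    have "prob (both_exceed signed {(False, a)} L w) = \<P>(\<omega> in M. X a \<omega> > w \<and> \<omega> \<in> both_exceed signed L L w)"
      unfolding both_exceed_def signed_def by (intro arg_cong[where f=prob]) auto
    also have "\<dots> \<le> 2 * mills w * prob (both_exceed signed L L (w - 4 / u)) + mills (2 * w)"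
      using w u far fL by (intro decouple_signed) (auto simp: L_def)
    also have "both_exceed signed L L (w - 4 / u) = minus.block_exceeds n (1 / u) c (u - 8 / u)"
      unfolding both_exceed_def signed_def L_def minus.block_exceeds_def w(4) by auto
    also have "2 * mills w * prob (minus.block_exceeds n (1 / u) c (u - 8 / u)) + mills (2 * w)
       \<le> 2 * (2 * exp 4 * \<psi>) * ((1 + 4 * exp (4 * K\<^sup>2)) * (2 * exp 8 * \<psi>)) + (2 * exp 4 * \<psi>) ^ 3"
    proof (intro add_mono mult_mono)
      have "prob (minus.block_exceeds n (1 / u) c (u - 8 / u)) \<le> (1 + 4 * exp (4 * K\<^sup>2)) * mills (u - 8 / u)"
      proof (rule minus.local_supremum)
        show "1 / u \<le> 1 / (u - 8 / u)" using elim u w by (intro divide_left_mono mult_pos_pos) auto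
      qed (use elim u in auto)
      also have "\<dots> \<le> (1 + 4 * exp (4 * K\<^sup>2)) * (2 * exp 8 * \<psi>)"
        using elim unfolding \<psi>_def by (intro mult_left_mono) (auto simp: add_nonneg_nonneg)
      finally show "prob (minus.block_exceeds n (1 / u) c (u - 8 / u)) \<le> (1 + 4 * exp (4 * K\<^sup>2)) * (2 * exp 8 * \<psi>)" .
      have "mills (2 * w) \<le> (mills w) ^ 3" using elim by (simp add: w_def)
      also have "\<dots> \<le> (2 * exp 4 * \<psi>) ^ 3" using elim mills_pos[OF w(1)] by (intro power_mono) (auto simp: w_def \<psi>_def)
      finally show "mills (2 * w) \<le> (2 * exp 4 * \<psi>) ^ 3" .
    qed (use elim \<psi> mills_pos[OF w(1)] in \<open>auto simp: w_def \<psi>_def\<close>)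
    also have "\<dots> = \<psi>\<^sup>2 * (2 * (2 * exp 4) * ((1 + 4 * exp (4 * K\<^sup>2)) * (2 * exp 8))) + \<psi> ^ 3 * (2 * exp 4) ^ 3"
      by (simp add: power2_eq_square power_mult_distrib)
    also have "\<psi> ^ 3 * (2 * exp 4) ^ 3 \<le> \<psi>\<^sup>2 * (2 * exp 4) ^ 3"
      using \<psi> by (intro mult_right_mono power_decreasing) auto
    finally have 2: "prob (both_exceed signed {(False, a)} L w) \<le> \<psi>\<^sup>2 * (2 * (2 * exp 4) * ((1 + 4 * exp (4 * K\<^sup>2)) * (2 * exp 8)) + (2 * exp 4) ^ 3)"
      by (simp add: distrib_left)
    have "2 * \<psi> * prob (both_exceed signed {(False, a)} L w) \<le> 2 * \<psi> * (\<psi>\<^sup>2 * (2 * (2 * exp 4) * ((1 + 4 * exp (4 * K\<^sup>2)) * (2 * exp 8)) + (2 * exp 4) ^ 3))"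
      using 2 \<psi> by (intro mult_left_mono) auto
    also have "\<dots> + \<psi> ^ 3 = low_far_const * \<psi> ^ 3"
    proof -
      have "2 * \<psi> * (\<psi>\<^sup>2 * k) + \<psi> ^ 3 = (2 * k + 1) * \<psi> ^ 3" for k
        by (simp add: power2_eq_square power3_eq_cube algebra_simps)
      then show ?thesis unfolding low_far_const_def .
    qed
    finally have "2 * \<psi> * prob (both_exceed signed {(False, a)} L w) + \<psi> ^ 3 \<le> low_far_const * \<psi> ^ 3" by simp
    then show "\<P>(\<omega> in M. X b \<omega> > u \<and> X a \<omega> > u \<and> (\<exists>l\<in>{..2^n}. - X (c + real l * (1 / u) / 2^n) \<omega> > u)) \<le> low_far_const * (mills u) ^ 3"
      unfolding le using 1 elim by (simp add: \<psi>_def)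
  qed
qed

text \<open>When the low block is close to the high point \<open>a\<close> only \<open>b\<close> can be decoupled. A value above \<open>w\<close> at \<open>a\<close> and one below \<open>- w\<close> in the block at \<open>c\<close> force
either \<open>X a - X c\<close> to be nearly \<open>2 * w\<close>, or the process to oscillate by a multiple of \<open>w\<close> within the short block. The difference has variance \<open>2 * (1 - \<rho>)\<close>,
at most \<open>2 * (2 - c0)\<close>, strictly less than \<open>4\<close>; this makes the event rarer than a single exceedance by a
factor that is exponential in \<open>u\<^sup>2\<close>, enough to absorb the number of blocks close to \<open>a\<close>.\<close>

lemma two_high_one_low_near:
  assumes c0: "c0 > 0" "c0 \<le> 1" "\<And>t. c0 \<le> 1 + \<rho> t"
  shows "\<exists>C>0. eventually (\<lambda>u. \<forall>a b c n. far_from u b a \<and> (\<forall>l\<in>{..2^n}. far_from u b (c + real l * (1 / u) / 2^n)) \<longrightarrow>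
    \<P>(\<omega> in M. X b \<omega> > u \<and> X a \<omega> > u \<and> (\<exists>l\<in>{..2^n}. - X (c + real l * (1 / u) / 2^n) \<omega> > u))
      \<le> mills u * (C * exp (- (1 + c0 / 4) * u\<^sup>2 / 2)) + (mills u) ^ 3) at_top"
proof -
  interpret minus: normal_process M "\<lambda>t \<omega>. - X t \<omega>" \<rho> K by (rule minus_process)
  \<comment> \<open>The tolerated oscillation; small enough that \<open>(2 - \<eta>)\<^sup>2 / (2 * (2 - c0)) \<ge> 1 + c0 / 4\<close>.\<close>
  define \<eta> where "\<eta> = c0 / 4"
  have \<eta>: "\<eta> > 0" "\<eta> \<le> 1/4" using c0 by (auto simp: \<eta>_def)
  define C where "C = 2 * (exp 8 + 2 * exp (8 * K\<^sup>2 / \<eta>\<^sup>2))"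
  show ?thesis
  proof (intro exI[of _ C] conjI)
    show "C > 0" unfolding C_def by (simp add: add_pos_pos)
    show "eventually (\<lambda>u. \<forall>a b c n. far_from u b a \<and> (\<forall>l\<in>{..2^n}. far_from u b (c + real l * (1 / u) / 2^n)) \<longrightarrow>
    \<P>(\<omega> in M. X b \<omega> > u \<and> X a \<omega> > u \<and> (\<exists>l\<in>{..2^n}. - X (c + real l * (1 / u) / 2^n) \<omega> > u))
      \<le> mills u * (C * exp (- (1 + c0 / 4) * u\<^sup>2 / 2)) + (mills u) ^ 3) at_top"
      using eventually_levels
    proof eventually_elim
      case (elim u)
      define w where "w = u - 4 / u"
      have u: "u > 0" using elim by simp
      have "u - 8 / u \<le> w" "w \<le> u" using u by (auto simp: w_def divide_right_mono)
      then have w: "w > 0" "w \<ge> 2" "w \<le> u" "w \<ge> u / 2" using elim by auto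
      show ?case
      proof (intro allI impI)
        fix a b c n assume far: "far_from u b a \<and> (\<forall>l\<in>{..2^n}. far_from u b (c + real l * (1 / u) / 2^n))"
        define L where "L = (\<lambda>l. (True, c + real l * (1 / u) / 2^n)) ` {..2^n}"
        have fL: "finite L" unfolding L_def by simp
        have le: "\<P>(\<omega> in M. X b \<omega> > u \<and> X a \<omega> > u \<and> (\<exists>l\<in>{..2^n}. - X (c + real l * (1 / u) / 2^n) \<omega> > u))
           = \<P>(\<omega> in M. X b \<omega> > u \<and> \<omega> \<in> both_exceed signed {(False, a)} L u)"
          unfolding L_def both_exceed_signed by (intro arg_cong[where f=prob]) auto
        have 1: "\<P>(\<omega> in M. X b \<omega> > u \<and> \<omega> \<in> both_exceed signed {(False, a)} L u)
            \<le> 2 * mills u * prob (both_exceed signed {(False, a)} L w) + mills (2 * u)"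
          unfolding w_def using elim far fL by (intro decouple_signed) (auto simp: L_def)
        let ?A = "{\<omega>\<in>space M. X a \<omega> - X c \<omega> > (2 - \<eta>) * w}"
        let ?B = "{\<omega>\<in>space M. \<exists>l\<in>{..2^n}. - X (c + real l * (1 / u) / 2^n) \<omega> > - X c \<omega> + \<eta> * w}"
        have "prob (both_exceed signed {(False, a)} L w) \<le> prob (?A \<union> ?B)"
        proof (rule finite_measure_mono)
          show "both_exceed signed {(False, a)} L w \<subseteq> ?A \<union> ?B"
          proof
            fix \<omega> assume "\<omega> \<in> both_exceed signed {(False, a)} L w"
            then obtain l where l: "\<omega> \<in> space M" "X a \<omega> > w" "l \<in> {..2^n}" "- X (c + real l * (1 / u) / 2^n) \<omega> > w"
              unfolding L_def both_exceed_signed by auto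
            show "\<omega> \<in> ?A \<union> ?B"
            proof (cases "- X (c + real l * (1 / u) / 2^n) \<omega> > - X c \<omega> + \<eta> * w")
              case False
              then have "X a \<omega> - X c \<omega> > 2 * w - \<eta> * w" using l by linarith
              then show ?thesis using l by (simp add: left_diff_distrib)
            qed (use l in auto)
          qed
        qed auto
        also have "\<dots> \<le> prob ?A + prob ?B" by (rule measure_Un_le) auto
        also have "prob ?A \<le> exp 8 * exp (- (1 + c0 / 4) * u\<^sup>2 / 2)"
        proof -
          define s where "s = sqrt (2 * (2 - c0))"
          have s: "s > 0" "s\<^sup>2 = 2 * (2 - c0)" "s \<le> 2" using c0 unfolding s_def by (auto intro: real_le_lsqrt)
          have x1: "(2 - \<eta>) * w / s \<ge> 1"
          proof -
            have "(2 - \<eta>) * w \<ge> 1 * 2" using \<eta> w by (intro mult_mono) auto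
            then show ?thesis using s by simp
          qed
          have cv: "cov (\<lambda>\<omega>. X a \<omega> - X c \<omega>) (\<lambda>\<omega>. X a \<omega> - X c \<omega>) \<le> s\<^sup>2"
            unfolding s(2) using c0(3)[of "c - a"] by (simp add: cov_diff_self X_mem cov_X \<rho>_0)
          have "prob ?A \<le> mills ((2 - \<eta>) * w / s)"
            using \<eta> w s cv by (intro tail_upper diff_mem X_mem) auto
          also have "\<dots> \<le> exp (- ((2 - \<eta>) * w / s)\<^sup>2 / 2) / 1"
            unfolding mills_def using x1 by (intro divide_left_mono) auto
          also have "\<dots> \<le> exp (8 + (- (1 + c0 / 4) * u\<^sup>2 / 2))"
          proof -
            have "(1 + c0 / 4) * (2 * (2 - c0)) \<le> (2 - \<eta>)\<^sup>2"
            proof -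
              have "(2 - \<eta>)\<^sup>2 - (1 + c0 / 4) * (2 * (2 - c0)) = c0\<^sup>2 * (9 / 16)"
                unfolding \<eta>_def by (simp add: power2_eq_square field_simps)
              then show ?thesis by (smt (verit) zero_le_power2 mult_nonneg_nonneg divide_nonneg_pos)
            qed
            then have "(1 + c0 / 4) \<le> (2 - \<eta>)\<^sup>2 / s\<^sup>2" using s c0 by (simp add: pos_le_divide_eq)
            then have "(1 + c0 / 4) * w\<^sup>2 \<le> (2 - \<eta>)\<^sup>2 / s\<^sup>2 * w\<^sup>2" by (intro mult_right_mono) auto
            also have "\<dots> = ((2 - \<eta>) * w / s)\<^sup>2" by (simp add: power_mult_distrib power_divide)
            finally have 3: "(1 + c0 / 4) * w\<^sup>2 \<le> ((2 - \<eta>) * w / s)\<^sup>2" .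
            have "w\<^sup>2 = u\<^sup>2 - 8 + (4 / u)\<^sup>2" using u by (simp add: w_def power2_diff)
            then have "u\<^sup>2 - 8 \<le> w\<^sup>2" by simp
            then have "(1 + c0 / 4) * (u\<^sup>2 - 8) \<le> (1 + c0 / 4) * w\<^sup>2" using c0 by (intro mult_left_mono) auto
            moreover have "(1 + c0 / 4) * 8 \<le> 16" using c0 by simp
            ultimately have "(1 + c0 / 4) * u\<^sup>2 - 16 \<le> ((2 - \<eta>) * w / s)\<^sup>2" using 3 by (simp add: right_diff_distrib)
            moreover have "- (1 + c0 / 4) * u\<^sup>2 / 2 = - ((1 + c0 / 4) * u\<^sup>2) / 2"
              by (simp add: algebra_simps)
            moreover have "P - 16 \<le> Q \<Longrightarrow> R = - P / 2 \<Longrightarrow> - Q / 2 \<le> 8 + R" for P Q R :: real by simp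
            ultimately show ?thesis unfolding div_by_1 exp_le_cancel_iff by blast
          qed
          finally show ?thesis by (simp only: exp_add)
        qed
        also have "prob ?B \<le> 2 * exp (8 * K\<^sup>2 / \<eta>\<^sup>2) * exp (- (1 + c0 / 4) * u\<^sup>2 / 2)"
        proof -
          define \<theta> where "\<theta> = 4 * u / \<eta>"
          have \<theta>: "\<theta> > 0" using u \<eta> by (simp add: \<theta>_def)
          have "prob ?B \<le> 2 * exp (\<theta>\<^sup>2 * K\<^sup>2 * (1 / u)\<^sup>2 / 2 - \<theta> * (\<eta> * w))"
            by (rule minus.block_oscillation[OF \<theta>]) (use u in simp)
          also have "\<dots> \<le> 2 * exp (8 * K\<^sup>2 / \<eta>\<^sup>2 + (- (1 + c0 / 4) * u\<^sup>2 / 2))"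
          proof -
            have "\<theta>\<^sup>2 * K\<^sup>2 * (1 / u)\<^sup>2 / 2 = 8 * K\<^sup>2 / \<eta>\<^sup>2" using u by (simp add: \<theta>_def power_mult_distrib power_divide)
            moreover have "\<theta> * (\<eta> * w) \<ge> 2 * u\<^sup>2"
            proof -
              have "\<theta> * (\<eta> * w) = 4 * u * w" using \<eta> by (simp add: \<theta>_def)
              also have "\<dots> \<ge> 4 * u * (u / 2)" using u w by (intro mult_left_mono) auto
              finally show ?thesis by (simp add: power2_eq_square)
            qed
            moreover have "(1 + c0 / 4) * u\<^sup>2 \<le> 2 * u\<^sup>2" using c0 by (intro mult_right_mono) auto
            moreover have "- (1 + c0 / 4) * u\<^sup>2 / 2 = - ((1 + c0 / 4) * u\<^sup>2) / 2"
              by (simp add: algebra_simps)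
            moreover have "x = A \<Longrightarrow> 2 * U \<le> Y \<Longrightarrow> P \<le> 2 * U \<Longrightarrow> R = - P / 2 \<Longrightarrow> 0 \<le> U \<Longrightarrow> 2 * exp (x - Y) \<le> 2 * exp (A + R)"
              for x A U Y P R :: real by simp
            ultimately show ?thesis using zero_le_power2[of u] by blast
          qed
          finally show ?thesis by (simp add: exp_add)
        qed
        finally have 2: "prob (both_exceed signed {(False, a)} L w) \<le> (exp 8 + 2 * exp (8 * K\<^sup>2 / \<eta>\<^sup>2)) * exp (- (1 + c0 / 4) * u\<^sup>2 / 2)"
          by (simp add: distrib_right)
        have "mills u > 0" using elim by simp
        have "2 * mills u * prob (both_exceed signed {(False, a)} L w) \<le> 2 * mills u * ((exp 8 + 2 * exp (8 * K\<^sup>2 / \<eta>\<^sup>2)) * exp (- (1 + c0 / 4) * u\<^sup>2 / 2))"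
          using 2 \<open>mills u > 0\<close> by (intro mult_left_mono) auto
        also have "\<dots> = mills u * (C * exp (- (1 + c0 / 4) * u\<^sup>2 / 2))" unfolding C_def by simp
        finally show "\<P>(\<omega> in M. X b \<omega> > u \<and> X a \<omega> > u \<and> (\<exists>l\<in>{..2^n}. - X (c + real l * (1 / u) / 2^n) \<omega> > u))
          \<le> mills u * (C * exp (- (1 + c0 / 4) * u\<^sup>2 / 2)) + (mills u) ^ 3"
          unfolding le using 1 elim by linarith
      qed
    qed
  qed
qed

definition pair_const :: real where "pair_const = 1 / (36 * 72 * exp 6)"

text \<open>The first-order term of the Bonferroni inequality used below.\<close>

lemma pair_exceed_lower:
  "eventually (\<lambda>u. \<forall>a b. far_from u b a \<longrightarrow> pair_const * (mills u)\<^sup>2 \<le> \<P>(\<omega> in M. X b \<omega> > u \<and> X a \<omega> > u)) at_top"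
proof -
  have t1: "eventually (\<lambda>u. (mills u)\<^sup>2 \<le> 1 / 36 \<and> 2 * (mills u)\<^sup>2 \<le> 1 / (72 * exp 6)) at_top"
  proof -
    have a: "eventually (\<lambda>u::real. (exp (- u\<^sup>2 / 2) / u)\<^sup>2 \<le> 1 / 36) at_top" by real_asymp
    have b: "eventually (\<lambda>u::real. 2 * (exp (- u\<^sup>2 / 2) / u)\<^sup>2 \<le> 1 / (72 * exp 6)) at_top" by real_asymp
    show ?thesis using a b unfolding mills_def by eventually_elim auto
  qed
  show ?thesis using eventually_levels t1
  proof eventually_elim
    case (elim u)
    define \<psi> where "\<psi> = mills u"
    have \<psi>: "\<psi> > 0" "\<psi>\<^sup>2 \<le> 1 / 36" "2 * \<psi>\<^sup>2 \<le> 1 / (72 * exp 6)" using elim by (auto simp: \<psi>_def)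
    have u: "u \<ge> 4" using elim by simp
    show ?case
    proof (intro allI impI)
      fix a b assume far: "far_from u b a"
      have up: "u + 4 * u * (1 / u\<^sup>2) = u + 4 / u" using u by (simp add: power2_eq_square)
      have u2: "u\<^sup>2 \<ge> 4" using power_mono[of 4 u 2] u by simp
      have cb: "\<bar>cov (X b) (X a)\<bar> \<le> 1 / u\<^sup>2" using far \<rho>_minus[of "b - a"] by (simp add: cov_X far_from_def)
      have m3: "mills (2 * u) \<le> \<psi> * \<psi>\<^sup>2" using elim by (simp add: \<psi>_def power2_eq_square power3_eq_cube)
      have A: "\<P>(\<omega> in M. X b \<omega> > u) - \<P>(\<omega> in M. X b \<omega> > 2 * u) \<ge> \<psi> / 36"
      proof -
        have "\<P>(\<omega> in M. X b \<omega> > u) \<ge> \<psi> / 18" using tail_lower[OF X_mem, of b u] u by (simp add: cov_X \<rho>_0 \<psi>_def)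
        moreover have "\<P>(\<omega> in M. X b \<omega> > 2 * u) \<le> mills (2 * u)" using u by (intro tail_X) simp
        moreover have "\<psi> * \<psi>\<^sup>2 \<le> \<psi> * (1 / 36)" using \<psi> by (intro mult_left_mono) auto
        ultimately show ?thesis using m3 by linarith
      qed
      have B: "\<P>(\<omega> in M. X a \<omega> > u + 4 / u) - \<P>(\<omega> in M. \<bar>X b \<omega>\<bar> > 2 * u) \<ge> \<psi> / (72 * exp 6)"
      proof -
        have "\<P>(\<omega> in M. X a \<omega> > u + 4 / u) \<ge> mills (u + 4 / u) / 18"
          using u by (intro tail_lower X_mem) (auto simp: cov_X \<rho>_0 add_increasing2)
        moreover have "\<psi> \<le> 2 * exp 6 * mills (u + 4 / u)"
          using mills_shift_up[of 4 u] u u2 by (simp add: \<psi>_def)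
        then have "\<psi> / (36 * exp 6) \<le> mills (u + 4 / u) / 18" by (simp add: field_simps)
        moreover have "\<P>(\<omega> in M. \<bar>X b \<omega>\<bar> > 2 * u) \<le> 2 * mills (2 * u)"
        proof -
          have "\<P>(\<omega> in M. \<bar>X b \<omega>\<bar> > 2 * u) \<le> \<P>(\<omega> in M. X b \<omega> > 2 * u) + \<P>(\<omega> in M. - X b \<omega> > 2 * u)"
            by (rule order_trans[OF _ measure_Un_le]) (auto intro!: finite_measure_mono)
          also have "\<dots> \<le> mills (2 * u) + mills (2 * u)"
            using tail_X[of "2 * u" b] normal_process.tail_X[OF minus_process, of "2 * u" b] u by (intro add_mono) auto
          finally show ?thesis by simp
        qed
        moreover have "2 * (\<psi> * \<psi>\<^sup>2) \<le> \<psi> * (1 / (72 * exp 6))"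
          using mult_left_mono[OF \<psi>(3), of \<psi>] \<psi>(1) by simp
        moreover have "\<psi> / (36 * exp 6) - \<psi> * (1 / (72 * exp 6)) = \<psi> / (72 * exp 6)" by (simp add: field_simps)
        ultimately show ?thesis using m3 by linarith
      qed
      have "pair_const * \<psi>\<^sup>2 = (\<psi> / 36) * (\<psi> / (72 * exp 6))" by (simp add: pair_const_def power2_eq_square)
      also have "\<dots> \<le> (\<P>(\<omega> in M. X b \<omega> > u) - \<P>(\<omega> in M. X b \<omega> > 2 * u)) * (\<P>(\<omega> in M. X a \<omega> > u + 4 * u * (1 / u\<^sup>2)) - \<P>(\<omega> in M. \<bar>X b \<omega>\<bar> > 2 * u))"
        unfolding up using A B \<psi> by (intro mult_mono) auto
      also have "\<dots> \<le> \<P>(\<omega> in M. X b \<omega> > u \<and> X a \<omega> > u)"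
        using u cb by (intro joint_tail_lower X_mem) (auto simp: cov_X \<rho>_0)
      finally show "pair_const * (mills u)\<^sup>2 \<le> \<P>(\<omega> in M. X b \<omega> > u \<and> X a \<omega> > u)" unfolding \<psi>_def .
    qed
  qed
qed

end

section \<open>Counting competing events\<close>

text \<open>The event that \<open>A i\<close> and \<open>B j\<close> occur, and none of their competitors does, has probability at least \<open>c\<close>. These events are disjoint for different pairs, so
their probabilities add up.\<close>

lemma (in prob_space) bonferroni_exact_pairs:
  fixes A B W :: "nat \<Rightarrow> 'a set"
  assumes [measurable]: "\<And>i. A i \<in> sets M" "\<And>j. B j \<in> sets M" "\<And>k. W k \<in> sets M"
    and c: "\<And>i j. i < n \<Longrightarrow> j < n \<Longrightarrow> c \<le> prob (A i \<inter> B j)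
      - (\<Sum>i'\<in>{..<n} - {i}. prob (A i \<inter> B j \<inter> A i')) - (\<Sum>j'\<in>{..<n} - {j}. prob (A i \<inter> B j \<inter> B j'))
      - (\<Sum>k<m. prob (A i \<inter> B j \<inter> W k))"
  shows "(real n)\<^sup>2 * c \<le> prob ((\<Union>i<n. \<Union>j<n. A i \<inter> B j) - (\<Union>k<m. W k))"
proof -
  define U where "U i j = (\<Union>i'\<in>{..<n} - {i}. A i \<inter> B j \<inter> A i') \<union> (\<Union>j'\<in>{..<n} - {j}. A i \<inter> B j \<inter> B j') \<union> (\<Union>k<m. A i \<inter> B j \<inter> W k)" for i j
  define E where "E z = A (fst z) \<inter> B (snd z) - U (fst z) (snd z)" for z
  have [measurable]: "U i j \<in> sets M" for i j unfolding U_def by measurable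
  have [measurable]: "E z \<in> sets M" for z unfolding E_def by measurable
  have E_ge: "c \<le> prob (E z)" if "z \<in> {..<n} \<times> {..<n}" for z
  proof -
    obtain i j where z: "z = (i, j)" "i < n" "j < n" using \<open>z \<in> _\<close> by auto
    have "prob (U i j) \<le> prob ((\<Union>i'\<in>{..<n} - {i}. A i \<inter> B j \<inter> A i') \<union> (\<Union>j'\<in>{..<n} - {j}. A i \<inter> B j \<inter> B j')) + prob (\<Union>k<m. A i \<inter> B j \<inter> W k)"
      unfolding U_def by (rule measure_Un_le) auto
    also have "\<dots> \<le> prob (\<Union>i'\<in>{..<n} - {i}. A i \<inter> B j \<inter> A i') + prob (\<Union>j'\<in>{..<n} - {j}. A i \<inter> B j \<inter> B j') + prob (\<Union>k<m. A i \<inter> B j \<inter> W k)"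
      by (intro add_right_mono measure_Un_le) auto
    also have "\<dots> \<le> (\<Sum>i'\<in>{..<n} - {i}. prob (A i \<inter> B j \<inter> A i')) + (\<Sum>j'\<in>{..<n} - {j}. prob (A i \<inter> B j \<inter> B j')) + (\<Sum>k<m. prob (A i \<inter> B j \<inter> W k))"
      by (intro add_mono finite_measure_subadditive_finite) auto
    finally have "prob (U i j) \<le> prob (A i \<inter> B j) - c" using c[OF z(2,3)] by linarith
    moreover have "prob (E z) = prob (A i \<inter> B j) - prob (U i j)"
      unfolding E_def z fst_conv snd_conv by (rule finite_measure_Diff) (auto simp: U_def)
    ultimately show ?thesis by simp
  qed
  have disj: "disjoint_family_on E ({..<n} \<times> {..<n})"
    unfolding disjoint_family_on_def
  proof (intro ballI impI)
    fix z z' assume z: "z \<in> {..<n} \<times> {..<n}" "z' \<in> {..<n} \<times> {..<n}" "z \<noteq> z'"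
    obtain i j i' j' where ij: "z = (i, j)" "z' = (i', j')" "i' < n" "j' < n"
      using z by auto
    have "\<omega> \<in> U i j" if "\<omega> \<in> A i \<inter> B j" "\<omega> \<in> A i' \<inter> B j'" for \<omega>
    proof (cases "i' = i")
      case False
      then have "i' \<in> {..<n} - {i}" using ij by simp
      then show ?thesis using that unfolding U_def by blast
    next
      case True
      then have "j' \<in> {..<n} - {j}" using ij z by auto
      then show ?thesis using that unfolding U_def by blast
    qed
    then show "E z \<inter> E z' = {}" unfolding E_def ij by auto
  qed
  have "(real n)\<^sup>2 * c = (\<Sum>z\<in>{..<n} \<times> {..<n}. c)" by (simp add: power2_eq_square)
  also have "\<dots> \<le> (\<Sum>z\<in>{..<n} \<times> {..<n}. prob (E z))" by (intro sum_mono E_ge)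
  also have "\<dots> = prob (\<Union>z\<in>{..<n} \<times> {..<n}. E z)"
    using disj by (intro finite_measure_finite_Union[symmetric]) auto
  also have "\<dots> \<le> prob ((\<Union>i<n. \<Union>j<n. A i \<inter> B j) - (\<Union>k<m. W k))"
  proof (rule finite_measure_mono)
    show "(\<Union>z\<in>{..<n} \<times> {..<n}. E z) \<subseteq> (\<Union>i<n. \<Union>j<n. A i \<inter> B j) - (\<Union>k<m. W k)"
      unfolding E_def U_def by auto
  qed auto
  finally show ?thesis .
qed

lemma card_near_real_le:
  fixes x :: real
  assumes "finite S" "G \<ge> 0"
  shows "real (card {k\<in>S. \<bar>real k - x\<bar> < G}) \<le> 2 * G + 1"
proof (cases "{k\<in>S. \<bar>real k - x\<bar> < G} = {}")
  case False
  let ?N = "{k\<in>S. \<bar>real k - x\<bar> < G}"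
  define k0 where "k0 = Min ?N"
  have fin: "finite ?N" using assms by simp
  have k0: "k0 \<in> ?N" unfolding k0_def using fin False by (rule Min_in)
  define g where "g = nat \<lfloor>2 * G\<rfloor>"
  have g: "real g \<le> 2 * G" "2 * G < real g + 1" unfolding g_def using assms by (simp_all add: floor_correct)
  have "?N \<subseteq> {k0..k0 + g}"
  proof
    fix k assume k: "k \<in> ?N"
    have "k0 \<le> k" unfolding k0_def using fin k by (rule Min_le)
    moreover have "real k - real k0 < 2 * G" using k k0 by (auto simp: abs_less_iff)
    then have "real k < real (k0 + g + 1)" using g by simp
    ultimately show "k \<in> {k0..k0 + g}" by auto
  qed
  then have "card ?N \<le> card {k0..k0 + g}" by (intro card_mono) auto
  then have "real (card ?N) \<le> real g + 1" by simp
  then show ?thesis using g by linarith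
next
  case True
  then show ?thesis using assms by (simp only: card.empty)
qed

lemma sum_geometric_distance_le:
  fixes q :: real
  assumes "0 \<le> q" "q < 1"
  shows "(\<Sum>j\<in>{..<n} - {i}. q ^ (nat \<bar>int i - int j\<bar>)) \<le> 2 * (q / (1 - q))"
proof -
  have geo: "(\<Sum>d\<in>{1..N}. q ^ d) \<le> q / (1 - q)" for N :: nat
  proof -
    have "(\<Sum>d\<in>{1..N}. q ^ d) = q * (\<Sum>d<N. q ^ d)"
      unfolding sum_distrib_left
      by (rule sum.reindex_bij_witness[of _ Suc "\<lambda>d. d - 1"]) (auto simp: power_Suc[symmetric] simp del: power_Suc)
    also have "(\<Sum>d<N. q ^ d) = (1 - q ^ N) / (1 - q)" using assms by (simp add: sum_gp_strict)
    also have "\<dots> \<le> 1 / (1 - q)" using assms by (intro divide_right_mono) auto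
    finally show ?thesis using assms by (simp add: mult_left_mono)
  qed
  have "(\<Sum>j\<in>{..<n} - {i}. q ^ (nat \<bar>int i - int j\<bar>)) \<le> (\<Sum>j\<in>{..<i} \<union> {i<..<n}. q ^ (nat \<bar>int i - int j\<bar>))"
    using assms by (intro sum_mono2) auto
  also have "\<dots> = (\<Sum>j\<in>{..<i}. q ^ (nat \<bar>int i - int j\<bar>)) + (\<Sum>j\<in>{i<..<n}. q ^ (nat \<bar>int i - int j\<bar>))"
    by (rule sum.union_disjoint) auto
  also have "(\<Sum>j\<in>{..<i}. q ^ (nat \<bar>int i - int j\<bar>)) = (\<Sum>d\<in>{1..i}. q ^ d)"
    by (rule sum.reindex_bij_witness[of _ "\<lambda>d. i - d" "\<lambda>j. i - j"]) (auto simp flip: of_nat_diff)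
  also have "(\<Sum>j\<in>{i<..<n}. q ^ (nat \<bar>int i - int j\<bar>)) = (\<Sum>d\<in>{1..n - 1 - i}. q ^ d)"
    by (rule sum.reindex_bij_witness[of _ "\<lambda>d. i + d" "\<lambda>j. j - i"]) (auto simp flip: of_nat_diff)
  finally show ?thesis using geo[of i] geo[of "n - 1 - i"] by linarith
qed

context normal_process begin

text \<open>Competitors of \<open>pt i\<close> on its own side, in three ranges. Up to distance \<open>T\<close> the joint probability decays geometrically along the grid of spacing \<open>D / u\<close>, with
ratio \<open>q\<close>. Points further away, but closer than \<open>\<Gamma>\<close>, pay \<open>exp (- u\<^sup>2 / 64)\<close> each. All others are independent up to a constant, and
their number is at most \<open>\<nu> / \<psi>\<close>.\<close>

lemma sum_competing_high_points:
  assumes T: "T > 0" and D: "D > 0" and \<kappa>: "\<kappa> > 0"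
    and u: "u > 0" and \<psi>: "\<psi> = mills u" "\<psi> > 0"
    and q: "q = exp (- (D\<^sup>2 / (64 * T\<^sup>2)))"
    and three: "\<And>a a'. far_from u b a \<Longrightarrow> far_from u b a' \<Longrightarrow>
      \<P>(\<omega> in M. X b \<omega> > u \<and> X a \<omega> > u \<and> X a' \<omega> > u) \<le> 2 * \<psi> * \<P>(\<omega> in M. X a \<omega> > u - 4 / u \<and> X a' \<omega> > u - 4 / u) + \<psi> ^ 3"
    and near: "\<And>a a'. \<P>(\<omega> in M. X a \<omega> > u - 4 / u \<and> X a' \<omega> > u - 4 / u) \<le> 2 * exp 4 * \<psi> * exp (- (u\<^sup>2 / 16) * (\<bar>a - a'\<bar> / (T + \<bar>a - a'\<bar>))\<^sup>2)"
    and far: "\<And>a a'. \<bar>a - a'\<bar> \<ge> \<Gamma> \<Longrightarrow> \<P>(\<omega> in M. X a \<omega> > u - 4 / u \<and> X a' \<omega> > u - 4 / u) \<le> C * \<psi>\<^sup>2"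
    and C: "C \<ge> 0" and \<Gamma>: "\<Gamma> \<ge> 0" and n: "real n * \<psi> \<le> \<nu>"
    and pt: "\<And>i j. \<bar>pt i - pt j\<bar> = \<bar>real i - real j\<bar> * (D / u)" and ff: "\<And>i. i < n \<Longrightarrow> far_from u b (pt i)" and i: "i < n"
  shows "(\<Sum>j\<in>{..<n} - {i}. \<P>(\<omega> in M. X b \<omega> > u \<and> X (pt i) \<omega> > u \<and> X (pt j) \<omega> > u))
    \<le> \<psi>\<^sup>2 * (8 * exp 4 * (q / (1 - q)) + 4 * exp 4 * ((2 * \<Gamma> * u / D + 1) * exp (- u\<^sup>2 / 64)) + (2 * C + 1) * \<nu>)"
proof -
  have q01: "0 \<le> q" "q < 1" using D T by (auto simp: q)
  define near_ind where "near_ind j = (if \<bar>real j - real i\<bar> < \<Gamma> * u / D then exp (- u\<^sup>2 / 64) else 0)" for j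
  have two: "\<P>(\<omega> in M. X (pt i) \<omega> > u - 4 / u \<and> X (pt j) \<omega> > u - 4 / u)
      \<le> 2 * exp 4 * \<psi> * (q ^ nat \<bar>int i - int j\<bar> + near_ind j) + C * \<psi>\<^sup>2" if j: "j \<noteq> i" for j
  proof -
    define t where "t = \<bar>pt i - pt j\<bar>"
    define d where "d = \<bar>real i - real j\<bar>"
    have d1: "d \<ge> 1" using j unfolding d_def by linarith
    have td: "t = d * (D / u)" unfolding t_def d_def by (rule pt)
    have tpos: "t > 0" using d1 D u by (simp add: td)
    have nonneg: "0 \<le> 2 * exp 4 * \<psi> * (q ^ nat \<bar>int i - int j\<bar> + near_ind j)" "0 \<le> C * \<psi>\<^sup>2"
      using q01 C \<psi> by (auto simp: near_ind_def intro!: mult_nonneg_nonneg add_nonneg_nonneg)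
    show ?thesis
    proof (cases "t \<ge> \<Gamma>")
      case True
      then show ?thesis using far[of "pt i" "pt j"] nonneg unfolding t_def by linarith
    next
      case False
      then have "d < \<Gamma> * u / D" using D u unfolding td by (simp add: field_simps)
      then have ni: "near_ind j = exp (- u\<^sup>2 / 64)" unfolding near_ind_def d_def by (simp add: abs_minus_commute)
      have "exp (- (u\<^sup>2 / 16) * (t / (T + t))\<^sup>2) \<le> q ^ nat \<bar>int i - int j\<bar> + near_ind j"
      proof (cases "t \<le> T")
        case True
        have "t / (2 * T) \<le> t / (T + t)" using True tpos T by (intro divide_left_mono) auto
        then have "(t / (2 * T))\<^sup>2 \<le> (t / (T + t))\<^sup>2" using tpos T by (intro power_mono) auto
        then have "(u\<^sup>2 / 16) * (t / (2 * T))\<^sup>2 \<le> (u\<^sup>2 / 16) * (t / (T + t))\<^sup>2" by (intro mult_left_mono) auto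
        moreover have "(u\<^sup>2 / 16) * (t / (2 * T))\<^sup>2 = d\<^sup>2 * (D\<^sup>2 / (64 * T\<^sup>2))"
          using u by (simp add: td power_mult_distrib power_divide)
        moreover have "d * (D\<^sup>2 / (64 * T\<^sup>2)) \<le> d\<^sup>2 * (D\<^sup>2 / (64 * T\<^sup>2))"
          using d1 by (intro mult_right_mono) (auto simp: power2_eq_square)
        ultimately have "d * (D\<^sup>2 / (64 * T\<^sup>2)) \<le> (u\<^sup>2 / 16) * (t / (T + t))\<^sup>2" by linarith
        then have "exp (- (u\<^sup>2 / 16) * (t / (T + t))\<^sup>2) \<le> exp (d * - (D\<^sup>2 / (64 * T\<^sup>2)))" by simp
        also have "\<dots> = q ^ nat \<bar>int i - int j\<bar>"
        proof -
          have "d = real (nat \<bar>int i - int j\<bar>)" unfolding d_def by simp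
          then show ?thesis unfolding q by (simp only: exp_of_nat_mult)
        qed
        finally show ?thesis unfolding ni by (simp add: add_increasing2)
      next
        case False
        then have "1 / 2 \<le> t / (T + t)" using tpos T by (simp add: field_simps)
        then have "(1 / 2)\<^sup>2 \<le> (t / (T + t))\<^sup>2" by (intro power_mono) auto
        then have "(u\<^sup>2 / 16) * (1 / 2)\<^sup>2 \<le> (u\<^sup>2 / 16) * (t / (T + t))\<^sup>2" by (intro mult_left_mono) auto
        then have "exp (- (u\<^sup>2 / 16) * (t / (T + t))\<^sup>2) \<le> exp (- u\<^sup>2 / 64)" by (simp add: power2_eq_square)
        then show ?thesis unfolding ni using q01 by (simp add: add_increasing)
      qed
      then have "2 * exp 4 * \<psi> * exp (- (u\<^sup>2 / 16) * (t / (T + t))\<^sup>2) \<le> 2 * exp 4 * \<psi> * (q ^ nat \<bar>int i - int j\<bar> + near_ind j)"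
        using \<psi> by (intro mult_left_mono) auto
      then show ?thesis using near[of "pt i" "pt j"] nonneg unfolding t_def by linarith
    qed
  qed
  have "(\<Sum>j\<in>{..<n} - {i}. \<P>(\<omega> in M. X b \<omega> > u \<and> X (pt i) \<omega> > u \<and> X (pt j) \<omega> > u))
      \<le> (\<Sum>j\<in>{..<n} - {i}. 2 * \<psi> * (2 * exp 4 * \<psi> * (q ^ nat \<bar>int i - int j\<bar> + near_ind j) + C * \<psi>\<^sup>2) + \<psi> ^ 3)"
  proof (rule sum_mono)
    fix j assume j: "j \<in> {..<n} - {i}"
    have "\<P>(\<omega> in M. X b \<omega> > u \<and> X (pt i) \<omega> > u \<and> X (pt j) \<omega> > u) \<le> 2 * \<psi> * \<P>(\<omega> in M. X (pt i) \<omega> > u - 4 / u \<and> X (pt j) \<omega> > u - 4 / u) + \<psi> ^ 3"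
      using j i by (intro three ff) auto
    also have "\<dots> \<le> 2 * \<psi> * (2 * exp 4 * \<psi> * (q ^ nat \<bar>int i - int j\<bar> + near_ind j) + C * \<psi>\<^sup>2) + \<psi> ^ 3"
      using j \<psi> by (intro add_right_mono mult_left_mono two) auto
    finally show "\<P>(\<omega> in M. X b \<omega> > u \<and> X (pt i) \<omega> > u \<and> X (pt j) \<omega> > u) \<le> \<dots>" .
  qed
  also have "\<dots> = 4 * exp 4 * \<psi>\<^sup>2 * ((\<Sum>j\<in>{..<n} - {i}. q ^ nat \<bar>int i - int j\<bar>) + (\<Sum>j\<in>{..<n} - {i}. near_ind j)) + real (card ({..<n} - {i})) * ((2 * C + 1) * \<psi> ^ 3)"
    by (simp add: sum.distrib sum_distrib_left distrib_left distrib_right power2_eq_square power3_eq_cube mult_ac)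
  also have "\<dots> \<le> 4 * exp 4 * \<psi>\<^sup>2 * (2 * (q / (1 - q)) + (2 * \<Gamma> * u / D + 1) * exp (- u\<^sup>2 / 64)) + \<psi>\<^sup>2 * ((2 * C + 1) * \<nu>)"
  proof (intro add_mono mult_left_mono)
    show "(\<Sum>j\<in>{..<n} - {i}. q ^ nat \<bar>int i - int j\<bar>) \<le> 2 * (q / (1 - q))" using q01 by (rule sum_geometric_distance_le)
    have "(\<Sum>j\<in>{..<n} - {i}. near_ind j) = real (card {j\<in>{..<n} - {i}. \<bar>real j - real i\<bar> < \<Gamma> * u / D}) * exp (- u\<^sup>2 / 64)"
      unfolding near_ind_def by (simp add: sum.If_cases Int_def)
    also have "\<dots> \<le> (2 * (\<Gamma> * u / D) + 1) * exp (- u\<^sup>2 / 64)"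
      using \<Gamma> u D by (intro mult_right_mono card_near_real_le) auto
    finally show "(\<Sum>j\<in>{..<n} - {i}. near_ind j) \<le> (2 * \<Gamma> * u / D + 1) * exp (- u\<^sup>2 / 64)" by (simp add: mult.assoc)
    have "card ({..<n} - {i}) \<le> n" using card_mono[of "{..<n}" "{..<n} - {i}"] by simp
    then have "real (card ({..<n} - {i})) * ((2 * C + 1) * \<psi> ^ 3) \<le> real n * ((2 * C + 1) * \<psi> ^ 3)"
      using C \<psi> by (intro mult_right_mono) auto
    also have "\<dots> = \<psi>\<^sup>2 * ((2 * C + 1) * (real n * \<psi>))" by (simp add: power2_eq_square power3_eq_cube)
    also have "\<dots> \<le> \<psi>\<^sup>2 * ((2 * C + 1) * \<nu>)" using C n by (intro mult_left_mono) auto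
    finally show "real (card ({..<n} - {i})) * ((2 * C + 1) * \<psi> ^ 3) \<le> \<psi>\<^sup>2 * ((2 * C + 1) * \<nu>)" .
  qed auto
  also have "\<dots> = \<psi>\<^sup>2 * (8 * exp 4 * (q / (1 - q)) + 4 * exp 4 * ((2 * \<Gamma> * u / D + 1) * exp (- u\<^sup>2 / 64)) + (2 * C + 1) * \<nu>)"
    by (simp only: distrib_left mult_ac)
  finally show ?thesis .
qed

text \<open>Low blocks within \<open>2 * \<Gamma>\<close> of \<open>a\<close> or \<open>b\<close> are few and each has probability at most \<open>Nb\<close>; a block cannot be close to both, as \<open>a\<close> and \<open>b\<close> are \<open>4 * \<Gamma>\<close> apart.
The remaining ones are separated from both and cost \<open>Cf * \<psi> ^ 3\<close> each; all but order \<open>\<Gamma> * u\<close> of them are accounted for by \<open>2 * D * \<nu> / \<psi>\<close>.\<close>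

lemma sum_low_blocks:
  assumes u: "u \<ge> 1" and \<psi>: "\<psi> > 0" and \<Gamma>: "\<Gamma> \<ge> 1" and m: "real m \<le> 4 * \<Gamma> * u + 2 * D * \<nu> / \<psi> + 2" and D: "D > 0" "\<nu> > 0"
    and near: "\<And>a b c n. far_from u b a \<Longrightarrow> (\<And>l. l \<le> 2^n \<Longrightarrow> far_from u b (c + real l * (1 / u) / 2^n)) \<Longrightarrow>
      \<P>(\<omega> in M. X b \<omega> > u \<and> X a \<omega> > u \<and> (\<exists>l\<in>{..2^n}. - X (c + real l * (1 / u) / 2^n) \<omega> > u)) \<le> Nb"
    and far: "\<And>a b c n. far_from u b a \<Longrightarrow> (\<And>l. l \<le> 2^n \<Longrightarrow> far_from u b (c + real l * (1 / u) / 2^n) \<and> far_from u a (c + real l * (1 / u) / 2^n)) \<Longrightarrow>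
      \<P>(\<omega> in M. X b \<omega> > u \<and> X a \<omega> > u \<and> (\<exists>l\<in>{..2^n}. - X (c + real l * (1 / u) / 2^n) \<omega> > u)) \<le> Cf * \<psi> ^ 3"
    and corr: "\<And>p q. \<bar>p - q\<bar> \<ge> \<Gamma> \<Longrightarrow> far_from u p q"
    and ab: "\<bar>a - b\<bar> \<ge> 4 * \<Gamma>" and Nb: "Nb \<ge> 0" and Cf: "Cf \<ge> 0"
  shows "(\<Sum>k<m. prob ({\<omega>\<in>space M. X a \<omega> > u \<and> X b \<omega> > u} \<inter> normal_process.block_sup M (\<lambda>t \<omega>. - X t \<omega>) (1 / u) ((real k - x) / u) u))
    \<le> 2 * (4 * \<Gamma> * u + 1) * Nb + (4 * \<Gamma> * u + 2) * (Cf * \<psi> ^ 3) + 2 * D * \<nu> * Cf * \<psi>\<^sup>2"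
proof -
  interpret minus: normal_process M "\<lambda>t \<omega>. - X t \<omega>" \<rho> K by (rule minus_process)
  let ?A = "{\<omega>\<in>space M. X a \<omega> > u \<and> X b \<omega> > u}"
  have eq: "?A \<inter> minus.block_exceeds n (1 / u) c u = {\<omega>\<in>space M. X b \<omega> > u \<and> X a \<omega> > u \<and> (\<exists>l\<in>{..2^n}. - X (c + real l * (1 / u) / 2^n) \<omega> > u)}"
      "?A \<inter> minus.block_exceeds n (1 / u) c u = {\<omega>\<in>space M. X a \<omega> > u \<and> X b \<omega> > u \<and> (\<exists>l\<in>{..2^n}. - X (c + real l * (1 / u) / 2^n) \<omega> > u)}" for n c
    unfolding minus.block_exceeds_def by auto
  have step: "0 \<le> real l * (1 / u) / 2^n" "real l * (1 / u) / 2^n \<le> 1" if "l \<le> 2^n" for l n :: nat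
  proof -
    have "real l \<le> 2^n" using that by (metis of_nat_le_iff of_nat_numeral of_nat_power)
    moreover have "real l * (1 / u) \<le> real l * 1" using u by (intro mult_left_mono) auto
    ultimately have "real l * (1 / u) \<le> 2^n" by linarith
    then show "real l * (1 / u) / 2^n \<le> 1" by (rule divide_le_eq_1_pos[THEN iffD2, rotated]) simp
  qed (use u in auto)
  define near_ind where "near_ind y k = (if \<bar>real k - (x + u * y)\<bar> < 2 * \<Gamma> * u then Nb else 0)" for y and k :: nat
  have one: "prob (?A \<inter> minus.block_sup (1 / u) ((real k - x) / u) u) \<le> near_ind a k + near_ind b k + Cf * \<psi> ^ 3" for k
  proof -
    define c where "c = (real k - x) / u"
    have pos: "0 \<le> near_ind a k" "0 \<le> near_ind b k" "0 \<le> Cf * \<psi> ^ 3" using Nb Cf \<psi> by (auto simp: near_ind_def)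
    have dist: "\<bar>real k - (x + u * y)\<bar> = u * \<bar>c - y\<bar>" for y
    proof -
      have "real k - (x + u * y) = u * (c - y)" using u by (simp add: c_def field_simps)
      then show ?thesis using u by (simp add: abs_mult)
    qed
    have ni: "near_ind y k = Nb" if "\<bar>c - y\<bar> < 2 * \<Gamma>" for y
      unfolding near_ind_def dist using that u by (simp add: mult.commute[of "2 * \<Gamma>"])
    consider "\<bar>c - a\<bar> < 2 * \<Gamma>" | "\<bar>c - b\<bar> < 2 * \<Gamma>" | "\<bar>c - a\<bar> \<ge> 2 * \<Gamma>" "\<bar>c - b\<bar> \<ge> 2 * \<Gamma>" by linarith
    then have "prob (?A \<inter> minus.block_exceeds n (1 / u) c u) \<le> near_ind a k + near_ind b k + Cf * \<psi> ^ 3" for n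
    proof cases
      case 1
      have "prob (?A \<inter> minus.block_exceeds n (1 / u) c u) \<le> Nb"
        unfolding eq(1)
      proof (intro near corr)
        show "\<Gamma> \<le> \<bar>b - a\<bar>" using ab \<Gamma> by linarith
        show "\<Gamma> \<le> \<bar>b - (c + real l * (1 / u) / 2 ^ n)\<bar>" if "l \<le> 2^n" for l
          using step[OF that] 1 ab \<Gamma> by linarith
      qed
      then show ?thesis using ni[OF 1] pos by linarith
    next
      case 2
      have "prob (?A \<inter> minus.block_exceeds n (1 / u) c u) \<le> Nb"
        unfolding eq(2)
      proof (intro near corr)
        show "\<Gamma> \<le> \<bar>a - b\<bar>" using ab \<Gamma> by linarith
        show "\<Gamma> \<le> \<bar>a - (c + real l * (1 / u) / 2 ^ n)\<bar>" if "l \<le> 2^n" for l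
          using step[OF that] 2 ab \<Gamma> by linarith
      qed
      then show ?thesis using ni[OF 2] pos by linarith
    next
      case 3
      have "prob (?A \<inter> minus.block_exceeds n (1 / u) c u) \<le> Cf * \<psi> ^ 3"
        unfolding eq(1)
      proof (intro far corr conjI)
        show "\<Gamma> \<le> \<bar>b - a\<bar>" using ab \<Gamma> by linarith
        show "\<Gamma> \<le> \<bar>b - (c + real l * (1 / u) / 2 ^ n)\<bar>" if "l \<le> 2^n" for l
          using step[OF that] 3 \<Gamma> by linarith
        show "\<Gamma> \<le> \<bar>a - (c + real l * (1 / u) / 2 ^ n)\<bar>" if "l \<le> 2^n" for l
          using step[OF that] 3 \<Gamma> by linarith
      qed
      then show ?thesis using pos by linarith
    qed
    then show ?thesis unfolding c_def by (intro minus.prob_block_sup_le) auto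
  qed
  have cnt: "(\<Sum>k<m. near_ind y k) \<le> (4 * \<Gamma> * u + 1) * Nb" for y
  proof -
    have "(\<Sum>k<m. near_ind y k) = real (card {k\<in>{..<m}. \<bar>real k - (x + u * y)\<bar> < 2 * \<Gamma> * u}) * Nb"
      unfolding near_ind_def by (simp add: sum.If_cases Int_def)
    also have "\<dots> \<le> (2 * (2 * \<Gamma> * u) + 1) * Nb" using \<Gamma> u Nb by (intro mult_right_mono card_near_real_le) auto
    finally show ?thesis by (simp add: mult.assoc)
  qed
  have "(\<Sum>k<m. prob (?A \<inter> minus.block_sup (1 / u) ((real k - x) / u) u)) \<le> (\<Sum>k<m. near_ind a k + near_ind b k + Cf * \<psi> ^ 3)"
    by (intro sum_mono one)
  also have "\<dots> = (\<Sum>k<m. near_ind a k) + (\<Sum>k<m. near_ind b k) + real m * (Cf * \<psi> ^ 3)"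
    by (simp add: sum.distrib)
  also have "\<dots> \<le> (4 * \<Gamma> * u + 1) * Nb + (4 * \<Gamma> * u + 1) * Nb + (4 * \<Gamma> * u + 2 * D * \<nu> / \<psi> + 2) * (Cf * \<psi> ^ 3)"
    using m Cf \<psi> by (intro add_mono cnt mult_right_mono) auto
  also have "(4 * \<Gamma> * u + 2 * D * \<nu> / \<psi> + 2) * (Cf * \<psi> ^ 3) = (4 * \<Gamma> * u + 2) * (Cf * \<psi> ^ 3) + 2 * D * \<nu> * Cf * \<psi>\<^sup>2"
  proof -
    have "2 * D * \<nu> / \<psi> * (Cf * \<psi> ^ 3) = 2 * D * \<nu> * Cf * \<psi>\<^sup>2" using \<psi> by (simp add: power2_eq_square power3_eq_cube)
    then show ?thesis by (simp only: distrib_right)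
  qed
  finally show ?thesis by (simp add: algebra_simps)
qed

end

section \<open>High excursions on both sides of the origin\<close>

context normal_process begin

text \<open>Two windows of \<open>n\<close> grid points of spacing \<open>D / u\<close>, with \<open>n * mills u\<close> between \<open>\<nu> / 2\<close> and \<open>\<nu>\<close>, are placed at distance \<open>2 * exp (\<kappa> * u\<^sup>2)\<close> on both sides of the origin.
By the Bonferroni inequality, with probability of order \<open>\<nu>\<^sup>2\<close> some point of each window exceeds \<open>u\<close> and no block in between goes below \<open>- u\<close>: first \<open>D\<close>
is taken large, which makes neighbouring exceedances rare in comparison with single ones, then \<open>\<nu>\<close> small, which makes a third event anywhere in the windows rare.
The event is given as a measurable predicate \<open>Q\<close> of the path so that it can be combined with the independent second process.\<close>

lemma same_sign_exit:
  "\<exists>c>0. eventually (\<lambda>u. \<exists>Q. Measurable.pred path_space Q \<and> c \<le> \<P>(\<omega> in M. Q (\<lambda>t. X t \<omega>)) \<and>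
    (\<forall>p. continuous_on UNIV p \<longrightarrow> Q p \<longrightarrow>
      (\<exists>a b. a \<le> - u \<and> u \<le> b \<and> p a > u \<and> p b > u \<and> (\<forall>t\<in>{a..b}. - u \<le> p t)))) at_top"
proof -
  interpret minus: normal_process M "\<lambda>t \<omega>. - X t \<omega>" \<rho> K by (rule minus_process)
  obtain T where T: "T > 0" "\<And>s. s > 0 \<Longrightarrow> s / (T + s) \<le> v s" using v_lower by auto
  obtain c0 where c0: "c0 > 0" "c0 \<le> 1" "\<And>t. c0 \<le> 1 + \<rho> t" using correlation_bounded_below by blast
  \<comment> \<open>Near blocks gain \<open>exp (- c0 * u\<^sup>2 / 8)\<close>, and near points \<open>exp (- u\<^sup>2 / 64)\<close>; the range \<open>exp (\<kappa> * u\<^sup>2)\<close> must be negligible against both.\<close>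
  define \<kappa> where "\<kappa> = c0 / 128"
  have \<kappa>: "\<kappa> > 0" using c0 by (simp add: \<kappa>_def)
  obtain CN where CN: "CN > 0" and evN: "eventually (\<lambda>u. \<forall>a b c n. far_from u b a \<and> (\<forall>l\<in>{..2^n}. far_from u b (c + real l * (1 / u) / 2^n)) \<longrightarrow>
    \<P>(\<omega> in M. X b \<omega> > u \<and> X a \<omega> > u \<and> (\<exists>l\<in>{..2^n}. - X (c + real l * (1 / u) / 2^n) \<omega> > u))
      \<le> mills u * (CN * exp (- (1 + c0 / 4) * u\<^sup>2 / 2)) + (mills u) ^ 3) at_top"
    using two_high_one_low_near[OF c0] by blast
  define Cf where "Cf = low_far_const"
  have Cf: "Cf > 0" unfolding Cf_def low_far_const_def by (intro add_nonneg_pos mult_nonneg_nonneg add_nonneg_nonneg) auto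
  define C where "C = (4 * exp 4 + 1) * (2 * exp 4 :: real)\<^sup>2"
  have C: "C > 0" unfolding C_def by (intro mult_pos_pos add_pos_pos) auto
  define c1 where "c1 = pair_const"
  have c1: "c1 > 0" by (simp add: c1_def pair_const_def)
  \<comment> \<open>The decay ratio of exceedances along a grid of spacing \<open>D / u\<close>.\<close>
  define qf where "qf D = exp (- (D\<^sup>2 / (64 * T\<^sup>2)))" for D
  have "((\<lambda>D. 16 * exp 4 * (qf D / (1 - qf D))) \<longlongrightarrow> 0) at_top"
    unfolding qf_def using T(1) by real_asymp
  then have "eventually (\<lambda>D. 16 * exp 4 * (qf D / (1 - qf D)) < c1 / 8) at_top"
    by (rule order_tendstoD) (use c1 in simp)
  then have "eventually (\<lambda>D. D > 0 \<and> 16 * exp 4 * (qf D / (1 - qf D)) \<le> c1 / 8) at_top"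
    using eventually_gt_at_top[of 0] by eventually_elim simp
  then obtain D where D: "D > 0" "16 * exp 4 * (qf D / (1 - qf D)) \<le> c1 / 8"
    by (auto simp: eventually_at_top_linorder)
  define q where "q = qf D"
  \<comment> \<open>Of the main term \<open>c1\<close>, four error terms take at most \<open>c1 / 8\<close> each.\<close>
  define \<nu> where "\<nu> = c1 / (8 * (2 * (2 * C + 1) + 2 * D * Cf))"
  have den: "2 * (2 * C + 1) + 2 * D * Cf > 0" using C D Cf by (intro add_pos_pos mult_pos_pos) auto
  have "0 < x \<Longrightarrow> c1 / (8 * x) > 0 \<and> x * (c1 / (8 * x)) = c1 / 8" for x using c1 by simp
  from this[OF den] have \<nu>: "\<nu> > 0" "(2 * (2 * C + 1) + 2 * D * Cf) * \<nu> = c1 / 8"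
    unfolding \<nu>_def by blast+
  define \<Gamma> where "\<Gamma> u = exp (\<kappa> * u\<^sup>2)" for u :: real
  define o1 where "o1 u = (2 * \<Gamma> u * u / D + 1) * exp (- u\<^sup>2 / 64)" for u
  define Nb where "Nb u = mills u * (CN * exp (- (1 + c0 / 4) * u\<^sup>2 / 2)) + (mills u) ^ 3" for u
  define o2 where "o2 u = 2 * (4 * \<Gamma> u * u + 1) * Nb u + (4 * \<Gamma> u * u + 2) * (Cf * (mills u) ^ 3)" for u
  have ev1: "eventually (\<lambda>u. 8 * exp 4 * o1 u \<le> c1 / 8) at_top"
  proof -
    have "((\<lambda>u. 8 * exp 4 * ((2 * exp (k * u\<^sup>2) * u / D + 1) * exp (- u\<^sup>2 / 64))) \<longlongrightarrow> 0) at_top" if "0 < k" "k < 1/64" for k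
      using that D(1) by real_asymp
    from this[of \<kappa>] have "((\<lambda>u. 8 * exp 4 * o1 u) \<longlongrightarrow> 0) at_top"
      unfolding o1_def \<Gamma>_def using c0 \<kappa> by (auto simp: \<kappa>_def)
    then have "eventually (\<lambda>u. 8 * exp 4 * o1 u < c1 / 8) at_top" by (rule order_tendstoD) (use c1 in simp)
    then show ?thesis by eventually_elim simp
  qed
  have ev2: "eventually (\<lambda>u. o2 u \<le> (c1 / 8) * (mills u)\<^sup>2) at_top"
  proof -
    have lim: "((\<lambda>u. 2 * (4 * exp (k * u\<^sup>2) * u + 1) * (u * (CN * exp (- (32 * k) * u\<^sup>2 / 2)) + exp (- u\<^sup>2 / 2) / u)
        + (4 * exp (k * u\<^sup>2) * u + 2) * (Cf * (exp (- u\<^sup>2 / 2) / u))) \<longlongrightarrow> 0) at_top" if "0 < k" "k < 1/64" for k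
    proof -
      have A: "((\<lambda>u. 2 * (4 * exp (k * u\<^sup>2) * u + 1) * (u * (CN * exp (- (32 * k) * u\<^sup>2 / 2)))) \<longlongrightarrow> 0) at_top"
        using that CN by real_asymp
      have B: "((\<lambda>u. 2 * (4 * exp (k * u\<^sup>2) * u + 1) * (exp (- u\<^sup>2 / 2) / u)) \<longlongrightarrow> 0) at_top"
        using that by real_asymp
      have C: "((\<lambda>u. (4 * exp (k * u\<^sup>2) * u + 2) * (Cf * (exp (- u\<^sup>2 / 2) / u))) \<longlongrightarrow> 0) at_top"
        using that Cf by real_asymp
      show ?thesis using tendsto_add[OF tendsto_add[OF A B] C] by (simp add: distrib_left)
    qed
    have "eventually (\<lambda>u. 2 * (4 * exp (\<kappa> * u\<^sup>2) * u + 1) * (u * (CN * exp (- (32 * \<kappa>) * u\<^sup>2 / 2)) + exp (- u\<^sup>2 / 2) / u)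
        + (4 * exp (\<kappa> * u\<^sup>2) * u + 2) * (Cf * (exp (- u\<^sup>2 / 2) / u)) < c1 / 8) at_top"
      by (rule order_tendstoD(2)[OF lim]) (use c0 \<kappa> c1 in \<open>auto simp: \<kappa>_def\<close>)
    then show ?thesis using eventually_gt_at_top[of 0]
    proof eventually_elim
      case (elim u)
      define \<psi> where "\<psi> = mills u"
      have \<psi>: "\<psi> > 0" "\<psi> = exp (- u\<^sup>2 / 2) / u" using elim mills_pos by (auto simp: \<psi>_def mills_def)
      have e: "exp (- (1 + c0 / 4) * u\<^sup>2 / 2) = \<psi> * (u * exp (- (32 * \<kappa>) * u\<^sup>2 / 2))"
      proof -
        have "- (1 + c0 / 4) * u\<^sup>2 / 2 = - u\<^sup>2 / 2 + - (32 * \<kappa>) * u\<^sup>2 / 2" by (simp add: \<kappa>_def field_simps)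
        then have "exp (- (1 + c0 / 4) * u\<^sup>2 / 2) = exp (- u\<^sup>2 / 2) * exp (- (32 * \<kappa>) * u\<^sup>2 / 2)" by (simp only: exp_add)
        then show ?thesis using elim by (simp add: \<psi>(2))
      qed
      have "o2 u = \<psi>\<^sup>2 * (2 * (4 * \<Gamma> u * u + 1) * (u * (CN * exp (- (32 * \<kappa>) * u\<^sup>2 / 2)) + \<psi>) + (4 * \<Gamma> u * u + 2) * (Cf * \<psi>))"
        unfolding o2_def Nb_def e \<psi>_def[symmetric] by (simp add: power2_eq_square power3_eq_cube algebra_simps)
      also have "\<dots> \<le> \<psi>\<^sup>2 * (c1 / 8)"
        using elim(1) unfolding \<Gamma>_def \<psi>(2)[symmetric] by (intro mult_left_mono) auto
      finally show ?case by (simp add: \<psi>_def mult.commute)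
    qed
  qed
  have evT: "eventually (\<lambda>u. \<forall>a a'. \<P>(\<omega> in M. X a \<omega> > u - 4 / u \<and> X a' \<omega> > u - 4 / u)
      \<le> 2 * exp 4 * mills u * exp (- (u\<^sup>2 / 16) * (\<bar>a - a'\<bar> / (T + \<bar>a - a'\<bar>))\<^sup>2)) at_top"
    by (rule two_exceed_shifted[OF T])
  have evG: "eventually (\<lambda>u. \<Gamma> u \<ge> u) at_top" unfolding \<Gamma>_def using \<kappa> by real_asymp
  have evL: "eventually (\<lambda>u. \<nu> / mills u \<ge> 1) at_top"
  proof -
    have "((\<lambda>u::real. exp (- u\<^sup>2 / 2) / u) \<longlongrightarrow> 0) at_top" by real_asymp
    then have "eventually (\<lambda>u. mills u < \<nu>) at_top" unfolding mills_def using \<nu>(1) by (rule order_tendstoD)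
    then show ?thesis using eventually_gt_at_top[of 0]
      by eventually_elim (use mills_pos in \<open>auto simp: field_simps\<close>)
  qed
  show ?thesis
  proof (intro exI[of _ "c1 / 8 * \<nu>\<^sup>2"] conjI)
    show "c1 / 8 * \<nu>\<^sup>2 > 0" using c1 \<nu> by simp
    show "eventually (\<lambda>u. \<exists>Q. Measurable.pred path_space Q \<and> c1 / 8 * \<nu>\<^sup>2 \<le> \<P>(\<omega> in M. Q (\<lambda>t. X t \<omega>)) \<and>
      (\<forall>p. continuous_on UNIV p \<longrightarrow> Q p \<longrightarrow>
      (\<exists>a b. a \<le> - u \<and> u \<le> b \<and> p a > u \<and> p b > u \<and> (\<forall>t\<in>{a..b}. - u \<le> p t)))) at_top"
      using evL evG ev1 ev2 evN two_high_one_low_far three_exceed evT two_exceed_shifted_far[OF \<kappa>]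
        eventually_far[OF \<kappa>] pair_exceed_lower eventually_levels
    proof eventually_elim
      case (elim u)
      define \<psi> where "\<psi> = mills u"
      have \<psi>: "\<psi> > 0" using elim by (auto simp: \<psi>_def)
      have u: "u \<ge> 4" using elim by auto
      define G where "G = \<Gamma> u"
      have G: "G \<ge> u" "G \<ge> 1" using elim u by (auto simp: G_def)
      define n where "n = nat \<lfloor>\<nu> / \<psi>\<rfloor>"
      have n: "real n * \<psi> \<le> \<nu>" "real n * \<psi> \<ge> \<nu> / 2"
      proof -
        have "real n \<le> \<nu> / \<psi>" unfolding n_def using \<nu> \<psi> by simp
        then show "real n * \<psi> \<le> \<nu>" using \<psi> by (simp add: pos_le_divide_eq)
        have "\<nu> / \<psi> / 2 \<le> real n" unfolding n_def using elim(1) by (intro half_le_floor) (simp add: \<psi>_def)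
        then show "real n * \<psi> \<ge> \<nu> / 2" using \<psi> by (simp add: field_simps)
      qed
      \<comment> \<open>Points of different windows, and all points of a window and the origin, are further apart than the range \<open>G\<close> of correlations, which is at least \<open>u\<close>.\<close>
      define a where "a i = - (2 * G + real i * (D / u))" for i :: nat
      define b where "b i = 2 * G + real i * (D / u)" for i :: nat
      have Du: "D / u > 0" using D u by simp
      have Dn: "0 \<le> real i * (D / u)" for i :: nat
        by (rule mult_nonneg_nonneg[OF of_nat_0_le_iff less_imp_le[OF Du]])
      have apt: "\<bar>a i - a j\<bar> = \<bar>real i - real j\<bar> * (D / u)" and bpt: "\<bar>b i - b j\<bar> = \<bar>real i - real j\<bar> * (D / u)" for i j
      proof -
        have "a i - a j = - ((real i - real j) * (D / u))" "b i - b j = (real i - real j) * (D / u)"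
          by (simp_all add: a_def b_def algebra_simps diff_divide_distrib)
        then show "\<bar>a i - a j\<bar> = \<bar>real i - real j\<bar> * (D / u)" "\<bar>b i - b j\<bar> = \<bar>real i - real j\<bar> * (D / u)"
          using Du by (simp_all only: abs_minus_cancel abs_mult abs_of_pos)
      qed
      have ab: "\<bar>a i - b j\<bar> \<ge> 4 * G" for i j
      proof -
        show ?thesis using Dn[of i] Dn[of j] unfolding a_def b_def using G by linarith
      qed
      have corr: "far_from u p q" if "\<bar>p - q\<bar> \<ge> G" for p q using elim that by (simp add: G_def \<Gamma>_def)
      have ffa: "far_from u (b j) (a i)" and ffb: "far_from u (a i) (b j)" for i j
        using ab[of i j] G by (auto intro!: corr)
      \<comment> \<open>The blocks of length \<open>1 / u\<close> numbered from \<open>- m0\<close> to \<open>m0\<close> cover both windows and all times between them.\<close>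
      define m0 where "m0 = nat \<lceil>u * (2 * G + real n * (D / u))\<rceil>"
      define m where "m = 2 * m0"
      have m0: "real m0 \<ge> u * (2 * G + real n * (D / u))" "real m0 \<le> u * (2 * G + real n * (D / u)) + 1"
      proof -
        have "0 \<le> u * (2 * G + real n * (D / u))" using u G Dn[of n] by (intro mult_nonneg_nonneg) linarith+
        then show "real m0 \<ge> u * (2 * G + real n * (D / u))" "real m0 \<le> u * (2 * G + real n * (D / u)) + 1"
          unfolding m0_def by simp_all
      qed
      have m: "real m \<le> 4 * G * u + 2 * D * \<nu> / \<psi> + 2"
      proof -
        have "real n \<le> \<nu> / \<psi>" using n \<psi> by (simp add: pos_le_divide_eq)
        then have "D * real n \<le> D * (\<nu> / \<psi>)" using D by (intro mult_left_mono) auto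
        moreover have "u * (2 * G + real n * (D / u)) = 2 * G * u + D * real n" using u by (simp add: field_simps)
        ultimately show ?thesis using m0 unfolding m_def by simp
      qed
      define W where "W k = minus.block_sup (1 / u) ((real k - real m0) / u) u" for k :: nat
      define A where "A i = {\<omega>\<in>space M. X (a i) \<omega> > u}" for i
      define B where "B j = {\<omega>\<in>space M. X (b j) \<omega> > u}" for j
      define c where "c = \<psi>\<^sup>2 * (c1 / 2)"
      have main: "(real n)\<^sup>2 * c \<le> prob ((\<Union>i<n. \<Union>j<n. A i \<inter> B j) - (\<Union>k<m. W k))"
      proof (rule bonferroni_exact_pairs)
        show "A i \<in> sets M" "B i \<in> sets M" "W i \<in> sets M" for i unfolding A_def B_def W_def by measurable
        fix i j assume ij: "i < n" "j < n"
        define S where "S = \<psi>\<^sup>2 * (8 * exp 4 * (q / (1 - q)) + 4 * exp 4 * ((2 * G * u / D + 1) * exp (- u\<^sup>2 / 64)) + (2 * C + 1) * \<nu>)"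
        have three: "\<P>(\<omega> in M. X y \<omega> > u \<and> X x \<omega> > u \<and> X x' \<omega> > u) \<le> 2 * \<psi> * \<P>(\<omega> in M. X x \<omega> > u - 4 / u \<and> X x' \<omega> > u - 4 / u) + \<psi> ^ 3"
          if "far_from u y x" "far_from u y x'" for x x' y
          using elim(7) that unfolding \<psi>_def by blast
        have nearp: "\<P>(\<omega> in M. X x \<omega> > u - 4 / u \<and> X x' \<omega> > u - 4 / u) \<le> 2 * exp 4 * \<psi> * exp (- (u\<^sup>2 / 16) * (\<bar>x - x'\<bar> / (T + \<bar>x - x'\<bar>))\<^sup>2)" for x x'
          using elim(8) unfolding \<psi>_def by blast
        have farp: "\<P>(\<omega> in M. X x \<omega> > u - 4 / u \<and> X x' \<omega> > u - 4 / u) \<le> C * \<psi>\<^sup>2" if "\<bar>x - x'\<bar> \<ge> G" for x x'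
        proof -
          have "\<P>(\<omega> in M. X x \<omega> > u - 4 / u \<and> X x' \<omega> > u - 4 / u) \<le> (4 * exp 4 + 1) * (2 * exp 4 * mills u)\<^sup>2"
            using elim(9) that unfolding G_def \<Gamma>_def by blast
          also have "\<dots> = C * \<psi>\<^sup>2" by (simp add: C_def \<psi>_def power_mult_distrib)
          finally show ?thesis .
        qed
        have SA: "(\<Sum>i'\<in>{..<n} - {i}. prob (A i \<inter> B j \<inter> A i')) \<le> S"
        proof -
          have "A i \<inter> B j \<inter> A i' = {\<omega>\<in>space M. X (b j) \<omega> > u \<and> X (a i) \<omega> > u \<and> X (a i') \<omega> > u}" for i'
            unfolding A_def B_def by auto
          then show ?thesis unfolding S_def
            using sum_competing_high_points[OF T(1) D(1) \<kappa> _ \<psi>_def \<psi> q_def[unfolded qf_def] three nearp farp _ _ n(1) apt ffa ij(1), of j] u C G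
            by simp
        qed
        have SB: "(\<Sum>j'\<in>{..<n} - {j}. prob (A i \<inter> B j \<inter> B j')) \<le> S"
        proof -
          have "A i \<inter> B j \<inter> B j' = {\<omega>\<in>space M. X (a i) \<omega> > u \<and> X (b j) \<omega> > u \<and> X (b j') \<omega> > u}" for j'
            unfolding A_def B_def by auto
          then show ?thesis unfolding S_def
            using sum_competing_high_points[OF T(1) D(1) \<kappa> _ \<psi>_def \<psi> q_def[unfolded qf_def] three nearp farp _ _ n(1) bpt ffb ij(2), of i] u C G
            by simp
        qed
        have SW: "(\<Sum>k<m. prob (A i \<inter> B j \<inter> W k)) \<le> o2 u + 2 * D * \<nu> * Cf * \<psi>\<^sup>2"
        proof -
          have eq: "A i \<inter> B j = {\<omega>\<in>space M. X (a i) \<omega> > u \<and> X (b j) \<omega> > u}" unfolding A_def B_def by auto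
          have "(\<Sum>k<m. prob (A i \<inter> B j \<inter> W k)) \<le> 2 * (4 * G * u + 1) * Nb u + (4 * G * u + 2) * (Cf * \<psi> ^ 3) + 2 * D * \<nu> * Cf * \<psi>\<^sup>2"
            unfolding eq W_def
          proof (rule sum_low_blocks[OF _ \<psi> G(2) m D(1) \<nu>(1) _ _ corr ab])
            show "u \<ge> 1" using u by simp
            show "Nb u \<ge> 0" unfolding Nb_def using \<psi> CN by (simp add: \<psi>_def)
            show "Cf \<ge> 0" using Cf by simp
          next
            fix x y c l
            assume "far_from u y x" "\<And>k. k \<le> 2^l \<Longrightarrow> far_from u y (c + real k * (1 / u) / 2^l)"
            then show "\<P>(\<omega> in M. X y \<omega> > u \<and> X x \<omega> > u \<and> (\<exists>k\<in>{..2^l}. - X (c + real k * (1 / u) / 2^l) \<omega> > u)) \<le> Nb u"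
              unfolding Nb_def by (intro elim(5)[rule_format]) simp
          next
            fix x y c l
            assume "far_from u y x" "\<And>k. k \<le> 2^l \<Longrightarrow> far_from u y (c + real k * (1 / u) / 2^l) \<and> far_from u x (c + real k * (1 / u) / 2^l)"
            then show "\<P>(\<omega> in M. X y \<omega> > u \<and> X x \<omega> > u \<and> (\<exists>k\<in>{..2^l}. - X (c + real k * (1 / u) / 2^l) \<omega> > u)) \<le> Cf * \<psi> ^ 3"
              unfolding Cf_def \<psi>_def by (intro elim(6)[rule_format]) simp
          qed
          then show ?thesis unfolding o2_def G_def \<psi>_def by simp
        qed
        have PAB: "c1 * \<psi>\<^sup>2 \<le> prob (A i \<inter> B j)"
        proof -
          have "A i \<inter> B j = {\<omega>\<in>space M. X (b j) \<omega> > u \<and> X (a i) \<omega> > u}" unfolding A_def B_def by auto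
          then show ?thesis using elim(11) ffa[of j i] unfolding c1_def \<psi>_def by simp
        qed
        have "2 * S + (o2 u + 2 * D * \<nu> * Cf * \<psi>\<^sup>2) \<le> \<psi>\<^sup>2 * (c1 / 2)"
        proof -
          have "2 * (P * (8 * e * x + 4 * e * y + (2 * C + 1) * N)) + 2 * D * N * Cf * P
              = P * (16 * e * x + 8 * e * y + (2 * (2 * C + 1) + 2 * D * Cf) * N)" for P e x y N :: real
            by (simp add: algebra_simps)
          then have "2 * S + 2 * D * \<nu> * Cf * \<psi>\<^sup>2 = \<psi>\<^sup>2 * (16 * exp 4 * (q / (1 - q)) + 8 * exp 4 * o1 u + (2 * (2 * C + 1) + 2 * D * Cf) * \<nu>)"
            unfolding S_def o1_def G_def[symmetric] .
          also have "\<dots> \<le> \<psi>\<^sup>2 * (c1 / 8 + c1 / 8 + c1 / 8)"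
            using D(2) elim(3) unfolding \<nu>(2) q_def by (intro mult_left_mono add_mono) auto
          finally have "2 * S + 2 * D * \<nu> * Cf * \<psi>\<^sup>2 \<le> \<psi>\<^sup>2 * (c1 / 8 + c1 / 8 + c1 / 8)" .
          moreover have "o2 u \<le> \<psi>\<^sup>2 * (c1 / 8)" using elim(4) by (simp add: \<psi>_def mult.commute)
          moreover have "\<psi>\<^sup>2 * (c1 / 8 + c1 / 8 + c1 / 8) + \<psi>\<^sup>2 * (c1 / 8) = \<psi>\<^sup>2 * (c1 / 2)" by (simp add: algebra_simps)
          ultimately show ?thesis by linarith
        qed
        moreover have "c1 * \<psi>\<^sup>2 - \<psi>\<^sup>2 * (c1 / 2) = c" by (simp add: c_def)
        ultimately show "c \<le> prob (A i \<inter> B j)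
          - (\<Sum>i'\<in>{..<n} - {i}. prob (A i \<inter> B j \<inter> A i')) - (\<Sum>j'\<in>{..<n} - {j}. prob (A i \<inter> B j \<inter> B j'))
          - (\<Sum>k<m. prob (A i \<inter> B j \<inter> W k))"
          using SA SB SW PAB by linarith
      qed
      \<comment> \<open>Low blocks are detected on dyadic points, which keeps the predicate measurable.\<close>
      define Q where "Q p \<longleftrightarrow> (\<exists>i\<in>{..<n}. \<exists>j\<in>{..<n}. p (a i) > u \<and> p (b j) > u) \<and>
        \<not> (\<exists>k\<in>{..<m}. \<exists>l. \<exists>r\<in>{..2^l}. - p ((real k - real m0) / u + real r * (1 / u) / 2^l) > u)" for p :: "real \<Rightarrow> real"
      show ?case
      proof (intro exI[of _ Q] conjI allI impI)
        show "Measurable.pred path_space Q" unfolding Q_def by measurable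
        have "c1 / 8 * \<nu>\<^sup>2 = (\<nu> / 2)\<^sup>2 * (c1 / 2)" by (simp add: power_divide)
        also have "\<dots> \<le> (real n * \<psi>)\<^sup>2 * (c1 / 2)" using n \<nu> c1 by (intro mult_right_mono power_mono) auto
        also have "\<dots> = (real n)\<^sup>2 * c" by (simp add: c_def power_mult_distrib)
        also note main
        also have "(\<Union>i<n. \<Union>j<n. A i \<inter> B j) - (\<Union>k<m. W k) = {\<omega>\<in>space M. Q (\<lambda>t. X t \<omega>)}"
          unfolding Q_def A_def B_def W_def minus.block_sup_def minus.block_exceeds_def by auto
        finally show "c1 / 8 * \<nu>\<^sup>2 \<le> \<P>(\<omega> in M. Q (\<lambda>t. X t \<omega>))" .
      next
        fix p :: "real \<Rightarrow> real" assume p: "continuous_on UNIV p" "Q p"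
        then obtain i j where ij: "i < n" "j < n" "p (a i) > u" "p (b j) > u" unfolding Q_def by auto
        have low: "- u \<le> p t" if t: "a i \<le> t" "t \<le> b j" for t
        proof -
          define x where "x = t * u + real m0"
          have "real i * (D / u) < real n * (D / u)" "real j * (D / u) < real n * (D / u)" 
            using mult_strict_right_mono[OF _ Du, of "real i" "real n"] mult_strict_right_mono[OF _ Du, of "real j" "real n"] ij by simp_all
          moreover define Z where "Z = 2 * G + real n * (D / u)"
          ultimately have t1: "- Z \<le> t" "t < Z" using t unfolding a_def b_def by linarith+
          have "- Z * u \<le> t * u" "t * u < Z * u"
            using mult_right_mono[OF t1(1), of u] mult_strict_right_mono[OF t1(2), of u] u by simp_all
          moreover have "Z * u \<le> real m0" using m0(1) unfolding Z_def by (simp only: mult.commute)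
          ultimately have x: "0 \<le> x" "x < real m" unfolding x_def m_def by simp_all
          define k where "k = nat \<lfloor>x\<rfloor>"
          have k: "real k \<le> x" "x < real k + 1" unfolding k_def using x by simp_all
          then have "k < m" using x by (metis le_less_trans of_nat_less_iff)
          have "- p t \<le> u"
          proof (rule le_on_interval_of_dyadic[where p="\<lambda>t. - p t" and c="(real k - real m0) / u" and h="1 / u"])
            show "continuous_on UNIV (\<lambda>t. - p t)" using p by (intro continuous_intros)
            show "- p ((real k - real m0) / u + real r * (1 / u) / 2 ^ l) \<le> u" if "r \<le> 2^l" for r l
            proof -
              have "k \<in> {..<m}" "r \<in> {..2^l}" using \<open>k < m\<close> that by auto
              then have "\<not> - p ((real k - real m0) / u + real r * (1 / u) / 2 ^ l) > u" using p(2) unfolding Q_def by blast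
              then show ?thesis by simp
            qed
            show "(real k - real m0) / u \<le> t" using k u unfolding x_def by (simp add: field_simps)
            show "t \<le> (real k - real m0) / u + 1 / u" using k u unfolding x_def by (simp add: field_simps)
          qed (use u in simp)
          then show ?thesis by simp
        qed
        have "a i \<le> - u" "u \<le> b j" using Dn[of i] Dn[of j] G u unfolding a_def b_def by linarith+
        then show "\<exists>a b. a \<le> - u \<and> u \<le> b \<and> p a > u \<and> p b > u \<and> (\<forall>t\<in>{a..b}. - u \<le> p t)"
          using ij low by (intro exI[of _ "a i"] exI[of _ "b j"]) auto
      qed
    qed
  qed
qed

end

section \<open>Normalisation of smooth stationary processes\<close>

text \<open>The density of a centred normal variable is at most \<open>1 / (2 * \<sigma>)\<close>.\<close>

lemma (in gaussian_space) small_ball: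
  assumes V: "V \<in> H" and var: "cov V V \<ge> \<tau>\<^sup>2" "\<tau> > 0" and B: "B \<ge> 0"
  shows "\<P>(x in M. \<bar>V x\<bar> \<le> B) \<le> B / \<tau>"
  using V
proof (cases rule: gauss_cases)
  case (2 \<sigma>)
  note [measurable] = meas[OF V]
  have "\<tau>\<^sup>2 \<le> \<sigma>\<^sup>2" using 2 var by (simp only: cov_self)
  then have \<sigma>: "\<tau> \<le> \<sigma>" by (rule power2_le_imp_le) (use 2 in simp)
  have dens: "normal_density 0 \<sigma> x \<le> 1 / (2 * \<sigma>)" for x
  proof -
    have "2 \<le> sqrt (2 * pi)" using pi_gt3 by (intro real_le_rsqrt) simp
    then have "2 * \<sigma> \<le> sqrt (2 * pi * \<sigma>\<^sup>2)" using 2(1) by (simp add: real_sqrt_mult)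
    then have "1 / sqrt (2 * pi * \<sigma>\<^sup>2) \<le> 1 / (2 * \<sigma>)" using 2(1) by (intro divide_left_mono) auto
    moreover have "1 / sqrt (2 * pi * \<sigma>\<^sup>2) * exp (- (x - 0)\<^sup>2 / (2 * \<sigma>\<^sup>2)) \<le> 1 / sqrt (2 * pi * \<sigma>\<^sup>2) * 1"
      by (intro mult_left_mono) auto
    ultimately show ?thesis unfolding normal_density_def by linarith
  qed
  have "emeasure M {x\<in>space M. \<bar>V x\<bar> \<le> B} = emeasure M (V -` {- B..B} \<inter> space M)"
    by (rule arg_cong[where f="emeasure M"]) (auto simp: abs_le_iff)
  also have "\<dots> = (\<integral>\<^sup>+x. ennreal (normal_density 0 \<sigma> x) * indicator {- B..B} x \<partial>lborel)"
    by (rule distributed_emeasure[OF 2(2)]) simp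
  also have "\<dots> \<le> (\<integral>\<^sup>+x. ennreal (1 / (2 * \<sigma>)) * indicator {- B..B} x \<partial>lborel)"
    by (intro nn_integral_mono mult_right_mono ennreal_leI dens) auto
  also have "\<dots> = ennreal (1 / (2 * \<sigma>)) * ennreal (2 * B)"
    using B by (subst nn_integral_cmult_indicator) auto
  also have "\<dots> = ennreal (B / \<sigma>)" using B 2(1) by (simp add: ennreal_mult[symmetric])
  finally have "\<P>(x in M. \<bar>V x\<bar> \<le> B) \<le> B / \<sigma>" using B 2(1) by (simp add: emeasure_eq_measure)
  also have "\<dots> \<le> B / \<tau>" using \<sigma> B var 2(1) by (intro divide_left_mono) auto
  finally show ?thesis .
qed (use var in \<open>simp add: cov_self\<close>)

lemma C2_smooth_continuous: "C2_smooth u \<Longrightarrow> continuous_on UNIV u"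
  unfolding C2_smooth_def by (meson DERIV_isCont continuous_at_imp_continuous_on)

context gaussian_space begin

text \<open>Almost sure convergence of the Gaussian difference quotients forces their variances to stay bounded: a family that is bounded by \<open>B\<close> with
probability above \<open>1/2\<close> cannot contain variables of standard deviation above \<open>2 * B\<close>, which are rarely that small.\<close>

lemma mean_square_lipschitz:
  assumes Y: "\<And>s. Y s \<in> H" and lim: "AE x in M. \<exists>l. ((\<lambda>s. Y s x / s) \<longlongrightarrow> l) (at 0)"
  shows "\<exists>C s0. s0 > 0 \<and> (\<forall>s. 0 < s \<and> s < s0 \<longrightarrow> cov (Y s) (Y s) \<le> (C * s)\<^sup>2)"
proof (rule ccontr)
  assume neg: "\<not> ?thesis"
  have "\<exists>s. 0 < s \<and> s < 1 / real (Suc n) \<and> cov (Y s) (Y s) > (real (Suc n) * s)\<^sup>2" for n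
    using neg by (metis not_le of_nat_0_less_iff zero_less_Suc zero_less_divide_1_iff)
  then obtain s where s: "\<And>n. 0 < s n" "\<And>n. s n < 1 / real (Suc n)" "\<And>n. cov (Y (s n)) (Y (s n)) > (real (Suc n) * s n)\<^sup>2"
    by metis
  note [measurable] = meas[OF Y]
  have s0: "s \<longlonglongrightarrow> 0"
  proof (rule tendsto_sandwich[of "\<lambda>_. 0" s sequentially "\<lambda>n. 1 / real (Suc n)"])
    show "(\<lambda>n. 1 / real (Suc n)) \<longlonglongrightarrow> 0" by (rule LIMSEQ_Suc[OF lim_1_over_n])
  qed (use s(1) less_imp_le[OF s(2)] in \<open>auto intro!: always_eventually less_imp_le\<close>)
  have at0: "filterlim s (at 0) sequentially"
    using s0 s(1) by (auto simp: filterlim_at less_imp_neq[symmetric] intro!: always_eventually)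
  define E where "E B = {x\<in>space M. \<forall>n. \<bar>Y (s n) x / s n\<bar> \<le> real B}" for B :: nat
  have [measurable]: "E B \<in> sets M" for B unfolding E_def by measurable
  have inc: "incseq E" unfolding E_def incseq_def by (auto intro: order_trans)
  have "AE x in M. x \<in> (\<Union>B. E B)"
    using lim AE_space
  proof eventually_elim
    case (elim x)
    then obtain l where "((\<lambda>s. Y s x / s) \<longlongrightarrow> l) (at 0)" by blast
    then have "(\<lambda>n. Y (s n) x / s n) \<longlonglongrightarrow> l" by (rule filterlim_compose[OF _ at0])
    then have "Bseq (\<lambda>n. Y (s n) x / s n)" by (intro convergent_imp_Bseq) (auto simp: convergent_def)
    then obtain c where "\<And>n. \<bar>Y (s n) x / s n\<bar> \<le> c" unfolding Bseq_def by auto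
    moreover obtain B :: nat where "c \<le> real B" using real_arch_simple by blast
    ultimately have "x \<in> E B" using elim unfolding E_def by (auto intro: order_trans)
    then show ?case by blast
  qed
  then have "prob (\<Union>B. E B) = 1" by (intro prob_eq_1[THEN iffD2]) auto
  moreover have "(\<lambda>B. prob (E B)) \<longlonglongrightarrow> prob (\<Union>B. E B)"
    using inc by (intro finite_Lim_measure_incseq) auto
  ultimately have "eventually (\<lambda>B. prob (E B) > 1/2) sequentially"
    using order_tendstoD(1)[of "\<lambda>B. prob (E B)" 1 sequentially "1/2"] by simp
  then obtain B where B: "prob (E B) > 1/2" by (auto simp: eventually_sequentially)
  \<comment> \<open>Then \<open>B / Suc n\<close> is below \<open>1/2\<close>.\<close>
  define n where "n = 2 * B"
  have "prob (E B) \<le> \<P>(x in M. \<bar>Y (s n) x\<bar> \<le> real B * s n)"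
  proof (rule finite_measure_mono)
    have "\<bar>Y (s n) x\<bar> \<le> real B * s n" if "x \<in> E B" for x
    proof -
      have "\<bar>Y (s n) x / s n\<bar> \<le> real B" using that unfolding E_def by blast
      then show ?thesis using s(1)[of n] by (simp add: abs_divide pos_divide_le_eq)
    qed
    then show "E B \<subseteq> {x\<in>space M. \<bar>Y (s n) x\<bar> \<le> real B * s n}" by (auto simp: E_def)
  qed auto
  also have "\<dots> \<le> (real B * s n) / (real (Suc n) * s n)"
    using s(1)[of n] s(3)[of n] by (intro small_ball Y) auto
  also have "\<dots> = real B / real (Suc n)" using s(1)[of n] by (intro mult_divide_mult_cancel_right) simp
  also have "\<dots> \<le> 1/2" by (simp add: n_def field_simps)
  finally show False using B by simp
qed

end

lemma (in prob_space) stationary_covariance: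
  assumes m: "\<And>t. g t \<in> borel_measurable M" and st: "stationary_process M g"
  shows "expectation (\<lambda>\<omega>. g s \<omega> * g t \<omega>) = covariance_kernel M g (t - s)"
proof -
  note [measurable] = m
  have [measurable]: "(\<lambda>\<omega> t. g (t + h) \<omega>) \<in> measurable M path_space" for h
    by (rule measurable_PiM_single') auto
  have [measurable]: "(\<lambda>\<omega> t. g t \<omega>) \<in> measurable M path_space"
    by (rule measurable_PiM_single') auto
  have "expectation (\<lambda>\<omega>. g s \<omega> * g t \<omega>) = (\<integral>z. z 0 * z (t - s) \<partial>distr M path_space (\<lambda>\<omega> t. g (t + s) \<omega>))"
    by (subst integral_distr) auto
  also have "distr M path_space (\<lambda>\<omega> t. g (t + s) \<omega>) = distr M path_space (\<lambda>\<omega> t. g (t + 0) \<omega>)"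
    using st unfolding stationary_process_def by simp
  also have "(\<integral>z. z 0 * z (t - s) \<partial>distr M path_space (\<lambda>\<omega> t. g (t + 0) \<omega>)) = covariance_kernel M g (t - s)"
    unfolding covariance_kernel_def by (subst integral_distr) auto
  finally show ?thesis .
qed

text \<open>The variance is positive, since otherwise the process would vanish at all rational times and, by continuity, everywhere. Differentiability of the
paths at \<open>0\<close> gives the Lipschitz property near \<open>0\<close>, and boundedness of \<open>\<rho>\<close> extends it to all lags with a larger constant.\<close>

lemma (in prob_space) normalisation:
  assumes g: "gaussian_process M g" and c: "centred_process M g" and st: "stationary_process M g"
    and nz: "\<not> (AE \<omega> in M. \<forall>t. g t \<omega> = 0)" and sm: "AE \<omega> in M. C2_smooth (\<lambda>t. g t \<omega>)"
    and dec: "((\<lambda>t. covariance_kernel M g t * ln \<bar>t\<bar>) \<longlongrightarrow> 0) at_infinity"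
  shows "\<exists>\<sigma> \<rho> K. \<sigma> > 0 \<and> normal_process M (\<lambda>t \<omega>. g t \<omega> / \<sigma>) \<rho> K"
proof -
  interpret gs: gaussian_space M "finite_combinations g" by (rule gaussian_space_of_process[OF g c])
  note mem = process_mem_finite_combinations[of g]
  note [measurable] = gs.meas[OF mem]
  let ?k = "covariance_kernel M g"
  have cv: "gs.cov (g s) (g t) = ?k (t - s)" for s t
    unfolding gs.cov_def by (rule stationary_covariance[OF gs.meas[OF mem] st])
  have k0: "?k 0 > 0"
  proof (rule ccontr)
    assume "\<not> ?k 0 > 0"
    then have z: "gs.cov (g t) (g t) = 0" for t using gs.cov_self_nonneg[of "g t"] by (simp add: cv)
    have "AE \<omega> in M. g t \<omega> = 0" for t
      by (rule gs.gauss_cases[OF mem[of t]]) (use z[of t] in \<open>auto simp: gs.cov_self\<close>)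
    then have "AE \<omega> in M. \<forall>t\<in>\<rat>. g t \<omega> = 0" by (simp add: AE_ball_countable countable_rat)
    then have "AE \<omega> in M. \<forall>t. g t \<omega> = 0"
      using sm
    proof eventually_elim
      case (elim \<omega>)
      have "g t \<omega> = 0" for t
      proof (rule continuous_constant_on_closure[of \<rat> "\<lambda>t. g t \<omega>" 0])
        show "continuous_on (closure \<rat>) (\<lambda>t. g t \<omega>)"
          using C2_smooth_continuous[OF elim(2)] by (rule continuous_on_subset) simp
        show "t \<in> closure \<rat>" by (simp add: Rats_closure_real)
      qed (use elim in simp)
      then show ?case by blast
    qed
    then show False using nz by simp
  qed
  define \<sigma> where "\<sigma> = sqrt (?k 0)"
  have \<sigma>: "\<sigma> > 0" "\<sigma>\<^sup>2 = ?k 0" using k0 by (auto simp: \<sigma>_def)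
  define \<rho> where "\<rho> t = ?k t / ?k 0" for t
  have kev: "?k (- t) = ?k t" for t using cv[of 0 t] cv[of t 0] gs.cov_commute[of "g 0" "g t"] by simp
  have inc: "gs.cov (\<lambda>\<omega>. g s \<omega> - g 0 \<omega>) (\<lambda>\<omega>. g s \<omega> - g 0 \<omega>) = 2 * (?k 0 - ?k s)" for s
    using kev[of s] by (simp add: gs.cov_diff_self mem cv)
  have absk: "\<bar>?k t\<bar> \<le> ?k 0" for t
    using gs.abs_cov_le[OF mem[of 0] mem[of t]] k0 by (simp add: cv gs.nrm_def)
  have "\<exists>C s0. s0 > 0 \<and> (\<forall>s. 0 < s \<and> s < s0 \<longrightarrow> gs.cov (\<lambda>\<omega>. g s \<omega> - g 0 \<omega>) (\<lambda>\<omega>. g s \<omega> - g 0 \<omega>) \<le> (C * s)\<^sup>2)"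
  proof (rule gs.mean_square_lipschitz)
    show "AE \<omega> in M. \<exists>l. ((\<lambda>s. (g s \<omega> - g 0 \<omega>) / s) \<longlongrightarrow> l) (at 0)"
      using sm
    proof eventually_elim
      case (elim \<omega>)
      then obtain u' where "\<forall>t. ((\<lambda>t. g t \<omega>) has_real_derivative u' t) (at t)" unfolding C2_smooth_def by auto
      then have "((\<lambda>t. g t \<omega>) has_real_derivative u' 0) (at 0)" by simp
      then show ?case by (auto simp: has_field_derivative_iff)
    qed
  qed (intro gs.diff_mem mem)
  then obtain C s0 where C: "s0 > 0" "\<And>s. 0 < s \<Longrightarrow> s < s0 \<Longrightarrow> 2 * (?k 0 - ?k s) \<le> (C * s)\<^sup>2"
    unfolding inc by blast
  define K where "K = \<bar>C\<bar> / \<sigma> + 2 / s0"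
  have K: "K > 0" "K \<ge> \<bar>C\<bar> / \<sigma>" "K \<ge> 2 / s0" using C(1) \<sigma> by (auto simp: K_def add_nonneg_pos)
  have lip_pos: "2 * (1 - \<rho> t) \<le> (K * t)\<^sup>2" if t: "t > 0" for t
  proof (cases "t < s0")
    case True
    have "2 * (1 - \<rho> t) = 2 * (?k 0 - ?k t) / ?k 0" using k0 by (simp add: \<rho>_def diff_divide_distrib)
    also have "\<dots> \<le> (C * t)\<^sup>2 / ?k 0" using C(2)[OF t True] k0 by (intro divide_right_mono) auto
    also have "\<dots> = (\<bar>C\<bar> / \<sigma> * t)\<^sup>2" using \<sigma> by (simp add: power_mult_distrib power_divide)
    also have "\<dots> \<le> (K * t)\<^sup>2" using K t \<sigma> by (intro power_mono mult_right_mono) auto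
    finally show ?thesis .
  next
    case False
    have "- 1 \<le> \<rho> t" using absk[of t] k0 by (simp add: \<rho>_def pos_le_divide_eq abs_le_iff)
    then have "2 * (1 - \<rho> t) \<le> 2\<^sup>2" by simp
    also have "\<dots> \<le> (2 / s0 * t)\<^sup>2" using False C(1) by (intro power_mono) (auto simp: field_simps)
    also have "\<dots> \<le> (K * t)\<^sup>2" using K t C(1) by (intro power_mono mult_right_mono) auto
    finally show ?thesis .
  qed
  have "normal_process M (\<lambda>t \<omega>. g t \<omega> / \<sigma>) \<rho> K"
  proof
    show "gaussian_process M (\<lambda>t \<omega>. g t \<omega> / \<sigma>)"
      unfolding gaussian_process_def
    proof (intro allI impI)
      fix S :: "real set" and d :: "real \<Rightarrow> real" assume "finite S"
      then have "gaussian_rv M (\<lambda>\<omega>. \<Sum>t\<in>S. (d t / \<sigma>) * g t \<omega>)"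
        by (rule g[unfolded gaussian_process_def, rule_format])
      then show "gaussian_rv M (\<lambda>\<omega>. \<Sum>t\<in>S. d t * (g t \<omega> / \<sigma>))" by simp
    qed
    show "centred_process M (\<lambda>t \<omega>. g t \<omega> / \<sigma>)" using c unfolding centred_process_def by simp
    show "expectation (\<lambda>\<omega>. g s \<omega> / \<sigma> * (g t \<omega> / \<sigma>)) = \<rho> (t - s)" for s t
      using cv[of s t] \<sigma> unfolding gs.cov_def \<rho>_def by (simp add: power2_eq_square)
    show "\<rho> 0 = 1" using k0 by (simp add: \<rho>_def)
    have "((\<lambda>t. (?k t * ln \<bar>t\<bar>) / ?k 0) \<longlongrightarrow> 0 / ?k 0) at_infinity"
      using k0 by (intro tendsto_divide dec tendsto_const) simp
    then show "((\<lambda>t. \<rho> t * ln \<bar>t\<bar>) \<longlongrightarrow> 0) at_infinity" by (simp add: \<rho>_def)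
    show "K > 0" by fact
    show "2 * (1 - \<rho> t) \<le> (K * t)\<^sup>2" for t
    proof -
      consider "t > 0" | "t = 0" | "- t > 0" by linarith
      then show ?thesis
        using lip_pos[of t] lip_pos[of "- t"] kev[of t] k0 by cases (auto simp: \<rho>_def)
    qed
  qed
  then show ?thesis using \<sigma> by blast
qed

section \<open>A zero-one law for asymptotically uncorrelated families\<close>

context gaussian_space begin

text \<open>The double sum is the covariance of a linear combination of the family and its translate by \<open>r\<close>.\<close>

lemma exists_spacing:
  fixes \<gamma> :: "'b \<Rightarrow> 'b \<Rightarrow> real \<Rightarrow> real" and K :: "('b \<times> real) set"
  assumes dec: "\<And>b b'. ((\<gamma> b b') \<longlongrightarrow> 0) at_infinity" and e: "e > 0"
  shows "\<exists>N::nat. N > 0 \<and> (\<forall>r. \<bar>r\<bar> \<ge> real N \<longrightarrow>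
    \<bar>\<Sum>k\<in>K. \<Sum>k'\<in>K. c k * c k' * \<gamma> (fst k) (fst k') (snd k' - snd k + r)\<bar> < e)"
proof -
  have "((\<lambda>r. \<Sum>k\<in>K. \<Sum>k'\<in>K. c k * c k' * \<gamma> (fst k) (fst k') (snd k' - snd k + r)) \<longlongrightarrow> (\<Sum>k\<in>K. \<Sum>k'\<in>K. c k * c k' * 0)) at_infinity"
  proof (intro tendsto_sum tendsto_mult tendsto_const)
    fix k k' :: "'b \<times> real"
    have "filterlim (\<lambda>r::real. snd k' - snd k + r) at_infinity at_infinity"
      by (rule tendsto_add_filterlim_at_infinity[OF tendsto_const]) (rule filterlim_ident)
    then show "((\<lambda>r. \<gamma> (fst k) (fst k') (snd k' - snd k + r)) \<longlongrightarrow> 0) at_infinity"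
      by (rule filterlim_compose[OF dec])
  qed
  from tendstoD[OF this e] obtain B where B: "\<And>r. \<bar>r\<bar> \<ge> B \<Longrightarrow> \<bar>\<Sum>k\<in>K. \<Sum>k'\<in>K. c k * c k' * \<gamma> (fst k) (fst k') (snd k' - snd k + r)\<bar> < e"
    by (auto simp: eventually_at_infinity dist_real_def)
  obtain N :: nat where "real N \<ge> B" using real_arch_simple by blast
  then show ?thesis using B by (intro exI[of _ "Suc N"]) auto
qed

text \<open>Let \<open>A\<close> be the invariant event. By the law of large numbers for the stationary sequence \<open>iexp (V m)\<close>, where \<open>V m\<close> are translates of a linear combination
\<open>V\<close>, averages over sparse translates converge in mean square to the constant \<open>\<mu> = E (iexp V)\<close>, and all translates have the same integral over \<open>A\<close>. So the integral of \<open>iexp V\<close>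
over \<open>A\<close> is \<open>prob A * \<mu>\<close>: conditionally on \<open>A\<close> the family has the same characteristic functions, hence the same law, and \<open>A\<close> itself, being determined by the family, has conditional
probability equal to its probability.\<close>

lemma zero_one_law:
  fixes Z :: "bool \<times> real \<Rightarrow> 'a \<Rightarrow> real" and \<gamma> :: "bool \<Rightarrow> bool \<Rightarrow> real \<Rightarrow> real"
  assumes Z: "\<And>k. Z k \<in> H" and cv: "\<And>b b' s t. cov (Z (b, s)) (Z (b', t)) = \<gamma> b b' (t - s)"
    and dec: "\<And>b b'. ((\<gamma> b b') \<longlongrightarrow> 0) at_infinity"
    and R [measurable]: "Measurable.pred (\<Pi>\<^sub>M k\<in>UNIV. borel) R"
    and inv: "\<And>z (m::nat). R (\<lambda>k. z (fst k, snd k + real m)) \<longleftrightarrow> R z"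
  shows "\<P>(\<omega> in M. R (\<lambda>k. Z k \<omega>)) \<in> {0, 1}"
proof -
  note [measurable] = meas[OF Z]
  have Zm [measurable]: "(\<lambda>\<omega> k. Z k \<omega>) \<in> measurable M (\<Pi>\<^sub>M k\<in>UNIV. borel)"
    by (rule measurable_PiM_single') auto
  have [measurable]: "Measurable.pred M (\<lambda>\<omega>. R (\<lambda>k. Z k \<omega>))"
    by (rule measurable_compose[OF Zm R])
  define A where "A = {\<omega>\<in>space M. R (\<lambda>k. Z k \<omega>)}"
  have [measurable]: "A \<in> sets M" unfolding A_def by measurable
  have key: "(CLINT \<omega>|M. indicator A \<omega> * iexp (\<Sum>k\<in>K. c k * Z k \<omega>)) = prob A * (CLINT \<omega>|M. iexp (\<Sum>k\<in>K. c k * Z k \<omega>))"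
    if K: "finite K" for K :: "(bool \<times> real) set" and c
  proof -
    define V where "V m \<omega> = (\<Sum>k\<in>K. c k * Z (fst k, snd k + real m) \<omega>)" for m :: nat and \<omega>
    have V: "V m \<in> H" for m unfolding V_def by (intro sum_mem Z)
    have [measurable]: "V m \<in> borel_measurable M" for m by (rule meas[OF V])
    define q where "q r = (\<Sum>k\<in>K. \<Sum>k'\<in>K. c k * c k' * \<gamma> (fst k) (fst k') (snd k' - snd k + r))" for r
    have covV: "cov (V m) (V l) = q (real l - real m)" for m l
      unfolding V_def q_def
      by (subst cov_sum_left) (auto intro!: sum.cong sum_mem Z simp: cov_sum_right Z cv sum_distrib_left algebra_simps)
    have q0: "q 0 \<ge> 0" using cov_self_nonneg[of "V 0"] by (simp add: covV)
    define \<mu> where "\<mu> = exp (- q 0 / 2)"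
    have EV: "(CLINT \<omega>|M. iexp (V m \<omega>)) = \<mu>" for m
      using characteristic[OF V[of m]] by (simp add: covV \<mu>_def)
    define Y where "Y m \<omega> = iexp (V m \<omega>) - of_real \<mu>" for m \<omega>
    have [measurable]: "Y m \<in> borel_measurable M" for m unfolding Y_def by measurable
    have Ybd: "norm (Y m \<omega>) \<le> 2" for m \<omega>
    proof -
      have "norm (Y m \<omega>) \<le> norm (iexp (V m \<omega>)) + norm (of_real \<mu> :: complex)" unfolding Y_def by (rule norm_triangle_ineq4)
      moreover have "\<mu> \<le> 1" "\<mu> > 0" using q0 by (simp_all add: \<mu>_def)
      ultimately show ?thesis by simp
    qed
    have iY: "integrable M (\<lambda>\<omega>. f \<omega> * Y m \<omega>)" if [measurable]: "f \<in> borel_measurable M" and "\<And>\<omega>. norm (f \<omega>) \<le> 2" for f m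
    proof (rule integrable_const_bound[of _ "2 * 2"])
      have "norm (f \<omega> * Y m \<omega>) \<le> 2 * 2" for \<omega>
        unfolding norm_mult using that(2)[of \<omega>] Ybd[of m \<omega>] by (intro mult_mono) auto
      then show "AE \<omega> in M. norm (f \<omega> * Y m \<omega>) \<le> 2 * 2" by (intro AE_I2)
    qed measurable
    have iE: "integrable M (\<lambda>\<omega>. iexp (V m \<omega>))" for m by (intro integrable_const_bound[of _ 1]) auto
    have iE2: "integrable M (\<lambda>\<omega>. iexp (V m \<omega> - V l \<omega>))" for m l by (intro integrable_const_bound[of _ 1]) auto
    have YY: "(CLINT \<omega>|M. Y m \<omega> * cnj (Y l \<omega>)) = of_real (exp (- q 0) * (exp (q (real l - real m)) - 1))" for m l
    proof -
      define E where "E m \<omega> = iexp (V m \<omega>)" for m \<omega>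
      define D where "D \<omega> = iexp (V m \<omega> - V l \<omega>)" for \<omega>
      have iE: "integrable M (E m)" for m unfolding E_def by (rule iE)
      have iD: "integrable M D" unfolding D_def by (rule iE2)
      have cnjE: "cnj (iexp x) = iexp (- x)" for x by (simp add: exp_cnj)
      have DE: "D \<omega> = E m \<omega> * cnj (E l \<omega>)" for \<omega>
        unfolding D_def E_def cnjE exp_add[symmetric] by (simp add: algebra_simps)
      have "Y m \<omega> * cnj (Y l \<omega>) = D \<omega> - \<mu> * E m \<omega> - \<mu> * cnj (E l \<omega>) + \<mu>\<^sup>2" for \<omega>
        unfolding DE Y_def E_def[symmetric] by (simp add: algebra_simps power2_eq_square)
      then have "(CLINT \<omega>|M. Y m \<omega> * cnj (Y l \<omega>)) = (CLINT \<omega>|M. D \<omega>) - \<mu> * (CLINT \<omega>|M. E m \<omega>) - \<mu> * cnj (CLINT \<omega>|M. E l \<omega>) + \<mu>\<^sup>2"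
        using iE[of m] iD integrable_cnj[OF iE[of l]] by (simp add: prob_space)
      also have "(CLINT \<omega>|M. D \<omega>) = exp (- (q 0 - 2 * q (real l - real m) + q 0) / 2)"
        unfolding D_def using characteristic[OF diff_mem[OF V[of m] V[of l]]] by (simp add: cov_diff_self V covV)
      finally have "(CLINT \<omega>|M. Y m \<omega> * cnj (Y l \<omega>)) = of_real (exp (- (q 0 - 2 * q (real l - real m) + q 0) / 2))
          - of_real \<mu> * of_real \<mu> - of_real \<mu> * cnj (of_real \<mu>) + of_real (\<mu>\<^sup>2)"
        unfolding E_def EV .
      also have "complex_of_real (exp (- (q 0 - 2 * q (real l - real m) + q 0) / 2)) - of_real \<mu> * of_real \<mu> - of_real \<mu> * cnj (of_real \<mu>) + of_real (\<mu>\<^sup>2)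
          = of_real (exp (- q 0) * (exp (q (real l - real m)) - 1))"
      proof -
        have "\<mu> * \<mu> = exp (- q 0)" unfolding \<mu>_def exp_add[symmetric] by simp
        moreover have "exp (- (q 0 - 2 * q (real l - real m) + q 0) / 2) = exp (- q 0) * exp (q (real l - real m))"
          unfolding exp_add[symmetric] by (simp add: field_simps)
        ultimately have "exp (- (q 0 - 2 * q (real l - real m) + q 0) / 2) - \<mu> * \<mu> - \<mu> * \<mu> + \<mu>\<^sup>2 = exp (- q 0) * (exp (q (real l - real m)) - 1)"
          by (simp add: power2_eq_square right_diff_distrib)
        then have "complex_of_real (exp (- (q 0 - 2 * q (real l - real m) + q 0) / 2) - \<mu> * \<mu> - \<mu> * \<mu> + \<mu>\<^sup>2) = of_real (exp (- q 0) * (exp (q (real l - real m)) - 1))"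
          by (simp only:)
        then show ?thesis by simp
      qed
      finally show ?thesis .
    qed
    define a where "a = (CLINT \<omega>|M. indicator A \<omega> * Y 0 \<omega>)"
    \<comment> \<open>Stationarity moves the translate, invariance of \<open>R\<close> keeps the event.\<close>
    have shift: "(CLINT \<omega>|M. indicator A \<omega> * Y m \<omega>) = a" for m
    proof -
      define h where "h z = (if R z then 1 else 0) * (iexp (\<Sum>k\<in>K. c k * z k) - of_real \<mu>)" for z :: "bool \<times> real \<Rightarrow> real"
      have [measurable]: "h \<in> borel_measurable (\<Pi>\<^sub>M k\<in>UNIV. borel)" unfolding h_def by measurable
      have sm [measurable]: "(\<lambda>\<omega> k. Z (fst k, snd k + real l) \<omega>) \<in> measurable M (\<Pi>\<^sub>M k\<in>UNIV. borel)" for l :: nat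
        by (rule measurable_PiM_single') auto
      have law: "distr M (\<Pi>\<^sub>M k\<in>UNIV. borel) (\<lambda>\<omega> k. Z (fst k, snd k + real m) \<omega>) = distr M (\<Pi>\<^sub>M k\<in>UNIV. borel) (\<lambda>\<omega> k. Z (fst k, snd k + real 0) \<omega>)"
      proof (rule distr_eq_of_char)
        fix L :: "(bool \<times> real) set" and d assume "finite L"
        have mem: "(\<lambda>\<omega>. \<Sum>k\<in>L. d k * Z (fst k, snd k + real l) \<omega>) \<in> H" for l :: nat by (intro sum_mem Z)
        have covL: "cov (\<lambda>\<omega>. \<Sum>k\<in>L. d k * Z (fst k, snd k + real l) \<omega>) (\<lambda>\<omega>. \<Sum>k\<in>L. d k * Z (fst k, snd k + real l) \<omega>)
            = (\<Sum>k\<in>L. \<Sum>k'\<in>L. d k * d k' * \<gamma> (fst k) (fst k') (snd k' - snd k))" for l :: nat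
          by (subst cov_sum_left) (auto intro!: sum.cong sum_mem Z simp: cov_sum_right Z cv sum_distrib_left algebra_simps)
        show "(CLINT \<omega>|M. iexp (\<Sum>k\<in>L. d k * Z (fst k, snd k + real m) \<omega>)) = (CLINT \<omega>|M. iexp (\<Sum>k\<in>L. d k * Z (fst k, snd k + real 0) \<omega>))"
          unfolding characteristic[OF mem] covL ..
      qed (auto simp: prob_space_axioms)
      have eq: "(CLINT \<omega>|M. indicator A \<omega> * Y l \<omega>) = (CLINT z|distr M (\<Pi>\<^sub>M k\<in>UNIV. borel) (\<lambda>\<omega> k. Z (fst k, snd k + real l) \<omega>). h z)" for l
      proof -
        have "(CLINT \<omega>|M. indicator A \<omega> * Y l \<omega>) = (CLINT \<omega>|M. h (\<lambda>k. Z (fst k, snd k + real l) \<omega>))"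
        proof (intro Bochner_Integration.integral_cong refl)
          fix \<omega> assume "\<omega> \<in> space M"
          moreover have "R (\<lambda>k. Z (fst k, snd k + real l) \<omega>) \<longleftrightarrow> R (\<lambda>k. Z k \<omega>)" using inv[of "\<lambda>k. Z k \<omega>" l] by simp
          ultimately show "indicator A \<omega> * Y l \<omega> = h (\<lambda>k. Z (fst k, snd k + real l) \<omega>)"
            unfolding h_def A_def Y_def V_def by (simp split: split_indicator)
        qed
        then show ?thesis by (subst integral_distr) auto
      qed
      show ?thesis unfolding a_def eq law ..
    qed
    have bound: "(norm a)\<^sup>2 \<le> 1 / real n + e" if n: "n > 0" and e: "e > 0" for n :: nat and e
    proof -
      have "\<exists>d>0. \<forall>x. \<bar>x\<bar> < d \<longrightarrow> \<bar>exp x - 1\<bar> < (e::real)"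
      proof -
        have "(exp \<longlongrightarrow> (1::real)) (at 0)" using isCont_exp[of "0::real"] unfolding isCont_def by simp
        from LIM_D[OF this e] obtain d where d: "d > 0" "\<And>x. x \<noteq> 0 \<Longrightarrow> \<bar>x\<bar> < d \<Longrightarrow> \<bar>exp x - 1\<bar> < e" by auto
        have "\<bar>exp x - 1\<bar> < e" if "\<bar>x\<bar> < d" for x using d(2)[of x] that e by (cases "x = 0") auto
        then show ?thesis using d(1) by blast
      qed
      then obtain d where d: "d > 0" "\<And>x. \<bar>x\<bar> < d \<Longrightarrow> \<bar>exp x - 1\<bar> < e" by blast
      obtain N where N: "N > 0" "\<And>r. \<bar>r\<bar> \<ge> real N \<Longrightarrow> \<bar>q r\<bar> < d"
        using exists_spacing[where \<gamma>=\<gamma> and K=K and c=c, OF dec d(1)] unfolding q_def by blast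
      \<comment> \<open>Translates by multiples of \<open>N\<close> are almost uncorrelated, so the sum has second moment of order \<open>n\<close>.\<close>
      define S where "S \<omega> = (\<Sum>j<n. Y (j * N) \<omega>)" for \<omega>
      have [measurable]: "S \<in> borel_measurable M" unfolding S_def by measurable
      have Sbd: "norm (S \<omega>) \<le> real n * 2" for \<omega>
        unfolding S_def using Ybd by (intro order_trans[OF norm_sum] sum_bounded_above[of "{..<n}", simplified]) auto
      have iS: "integrable M (\<lambda>\<omega>. norm (S \<omega>))" using Sbd by (intro integrable_const_bound[of _ "real n * 2"]) auto
      have iS2: "integrable M (\<lambda>\<omega>. (norm (S \<omega>))\<^sup>2)" 
      proof (rule integrable_const_bound[of _ "(real n * 2)\<^sup>2"])
        have "norm ((norm (S \<omega>))\<^sup>2) \<le> (real n * 2)\<^sup>2" for \<omega>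
          using power_mono[OF Sbd[of \<omega>] norm_ge_zero, of 2] by simp
        then show "AE \<omega> in M. norm ((norm (S \<omega>))\<^sup>2) \<le> (real n * 2)\<^sup>2" by (intro AE_I2)
      qed measurable
      have pair: "exp (- q 0) * (exp (q (real (l * N) - real (j * N))) - 1) \<le> (if l = j then 1 else 0) + e" for j l
      proof (cases "l = j")
        case True
        have "exp (- q 0) * (exp (q 0) - 1) = 1 - exp (- q 0)" by (simp add: right_diff_distrib exp_add[symmetric])
        then show ?thesis using True e by (simp add: add_increasing2 less_imp_le)
      next
        case False
        have "real N * 1 \<le> real N * \<bar>real l - real j\<bar>" using False by (intro mult_left_mono) auto
        also have "\<dots> = \<bar>real (l * N) - real (j * N)\<bar>" 
        proof -
          have "real (l * N) - real (j * N) = real N * (real l - real j)" by (simp add: algebra_simps)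
          then show ?thesis by (simp only: abs_mult abs_of_nat)
        qed
        finally have "\<bar>exp (q (real (l * N) - real (j * N))) - 1\<bar> < e" using N(2) d(2) by simp
        moreover have "exp (- q 0) * y \<le> \<bar>y\<bar>" for y
        proof -
          have "exp (- q 0) * y \<le> exp (- q 0) * \<bar>y\<bar>" by (intro mult_left_mono) auto
          also have "\<dots> \<le> 1 * \<bar>y\<bar>" using q0 by (intro mult_right_mono) auto
          finally show ?thesis by simp
        qed
        ultimately have "exp (- q 0) * (exp (q (real (l * N) - real (j * N))) - 1) \<le> e"
          by (meson less_imp_le order_trans)
        then show ?thesis using False by simp
      qed
      have "of_real (expectation (\<lambda>\<omega>. (norm (S \<omega>))\<^sup>2)) = (CLINT \<omega>|M. S \<omega> * cnj (S \<omega>))"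
        unfolding complex_norm_square[symmetric] by (rule integral_complex_of_real[symmetric])
      also have "\<dots> = (CLINT \<omega>|M. \<Sum>j<n. \<Sum>l<n. Y (j * N) \<omega> * cnj (Y (l * N) \<omega>))"
        unfolding S_def by (simp add: sum_product)
      also have "\<dots> = (\<Sum>j<n. \<Sum>l<n. (CLINT \<omega>|M. Y (j * N) \<omega> * cnj (Y (l * N) \<omega>)))"
      proof -
        have "integrable M (\<lambda>\<omega>. Y j \<omega> * cnj (Y l \<omega>))" for j l
        proof -
          have "integrable M (Y l)" using iY[of "\<lambda>_. 1" l] by simp
          then have "(\<lambda>\<omega>. cnj (Y l \<omega>)) \<in> borel_measurable M" by (rule borel_measurable_integrable[OF integrable_cnj])
          from iY[OF this, of j] Ybd show ?thesis by (simp add: mult.commute)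
        qed
        then show ?thesis by (simp add: Bochner_Integration.integral_sum)
      qed
      also have "\<dots> = of_real (\<Sum>j<n. \<Sum>l<n. exp (- q 0) * (exp (q (real (l * N) - real (j * N))) - 1))"
        unfolding YY by simp
      finally have "expectation (\<lambda>\<omega>. (norm (S \<omega>))\<^sup>2) = (\<Sum>j<n. \<Sum>l<n. exp (- q 0) * (exp (q (real (l * N) - real (j * N))) - 1))"
        by (simp only: of_real_eq_iff)
      also have "\<dots> \<le> (\<Sum>j<n. \<Sum>l<n. (if l = j then 1 else 0) + e)" by (intro sum_mono pair)
      also have "\<dots> = real n + (real n)\<^sup>2 * e" by (simp add: sum.distrib power2_eq_square algebra_simps)
      finally have ES: "expectation (\<lambda>\<omega>. (norm (S \<omega>))\<^sup>2) \<le> real n + (real n)\<^sup>2 * e" .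
      have "real n * norm a = norm (CLINT \<omega>|M. indicator A \<omega> * S \<omega>)"
      proof -
        have "(CLINT \<omega>|M. indicator A \<omega> * S \<omega>) = (\<Sum>j<n. (CLINT \<omega>|M. indicator A \<omega> * Y (j * N) \<omega>))"
          unfolding S_def sum_distrib_left using iY[of "indicator A"]
          by (subst Bochner_Integration.integral_sum) (auto split: split_indicator)
        also have "\<dots> = of_nat n * a" by (simp add: shift)
        finally show ?thesis by (simp add: norm_mult)
      qed
      also have "\<dots> \<le> expectation (\<lambda>\<omega>. norm (indicator A \<omega> * S \<omega>))" by (rule integral_norm_bound)
      also have "\<dots> \<le> expectation (\<lambda>\<omega>. norm (S \<omega>))"
        using iS by (intro integral_mono Bochner_Integration.integrable_bound[OF iS]) (auto split: split_indicator)
      finally have "(real n * norm a)\<^sup>2 \<le> (expectation (\<lambda>\<omega>. norm (S \<omega>)))\<^sup>2" by (intro power_mono) auto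
      also have "\<dots> \<le> expectation (\<lambda>\<omega>. (norm (S \<omega>))\<^sup>2)"
        using variance_eq[OF iS iS2] variance_positive[of "\<lambda>\<omega>. norm (S \<omega>)"] by simp
      finally have "(real n)\<^sup>2 * (norm a)\<^sup>2 \<le> real n + (real n)\<^sup>2 * e" using ES by (simp add: power_mult_distrib)
      also have "\<dots> = (real n)\<^sup>2 * (1 / real n + e)" using n by (simp add: power2_eq_square distrib_left)
      finally show ?thesis using n by simp
    qed
    have "(norm a)\<^sup>2 \<le> 0"
    proof (rule field_le_epsilon)
      fix e :: real assume e: "e > 0"
      obtain k where "1 / real (Suc k) < e / 2" using nat_approx_posE[of "e / 2"] e by auto
      then obtain n :: nat where n: "n > 0" "1 / real n < e / 2" by blast
      show "(norm a)\<^sup>2 \<le> 0 + e" using bound[OF n(1), of "e / 2"] e n(2) by simp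
    qed
    then have "a = 0" by simp
    then have "(CLINT \<omega>|M. indicator A \<omega> * iexp (V 0 \<omega>) - indicator A \<omega> * of_real \<mu>) = 0"
      unfolding a_def Y_def by (simp add: right_diff_distrib)
    moreover have "integrable M (\<lambda>\<omega>. indicator A \<omega> * iexp (V 0 \<omega>))"
      by (intro integrable_const_bound[of _ 1]) (auto simp: norm_mult split: split_indicator)
    moreover have "integrable M (\<lambda>\<omega>. indicator A \<omega> * complex_of_real \<mu>)"
      by (intro integrable_const_bound[of _ \<mu>]) (auto simp: norm_mult \<mu>_def split: split_indicator)
    ultimately have "(CLINT \<omega>|M. indicator A \<omega> * iexp (V 0 \<omega>)) = (CLINT \<omega>|M. indicator A \<omega> * of_real \<mu>)" by simp
    also have "\<dots> = (CLINT \<omega>|M. complex_of_real (indicator A \<omega> * \<mu>))"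
      by (intro Bochner_Integration.integral_cong) (auto split: split_indicator)
    also have "\<dots> = of_real (expectation (\<lambda>\<omega>. indicator A \<omega> * \<mu>))" by (rule integral_complex_of_real)
    also have "\<dots> = of_real (prob A) * of_real \<mu>" by simp
    finally show ?thesis using EV[of 0] by (simp add: V_def)
  qed
  show ?thesis
  proof (cases "prob A = 0")
    case False
    then have pA: "prob A > 0" by (simp add: less_le)
    interpret U: prob_space "uniform_measure M A"
      using pA by (intro prob_space_uniform_measure) (auto simp: emeasure_eq_measure)
    have inv_pA: "1 / ennreal (prob A) = ennreal (1 / prob A)" using divide_ennreal[of 1 "prob A"] pA by simp
    have um: "uniform_measure M A = density M (\<lambda>\<omega>. ennreal (indicator A \<omega> / prob A))"
      unfolding uniform_measure_def using pA
      by (intro density_cong) (auto simp: emeasure_eq_measure inv_pA split: split_indicator)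
    have law: "distr (uniform_measure M A) (\<Pi>\<^sub>M k\<in>UNIV. borel) (\<lambda>\<omega> k. Z k \<omega>) = distr M (\<Pi>\<^sub>M k\<in>UNIV. borel) (\<lambda>\<omega> k. Z k \<omega>)"
    proof (rule distr_eq_of_char)
      fix K :: "(bool \<times> real) set" and c assume K: "finite K"
      have "(CLINT \<omega>|uniform_measure M A. iexp (\<Sum>k\<in>K. c k * Z k \<omega>)) = (CLINT \<omega>|M. (indicator A \<omega> / prob A) *\<^sub>R iexp (\<Sum>k\<in>K. c k * Z k \<omega>))"
        unfolding um by (rule integral_density) (auto split: split_indicator)
      also have "\<dots> = (CLINT \<omega>|M. (indicator A \<omega> * iexp (\<Sum>k\<in>K. c k * Z k \<omega>)) / prob A)"
        by (intro Bochner_Integration.integral_cong) (auto simp: scaleR_conv_of_real split: split_indicator)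
      also have "\<dots> = (CLINT \<omega>|M. iexp (\<Sum>k\<in>K. c k * Z k \<omega>))"
        using key[OF K, of c] pA by simp
      finally show "(CLINT \<omega>|uniform_measure M A. iexp (\<Sum>k\<in>K. c k * Z k \<omega>)) = (CLINT \<omega>|M. iexp (\<Sum>k\<in>K. c k * Z k \<omega>))" .
    qed (auto simp: prob_space_axioms U.prob_space_axioms)
    have mR: "{z. R z} \<in> sets (\<Pi>\<^sub>M k\<in>UNIV. borel)" using measurable_sets[OF R, of "{True}"] by (simp add: space_PiM vimage_def)
    have pre: "(\<lambda>\<omega> k. Z k \<omega>) -` {z. R z} \<inter> space M = A" by (auto simp: A_def)
    have mZ: "(\<lambda>\<omega> k. Z k \<omega>) \<in> measurable M (\<Pi>\<^sub>M k\<in>UNIV. borel)" by measurable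
    then have mZ': "(\<lambda>\<omega> k. Z k \<omega>) \<in> measurable (uniform_measure M A) (\<Pi>\<^sub>M k\<in>UNIV. borel)" by simp
    have "measure (distr M (\<Pi>\<^sub>M k\<in>UNIV. borel) (\<lambda>\<omega> k. Z k \<omega>)) {z. R z} = prob A"
      using measure_distr[OF mZ mR] by (simp only: pre)
    moreover have "measure (distr (uniform_measure M A) (\<Pi>\<^sub>M k\<in>UNIV. borel) (\<lambda>\<omega> k. Z k \<omega>)) {z. R z} = measure (uniform_measure M A) A"
      using measure_distr[OF mZ' mR] by (simp only: space_uniform_measure pre)
    moreover have "measure (uniform_measure M A) A = 1"
      using pA by (subst measure_uniform_measure) (auto simp: emeasure_eq_measure)
    ultimately have "prob A = 1" using law by simp
    then show ?thesis by (simp add: A_def)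
  qed (simp add: A_def)
qed

end

section \<open>Frames and grids in the plane\<close>

definition rectangle_frame :: "real \<Rightarrow> real \<Rightarrow> real \<Rightarrow> real \<Rightarrow> (real \<times> real) set" where
  "rectangle_frame a b c d = ({a, b} \<times> {c..d}) \<union> ({a..b} \<times> {c, d})"

lemma connected_subset_rectangle:
  assumes C: "connected C" and p: "p \<in> C" "a < fst p" "fst p < b" "c < snd p" "snd p < d"
    and disj: "C \<inter> rectangle_frame a b c d = {}"
  shows "C \<subseteq> {a..b} \<times> {c..d}"
proof -
  let ?U = "{a<..<b} \<times> {c<..<d}" and ?V = "- ({a..b} \<times> {c..d})"
  have "open ?U" by (intro open_Times) auto
  moreover have "open ?V" by (intro open_Compl closed_Times) auto
  moreover have "C \<subseteq> ?U \<union> ?V"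
  proof
    fix x assume "x \<in> C"
    then have "x \<notin> rectangle_frame a b c d" using disj by blast
    then show "x \<in> ?U \<union> ?V" unfolding rectangle_frame_def by (cases x) auto
  qed
  moreover have "?U \<inter> ?V \<inter> C = {}" by auto
  moreover have "?U \<inter> C \<noteq> {}" using p by (auto simp: mem_Times_iff intro!: exI[of _ p])
  ultimately have "?V \<inter> C = {}" using connectedD[OF C, of ?U ?V] by blast
  then show ?thesis by blast
qed

text \<open>A component cannot cross a frame around one of its points.\<close>

lemma components_bounded_of_frames:
  assumes frames: "\<And>R. \<exists>a b c d. a < - R \<and> R < b \<and> c < - R \<and> R < d \<and> S \<inter> rectangle_frame a b c d = {}"
  shows "\<forall>C\<in>components S. bounded C"
proof
  fix C assume C: "C \<in> components S"
  then obtain p where p: "p \<in> C" using in_components_nonempty by fastforce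
  define R where "R = \<bar>fst p\<bar> + \<bar>snd p\<bar>"
  obtain a b c d where abcd: "a < - R" "R < b" "c < - R" "R < d" "S \<inter> rectangle_frame a b c d = {}"
    using frames[of R] by blast
  have "C \<subseteq> {a..b} \<times> {c..d}"
  proof (rule connected_subset_rectangle)
    show "connected C" using C by (rule in_components_connected)
    show "C \<inter> rectangle_frame a b c d = {}" using abcd in_components_subset[OF C] by blast
  qed (use p abcd in \<open>auto simp: R_def\<close>)
  then show "bounded C" by (rule bounded_subset[rotated]) (intro bounded_Times; simp)
qed

lemma components_bounded_subset:
  assumes "\<forall>C\<in>components S. bounded C" and "T \<subseteq> S"
  shows "\<forall>C\<in>components T. bounded C"
proof
  fix C assume C: "C \<in> components T"
  have "connected C" "C \<noteq> {}" "C \<subseteq> S"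
    using in_components_connected[OF C] in_components_nonempty[OF C] in_components_subset[OF C] assms(2) by auto
  then obtain D where "D \<in> components S" "C \<subseteq> D" using exists_component_superset[of C S] by auto
  then show "bounded C" using assms(1) bounded_subset by blast
qed

text \<open>Two vertical and two horizontal segments; when \<open>a\<close>, \<open>b\<close>, \<open>c\<close>, \<open>d\<close> are in range it contains the frame of the rectangle between them.\<close>

definition hash_shape :: "real \<Rightarrow> real \<Rightarrow> real \<Rightarrow> real \<Rightarrow> real \<Rightarrow> real \<Rightarrow> (real \<times> real) set" where
  "hash_shape a b c d L L' = ({a, b} \<times> {- L'..L'}) \<union> ({- L..L} \<times> {c, d})"

lemma connected_hash_shape:
  assumes "a \<in> {- L..L}" "b \<in> {- L..L}" "c \<in> {- L'..L'}" "d \<in> {- L'..L'}"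
  shows "connected (hash_shape a b c d L L')"
proof -
  have c1: "connected ({x} \<times> {- L'..L'})" for x :: real by (intro connected_Times) auto
  have c2: "connected ({- L..L} \<times> {y})" for y :: real by (intro connected_Times) auto
  have cross: "({x} \<times> {- L'..L'}) \<inter> ({- L..L} \<times> {y}) \<noteq> {}" if "x \<in> {- L..L}" "y \<in> {- L'..L'}" for x y :: real
  proof -
    have "(x, y) \<in> ({x} \<times> {- L'..L'}) \<inter> ({- L..L} \<times> {y})" using that by auto
    then show ?thesis by blast
  qed
  have "connected (({a} \<times> {- L'..L'}) \<union> ({- L..L} \<times> {c}))"
    by (rule connected_Un[OF c1 c2 cross[OF assms(1,3)]])
  then have "connected ((({a} \<times> {- L'..L'}) \<union> ({- L..L} \<times> {c})) \<union> ({b} \<times> {- L'..L'}))"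
    by (rule connected_Un[OF _ c1]) (use cross[OF assms(2,3)] in blast)
  then have "connected (((({a} \<times> {- L'..L'}) \<union> ({- L..L} \<times> {c})) \<union> ({b} \<times> {- L'..L'})) \<union> ({- L..L} \<times> {d}))"
    by (rule connected_Un[OF _ c2]) (use cross[OF assms(1,4)] in blast)
  moreover have "(((({a} \<times> {- L'..L'}) \<union> ({- L..L} \<times> {c})) \<union> ({b} \<times> {- L'..L'})) \<union> ({- L..L} \<times> {d})) = hash_shape a b c d L L'"
    unfolding hash_shape_def by auto
  ultimately show ?thesis by simp
qed

lemma connected_UN_chain:
  fixes A :: "nat \<Rightarrow> 'a::topological_space set"
  assumes c: "\<And>n. connected (A n)" and i: "\<And>n. A n \<inter> A (Suc n) \<noteq> {}"
  shows "connected (\<Union>n. A n)"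
proof -
  have conn: "connected (\<Union>k\<le>n. A k)" for n
  proof (induction n)
    case (Suc n)
    have "connected ((\<Union>k\<le>n. A k) \<union> A (Suc n))"
      using i[of n] by (intro connected_Un Suc c) auto
    then show ?case by (simp add: atMost_Suc Un_commute)
  qed (simp add: c)
  obtain p where p: "p \<in> A 0" using i[of 0] by auto
  have "connected (\<Union>((\<lambda>n. \<Union>k\<le>n. A k) ` UNIV))"
    by (rule connected_Union) (use conn p in auto)
  moreover have "\<Union>((\<lambda>n. \<Union>k\<le>n. A k) ` UNIV) = (\<Union>n. A n)" by auto
  ultimately show ?thesis by simp
qed

text \<open>The condition on \<open>a (Suc n)\<close> makes a vertical segment of each grid cross a horizontal segment of the preceding one, so the union of the grids is connected. It is
unbounded, and each grid contains a frame: a component that contains a point inside the frame and misses the union is confined by it.\<close>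

lemma unique_unbounded_component:
  assumes sub: "\<And>n. hash_shape (a n) (b n) (c n) (d n) (L n) (L' n) \<subseteq> S"
    and ab: "\<And>n. a n \<in> {- L n..L n}" "\<And>n. b n \<in> {- L n..L n}" "\<And>n. c n \<in> {- L' n..L' n}" "\<And>n. d n \<in> {- L' n..L' n}"
    and ab': "\<And>n. a (Suc n) \<in> {- L n..L n}" and L': "\<And>n. L' n \<le> L' (Suc n)"
    and lim: "filterlim a at_bot sequentially" "filterlim b at_top sequentially" "filterlim c at_bot sequentially" "filterlim d at_top sequentially"
  shows "\<exists>!C. C \<in> components S \<and> \<not> bounded C"
proof -
  define A where "A n = hash_shape (a n) (b n) (c n) (d n) (L n) (L' n)" for n
  have cA: "connected (A n)" for n unfolding A_def using ab by (intro connected_hash_shape)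
  have iA: "A n \<inter> A (Suc n) \<noteq> {}" for n
  proof -
    have "(a (Suc n), c n) \<in> A n" unfolding A_def hash_shape_def using ab'[of n] by auto
    moreover have "c n \<in> {- L' (Suc n)..L' (Suc n)}" using ab(3)[of n] L'[of n] by auto
    then have "(a (Suc n), c n) \<in> A (Suc n)" unfolding A_def hash_shape_def by auto
    ultimately show ?thesis by blast
  qed
  define U where "U = (\<Union>n. A n)"
  have U: "connected U" unfolding U_def by (rule connected_UN_chain[where A=A, OF cA iA])
  have US: "U \<subseteq> S" using sub unfolding U_def A_def by blast
  have bU: "(b n, c n) \<in> U" for n unfolding U_def A_def hash_shape_def using ab(2)[of n] by auto
  have "\<not> bounded U"
  proof
    assume "bounded U"
    then have "bounded (fst ` U)" by (rule bounded_fst)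
    then obtain B where B: "\<And>x. x \<in> U \<Longrightarrow> \<bar>fst x\<bar> \<le> B" unfolding bounded_iff by auto
    have "eventually (\<lambda>n. b n > B) sequentially" using lim(2) by (simp add: filterlim_at_top_dense)
    then obtain n where "b n > B" by (auto simp: eventually_sequentially)
    then show False using B[OF bU[of n]] by simp
  qed
  have "S \<noteq> {}" using bU US by blast
  then obtain C0 where C0: "C0 \<in> components S" "U \<subseteq> C0" using exists_component_superset[OF US _ U] by blast
  show ?thesis
  proof (intro ex1I[of _ C0] conjI C0(1))
    show "\<not> bounded C0" using \<open>\<not> bounded U\<close> C0(2) bounded_subset by blast
    fix C assume C: "C \<in> components S \<and> \<not> bounded C"
    then obtain p where p: "p \<in> C" using in_components_nonempty by fastforce
    have "eventually (\<lambda>n. a n < fst p \<and> b n > fst p \<and> c n < snd p \<and> d n > snd p) sequentially"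
      using lim by (intro eventually_conj) (simp_all add: filterlim_at_top_dense filterlim_at_bot_dense)
    then obtain n where n: "a n < fst p" "b n > fst p" "c n < snd p" "d n > snd p" by (auto simp: eventually_sequentially)
    have fr: "rectangle_frame (a n) (b n) (c n) (d n) \<subseteq> A n"
      unfolding rectangle_frame_def A_def hash_shape_def using ab[of n] by auto
    have "C \<inter> rectangle_frame (a n) (b n) (c n) (d n) \<noteq> {}"
    proof
      assume "C \<inter> rectangle_frame (a n) (b n) (c n) (d n) = {}"
      then have "C \<subseteq> {a n..b n} \<times> {c n..d n}"
        using C p n by (intro connected_subset_rectangle[of C p]) (auto intro: in_components_connected)
      then have "bounded C" by (rule bounded_subset[rotated]) (intro bounded_Times; simp)
      then show False using C by blast
    qed
    then have "C \<inter> C0 \<noteq> {}" using fr C0(2) unfolding U_def by blast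
    then show "C = C0" using C C0(1) components_eq by blast
  qed
qed

section \<open>Positive frames and low grids of the random field\<close>

lemma (in prob_space) indep_var_finite_combinations:
  assumes ind: "independent_processes M X\<^sub>1 X\<^sub>2"
    and V: "V \<in> finite_combinations X\<^sub>1" and W: "W \<in> finite_combinations X\<^sub>2"
  shows "indep_var borel V borel W"
proof -
  obtain T c where T: "V = (\<lambda>\<omega>. \<Sum>t\<in>T. c t * X\<^sub>1 t \<omega>)" using V unfolding finite_combinations_def by blast
  obtain S d where S: "W = (\<lambda>\<omega>. \<Sum>t\<in>S. d t * X\<^sub>2 t \<omega>)" using W unfolding finite_combinations_def by blast
  have "indep_var borel ((\<lambda>p. \<Sum>t\<in>T. c t * p t) \<circ> (\<lambda>\<omega> t. X\<^sub>1 t \<omega>)) borel ((\<lambda>p. \<Sum>t\<in>S. d t * p t) \<circ> (\<lambda>\<omega> t. X\<^sub>2 t \<omega>))"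
    by (rule indep_var_compose[OF ind[unfolded independent_processes_def]]) measurable
  then show ?thesis unfolding T S by (simp add: comp_def)
qed

lemma independent_processes_scale:
  assumes "prob_space M" and ind: "independent_processes M g\<^sub>1 g\<^sub>2"
  shows "independent_processes M (\<lambda>t \<omega>. c\<^sub>1 * g\<^sub>1 t \<omega>) (\<lambda>t \<omega>. c\<^sub>2 * g\<^sub>2 t \<omega>)"
proof -
  interpret prob_space M by fact
  have m: "(\<lambda>p t. c * p t) \<in> measurable path_space path_space" for c :: real
    by (rule measurable_PiM_single') auto
  have "indep_var path_space ((\<lambda>p t. c\<^sub>1 * p t) \<circ> (\<lambda>\<omega> t. g\<^sub>1 t \<omega>)) path_space ((\<lambda>p t. c\<^sub>2 * p t) \<circ> (\<lambda>\<omega> t. g\<^sub>2 t \<omega>))"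
    by (rule indep_var_compose[OF ind[unfolded independent_processes_def] m m])
  then show ?thesis unfolding independent_processes_def by (simp add: comp_def)
qed

text \<open>Zero-one law and covariances concern the two processes jointly; this is the joint space of two independent Gaussian spaces.\<close>

definition sum_space :: "('a \<Rightarrow> real) set \<Rightarrow> ('a \<Rightarrow> real) set \<Rightarrow> ('a \<Rightarrow> real) set" where
  "sum_space G H = {\<lambda>\<omega>. V \<omega> + W \<omega> | V W. V \<in> G \<and> W \<in> H}"

lemma sum_spaceI: "V \<in> G \<Longrightarrow> W \<in> H \<Longrightarrow> (\<lambda>\<omega>. V \<omega> + W \<omega>) \<in> sum_space G H"
  unfolding sum_space_def by blast

lemma sum_spaceE:
  assumes "U \<in> sum_space G H"
  obtains V W where "U = (\<lambda>\<omega>. V \<omega> + W \<omega>)" "V \<in> G" "W \<in> H"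
  using assms unfolding sum_space_def by blast

lemma (in prob_space) gaussian_space_sum_space:
  assumes G: "gaussian_space M G" and H: "gaussian_space M H"
    and ind: "\<And>V W. V \<in> G \<Longrightarrow> W \<in> H \<Longrightarrow> indep_var borel V borel W"
  shows "gaussian_space M (sum_space G H)"
proof -
  interpret G: gaussian_space M G by fact
  interpret H: gaussian_space M H by fact
  show ?thesis
  proof
    show "(\<lambda>_. 0) \<in> sum_space G H" using sum_spaceI[OF G.zero_mem H.zero_mem] by simp
    show "(\<lambda>x. V x + W x) \<in> sum_space G H" if hV: "V \<in> sum_space G H" and hW: "W \<in> sum_space G H" for V W
    proof -
      obtain V1 V2 where V: "V = (\<lambda>\<omega>. V1 \<omega> + V2 \<omega>)" "V1 \<in> G" "V2 \<in> H" by (rule sum_spaceE[OF hV])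
      obtain W1 W2 where W: "W = (\<lambda>\<omega>. W1 \<omega> + W2 \<omega>)" "W1 \<in> G" "W2 \<in> H" by (rule sum_spaceE[OF hW])
      have "(\<lambda>x. V x + W x) = (\<lambda>\<omega>. (V1 \<omega> + W1 \<omega>) + (V2 \<omega> + W2 \<omega>))" unfolding V W by (simp add: add_ac)
      then show ?thesis using sum_spaceI[OF G.add_mem[OF V(2) W(2)] H.add_mem[OF V(3) W(3)]] by simp
    qed
    show "(\<lambda>x. c * V x) \<in> sum_space G H" if hV: "V \<in> sum_space G H" for c V
    proof -
      obtain V1 V2 where V: "V = (\<lambda>\<omega>. V1 \<omega> + V2 \<omega>)" "V1 \<in> G" "V2 \<in> H" by (rule sum_spaceE[OF hV])
      have "(\<lambda>x. c * V x) = (\<lambda>\<omega>. c * V1 \<omega> + c * V2 \<omega>)" unfolding V by (simp add: distrib_left)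
      then show ?thesis using sum_spaceI[OF G.scale_mem[OF V(2), of c] H.scale_mem[OF V(3), of c]] by simp
    qed
    show "V \<in> borel_measurable M" if "V \<in> sum_space G H" for V
      using that by (rule sum_spaceE) (use G.meas H.meas in auto)
    show "(AE x in M. V x = 0) \<or> (\<exists>\<sigma>>0. distributed M lborel V (normal_density 0 \<sigma>))" if hV: "V \<in> sum_space G H" for V
    proof -
      obtain V1 V2 where V: "V = (\<lambda>\<omega>. V1 \<omega> + V2 \<omega>)" "V1 \<in> G" "V2 \<in> H" by (rule sum_spaceE[OF hV])
      note [measurable] = G.meas[OF V(2)] H.meas[OF V(3)]
      have cong: "distributed M lborel V f" if "distributed M lborel U f" "AE x in M. U x = V x" for U f
      proof -
        have [measurable]: "U \<in> borel_measurable M" using that(1) unfolding distributed_def by simp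
        have [measurable]: "V \<in> borel_measurable M" unfolding V by measurable
        have "distr M lborel U = distr M lborel V" using that(2) by (intro distr_cong_AE) auto
        then show ?thesis using that(1) unfolding distributed_def by simp
      qed
      from G.gauss[OF V(2)] H.gauss[OF V(3)] show ?thesis
      proof (elim disjE exE conjE)
        assume "AE x in M. V1 x = 0" "AE x in M. V2 x = 0"
        then have "AE x in M. V x = 0" unfolding V by eventually_elim simp
        then show ?thesis ..
      next
        fix s assume s: "s > 0" "distributed M lborel V1 (normal_density 0 s)" and z: "AE x in M. V2 x = 0"
        from z have "AE x in M. V1 x = V x" unfolding V by eventually_elim simp
        with cong[OF s(2)] s(1) show ?thesis by auto
      next
        fix s assume z: "AE x in M. V1 x = 0" and s: "s > 0" "distributed M lborel V2 (normal_density 0 s)"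
        from z have "AE x in M. V2 x = V x" unfolding V by eventually_elim simp
        with cong[OF s(2)] s(1) show ?thesis by auto
      next
        fix s t assume s: "s > 0" "distributed M lborel V1 (normal_density 0 s)"
          and t: "t > 0" "distributed M lborel V2 (normal_density 0 t)"
        have "distributed M lborel V (normal_density (0 + 0) (sqrt (s\<^sup>2 + t\<^sup>2)))"
          unfolding V by (rule add_indep_normal[OF ind[OF V(2,3)] s(1) t(1) s(2) t(2)])
        moreover have "sqrt (s\<^sup>2 + t\<^sup>2) > 0" using s t by (simp add: add_pos_pos)
        ultimately show ?thesis by auto
      qed
    qed
  qed
qed

text \<open>All times are rational, and so the event depends on countably many coordinates and is measurable for the product sigma-algebra. For continuous paths real
times give the same up to a negligible change of the end points.\<close>

definition exits :: "(real \<Rightarrow> real) \<Rightarrow> nat \<Rightarrow> nat \<Rightarrow> bool" where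
  "exits p N u \<longleftrightarrow> (\<exists>a b :: rat. of_rat a < - real N \<and> real N < of_rat b \<and> real u < p (of_rat a) \<and> real u < p (of_rat b) \<and>
     (\<forall>s. a \<le> s \<and> s \<le> b \<longrightarrow> - real u \<le> p (of_rat s)))"

lemma pred_exits: "Measurable.pred path_space (\<lambda>p. exits p N u)"
  unfolding exits_def by measurable

lemma exits_shift:
  assumes "exits p N' u" and N: "real N + \<bar>real_of_int w\<bar> \<le> real N'"
  shows "exits (\<lambda>t. p (t + of_int w)) N u"
proof -
  obtain a b where ab: "of_rat a < - real N'" "real N' < of_rat b" "real u < p (of_rat a)" "real u < p (of_rat b)"
    "\<And>s. a \<le> s \<Longrightarrow> s \<le> b \<Longrightarrow> - real u \<le> p (of_rat s)" using assms(1) unfolding exits_def by blast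
  show ?thesis
    unfolding exits_def
  proof (rule exI[of _ "a - of_int w"], rule exI[of _ "b - of_int w"], intro conjI allI impI)
    fix s assume s: "a - of_int w \<le> s \<and> s \<le> b - of_int w"
    have "- real u \<le> p (of_rat (s + of_int w))" using s by (intro ab(5)) (simp_all add: diff_le_eq le_diff_eq)
    then show "- real u \<le> p (of_rat s + of_int w)" by (simp add: of_rat_add)
  qed (use ab N in \<open>auto simp: of_rat_diff\<close>)
qed

lemma exits_of_real:
  assumes p: "continuous_on UNIV p" and ab: "a < - real N" "real N < b" "real u < p a" "real u < p b"
    and low: "\<And>t. t \<in> {a..b} \<Longrightarrow> - real u \<le> p t"
  shows "exits p N u"
proof -
  have op: "open ({t. real u < p t} \<inter> S)" if "open S" for S
    by (rule open_Int[OF open_Collect_less[OF continuous_on_const p] that])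
  obtain \<delta> where \<delta>: "\<delta> > 0" "ball a \<delta> \<subseteq> {t. real u < p t} \<inter> {..<- real N}"
  proof (rule openE[OF op[OF open_lessThan[of "- real N"]], of a])
  qed (use ab in auto)
  obtain \<delta>' where \<delta>': "\<delta>' > 0" "ball b \<delta>' \<subseteq> {t. real u < p t} \<inter> {real N<..}"
  proof (rule openE[OF op[OF open_greaterThan[of "real N"]], of b])
  qed (use ab in auto)
  obtain r where r: "a < of_rat r" "of_rat r < a + \<delta>" using of_rat_dense[of a "a + \<delta>"] \<delta>(1) by auto
  obtain r' where r': "b - \<delta>' < of_rat r'" "of_rat r' < b" using of_rat_dense[of "b - \<delta>'" b] \<delta>'(1) by auto
  have "of_rat r \<in> ball a \<delta>" "of_rat r' \<in> ball b \<delta>'" using r r' by (auto simp: dist_real_def)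
  then have in_sets: "of_rat r \<in> {t. real u < p t} \<inter> {..<- real N}" "of_rat r' \<in> {t. real u < p t} \<inter> {real N<..}"
    using \<delta>(2) \<delta>'(2) by blast+
  show ?thesis
    unfolding exits_def
  proof (rule exI[of _ r], rule exI[of _ r'], intro conjI allI impI)
    fix s assume "r \<le> s \<and> s \<le> r'"
    then have "real_of_rat r \<le> of_rat s" "real_of_rat s \<le> of_rat r'" by (simp_all add: of_rat_less_eq)
    then show "- real u \<le> p (of_rat s)" using r r' by (intro low) simp
  qed (use in_sets in auto)
qed

lemma exits_of_scaled:
  assumes p: "continuous_on UNIV p" and s: "s > 0" and N: "real N < real k / s"
    and ab: "a \<le> - (real k / s)" "real k / s \<le> b" "real k / s < p a" "real k / s < p b"
    and low: "\<And>t. t \<in> {a..b} \<Longrightarrow> - (real k / s) \<le> p t"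
  shows "exits (\<lambda>t. s * p t) N k"
proof (rule exits_of_real)
  show "continuous_on UNIV (\<lambda>t. s * p t)" using p by (intro continuous_intros)
  show "a < - real N" "real N < b" using ab(1,2) N by simp_all
  show "real k < s * p a" "real k < s * p b" using ab(3,4) s by (simp_all add: pos_divide_less_eq mult.commute)
  show "- real k \<le> s * p t" if "t \<in> {a..b}" for t
    using mult_left_mono[OF low[OF that], of s] s by simp
qed

lemma real_of_exits:
  assumes p: "continuous_on UNIV p" and ex: "exits p N u"
  shows "\<exists>a b. a < - real N \<and> real N < b \<and> real u < p a \<and> real u < p b \<and> (\<forall>t\<in>{a..b}. - real u \<le> p t)"
proof -
  obtain a b where ab: "of_rat a < - real N" "real N < of_rat b" "real u < p (of_rat a)" "real u < p (of_rat b)"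
    "\<And>s. a \<le> s \<Longrightarrow> s \<le> b \<Longrightarrow> - real u \<le> p (of_rat s)" using ex unfolding exits_def by blast
  have lt: "real_of_rat a < of_rat b" using ab by linarith
  have "- real u \<le> p t" if t: "t \<in> {of_rat a..of_rat b}" for t
  proof (rule ccontr)
    assume "\<not> - real u \<le> p t"
    define V where "V = {s. p s < - real u}"
    have V: "open V" unfolding V_def using p by (intro open_Collect_less) auto
    have "t \<in> V \<inter> closure {of_rat a<..<of_rat b}" using t lt \<open>\<not> _\<close> by (simp add: V_def)
    then have "V \<inter> {of_rat a<..<of_rat b} \<noteq> {}" using open_Int_closure_eq_empty[OF V] by blast
    then have "V \<inter> {of_rat a<..<of_rat b} \<inter> \<rat> \<noteq> {}"
      using open_Int_closure_eq_empty[of "V \<inter> {of_rat a<..<of_rat b}" \<rat>] V by (simp add: Rats_closure_real open_Int)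
    then obtain s where s: "s \<in> \<rat>" "s \<in> V" "of_rat a < s" "s < of_rat b" by auto
    then obtain q where q: "s = of_rat q" by (auto elim: Rats_cases)
    have "- real u \<le> p s" unfolding q using s by (intro ab(5)) (simp_all add: q of_rat_less)
    then show False using s by (simp add: V_def)
  qed
  then show ?thesis using ab by blast
qed

text \<open>The two processes are the coordinates \<open>(False, t)\<close> and \<open>(True, t)\<close> of one family \<open>z\<close>. The common threshold \<open>u\<close> couples them; frames are requested for every \<open>N\<close>
in order that the event be invariant under translations.\<close>

definition far_frames :: "real \<Rightarrow> real \<Rightarrow> (bool \<times> real \<Rightarrow> real) \<Rightarrow> bool" where
  "far_frames s\<^sub>1 s\<^sub>2 z \<longleftrightarrow>
     (\<forall>N. \<exists>u. exits (\<lambda>t. s\<^sub>1 * z (False, t)) N u \<and> exits (\<lambda>t. s\<^sub>2 * z (True, t)) N u)"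

lemma pred_far_frames: "Measurable.pred (\<Pi>\<^sub>M k\<in>UNIV. borel) (far_frames s\<^sub>1 s\<^sub>2)"
proof -
  have m: "(\<lambda>z t. s * z (b, t)) \<in> measurable (\<Pi>\<^sub>M k\<in>UNIV. borel) path_space" for s :: real and b :: bool
    by (rule measurable_PiM_single') auto
  have [measurable]: "Measurable.pred (\<Pi>\<^sub>M k\<in>UNIV. borel) (\<lambda>z. exits (\<lambda>t. s * z (b, t)) N u)" for s :: real and b :: bool and N u
    by (rule measurable_compose[OF m pred_exits])
  show ?thesis unfolding far_frames_def by measurable
qed

lemma far_frames_shift:
  assumes "far_frames s\<^sub>1 s\<^sub>2 z"
  shows "far_frames s\<^sub>1 s\<^sub>2 (\<lambda>k. z (fst k, snd k + of_int w))"
  unfolding far_frames_def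
proof
  fix N :: nat
  have N: "real N + \<bar>real_of_int w\<bar> \<le> real (N + nat \<bar>w\<bar>)" by simp
  obtain u where u: "exits (\<lambda>t. s\<^sub>1 * z (False, t)) (N + nat \<bar>w\<bar>) u" "exits (\<lambda>t. s\<^sub>2 * z (True, t)) (N + nat \<bar>w\<bar>) u"
    using assms unfolding far_frames_def by blast
  show "\<exists>u. exits (\<lambda>t. s\<^sub>1 * z (fst (False, t), snd (False, t) + of_int w)) N u \<and>
      exits (\<lambda>t. s\<^sub>2 * z (fst (True, t), snd (True, t) + of_int w)) N u"
    using exits_shift[OF u(1) N] exits_shift[OF u(2) N] by auto
qed

lemma far_frames_shift_iff: "far_frames s\<^sub>1 s\<^sub>2 (\<lambda>k. z (fst k, snd k + real m)) \<longleftrightarrow> far_frames s\<^sub>1 s\<^sub>2 z"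
  using far_frames_shift[of s\<^sub>1 s\<^sub>2 z "int m"]
    far_frames_shift[of s\<^sub>1 s\<^sub>2 "\<lambda>k. z (fst k, snd k + real m)" "- int m"] by auto

text \<open>The exits of the two processes at level \<open>k\<close> occur jointly with probability at least \<open>d1 * d2\<close>, so infinitely many \<open>k\<close> succeed with at
least this probability.\<close>

lemma far_frames_pos_prob:
  assumes n1: "normal_process M X\<^sub>1 \<rho>\<^sub>1 K\<^sub>1" and n2: "normal_process M X\<^sub>2 \<rho>\<^sub>2 K\<^sub>2"
    and ind: "independent_processes M X\<^sub>1 X\<^sub>2" and s: "s\<^sub>1 > 0" "s\<^sub>2 > 0"
    and c1: "AE \<omega> in M. continuous_on UNIV (\<lambda>t. X\<^sub>1 t \<omega>)" and c2: "AE \<omega> in M. continuous_on UNIV (\<lambda>t. X\<^sub>2 t \<omega>)"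
  shows "0 < \<P>(\<omega> in M. far_frames s\<^sub>1 s\<^sub>2 (\<lambda>k. if fst k then X\<^sub>2 (snd k) \<omega> else X\<^sub>1 (snd k) \<omega>))"
proof -
  interpret n1: normal_process M X\<^sub>1 \<rho>\<^sub>1 K\<^sub>1 by fact
  interpret n2: normal_process M X\<^sub>2 \<rho>\<^sub>2 K\<^sub>2 by fact
  note [measurable] = n1.X_meas n2.X_meas
  define exit where "exit u p \<longleftrightarrow> (\<exists>a b. a \<le> - u \<and> u \<le> b \<and> p a > u \<and> p b > u \<and> (\<forall>t\<in>{a..b}. - u \<le> p t))"
    for u :: real and p :: "real \<Rightarrow> real"
  define good where "good u Q \<longleftrightarrow> (\<forall>p. continuous_on UNIV p \<longrightarrow> Q p \<longrightarrow> exit u p)"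
    for u :: real and Q :: "(real \<Rightarrow> real) \<Rightarrow> bool"
  obtain d1 where d1: "d1 > 0" "eventually (\<lambda>u. \<exists>Q. Measurable.pred path_space Q \<and> d1 \<le> \<P>(\<omega> in M. Q (\<lambda>t. X\<^sub>1 t \<omega>)) \<and> good u Q) at_top"
    using n1.same_sign_exit by (elim exE conjE) (rule that, assumption, unfold good_def exit_def)
  obtain d2 where d2: "d2 > 0" "eventually (\<lambda>u. \<exists>Q. Measurable.pred path_space Q \<and> d2 \<le> \<P>(\<omega> in M. Q (\<lambda>t. X\<^sub>2 t \<omega>)) \<and> good u Q) at_top"
    using n2.same_sign_exit by (elim exE conjE) (rule that, assumption, unfold good_def exit_def)
  have lim: "filterlim (\<lambda>k. real k / s) at_top sequentially" if "s > 0" for s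
    using that by real_asymp
  have "eventually (\<lambda>k. (\<exists>Q. Measurable.pred path_space Q \<and> d1 \<le> \<P>(\<omega> in M. Q (\<lambda>t. X\<^sub>1 t \<omega>)) \<and> good (real k / s\<^sub>1) Q) \<and>
      (\<exists>Q. Measurable.pred path_space Q \<and> d2 \<le> \<P>(\<omega> in M. Q (\<lambda>t. X\<^sub>2 t \<omega>)) \<and> good (real k / s\<^sub>2) Q)) sequentially"
    using eventually_compose_filterlim[OF d1(2) lim[OF s(1)]] eventually_compose_filterlim[OF d2(2) lim[OF s(2)]]
    by (rule eventually_conj)
  then obtain k0 where k0: "\<And>k. k \<ge> k0 \<Longrightarrow> \<exists>Q. Measurable.pred path_space Q \<and> d1 \<le> \<P>(\<omega> in M. Q (\<lambda>t. X\<^sub>1 t \<omega>)) \<and> good (real k / s\<^sub>1) Q"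
    "\<And>k. k \<ge> k0 \<Longrightarrow> \<exists>Q. Measurable.pred path_space Q \<and> d2 \<le> \<P>(\<omega> in M. Q (\<lambda>t. X\<^sub>2 t \<omega>)) \<and> good (real k / s\<^sub>2) Q"
    unfolding eventually_sequentially by blast
  have "\<forall>k. \<exists>Q. Measurable.pred path_space Q \<and> d1 \<le> \<P>(\<omega> in M. Q (\<lambda>t. X\<^sub>1 t \<omega>)) \<and> good (real (k0 + k) / s\<^sub>1) Q"
    by (intro allI k0(1)) simp
  from choice[OF this] obtain Q1 where Q1': "\<forall>k. Measurable.pred path_space (Q1 k) \<and> d1 \<le> \<P>(\<omega> in M. Q1 k (\<lambda>t. X\<^sub>1 t \<omega>)) \<and> good (real (k0 + k) / s\<^sub>1) (Q1 k)" ..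
  have Q1: "Measurable.pred path_space (Q1 k)" "d1 \<le> \<P>(\<omega> in M. Q1 k (\<lambda>t. X\<^sub>1 t \<omega>))" "good (real (k0 + k) / s\<^sub>1) (Q1 k)" for k
    using Q1'[rule_format, of k] by simp_all
  have "\<forall>k. \<exists>Q. Measurable.pred path_space Q \<and> d2 \<le> \<P>(\<omega> in M. Q (\<lambda>t. X\<^sub>2 t \<omega>)) \<and> good (real (k0 + k) / s\<^sub>2) Q"
    by (intro allI k0(2)) simp
  from choice[OF this] obtain Q2 where Q2': "\<forall>k. Measurable.pred path_space (Q2 k) \<and> d2 \<le> \<P>(\<omega> in M. Q2 k (\<lambda>t. X\<^sub>2 t \<omega>)) \<and> good (real (k0 + k) / s\<^sub>2) (Q2 k)" ..
  have Q2: "Measurable.pred path_space (Q2 k)" "d2 \<le> \<P>(\<omega> in M. Q2 k (\<lambda>t. X\<^sub>2 t \<omega>))" "good (real (k0 + k) / s\<^sub>2) (Q2 k)" for k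
    using Q2'[rule_format, of k] by simp_all
  have mX [measurable]: "(\<lambda>\<omega> t. X\<^sub>1 t \<omega>) \<in> measurable M path_space" "(\<lambda>\<omega> t. X\<^sub>2 t \<omega>) \<in> measurable M path_space"
    by (rule measurable_PiM_single'; auto)+
  define E where "E k = {\<omega>\<in>space M. Q1 k (\<lambda>t. X\<^sub>1 t \<omega>) \<and> Q2 k (\<lambda>t. X\<^sub>2 t \<omega>)}" for k
  have mQ [measurable]: "Measurable.pred M (\<lambda>\<omega>. Q1 k (\<lambda>t. X\<^sub>1 t \<omega>))" "Measurable.pred M (\<lambda>\<omega>. Q2 k (\<lambda>t. X\<^sub>2 t \<omega>))" for k
    using measurable_compose[OF mX(1) Q1(1)] measurable_compose[OF mX(2) Q2(1)] by auto
  have [measurable]: "E k \<in> sets M" for k unfolding E_def by measurable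
  have sQ: "{p. Q p} \<in> sets path_space" if "Measurable.pred path_space Q" for Q
    using measurable_sets[OF that, of "{True}"] by (simp add: space_PiM vimage_def)
  have pE: "d1 * d2 \<le> measure M (E k)" for k
  proof -
    have "measure M ((\<lambda>x. ((\<lambda>t. X\<^sub>1 t x), (\<lambda>t. X\<^sub>2 t x))) -` ({p. Q1 k p} \<times> {p. Q2 k p}) \<inter> space M) =
        measure M ((\<lambda>x t. X\<^sub>1 t x) -` {p. Q1 k p} \<inter> space M) * measure M ((\<lambda>x t. X\<^sub>2 t x) -` {p. Q2 k p} \<inter> space M)"
      by (rule n1.indep_varD[OF ind[unfolded independent_processes_def] sQ[OF Q1(1)] sQ[OF Q2(1)]])
    moreover have "(\<lambda>x. ((\<lambda>t. X\<^sub>1 t x), (\<lambda>t. X\<^sub>2 t x))) -` ({p. Q1 k p} \<times> {p. Q2 k p}) \<inter> space M = E k"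
      by (auto simp: E_def)
    moreover have "(\<lambda>x t. X\<^sub>1 t x) -` {p. Q1 k p} \<inter> space M = {\<omega>\<in>space M. Q1 k (\<lambda>t. X\<^sub>1 t \<omega>)}"
      "(\<lambda>x t. X\<^sub>2 t x) -` {p. Q2 k p} \<inter> space M = {\<omega>\<in>space M. Q2 k (\<lambda>t. X\<^sub>2 t \<omega>)}" by auto
    ultimately have "measure M (E k) = \<P>(\<omega> in M. Q1 k (\<lambda>t. X\<^sub>1 t \<omega>)) * \<P>(\<omega> in M. Q2 k (\<lambda>t. X\<^sub>2 t \<omega>))" by simp
    then show ?thesis using mult_mono[OF Q1(2)[of k] Q2(2)[of k]] d1 d2 by simp
  qed
  define B where "B n = (\<Union>k\<in>{n..}. E k)" for n
  have [measurable]: "B n \<in> sets M" for n unfolding B_def by measurable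
  have "(\<lambda>n. measure M (B n)) \<longlonglongrightarrow> measure M (\<Inter>n. B n)"
  proof (rule n1.finite_Lim_measure_decseq)
    show "decseq B" unfolding decseq_def B_def by (intro allI impI UN_mono) auto
  qed auto
  moreover have "d1 * d2 \<le> measure M (B n)" for n
    using pE[of n] n1.finite_measure_mono[of "E n" "B n"] by (force simp: B_def)
  ultimately have lower: "d1 * d2 \<le> measure M (\<Inter>n. B n)" by (intro LIMSEQ_le_const) auto
  have "AE \<omega> in M. \<omega> \<in> (\<Inter>n. B n) \<longrightarrow> \<omega> \<in> {\<omega>\<in>space M. far_frames s\<^sub>1 s\<^sub>2 (\<lambda>k. if fst k then X\<^sub>2 (snd k) \<omega> else X\<^sub>1 (snd k) \<omega>)}"
    using c1 c2 AE_space
  proof eventually_elim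
    case (elim \<omega>)
    have ex: "exits (\<lambda>t. s * p t) N k" if p: "continuous_on UNIV p" and s: "s > 0" and Q: "Q p" "good (real k / s) Q" and k: "real k / s > real N"
      for s p N k Q
    proof -
      have "exit (real k / s) p" using spec[OF Q(2)[unfolded good_def], of p] p Q(1) by simp
      then obtain a b where ab: "a \<le> - (real k / s) \<and> real k / s \<le> b \<and> p a > real k / s \<and> p b > real k / s \<and> (\<forall>t\<in>{a..b}. - (real k / s) \<le> p t)"
        unfolding exit_def by (elim exE)
      show ?thesis by (rule exits_of_scaled[OF p s k]) (use ab in auto)
    qed
    show ?case
    proof (intro impI CollectI conjI)
      assume \<omega>: "\<omega> \<in> (\<Inter>n. B n)"
      show "far_frames s\<^sub>1 s\<^sub>2 (\<lambda>k. if fst k then X\<^sub>2 (snd k) \<omega> else X\<^sub>1 (snd k) \<omega>)"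
        unfolding far_frames_def
      proof
        fix N :: nat
        have "eventually (\<lambda>k. real k / s\<^sub>1 > real N \<and> real k / s\<^sub>2 > real N) sequentially"
          using lim[OF s(1)] lim[OF s(2)] unfolding filterlim_at_top_dense by (intro eventually_conj) blast+
        then obtain n where n: "\<And>k. k \<ge> n \<Longrightarrow> real k / s\<^sub>1 > real N \<and> real k / s\<^sub>2 > real N"
          unfolding eventually_sequentially by blast
        obtain k where k: "k \<ge> n" "\<omega> \<in> E k" using \<omega> by (auto simp: B_def)
        have "real (k0 + k) / s\<^sub>1 > real N" "real (k0 + k) / s\<^sub>2 > real N" using n[of "k0 + k"] k by auto
        then have "exits (\<lambda>t. s\<^sub>1 * X\<^sub>1 t \<omega>) N (k0 + k)" "exits (\<lambda>t. s\<^sub>2 * X\<^sub>2 t \<omega>) N (k0 + k)"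
          using ex[OF elim(1) s(1) _ Q1(3)] ex[OF elim(2) s(2) _ Q2(3)] k(2) unfolding E_def by auto
        then show "\<exists>u. exits (\<lambda>t. s\<^sub>1 * (if fst (False, t) then X\<^sub>2 (snd (False, t)) \<omega> else X\<^sub>1 (snd (False, t)) \<omega>)) N u \<and>
            exits (\<lambda>t. s\<^sub>2 * (if fst (True, t) then X\<^sub>2 (snd (True, t)) \<omega> else X\<^sub>1 (snd (True, t)) \<omega>)) N u" by auto
      qed
    qed (use elim in simp)
  qed
  moreover have "(\<lambda>\<omega> k. if fst k then X\<^sub>2 (snd k) \<omega> else X\<^sub>1 (snd k) \<omega>) \<in> measurable M (\<Pi>\<^sub>M k\<in>(UNIV :: (bool \<times> real) set). borel)"
  proof (rule measurable_PiM_single')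
    show "(\<lambda>\<omega>. if fst k then X\<^sub>2 (snd k) \<omega> else X\<^sub>1 (snd k) \<omega>) \<in> borel_measurable M" for k :: "bool \<times> real"
      by (cases "fst k") auto
  qed auto
  from measurable_compose[OF this pred_far_frames]
  have "{\<omega>\<in>space M. far_frames s\<^sub>1 s\<^sub>2 (\<lambda>k. if fst k then X\<^sub>2 (snd k) \<omega> else X\<^sub>1 (snd k) \<omega>)} \<in> sets M" by measurable
  ultimately have "measure M (\<Inter>n. B n) \<le> \<P>(\<omega> in M. far_frames s\<^sub>1 s\<^sub>2 (\<lambda>k. if fst k then X\<^sub>2 (snd k) \<omega> else X\<^sub>1 (snd k) \<omega>))"
    by (intro n1.finite_measure_mono_AE)
  then show ?thesis using lower mult_pos_pos[OF d1(1) d2(1)] by linarith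
qed

lemma (in normal_process) tendsto_\<rho>: "(\<rho> \<longlongrightarrow> 0) at_infinity"
proof (rule Lim_null_comparison)
  have "eventually (\<lambda>t :: real. norm t \<ge> exp 1) at_infinity" unfolding eventually_at_infinity by blast
  then show "eventually (\<lambda>t. norm (\<rho> t) \<le> \<bar>\<rho> t * ln \<bar>t\<bar>\<bar>) at_infinity"
  proof eventually_elim
    case (elim t)
    then have "1 \<le> ln \<bar>t\<bar>" using ln_ge_iff[of "\<bar>t\<bar>" 1] by (smt (verit) exp_gt_zero real_norm_def)
    then have "\<bar>\<rho> t\<bar> * 1 \<le> \<bar>\<rho> t\<bar> * ln \<bar>t\<bar>" by (intro mult_left_mono) auto
    then show ?case using \<open>1 \<le> _\<close> by (simp add: abs_mult)
  qed
  show "((\<lambda>t. \<bar>\<rho> t * ln \<bar>t\<bar>\<bar>) \<longlongrightarrow> 0) at_infinity" using tendsto_rabs[OF decay] by simp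
qed

text \<open>The growth bounds for \<open>X\<close>, \<open>- X\<close> and their time reversals, in terms of a process with standard deviation \<open>\<sigma>\<close>.\<close>

lemma scaled_growth:
  assumes X: "normal_process M (\<lambda>t \<omega>. g t \<omega> / \<sigma>) \<rho> K" and \<sigma>: "\<sigma> > 0"
    and cont: "AE \<omega> in M. continuous_on UNIV (\<lambda>t. g t \<omega>)" and e: "e > 0"
  shows "AE \<omega> in M. eventually (\<lambda>k.
    (\<forall>t\<in>{- exp ((real k * (e / \<sigma>))\<^sup>2 / 2)..exp ((real k * (e / \<sigma>))\<^sup>2 / 2)}. g t \<omega> \<le> real k * e + e) \<and>
    (\<exists>t\<in>{- exp ((real k * (e / \<sigma>))\<^sup>2 / 2)..0}. g t \<omega> \<le> - (real k * e - e)) \<and>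
    (\<exists>t\<in>{0..exp ((real k * (e / \<sigma>))\<^sup>2 / 2)}. g t \<omega> \<le> - (real k * e - e))) sequentially"
proof -
  interpret n: normal_process M "\<lambda>t \<omega>. g t \<omega> / \<sigma>" \<rho> K by fact
  interpret r: normal_process M "\<lambda>t \<omega>. g (- t) \<omega> / \<sigma>" \<rho> K by (rule n.reversed_process)
  interpret m: normal_process M "\<lambda>t \<omega>. - (g t \<omega> / \<sigma>)" \<rho> K by (rule n.minus_process)
  interpret mr: normal_process M "\<lambda>t \<omega>. - (g (- t) \<omega> / \<sigma>)" \<rho> K by (rule r.minus_process)
  define L where "L k = exp ((real k * (e / \<sigma>))\<^sup>2 / 2)" for k
  have e': "e / \<sigma> > 0" using e \<sigma> by simp
  have c: "AE \<omega> in M. continuous_on UNIV (\<lambda>t. g t \<omega> / \<sigma>)"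
    using cont
  proof eventually_elim
    case (elim \<omega>)
    show ?case by (rule continuous_on_divide[OF elim continuous_on_const]) (use \<sigma> in simp)
  qed
  have cr: "AE \<omega> in M. continuous_on UNIV (\<lambda>t. g (- t) \<omega> / \<sigma>)"
    using c
  proof eventually_elim
    case (elim \<omega>)
    show ?case using continuous_on_compose2[OF elim, of UNIV uminus] by (simp add: continuous_on_minus)
  qed
  have up: "x \<le> real k * e + e" if "x / \<sigma> \<le> real k * (e / \<sigma>) + e / \<sigma>" for x k
    using mult_left_mono[OF that, of \<sigma>] \<sigma> by (simp add: distrib_left)
  have low: "x \<le> - (real k * e - e)" if "real k * (e / \<sigma>) - e / \<sigma> \<le> - (x / \<sigma>)" for x k
    using mult_left_mono[OF that, of \<sigma>] \<sigma> by (simp add: right_diff_distrib)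
  show ?thesis
    using n.growth_upper[OF c e'] r.growth_upper[OF cr e'] m.growth_lower[OF e'] mr.growth_lower[OF e']
    unfolding L_def[symmetric]
  proof eventually_elim
    case (elim \<omega>)
    then show ?case
    proof eventually_elim
      case (elim k)
      have "g t \<omega> \<le> real k * e + e" if t: "t \<in> {- L k..L k}" for t
      proof (cases "t \<ge> 0")
        case True
        with t elim(1) show ?thesis by (intro up) simp
      next
        case False
        then have "- t \<in> {0..L k}" using t by auto
        with elim(2) have "g (- (- t)) \<omega> / \<sigma> \<le> real k * (e / \<sigma>) + e / \<sigma>" by (rule bspec)
        then show ?thesis by (intro up) simp
      qed
      moreover from elim(3) obtain t where t: "t \<in> {0..L k}" "real k * (e / \<sigma>) - e / \<sigma> \<le> - (g t \<omega> / \<sigma>)" by (rule bexE)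
      have "\<exists>t\<in>{0..L k}. g t \<omega> \<le> - (real k * e - e)" by (rule bexI[of _ t], rule low[OF t(2)], rule t(1))
      moreover from elim(4) obtain t' where t': "t' \<in> {0..L k}" "real k * (e / \<sigma>) - e / \<sigma> \<le> - (g (- t') \<omega> / \<sigma>)" by (rule bexE)
      have "\<exists>t\<in>{- L k..0}. g t \<omega> \<le> - (real k * e - e)" by (rule bexI[of _ "- t'"], rule low[OF t'(2)], use t'(1) in auto)
      ultimately show ?case by (intro conjI ballI)
    qed
  qed
qed

text \<open>A continuous function is bounded below on compact sets.\<close>

lemma low_points_escape:
  fixes p :: "real \<Rightarrow> real"
  assumes p: "continuous_on UNIV p" and x: "\<And>n. 0 \<le> x n" and lim: "filterlim (\<lambda>n. p (x n)) at_bot sequentially"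
  shows "filterlim x at_top sequentially"
  unfolding filterlim_at_top
proof
  fix B :: real
  have "compact (p ` {0..B})" by (intro compact_continuous_image continuous_on_subset[OF p]) auto
  then have "bdd_below (p ` {0..B})" by (intro bounded_imp_bdd_below compact_imp_bounded)
  then obtain m where m: "\<And>t. t \<in> {0..B} \<Longrightarrow> m \<le> p t" unfolding bdd_below_def by (metis imageI)
  have "eventually (\<lambda>n. p (x n) < m) sequentially" using lim unfolding filterlim_at_bot_dense by simp
  then show "eventually (\<lambda>n. B \<le> x n) sequentially"
  proof eventually_elim
    case (elim n)
    show ?case
    proof (rule ccontr)
      assume "\<not> B \<le> x n"
      then have "m \<le> p (x n)" using x[of n] by (intro m) auto
      with elim show False by simp
    qed
  qed
qed

text \<open>The grid of scale \<open>n\<close> consists of lines through low points of scale \<open>k0 + n\<close>, extended to the range of scale \<open>k0 + n + 1\<close> so that it meets the next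
grid. There the other process is at most \<open>(k0 + n + 2) * e\<close>, while the value at the low point is at most \<open>- (k0 + n - 1) * e\<close>; the sum is \<open>3 * e\<close>.\<close>

lemma unique_unbounded_component_of_growth:
  fixes p q :: "real \<Rightarrow> real" and L L' :: "nat \<Rightarrow> real"
  assumes e: "e > 0" and p: "continuous_on UNIV p" and q: "continuous_on UNIV q"
    and L: "mono L" and L': "mono L'"
    and P: "eventually (\<lambda>k. (\<forall>t\<in>{- L k..L k}. p t \<le> real k * e + e) \<and>
      (\<exists>t\<in>{- L k..0}. p t \<le> - (real k * e - e)) \<and> (\<exists>t\<in>{0..L k}. p t \<le> - (real k * e - e))) sequentially"
    and Q: "eventually (\<lambda>k. (\<forall>t\<in>{- L' k..L' k}. q t \<le> real k * e + e) \<and>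
      (\<exists>t\<in>{- L' k..0}. q t \<le> - (real k * e - e)) \<and> (\<exists>t\<in>{0..L' k}. q t \<le> - (real k * e - e))) sequentially"
  shows "\<exists>!C. C \<in> components {x. p (fst x) + q (snd x) \<le> 3 * e} \<and> \<not> bounded C"
proof -
  obtain k1 where k1: "\<forall>k\<ge>k1. (\<forall>t\<in>{- L k..L k}. p t \<le> real k * e + e) \<and>
      (\<exists>t\<in>{- L k..0}. p t \<le> - (real k * e - e)) \<and> (\<exists>t\<in>{0..L k}. p t \<le> - (real k * e - e))"
    using P unfolding eventually_sequentially ..
  obtain k2 where k2: "\<forall>k\<ge>k2. (\<forall>t\<in>{- L' k..L' k}. q t \<le> real k * e + e) \<and>
      (\<exists>t\<in>{- L' k..0}. q t \<le> - (real k * e - e)) \<and> (\<exists>t\<in>{0..L' k}. q t \<le> - (real k * e - e))"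
    using Q unfolding eventually_sequentially ..
  define k0 where "k0 = max k1 k2"
  have k0: "(\<forall>t\<in>{- L k..L k}. p t \<le> real k * e + e) \<and> (\<exists>t\<in>{- L k..0}. p t \<le> - (real k * e - e)) \<and> (\<exists>t\<in>{0..L k}. p t \<le> - (real k * e - e))"
    "(\<forall>t\<in>{- L' k..L' k}. q t \<le> real k * e + e) \<and> (\<exists>t\<in>{- L' k..0}. q t \<le> - (real k * e - e)) \<and> (\<exists>t\<in>{0..L' k}. q t \<le> - (real k * e - e))"
    if "k0 \<le> k" for k
    using k1[rule_format, of k] k2[rule_format, of k] that by (auto simp: k0_def)
  have upp: "p t \<le> real k * e + e" if "k \<ge> k0" "t \<in> {- L k..L k}" for k t using k0(1)[OF that(1)] that(2) by blast
  have upq: "q t \<le> real k * e + e" if "k \<ge> k0" "t \<in> {- L' k..L' k}" for k t using k0(2)[OF that(1)] that(2) by blast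
  have "\<forall>n. \<exists>t. t \<in> {- L (k0 + n)..0} \<and> p t \<le> - (real (k0 + n) * e - e)" using k0(1)[OF le_add1] by blast
  from choice[OF this] obtain a where a: "\<forall>n. a n \<in> {- L (k0 + n)..0} \<and> p (a n) \<le> - (real (k0 + n) * e - e)" ..
  have "\<forall>n. \<exists>t. t \<in> {0..L (k0 + n)} \<and> p t \<le> - (real (k0 + n) * e - e)" using k0(1)[OF le_add1] by blast
  from choice[OF this] obtain b where b: "\<forall>n. b n \<in> {0..L (k0 + n)} \<and> p (b n) \<le> - (real (k0 + n) * e - e)" ..
  have "\<forall>n. \<exists>t. t \<in> {- L' (k0 + n)..0} \<and> q t \<le> - (real (k0 + n) * e - e)" using k0(2)[OF le_add1] by blast
  from choice[OF this] obtain c where c: "\<forall>n. c n \<in> {- L' (k0 + n)..0} \<and> q (c n) \<le> - (real (k0 + n) * e - e)" ..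
  have "\<forall>n. \<exists>t. t \<in> {0..L' (k0 + n)} \<and> q t \<le> - (real (k0 + n) * e - e)" using k0(2)[OF le_add1] by blast
  from choice[OF this] obtain d where d: "\<forall>n. d n \<in> {0..L' (k0 + n)} \<and> q (d n) \<le> - (real (k0 + n) * e - e)" ..
  have thr: "filterlim (\<lambda>n. - (real (k0 + n) * e - e)) at_bot sequentially" using e by real_asymp
  have bot: "filterlim (\<lambda>n. r (x n)) at_bot sequentially" if "\<And>n. r (x n) \<le> - (real (k0 + n) * e - e)" for r x :: "_ \<Rightarrow> real"
    by (rule filterlim_at_bot_mono[OF thr]) (use that in auto)
  have neg: "filterlim x at_bot sequentially"
    if r: "continuous_on UNIV r" and x: "\<And>n. x n \<le> 0" and l: "\<And>n. r (x n) \<le> - (real (k0 + n) * e - e)"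
    for r :: "real \<Rightarrow> real" and x
  proof -
    have "continuous_on UNIV (\<lambda>t. r (- t))"
      by (rule continuous_on_compose2[OF r]) (auto intro!: continuous_intros)
    then have "filterlim (\<lambda>n. - x n) at_top sequentially"
      using low_points_escape[of "\<lambda>t. r (- t)" "\<lambda>n. - x n"] x bot[of r x, OF l] by simp
    then show ?thesis by (simp add: filterlim_uminus_at_bot)
  qed
  have Lle: "L (k0 + n) \<le> L (k0 + Suc n)" "L' (k0 + n) \<le> L' (k0 + Suc n)" for n
    using L L' by (auto intro: monoD)
  have L0: "0 \<le> L (k0 + n)" "0 \<le> L' (k0 + n)" for n using b[rule_format, of n] d[rule_format, of n] by auto
  show ?thesis
  proof (rule unique_unbounded_component[where a = a and b = b and c = c and d = d
        and L = "\<lambda>n. L (k0 + Suc n)" and L' = "\<lambda>n. L' (k0 + Suc n)"])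
    show "hash_shape (a n) (b n) (c n) (d n) (L (k0 + Suc n)) (L' (k0 + Suc n)) \<subseteq> {x. p (fst x) + q (snd x) \<le> 3 * e}" for n
    proof -
      have q': "q t \<le> real (k0 + n) * e + 2 * e" if "t \<in> {- L' (k0 + Suc n)..L' (k0 + Suc n)}" for t
        using upq[OF _ that] by (simp add: algebra_simps)
      have p': "p t \<le> real (k0 + n) * e + 2 * e" if "t \<in> {- L (k0 + Suc n)..L (k0 + Suc n)}" for t
        using upp[OF _ that] by (simp add: algebra_simps)
      have low: "p (a n) \<le> - (real (k0 + n) * e - e)" "p (b n) \<le> - (real (k0 + n) * e - e)"
        "q (c n) \<le> - (real (k0 + n) * e - e)" "q (d n) \<le> - (real (k0 + n) * e - e)"
        using a b c d by blast+
      show ?thesis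
      proof (intro subsetI CollectI)
        fix x assume "x \<in> hash_shape (a n) (b n) (c n) (d n) (L (k0 + Suc n)) (L' (k0 + Suc n))"
        then consider "fst x = a n \<or> fst x = b n" "snd x \<in> {- L' (k0 + Suc n)..L' (k0 + Suc n)}"
          | "snd x = c n \<or> snd x = d n" "fst x \<in> {- L (k0 + Suc n)..L (k0 + Suc n)}"
          unfolding hash_shape_def by auto
        then show "p (fst x) + q (snd x) \<le> 3 * e"
        proof cases
          case 1
          then have "p (fst x) \<le> - (real (k0 + n) * e - e)" using low by auto
          with q'[OF 1(2)] show ?thesis by linarith
        next
          case 2
          then have "q (snd x) \<le> - (real (k0 + n) * e - e)" using low by auto
          with p'[OF 2(2)] show ?thesis by linarith
        qed
      qed
    qed
    show "a n \<in> {- L (k0 + Suc n)..L (k0 + Suc n)}" for n using a[rule_format, of n] Lle[of n] L0[of n] by auto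
    show "b n \<in> {- L (k0 + Suc n)..L (k0 + Suc n)}" for n using b[rule_format, of n] Lle[of n] L0[of n] by auto
    show "c n \<in> {- L' (k0 + Suc n)..L' (k0 + Suc n)}" for n using c[rule_format, of n] Lle[of n] L0[of n] by auto
    show "d n \<in> {- L' (k0 + Suc n)..L' (k0 + Suc n)}" for n using d[rule_format, of n] Lle[of n] L0[of n] by auto
    show "a (Suc n) \<in> {- L (k0 + Suc n)..L (k0 + Suc n)}" for n using a[rule_format, of "Suc n"] L0[of "Suc n"] by auto
    show "L' (k0 + Suc n) \<le> L' (k0 + Suc (Suc n))" for n using Lle(2)[of "Suc n"] by simp
    show "filterlim a at_bot sequentially" by (rule neg[OF p]) (use a in auto)
    show "filterlim c at_bot sequentially" by (rule neg[OF q]) (use c in auto)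
    show "filterlim b at_top sequentially" by (rule low_points_escape[OF p], use b in simp, rule bot[of p]) (use b in blast)
    show "filterlim d at_top sequentially" by (rule low_points_escape[OF q], use d in simp, rule bot[of q]) (use d in blast)
  qed
qed

text \<open>Positive probability and the zero-one law give probability one; continuity turns the rational frames into real ones.\<close>

lemma frames_almost_surely:
  assumes n1: "normal_process M X\<^sub>1 \<rho>\<^sub>1 K\<^sub>1" and n2: "normal_process M X\<^sub>2 \<rho>\<^sub>2 K\<^sub>2"
    and ind: "independent_processes M X\<^sub>1 X\<^sub>2" and s: "s\<^sub>1 > 0" "s\<^sub>2 > 0"
    and c1: "AE \<omega> in M. continuous_on UNIV (\<lambda>t. X\<^sub>1 t \<omega>)" and c2: "AE \<omega> in M. continuous_on UNIV (\<lambda>t. X\<^sub>2 t \<omega>)"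
  shows "AE \<omega> in M. \<forall>R. \<exists>a b c d. a < - R \<and> R < b \<and> c < - R \<and> R < d \<and>
    (\<forall>x\<in>rectangle_frame a b c d. s\<^sub>1 * X\<^sub>1 (fst x) \<omega> + s\<^sub>2 * X\<^sub>2 (snd x) \<omega> > 0)"
proof -
  interpret n1: normal_process M X\<^sub>1 \<rho>\<^sub>1 K\<^sub>1 by fact
  interpret n2: normal_process M X\<^sub>2 \<rho>\<^sub>2 K\<^sub>2 by fact
  interpret G: gaussian_space M "sum_space (finite_combinations X\<^sub>1) (finite_combinations X\<^sub>2)"
    by (rule n1.gaussian_space_sum_space[OF n1.gaussian_space_axioms n2.gaussian_space_axioms n1.indep_var_finite_combinations[OF ind]])
  define Z where "Z k = (\<lambda>\<omega>. if fst k then X\<^sub>2 (snd k) \<omega> else X\<^sub>1 (snd k) \<omega>)" for k :: "bool \<times> real"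
  have Z: "Z k \<in> sum_space (finite_combinations X\<^sub>1) (finite_combinations X\<^sub>2)" for k
    using sum_spaceI[OF n1.zero_mem n2.X_mem[of "snd k"]] sum_spaceI[OF n1.X_mem[of "snd k"] n2.zero_mem]
    by (cases "fst k") (simp_all add: Z_def)
  have cross: "n1.expectation (\<lambda>\<omega>. X\<^sub>1 s \<omega> * X\<^sub>2 t \<omega>) = 0" for s t
  proof -
    have "n1.expectation (\<lambda>\<omega>. X\<^sub>1 s \<omega> * X\<^sub>2 t \<omega>) = n1.expectation (X\<^sub>1 s) * n1.expectation (X\<^sub>2 t)"
      by (rule n1.indep_var_lebesgue_integral[OF n1.indep_var_finite_combinations[OF ind n1.X_mem n2.X_mem]
            n1.integrable_mem[OF n1.X_mem] n2.integrable_mem[OF n2.X_mem]])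
    then show ?thesis using n1.centred_X unfolding centred_process_def by simp
  qed
  define \<gamma> where "\<gamma> b b' t = (if b = b' then (if b then \<rho>\<^sub>2 t else \<rho>\<^sub>1 t) else 0)" for b b' :: bool and t :: real
  have \<gamma>: "G.cov (Z (b, s)) (Z (b', t)) = \<gamma> b b' (t - s)" for b b' s t
    using cross[of s t] cross[of t s] n1.covariance_X[of s t] n2.covariance_X[of s t]
    by (cases b; cases b') (simp_all add: G.cov_def Z_def \<gamma>_def mult.commute)
  have dec: "(\<gamma> b b' \<longlongrightarrow> 0) at_infinity" for b b'
    using n1.tendsto_\<rho> n2.tendsto_\<rho> by (cases b; cases b') (simp_all add: \<gamma>_def[abs_def])
  have "\<P>(\<omega> in M. far_frames s\<^sub>1 s\<^sub>2 (\<lambda>k. Z k \<omega>)) \<in> {0, 1}"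
    by (rule G.zero_one_law[OF Z \<gamma> dec pred_far_frames far_frames_shift_iff])
  moreover have "0 < \<P>(\<omega> in M. far_frames s\<^sub>1 s\<^sub>2 (\<lambda>k. Z k \<omega>))"
    unfolding Z_def by (rule far_frames_pos_prob[OF n1 n2 ind s c1 c2])
  ultimately have one: "\<P>(\<omega> in M. far_frames s\<^sub>1 s\<^sub>2 (\<lambda>k. Z k \<omega>)) = 1" by auto
  note [measurable] = G.meas[OF Z]
  have mZ: "(\<lambda>\<omega> k. Z k \<omega>) \<in> measurable M (\<Pi>\<^sub>M k\<in>UNIV. borel)" by (rule measurable_PiM_single') auto
  have "Measurable.pred M (\<lambda>\<omega>. far_frames s\<^sub>1 s\<^sub>2 (\<lambda>k. Z k \<omega>))" by (rule measurable_compose[OF mZ pred_far_frames])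
  then have "{\<omega> \<in> space M. far_frames s\<^sub>1 s\<^sub>2 (\<lambda>k. Z k \<omega>)} \<in> sets M" by measurable
  from n1.prob_Collect_eq_1[OF this] one have ae: "AE \<omega> in M. far_frames s\<^sub>1 s\<^sub>2 (\<lambda>k. Z k \<omega>)" by simp
  show ?thesis
    using ae c1 c2
  proof eventually_elim
    case (elim \<omega>)
    show ?case
    proof
      fix R :: real
      obtain N :: nat where N: "R \<le> real N" using real_arch_simple by blast
      obtain u where u: "exits (\<lambda>t. s\<^sub>1 * X\<^sub>1 t \<omega>) N u" "exits (\<lambda>t. s\<^sub>2 * X\<^sub>2 t \<omega>) N u"
        using elim(1)[unfolded far_frames_def, rule_format, of N] by (auto simp: Z_def)
      have c: "continuous_on UNIV (\<lambda>t. s\<^sub>1 * X\<^sub>1 t \<omega>)" "continuous_on UNIV (\<lambda>t. s\<^sub>2 * X\<^sub>2 t \<omega>)"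
        by (rule continuous_on_mult_left[OF elim(2)], rule continuous_on_mult_left[OF elim(3)])
      from real_of_exits[OF c(1) u(1)] obtain a b where ab: "a < - real N \<and> real N < b \<and> real u < s\<^sub>1 * X\<^sub>1 a \<omega> \<and> real u < s\<^sub>1 * X\<^sub>1 b \<omega> \<and> (\<forall>t\<in>{a..b}. - real u \<le> s\<^sub>1 * X\<^sub>1 t \<omega>)"
        by (elim exE)
      from real_of_exits[OF c(2) u(2)] obtain c d where cd: "c < - real N \<and> real N < d \<and> real u < s\<^sub>2 * X\<^sub>2 c \<omega> \<and> real u < s\<^sub>2 * X\<^sub>2 d \<omega> \<and> (\<forall>t\<in>{c..d}. - real u \<le> s\<^sub>2 * X\<^sub>2 t \<omega>)"
        by (elim exE)
      have "s\<^sub>1 * X\<^sub>1 (fst x) \<omega> + s\<^sub>2 * X\<^sub>2 (snd x) \<omega> > 0" if hx: "x \<in> rectangle_frame a b c d" for x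
      proof -
        consider "fst x = a \<or> fst x = b" "snd x \<in> {c..d}" | "snd x = c \<or> snd x = d" "fst x \<in> {a..b}"
          using hx unfolding rectangle_frame_def by auto
        then show ?thesis
        proof cases
          case 1
          then have "real u < s\<^sub>1 * X\<^sub>1 (fst x) \<omega>" "- real u \<le> s\<^sub>2 * X\<^sub>2 (snd x) \<omega>" using ab cd by auto
          then show ?thesis by linarith
        next
          case 2
          then have "real u < s\<^sub>2 * X\<^sub>2 (snd x) \<omega>" "- real u \<le> s\<^sub>1 * X\<^sub>1 (fst x) \<omega>" using ab cd by auto
          then show ?thesis by linarith
        qed
      qed
      moreover have "a < - R" "R < b" "c < - R" "R < d" using ab cd N by linarith+
      ultimately show "\<exists>a b c d. a < - R \<and> R < b \<and> c < - R \<and> R < d \<and>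
          (\<forall>x\<in>rectangle_frame a b c d. s\<^sub>1 * X\<^sub>1 (fst x) \<omega> + s\<^sub>2 * X\<^sub>2 (snd x) \<omega> > 0)" by blast
    qed
  qed
qed

theorem theorem1p2:
  fixes M :: "'a measure" and g\<^sub>1 g\<^sub>2 :: "real \<Rightarrow> 'a \<Rightarrow> real"
  assumes "prob_space M"
    and "gaussian_process M g\<^sub>1" and "gaussian_process M g\<^sub>2"
    and "centred_process M g\<^sub>1" and "centred_process M g\<^sub>2"
    and "stationary_process M g\<^sub>1" and "stationary_process M g\<^sub>2"
    and "independent_processes M g\<^sub>1 g\<^sub>2"
    and "\<not> (AE \<omega> in M. \<forall>t. g\<^sub>1 t \<omega> = 0)" and "\<not> (AE \<omega> in M. \<forall>t. g\<^sub>2 t \<omega> = 0)"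
    and "AE \<omega> in M. C2_smooth (\<lambda>t. g\<^sub>1 t \<omega>)" and "AE \<omega> in M. C2_smooth (\<lambda>t. g\<^sub>2 t \<omega>)"
    and "((\<lambda>t. covariance_kernel M g\<^sub>1 t * ln \<bar>t\<bar>) \<longlongrightarrow> 0) at_infinity"
    and "((\<lambda>t. covariance_kernel M g\<^sub>2 t * ln \<bar>t\<bar>) \<longlongrightarrow> 0) at_infinity"
  shows "(\<forall>l\<le>0. AE \<omega> in M.
            \<forall>C\<in>components {x. additive_field g\<^sub>1 g\<^sub>2 \<omega> x \<le> l}. bounded C) \<and>
         (\<forall>l>0. AE \<omega> in M.
            \<exists>!C. C \<in> components {x. additive_field g\<^sub>1 g\<^sub>2 \<omega> x \<le> l} \<and> \<not> bounded C) \<and>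
         (\<forall>l. AE \<omega> in M.
            \<forall>C\<in>components {x. additive_field g\<^sub>1 g\<^sub>2 \<omega> x = l}. bounded C)"
proof -
  interpret prob_space M by fact
  obtain \<sigma>\<^sub>1 \<rho>\<^sub>1 K\<^sub>1 where \<sigma>\<^sub>1: "\<sigma>\<^sub>1 > 0" and n1: "normal_process M (\<lambda>t \<omega>. g\<^sub>1 t \<omega> / \<sigma>\<^sub>1) \<rho>\<^sub>1 K\<^sub>1"
    using normalisation[OF assms(2,4,6,9,11,13)] by blast
  obtain \<sigma>\<^sub>2 \<rho>\<^sub>2 K\<^sub>2 where \<sigma>\<^sub>2: "\<sigma>\<^sub>2 > 0" and n2: "normal_process M (\<lambda>t \<omega>. g\<^sub>2 t \<omega> / \<sigma>\<^sub>2) \<rho>\<^sub>2 K\<^sub>2"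
    using normalisation[OF assms(3,5,7,10,12,14)] by blast
  interpret n1: normal_process M "\<lambda>t \<omega>. g\<^sub>1 t \<omega> / \<sigma>\<^sub>1" \<rho>\<^sub>1 K\<^sub>1 by fact
  interpret n2: normal_process M "\<lambda>t \<omega>. g\<^sub>2 t \<omega> / \<sigma>\<^sub>2" \<rho>\<^sub>2 K\<^sub>2 by fact
  have c1: "AE \<omega> in M. continuous_on UNIV (\<lambda>t. g\<^sub>1 t \<omega>)"
    using assms(11) by eventually_elim (rule C2_smooth_continuous)
  have c2: "AE \<omega> in M. continuous_on UNIV (\<lambda>t. g\<^sub>2 t \<omega>)"
    using assms(12) by eventually_elim (rule C2_smooth_continuous)
  have scaled: "AE \<omega> in M. continuous_on UNIV (\<lambda>t. g t \<omega> / s)" "AE \<omega> in M. continuous_on UNIV (\<lambda>t. - (g t \<omega> / s))"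
    if "AE \<omega> in M. continuous_on UNIV (\<lambda>t. g t \<omega>)" "s > 0" for g :: "real \<Rightarrow> 'a \<Rightarrow> real" and s
  proof -
    show c: "AE \<omega> in M. continuous_on UNIV (\<lambda>t. g t \<omega> / s)"
      using that(1)
    proof eventually_elim
      case (elim \<omega>)
      show ?case by (rule continuous_on_divide[OF elim continuous_on_const]) (use that in simp)
    qed
    show "AE \<omega> in M. continuous_on UNIV (\<lambda>t. - (g t \<omega> / s))"
      using c by eventually_elim (rule continuous_on_minus)
  qed
  have pos: "AE \<omega> in M. \<forall>R. \<exists>a b c d. a < - R \<and> R < b \<and> c < - R \<and> R < d \<and>
      (\<forall>x\<in>rectangle_frame a b c d. additive_field g\<^sub>1 g\<^sub>2 \<omega> x > 0)"
  proof -
    have "independent_processes M (\<lambda>t \<omega>. g\<^sub>1 t \<omega> / \<sigma>\<^sub>1) (\<lambda>t \<omega>. g\<^sub>2 t \<omega> / \<sigma>\<^sub>2)"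
      using independent_processes_scale[OF assms(1,8), of "1 / \<sigma>\<^sub>1" "1 / \<sigma>\<^sub>2"] by simp
    from frames_almost_surely[OF n1 n2 this \<sigma>\<^sub>1 \<sigma>\<^sub>2 scaled(1)[OF c1 \<sigma>\<^sub>1] scaled(1)[OF c2 \<sigma>\<^sub>2]]
    show ?thesis using \<sigma>\<^sub>1 \<sigma>\<^sub>2 by (simp add: additive_field_def)
  qed
  have neg: "AE \<omega> in M. \<forall>R. \<exists>a b c d. a < - R \<and> R < b \<and> c < - R \<and> R < d \<and>
      (\<forall>x\<in>rectangle_frame a b c d. - g\<^sub>1 (fst x) \<omega> + - g\<^sub>2 (snd x) \<omega> > 0)"
  proof -
    have "independent_processes M (\<lambda>t \<omega>. - (g\<^sub>1 t \<omega> / \<sigma>\<^sub>1)) (\<lambda>t \<omega>. - (g\<^sub>2 t \<omega> / \<sigma>\<^sub>2))"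
      using independent_processes_scale[OF assms(1,8), of "- 1 / \<sigma>\<^sub>1" "- 1 / \<sigma>\<^sub>2"] by simp
    from frames_almost_surely[OF n1.minus_process n2.minus_process this \<sigma>\<^sub>1 \<sigma>\<^sub>2 scaled(2)[OF c1 \<sigma>\<^sub>1] scaled(2)[OF c2 \<sigma>\<^sub>2]]
    show ?thesis using \<sigma>\<^sub>1 \<sigma>\<^sub>2 by simp
  qed
  have nonpos: "AE \<omega> in M. \<forall>C\<in>components {x. additive_field g\<^sub>1 g\<^sub>2 \<omega> x \<le> l}. bounded C" if l: "l \<le> 0" for l
    using pos
  proof eventually_elim
    case (elim \<omega>)
    show ?case
    proof (rule components_bounded_of_frames)
      fix R :: real
      from elim[rule_format, of R] obtain a b c d where f: "a < - R \<and> R < b \<and> c < - R \<and> R < d \<and>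
          (\<forall>x\<in>rectangle_frame a b c d. additive_field g\<^sub>1 g\<^sub>2 \<omega> x > 0)" by (elim exE)
      then have "{x. additive_field g\<^sub>1 g\<^sub>2 \<omega> x \<le> l} \<inter> rectangle_frame a b c d = {}" using l by fastforce
      with f show "\<exists>a b c d. a < - R \<and> R < b \<and> c < - R \<and> R < d \<and> {x. additive_field g\<^sub>1 g\<^sub>2 \<omega> x \<le> l} \<inter> rectangle_frame a b c d = {}"
        by blast
    qed
  qed
  moreover have "AE \<omega> in M. \<exists>!C. C \<in> components {x. additive_field g\<^sub>1 g\<^sub>2 \<omega> x \<le> l} \<and> \<not> bounded C" if l: "l > 0" for l
  proof -
    define e where "e = l / 3"
    have e: "e > 0" "3 * e = l" using l by (simp_all add: e_def)
    have mon: "mono (\<lambda>k. exp ((real k * (e / \<sigma>))\<^sup>2 / 2))" if "\<sigma> > 0" for \<sigma>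
      using e that by (intro monoI iffD2[OF exp_le_cancel_iff] divide_right_mono power_mono mult_right_mono) simp_all
    show ?thesis
      using scaled_growth[OF n1 \<sigma>\<^sub>1 c1 e(1)] scaled_growth[OF n2 \<sigma>\<^sub>2 c2 e(1)] c1 c2
    proof eventually_elim
      case (elim \<omega>)
      show ?case
        using unique_unbounded_component_of_growth[OF e(1) elim(3,4) mon[OF \<sigma>\<^sub>1] mon[OF \<sigma>\<^sub>2] elim(1,2)]
        by (simp add: e(2) additive_field_def)
    qed
  qed
  moreover have "AE \<omega> in M. \<forall>C\<in>components {x. additive_field g\<^sub>1 g\<^sub>2 \<omega> x = l}. bounded C" for l
  proof (cases "l \<le> 0")
    case True
    show ?thesis
      using nonpos[OF True] by eventually_elim (rule components_bounded_subset, assumption, auto)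
  next
    case False
    show ?thesis
      using neg
    proof eventually_elim
      case (elim \<omega>)
      show ?case
      proof (rule components_bounded_of_frames)
        fix R :: real
        from elim[rule_format, of R] obtain a b c d where f: "a < - R \<and> R < b \<and> c < - R \<and> R < d \<and>
            (\<forall>x\<in>rectangle_frame a b c d. - g\<^sub>1 (fst x) \<omega> + - g\<^sub>2 (snd x) \<omega> > 0)" by (elim exE)
        then have "{x. additive_field g\<^sub>1 g\<^sub>2 \<omega> x = l} \<inter> rectangle_frame a b c d = {}"
          using False by (fastforce simp: additive_field_def)
        with f show "\<exists>a b c d. a < - R \<and> R < b \<and> c < - R \<and> R < d \<and> {x. additive_field g\<^sub>1 g\<^sub>2 \<omega> x = l} \<inter> rectangle_frame a b c d = {}"
          by blast
      qed
    qed
  qed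
  ultimately show ?thesis by blast
qed

end
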